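(* Let $\mathcal{A}$ be a finite affine hyperplane arrangement in $\mathbb{R}^\ell$ with a generic flag $\mathcal{F}$ and defining affine forms $h_1,\dots,h_\ell$ satisfying the standing assumptions listed in the context, and let $0\le q\le\ell$. Then the classes $$\{[\mathrm{cl}_{\mathsf{M}(\mathcal{A})}(S(C))]\}_{C\in\mathsf{ch}^q_{\mathcal{F}}(\mathcal{A})}$$ form a basis of the $(2\ell-q)$-th Borel–Moore homology group $H^{BM}_{2\ell-q}(\mathsf{M}(\mathcal{A}),\mathbb{Z})$.
   Context: Arrangement: $\mathcal{A}=\{H_1,\dots,H_n\}$ is a finite set of affine hyperplanes in $\mathbb{R}^\ell$. $L(\mathcal{A})$ is the set of nonempty intersections of elements of $\mathcal{A}$ (including $\mathbb{R}^\ell$, the empty intersection). $\mathsf{ch}(\mathcal{A})$ is the set of chambers, i.e. connected components of $\mathbb{R}^\ell\setminus\bigcup_{H\in\mathcal{A}}H$. For an affine subspace $X\subset\mathbb{R}^\ell$, $X_{\mathbb{C}}\subset\mathbb{C}^\ell$ is its complexification, and $\mathsf{M}(\mathcal{A})=\mathbb{C}^\ell\setminus\bigcup_{H\in\mathcal{A}}H_{\mathbb{C}}$. $\tau(X)$ is the linear subspace through the origin parallel to $X$ with $\dim\tau(X)=\dim X$. Flag: $\mathcal{F}:\emptyset=\mathcal{F}^{-1}\subset\mathcal{F}^0\subset\cdots\subset\mathcal{F}^\ell=\mathbb{R}^\ell$ is a generic flag: $\mathcal{F}^q$ is a $q$-dimensional affine subspace with $\dim(\mathcal{F}^q\cap X)=q+\dim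 X-\ell$ for all $X\in L(\mathcal{A})$ (empty intersection when this number is negative). $h_1,\dots,h_\ell$ are affine linear forms on $\mathbb{R}^\ell$ with $\mathcal{F}^q=\{h_{q+1}=\cdots=h_\ell=0\}$ for $0\le q\le\ell-1$. Put $\mathsf{ch}^q_{\mathcal{F}}(\mathcal{A})=\{C\in\mathsf{ch}(\mathcal{A})\mid C\cap\mathcal{F}^q\ne\emptyset,\ C\cap\mathcal{F}^{q-1}=\emptyset\}$. Standing assumption, for $q=1,\dots,\ell$: (1) if $C\in\mathsf{ch}^q_{\mathcal{F}}(\mathcal{A})$ then $C\cap\mathcal{F}^q\subset\{h_{q+1}=\cdots=h_\ell=0,\ h_q>0\}$; (2) if $X\neq X'$ in $L(\mathcal{A})$ both have dimension $\ell-q$ (so each meets $\mathcal{F}^q$ in one point), then $h_q(X\cap\mathcal{F}^q)\ne h_q(X'\cap\mathcal{F}^q)$. The subspace $X_C$: for $C\in\mathsf{ch}^q_{\mathcal{F}}(\mathcal{A})$ with $q\ge1$, $\overline{C}\cap\mathcal{F}^q$ is a $q$-dimensional polyhedron on which $h_q$ attains its minimum at a unique vertex $p$; $X_C$ is the unique element of $L(\mathcal{A})$ with $X_C\cap\mathcal{F}^q=\{p\}$ (so $\dim X_C=\ell-q$). For $q=0$, $X_C=\mathbb{R}^\ell$. Put $\mathcal{A}_{[X]}=\{H\in\mathcal{A}\mid\tau(H)\supset\tau(X)\}$, and let $\widetilde{C}$ be the unique chamber of $\mathcal{A}_{[X_C]}$ containing $C$. For points $p_1,p_2\in\mathbb{R}^\ell$,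 $\mathrm{Sep}(p_1,p_2)=\{H\in\mathcal{A}\mid[p_1,p_2]\cap H\ne\emptyset\}$, where $[p_1,p_2]$ is the closed line segment. The set $S(C)$: for each $q$ and $C\in\mathsf{ch}^q_{\mathcal{F}}(\mathcal{A})$ fix a base point $p_C\in C\cap\mathcal{F}^q$ (the constructions do not depend on the choice), and define $$S(C)=\{x+\sqrt{-1}\,v\in\mathbb{C}^\ell\mid x\in\mathbb{R}^\ell,\ v\in\tau(X_C),\ v\notin\tau(H)\text{ for all }H\in\mathrm{Sep}(p_C,x)\}.$$ Closures and classes: $\mathrm{cl}_{\mathsf{M}(\mathcal{A})}(Y)=\overline{Y}\cap\mathsf{M}(\mathcal{A})$, with $\overline{Y}$ the closure in $\mathbb{C}^\ell$ for the classical topology. For $C\in\mathsf{ch}^q_{\mathcal{F}}(\mathcal{A})$ one has $\mathrm{cl}_{\mathsf{M}(\mathcal{A})}(S(C))=(\widetilde{C}\times\sqrt{-1}\,\tau(X_C))\cap\mathsf{M}(\mathcal{A})$, a closed $(2\ell-q)$-dimensional submanifold of $\mathsf{M}(\mathcal{A})$, open in $\mathbb{R}^\ell\times\sqrt{-1}\,\tau(X_C)$. It is oriented by the ordered basis $(\partial_{h_1},\dots,\partial_{h_\ell},\sqrt{-1}\partial_{h_{q+1}},\dots,\sqrt{-1}\partial_{h_\ell})$ of its tangent spaces, where $(\partial_{h_1},\dots,\partial_{h_\ell})$ is the basis of $\mathbb{R}^\ell$ dual to $(dh_1,\dots,dh_\ell)$, and where the orientation of the factor $\tau(X_C)$ is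 the one for which $(h_{q+1},\dots,h_\ell)$ restricted to $X_C$ is a positive coordinate system (so on $\tau(X_C)$ the vectors $\partial_{h_{q+1}},\dots,\partial_{h_\ell}$ mean the basis of $\tau(X_C)$ dual to the restrictions of $dh_{q+1},\dots,dh_\ell$). $[\mathrm{cl}_{\mathsf{M}(\mathcal{A})}(S(C))]\in H^{BM}_{2\ell-q}(\mathsf{M}(\mathcal{A}),\mathbb{Z})$ is its fundamental class in Borel–Moore (locally finite) homology. *)

theory Defs
  imports "HOL-Homology.Homology"
begin

section \<open>Borel--Moore (locally finite singular) homology\<close>

text \<open>A locally finite chain is a possibly infinite integer combination of singular simplices,
  given by its coefficient function, such that every compact set meets only finitely many of the
  simplices that occur.  A chain in a closed subspace is, as a coefficient function, literally the
  same object as its image in the ambient space.\<close>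

type_synonym 'a lf_chain = "((nat \<Rightarrow> real) \<Rightarrow> 'a) \<Rightarrow> int"

definition lf_singular_chain :: "nat \<Rightarrow> 'a topology \<Rightarrow> 'a lf_chain \<Rightarrow> bool" where
  "lf_singular_chain p X c \<longleftrightarrow>
     (\<forall>f. c f \<noteq> 0 \<longrightarrow> singular_simplex p X f) \<and>
     (\<forall>K. compactin X K \<longrightarrow> finite {f. c f \<noteq> 0 \<and> f ` standard_simplex p \<inter> K \<noteq> {}})"

text \<open>The inner sum is finite for a locally finite chain: all the simplices involved meet the
  compact image of \<open>g\<close>.\<close>

definition lf_boundary :: "nat \<Rightarrow> 'a lf_chain \<Rightarrow> 'a lf_chain" where
  "lf_boundary p c = (\<lambda>g. if p = 0 then 0 else
     (\<Sum>k\<le>p. (-1) ^ k * (\<Sum>f | c f \<noteq> 0 \<and> singular_face p k f = g. c f)))"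

definition lf_cycle_group :: "nat \<Rightarrow> 'a topology \<Rightarrow> 'a lf_chain monoid" where
  "lf_cycle_group p X =
     \<lparr>carrier = {c. lf_singular_chain p X c \<and> lf_boundary p c = (\<lambda>_. 0)},
      monoid.mult = (\<lambda>c d f. c f + d f), one = (\<lambda>_. 0)\<rparr>"

definition lf_boundaries :: "nat \<Rightarrow> 'a topology \<Rightarrow> 'a lf_chain set" where
  "lf_boundaries p X = lf_boundary (Suc p) ` {d. lf_singular_chain (Suc p) X d}"

definition BM_homology_group :: "nat \<Rightarrow> 'a topology \<Rightarrow> 'a lf_chain set monoid" where
  "BM_homology_group p X = lf_cycle_group p X Mod lf_boundaries p X"

definition BM_class :: "nat \<Rightarrow> 'a topology \<Rightarrow> 'a lf_chain \<Rightarrow> 'a lf_chain set" where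
  "BM_class p X c = lf_boundaries p X #>\<^bsub>lf_cycle_group p X\<^esub> c"

text \<open>The finite part of a locally finite chain consisting of the simplices that meet \<open>K\<close>.\<close>

definition lf_truncate :: "nat \<Rightarrow> 'a set \<Rightarrow> 'a lf_chain \<Rightarrow> 'a chain" where
  "lf_truncate p K c =
     Abs_poly_mapping (\<lambda>f. if f ` standard_simplex p \<inter> K \<noteq> {} then c f else 0)"

text \<open>The next lemmas check that the constructions above make sense: on finite chains
  \<open>lf_boundary\<close> is the library's boundary, it squares to zero, and Borel--Moore homology is an
  abelian group.\<close>

lemma lf_boundary_lookup:
  "lf_boundary p (Poly_Mapping.lookup c) = Poly_Mapping.lookup (chain_boundary p c)"
proof (cases "p = 0")
  case True
  then show ?thesis by (simp add: lf_boundary_def chain_boundary_def fun_eq_iff)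
next
  case False
  show ?thesis
  proof
    fix g
    have lk: "Poly_Mapping.lookup (sum F I) g = (\<Sum>i\<in>I. Poly_Mapping.lookup (F i) g)"
      for F :: "'z \<Rightarrow> 'b chain" and I and g
      by (induction I rule: infinite_finite_induct) (auto simp: lookup_add)
    have "Poly_Mapping.lookup (chain_boundary p c) g =
       (\<Sum>f\<in>Poly_Mapping.keys c. \<Sum>k\<le>p. Poly_Mapping.lookup c f *
            ((-1)^k * (if singular_face p k f = g then 1 else 0)))"
      using False
      by (simp add: chain_boundary_def frag_extend_def lk sum_distrib_left lookup_single eq_commute[of g])
    also have "\<dots> = (\<Sum>k\<le>p. \<Sum>f\<in>Poly_Mapping.keys c. Poly_Mapping.lookup c f *
            ((-1)^k * (if singular_face p k f = g then 1 else 0)))"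
      by (rule sum.swap)
    also have "\<dots> = (\<Sum>k\<le>p. (-1)^k * (\<Sum>f\<in>Poly_Mapping.keys c. 
            (if singular_face p k f = g then Poly_Mapping.lookup c f else 0)))"
      by (intro sum.cong refl) (auto simp: sum_distrib_left intro!: sum.cong)
    also have "\<dots> = (\<Sum>k\<le>p. (-1)^k * (\<Sum>f | Poly_Mapping.lookup c f \<noteq> 0 \<and> singular_face p k f = g.
             Poly_Mapping.lookup c f))"
      by (intro sum.cong[OF refl] arg_cong[where f="\<lambda>z. (-1) ^ _ * z"] sum.mono_neutral_cong_right)
         (auto simp: in_keys_iff)
    finally show "lf_boundary p (Poly_Mapping.lookup c) g
        = Poly_Mapping.lookup (chain_boundary p c) g"
      using False by (simp add: lf_boundary_def)
  qed
qed

lemma lookup_lf_truncate: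
  assumes "lf_singular_chain p X c" "compactin X K"
  shows "Poly_Mapping.lookup (lf_truncate p K c)
    = (\<lambda>f. if f ` standard_simplex p \<inter> K \<noteq> {} then c f else 0)"
proof -
  have "finite {f. c f \<noteq> 0 \<and> f ` standard_simplex p \<inter> K \<noteq> {}}"
    using assms by (simp add: lf_singular_chain_def)
  then have "finite {f. (if f ` standard_simplex p \<inter> K \<noteq> {} then c f else 0) \<noteq> 0}"
    by (rule rev_finite_subset) auto
  then show ?thesis
    unfolding lf_truncate_def by (rule lookup_Abs_poly_mapping)
qed

lemma singular_chain_lf_truncate:
  assumes "lf_singular_chain p X c" "compactin X K"
  shows "singular_chain p X (lf_truncate p K c)"
  using assms
  by (auto simp: singular_chain_def in_keys_iff lookup_lf_truncate lf_singular_chain_def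
      split: if_splits)

lemma image_singular_face_subset:
  assumes "p > 0" "k \<le> p"
  shows "singular_face p k f ` standard_simplex (p - Suc 0) \<subseteq> f ` standard_simplex p"
  using assms simplical_face_in_standard_simplex[of p k]
  by (force simp: singular_face_def)

lemma lf_boundary_local:
  assumes "p > 0"
    and "\<And>f. g ` standard_simplex (p - Suc 0) \<subseteq> f ` standard_simplex p \<Longrightarrow> c f = d f"
  shows "lf_boundary p c g = lf_boundary p d g"
proof -
  have "{f. c f \<noteq> 0 \<and> singular_face p k f = g} = {f. d f \<noteq> 0 \<and> singular_face p k f = g}"
    if "k \<le> p" for k
    using assms image_singular_face_subset[OF assms(1) that] by metis
  moreover have "c f = d f" if "k \<le> p" "singular_face p k f = g" for k f
    using assms image_singular_face_subset[OF assms(1) that(1)] that by metis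
  ultimately show ?thesis
    unfolding lf_boundary_def
    by (auto intro!: sum.cong)
qed

lemma lf_boundary_truncate:
  assumes c: "lf_singular_chain p X c" "compactin X K"
    and g: "g ` standard_simplex (p - Suc 0) \<inter> K \<noteq> {}"
  shows "lf_boundary p c g = Poly_Mapping.lookup (chain_boundary p (lf_truncate p K c)) g"
proof (cases "p = 0")
  case True
  then show ?thesis by (simp add: lf_boundary_def chain_boundary_def)
next
  case False
  have "lf_boundary p c g = lf_boundary p (Poly_Mapping.lookup (lf_truncate p K c)) g"
    by (rule lf_boundary_local) (use False g in \<open>auto simp: lookup_lf_truncate[OF c]\<close>)
  then show ?thesis by (simp add: lf_boundary_lookup)
qed

lemma compactin_singular_simplex_image:
  assumes "singular_simplex p X f"
  shows "compactin X (f ` standard_simplex p)"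
  using assms image_compactin[of "subtopology (powertop_real UNIV) (standard_simplex p)"
      "standard_simplex p" X f]
  by (simp add: singular_simplex_def compactin_standard_simplex compactin_subtopology)

lemma lf_singular_chain_boundary:
  assumes c: "lf_singular_chain p X c"
  shows "lf_singular_chain (p - Suc 0) X (lf_boundary p c)"
proof (cases "p = 0")
  case True
  then show ?thesis by (simp add: lf_singular_chain_def lf_boundary_def)
next
  case False
  have 1: "singular_simplex (p - Suc 0) X g" if g: "lf_boundary p c g \<noteq> 0" for g
  proof (rule ccontr)
    assume not: "\<not> singular_simplex (p - Suc 0) X g"
    have "{f. c f \<noteq> 0 \<and> singular_face p k f = g} = {}" if "k \<le> p" for k
      using c not that False singular_simplex_singular_face[of p X _ k]
      by (auto simp: lf_singular_chain_def)
    then have "(\<Sum>k\<le>p. (-1) ^ k * (\<Sum>f | c f \<noteq> 0 \<and> singular_face p k f = g. c f)) = 0"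
      by (intro sum.neutral ballI) (simp only: atMost_iff sum.empty mult_zero_right)
    then have "lf_boundary p c g = 0"
      by (simp add: lf_boundary_def)
    with g show False by simp
  qed
  have 2: "finite {g. lf_boundary p c g \<noteq> 0 \<and> g ` standard_simplex (p - Suc 0) \<inter> K \<noteq> {}}"
    if K: "compactin X K" for K
  proof (rule finite_subset[OF _ finite_keys[of "chain_boundary p (lf_truncate p K c)"]], rule subsetI)
    fix g
    assume "g \<in> {g. lf_boundary p c g \<noteq> 0 \<and> g ` standard_simplex (p - Suc 0) \<inter> K \<noteq> {}}"
    then have "lf_boundary p c g \<noteq> 0" "g ` standard_simplex (p - Suc 0) \<inter> K \<noteq> {}"
      by blast+
    then show "g \<in> Poly_Mapping.keys (chain_boundary p (lf_truncate p K c))"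
      using lf_boundary_truncate[OF c K] unfolding in_keys_iff by metis
  qed
  show ?thesis
    using 1 2 by (simp add: lf_singular_chain_def)
qed

lemma lf_boundary_boundary:
  assumes c: "lf_singular_chain (Suc p) X c"
  shows "lf_boundary p (lf_boundary (Suc p) c) = (\<lambda>_. 0)"
proof
  fix g
  show "lf_boundary p (lf_boundary (Suc p) c) g = 0"
  proof (rule ccontr)
    assume nz: "lf_boundary p (lf_boundary (Suc p) c) g \<noteq> 0"
    then have p: "p > 0" by (auto simp: lf_boundary_def split: if_splits)
    have "lf_singular_chain p X (lf_boundary (Suc p) c)"
      using lf_singular_chain_boundary[OF c] by simp
    from lf_singular_chain_boundary[OF this] nz
    have g: "singular_simplex (p - Suc 0) X g"
      by (auto simp: lf_singular_chain_def)
    define K where "K = g ` standard_simplex (p - Suc 0)"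
    have K: "compactin X K"
      unfolding K_def using g by (rule compactin_singular_simplex_image)
    have ne: "K \<noteq> {}" by (simp add: K_def nonempty_standard_simplex)
    have "lf_boundary p (lf_boundary (Suc p) c) g =
      lf_boundary p (Poly_Mapping.lookup (chain_boundary (Suc p) (lf_truncate (Suc p) K c))) g"
    proof (rule lf_boundary_local[OF p])
      fix f
      assume "g ` standard_simplex (p - Suc 0) \<subseteq> f ` standard_simplex p"
      then have "f ` standard_simplex (Suc p - Suc 0) \<inter> K \<noteq> {}"
        using ne by (auto simp: K_def)
      then show "lf_boundary (Suc p) c f
        = Poly_Mapping.lookup (chain_boundary (Suc p) (lf_truncate (Suc p) K c)) f"
        by (rule lf_boundary_truncate[OF c K])
    qed
    also have "\<dots> = 0"
      using chain_boundary_boundary_alt[OF singular_chain_lf_truncate[OF c K]]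
      by (simp add: lf_boundary_lookup)
    finally show False using nz by simp
  qed
qed

lemma lf_singular_chain_zero: "lf_singular_chain p X (\<lambda>_. 0)"
  by (simp add: lf_singular_chain_def)

lemma lf_singular_chain_lincomb:
  assumes "lf_singular_chain p X c" "lf_singular_chain p X d"
  shows "lf_singular_chain p X (\<lambda>f. a * c f + b * d f)"
proof -
  have "finite {f. a * c f + b * d f \<noteq> 0 \<and> f ` standard_simplex p \<inter> K \<noteq> {}}"
    if "compactin X K" for K
    by (rule finite_subset[of _ "{f. c f \<noteq> 0 \<and> f ` standard_simplex p \<inter> K \<noteq> {}} \<union>
          {f. d f \<noteq> 0 \<and> f ` standard_simplex p \<inter> K \<noteq> {}}"])
       (use assms that in \<open>auto simp: lf_singular_chain_def\<close>)
  moreover have "singular_simplex p X f" if "a * c f + b * d f \<noteq> 0" for f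
  proof -
    have "c f \<noteq> 0 \<or> d f \<noteq> 0"
      using that by auto
    with assms show ?thesis by (auto simp: lf_singular_chain_def)
  qed
  ultimately show ?thesis
    unfolding lf_singular_chain_def by simp
qed

lemma lf_boundary_zero: "lf_boundary p (\<lambda>_. 0) = (\<lambda>_. 0)"
  by (simp add: lf_boundary_def fun_eq_iff)

lemma lf_boundary_lincomb:
  assumes c: "lf_singular_chain p X c" and d: "lf_singular_chain p X d"
  shows "lf_boundary p (\<lambda>f. a * c f + b * d f)
    = (\<lambda>g. a * lf_boundary p c g + b * lf_boundary p d g)"
proof
  fix g
  let ?e = "\<lambda>f. a * c f + b * d f"
  have e: "lf_singular_chain p X ?e"
    using lf_singular_chain_lincomb[OF c d] .
  show "lf_boundary p ?e g = a * lf_boundary p c g + b * lf_boundary p d g"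
  proof (cases "singular_simplex (p - Suc 0) X g")
    case False
    have "lf_boundary p b g = 0" if "lf_singular_chain p X b" for b
      using lf_singular_chain_boundary[OF that] False unfolding lf_singular_chain_def by blast
    from this[OF c] this[OF d] this[OF e] show ?thesis by simp
  next
    case True
    define K where "K = g ` standard_simplex (p - Suc 0)"
    have K: "compactin X K"
      unfolding K_def using True by (rule compactin_singular_simplex_image)
    have gK: "g ` standard_simplex (p - Suc 0) \<inter> K \<noteq> {}"
      by (simp add: K_def nonempty_standard_simplex)
    have "lf_truncate p K ?e
      = frag_cmul a (lf_truncate p K c) + frag_cmul b (lf_truncate p K d)"
      by (rule poly_mapping_eqI)
         (simp add: lookup_lf_truncate[OF c K] lookup_lf_truncate[OF d K]
           lookup_lf_truncate[OF e K] lookup_add)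
    then show ?thesis
      by (simp add: lf_boundary_truncate[OF _ K gK] c d e chain_boundary_add
          chain_boundary_cmul lookup_add)
  qed
qed

lemma comm_group_lf_cycle_group: "comm_group (lf_cycle_group p X)"
proof (rule comm_groupI)
  fix x y
  assume "x \<in> carrier (lf_cycle_group p X)" "y \<in> carrier (lf_cycle_group p X)"
  then show "x \<otimes>\<^bsub>lf_cycle_group p X\<^esub> y \<in> carrier (lf_cycle_group p X)"
    using lf_singular_chain_lincomb[of p X x y 1 1] lf_boundary_lincomb[of p X x y 1 1]
    by (simp add: lf_cycle_group_def)
next
  fix x
  assume x: "x \<in> carrier (lf_cycle_group p X)"
  then have "(\<lambda>f. - x f) \<in> carrier (lf_cycle_group p X)"
    using lf_singular_chain_lincomb[of p X x x "-1" 0] lf_boundary_lincomb[of p X x x "-1" 0]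
    by (simp add: lf_cycle_group_def)
  then show "\<exists>y\<in>carrier (lf_cycle_group p X).
      y \<otimes>\<^bsub>lf_cycle_group p X\<^esub> x = \<one>\<^bsub>lf_cycle_group p X\<^esub>"
    by (intro bexI[of _ "\<lambda>f. - x f"]) (simp_all add: lf_cycle_group_def)
qed (auto simp: lf_cycle_group_def lf_singular_chain_zero lf_boundary_zero algebra_simps)

lemma subgroup_lf_boundaries: "subgroup (lf_boundaries p X) (lf_cycle_group p X)"
proof -
  interpret comm_group "lf_cycle_group p X"
    by (rule comm_group_lf_cycle_group)
  have sub: "lf_boundaries p X \<subseteq> carrier (lf_cycle_group p X)"
    using lf_singular_chain_boundary[of "Suc p" X] lf_boundary_boundary[of p X]
    by (auto simp: lf_boundaries_def lf_cycle_group_def)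
  show ?thesis
  proof (rule subgroupI)
    show "lf_boundaries p X \<subseteq> carrier (lf_cycle_group p X)" by (rule sub)
    show "lf_boundaries p X \<noteq> {}"
      using lf_singular_chain_zero[of "Suc p" X] by (auto simp: lf_boundaries_def)
    fix a
    assume a: "a \<in> lf_boundaries p X"
    then obtain c where c: "lf_singular_chain (Suc p) X c" "a = lf_boundary (Suc p) c"
      by (auto simp: lf_boundaries_def)
    have m: "(\<lambda>f. - a f) \<in> lf_boundaries p X"
      using lf_singular_chain_lincomb[OF c(1) c(1), of "-1" 0]
        lf_boundary_lincomb[OF c(1) c(1), of "-1" 0] c(2)
      unfolding lf_boundaries_def
      by (intro image_eqI[of _ _ "\<lambda>f. - c f"]) simp_all
    have "inv\<^bsub>lf_cycle_group p X\<^esub> a = (\<lambda>f. - a f)"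
      by (rule inv_equality) (use a m sub in \<open>auto simp: lf_cycle_group_def\<close>)
    with m show "inv\<^bsub>lf_cycle_group p X\<^esub> a \<in> lf_boundaries p X" by simp
    fix b
    assume "b \<in> lf_boundaries p X"
    then obtain d where d: "lf_singular_chain (Suc p) X d" "b = lf_boundary (Suc p) d"
      by (auto simp: lf_boundaries_def)
    show "a \<otimes>\<^bsub>lf_cycle_group p X\<^esub> b \<in> lf_boundaries p X"
      using lf_singular_chain_lincomb[OF c(1) d(1), of 1 1]
        lf_boundary_lincomb[OF c(1) d(1), of 1 1] c(2) d(2)
      unfolding lf_boundaries_def
      by (intro image_eqI[of _ _ "\<lambda>f. c f + d f"]) (simp_all add: lf_cycle_group_def)
  qed
qed

lemma comm_group_BM_homology_group: "comm_group (BM_homology_group p X)"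
  unfolding BM_homology_group_def
  by (rule comm_group.abelian_FactGroup[OF comm_group_lf_cycle_group subgroup_lf_boundaries])


section \<open>Fundamental classes of oriented closed submanifolds\<close>

text \<open>The affine singular simplex whose vertices are \<open>y - \<epsilon> (b\<^sub>1 + \<dots> + b\<^sub>k)\<close>,
  \<open>y + \<epsilon> b\<^sub>1\<close>, \<dots>, \<open>y + \<epsilon> b\<^sub>k\<close>, in this order.  Its barycentre is \<open>y\<close>, and for \<open>\<epsilon> > 0\<close> and
  linearly independent \<open>b\<^sub>i\<close> its edge vectors \<open>v\<^sub>1 - v\<^sub>0\<close>, \<dots>, \<open>v\<^sub>k - v\<^sub>0\<close> induce the same
  orientation as \<open>b\<^sub>1, \<dots>, b\<^sub>k\<close> (the transition matrix is \<open>\<epsilon>\<close> times the sum of the identity and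
  the all-ones matrix).  It therefore represents the local orientation at \<open>y\<close> determined by the ordered basis
  \<open>b\<^sub>1, \<dots>, b\<^sub>k\<close> of the tangent space.\<close>

definition oriented_vertex :: "'a::real_vector list \<Rightarrow> 'a \<Rightarrow> real \<Rightarrow> nat \<Rightarrow> 'a" where
  "oriented_vertex bs y \<epsilon> i =
     (if i = 0 then y - \<epsilon> *\<^sub>R sum_list bs else y + \<epsilon> *\<^sub>R (bs ! (i - 1)))"

definition local_orientation_simplex ::
    "'a::real_vector list \<Rightarrow> 'a \<Rightarrow> real \<Rightarrow> (nat \<Rightarrow> real) \<Rightarrow> 'a" where
  "local_orientation_simplex bs y \<epsilon> =
     (\<lambda>t\<in>standard_simplex (length bs). \<Sum>i\<le>length bs. t i *\<^sub>R oriented_vertex bs y \<epsilon> i)"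

text \<open>Let \<open>Y\<close> be an open subset of an affine subspace with direction spanned by the basis \<open>bs\<close>.
  A locally finite cycle of \<open>Y\<close> of degree \<open>dim Y\<close> is a fundamental cycle if for every \<open>y \<in> Y\<close> its
  image in \<open>H\<^sub>k(Y, Y - {y})\<close> is the generator given by the orientation.  The map from locally finite
  homology to \<open>H\<^sub>k(Y, Y - {y})\<close> discards the simplices that do not contain \<open>y\<close>.\<close>

definition fundamental_cycle ::
    "'a::real_normed_vector set \<Rightarrow> 'a list \<Rightarrow> 'a lf_chain \<Rightarrow> bool" where
  "fundamental_cycle Y bs c \<longleftrightarrow>
     c \<in> carrier (lf_cycle_group (length bs) (top_of_set Y)) \<and>
     (\<forall>y\<in>Y. \<exists>\<epsilon>>0.
        singular_simplex (length bs) (top_of_set Y) (local_orientation_simplex bs y \<epsilon>) \<and>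
        homologous_rel_set (length bs) (top_of_set Y) (Y - {y})
            (lf_truncate (length bs) {y} c) =
        homologous_rel_set (length bs) (top_of_set Y) (Y - {y})
            (frag_of (local_orientation_simplex bs y \<epsilon>)))"

text \<open>The fundamental class of a closed submanifold \<open>Y\<close> of \<open>M\<close>, pushed forward to \<open>M\<close>.\<close>

definition BM_fundamental_class ::
    "'a::real_normed_vector set \<Rightarrow> 'a set \<Rightarrow> 'a list \<Rightarrow> 'a lf_chain set" where
  "BM_fundamental_class M Y bs =
     (THE \<xi>. \<exists>c. fundamental_cycle Y bs c \<and> \<xi> = BM_class (length bs) (top_of_set M) c)"


section \<open>Bases of abelian groups\<close>

definition abelian_group_basis :: "('g, 'm) monoid_scheme \<Rightarrow> 'i set \<Rightarrow> ('i \<Rightarrow> 'g) \<Rightarrow> bool" where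
  "abelian_group_basis G I b \<longleftrightarrow>
     b \<in> I \<rightarrow> carrier G \<and>
     (\<forall>g\<in>carrier G. \<exists>!c::'i \<Rightarrow>\<^sub>0 int. Poly_Mapping.keys c \<subseteq> I \<and>
        g = (\<Otimes>\<^bsub>G\<^esub>i\<in>Poly_Mapping.keys c. b i [^]\<^bsub>G\<^esub> Poly_Mapping.lookup c i))"


section \<open>Arrangements\<close>

definition hyperplane_arrangement :: "'a::euclidean_space set set \<Rightarrow> bool" where
  "hyperplane_arrangement A \<longleftrightarrow>
     finite A \<and> (\<forall>H\<in>A. \<exists>a b. a \<noteq> 0 \<and> H = {x. a \<bullet> x = b})"

definition flats :: "'a set set \<Rightarrow> 'a set set" where
  "flats A = {\<Inter>B | B. B \<subseteq> A \<and> \<Inter>B \<noteq> {}}"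

definition chambers :: "'a::topological_space set set \<Rightarrow> 'a set set" where
  "chambers A = components (- \<Union>A)"

text \<open>The direction \<open>\<tau>(X)\<close> of a nonempty affine subspace.\<close>

definition direction :: "'a::ab_group_add set \<Rightarrow> 'a set" where
  "direction X = {x - y | x y. x \<in> X \<and> y \<in> X}"

text \<open>The point \<open>x + \<i> v\<close>.\<close>

definition cvec :: "real ^ 'n \<Rightarrow> real ^ 'n \<Rightarrow> complex ^ 'n" where
  "cvec x v = (\<chi> j. Complex (x $ j) (v $ j))"

definition complexification :: "(real ^ 'n) set \<Rightarrow> (complex ^ 'n) set" where
  "complexification X = {cvec x v | x v. x \<in> X \<and> v \<in> direction X}"

definition arr_complement :: "(real ^ 'n) set set \<Rightarrow> (complex ^ 'n) set" where
  "arr_complement A = - (\<Union>H\<in>A. complexification H)"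


section \<open>Generic flags\<close>

text \<open>The condition \<open>\<F>\<^sup>-\<^sup>1 = {}\<close> is built into \<open>flag_chambers\<close> below.\<close>

definition generic_flag ::
    "'a::euclidean_space set set \<Rightarrow> (nat \<Rightarrow> 'a set) \<Rightarrow> bool" where
  "generic_flag A F \<longleftrightarrow>
     (\<forall>q\<le>DIM('a). affine (F q) \<and> aff_dim (F q) = int q) \<and>
     (\<forall>q<DIM('a). F q \<subseteq> F (Suc q)) \<and>
     F (DIM('a)) = UNIV \<and>
     (\<forall>q\<le>DIM('a). \<forall>X\<in>flats A.
        if int q + aff_dim X - int (DIM('a)) \<ge> 0
        then aff_dim (F q \<inter> X) = int q + aff_dim X - int (DIM('a))
        else F q \<inter> X = {})"

definition affine_form :: "('a::real_vector \<Rightarrow> real) \<Rightarrow> bool" where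
  "affine_form f \<longleftrightarrow> (\<exists>g c. linear g \<and> f = (\<lambda>x. g x + c))"

definition flag_forms ::
    "(nat \<Rightarrow> 'a::euclidean_space set) \<Rightarrow> (nat \<Rightarrow> 'a \<Rightarrow> real) \<Rightarrow> bool" where
  "flag_forms F h \<longleftrightarrow>
     (\<forall>i\<in>{1..DIM('a)}. affine_form (h i)) \<and>
     (\<forall>q<DIM('a). F q = {x. \<forall>i\<in>{q+1..DIM('a)}. h i x = 0})"

definition flag_chambers ::
    "'a::euclidean_space set set \<Rightarrow> (nat \<Rightarrow> 'a set) \<Rightarrow> nat \<Rightarrow> 'a set set" where
  "flag_chambers A F q =
     {C \<in> chambers A. C \<inter> F q \<noteq> {} \<and> (q \<noteq> 0 \<longrightarrow> C \<inter> F (q - 1) = {})}"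

definition flag_position ::
    "'a::euclidean_space set set \<Rightarrow> (nat \<Rightarrow> 'a set) \<Rightarrow> (nat \<Rightarrow> 'a \<Rightarrow> real) \<Rightarrow> bool" where
  "flag_position A F h \<longleftrightarrow>
     (\<forall>q\<in>{1..DIM('a)}.
        (\<forall>C\<in>flag_chambers A F q.
           C \<inter> F q \<subseteq> {x. (\<forall>i\<in>{q+1..DIM('a)}. h i x = 0) \<and> h q x > 0}) \<and>
        (\<forall>X\<in>flats A. \<forall>X'\<in>flats A.
           X \<noteq> X' \<and> aff_dim X = int (DIM('a)) - int q \<and> aff_dim X' = int (DIM('a)) - int q
           \<longrightarrow> h q ` (X \<inter> F q) \<noteq> h q ` (X' \<inter> F q)))"


section \<open>The sets \<open>S(C)\<close> and their orientation\<close>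

definition min_vertex ::
    "(nat \<Rightarrow> 'a::euclidean_space set) \<Rightarrow> (nat \<Rightarrow> 'a \<Rightarrow> real) \<Rightarrow> nat \<Rightarrow> 'a set \<Rightarrow> 'a" where
  "min_vertex F h q C = (THE p. is_arg_min (h q) (\<lambda>x. x \<in> closure C \<inter> F q) p)"

text \<open>\<open>X\<^sub>C\<close> for \<open>C \<in> ch\<^sup>q\<close>.\<close>

definition chamber_flat ::
    "'a::euclidean_space set set \<Rightarrow> (nat \<Rightarrow> 'a set) \<Rightarrow> (nat \<Rightarrow> 'a \<Rightarrow> real) \<Rightarrow> nat \<Rightarrow> 'a set \<Rightarrow> 'a set"
  where
  "chamber_flat A F h q C =
     (if q = 0 then UNIV else (THE X. X \<in> flats A \<and> X \<inter> F q = {min_vertex F h q C}))"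

definition Sep :: "'a::euclidean_space set set \<Rightarrow> 'a \<Rightarrow> 'a \<Rightarrow> 'a set set" where
  "Sep A p1 p2 = {H \<in> A. closed_segment p1 p2 \<inter> H \<noteq> {}}"

text \<open>\<open>S(C)\<close>, with \<open>X\<close> standing for \<open>X\<^sub>C\<close> and \<open>p\<close> for the base point \<open>p\<^sub>C\<close>.\<close>

definition S_set :: "(real ^ 'n) set set \<Rightarrow> (real ^ 'n) set \<Rightarrow> real ^ 'n \<Rightarrow> (complex ^ 'n) set" where
  "S_set A X p = {cvec x v | x v. v \<in> direction X \<and> (\<forall>H\<in>Sep A p x. v \<notin> direction H)}"

definition cl_complement ::
    "(real ^ 'n) set set \<Rightarrow> (complex ^ 'n) set \<Rightarrow> (complex ^ 'n) set" where
  "cl_complement A Y = closure Y \<inter> arr_complement A"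

text \<open>The \<open>i\<close>-th member of the basis of the linear subspace \<open>V\<close> dual to the restrictions to \<open>V\<close> of
  the linear parts of \<open>h\<^sub>j\<close>, \<open>j \<in> J\<close>.\<close>

definition dual_vector ::
    "(nat \<Rightarrow> 'a::real_vector \<Rightarrow> real) \<Rightarrow> 'a set \<Rightarrow> nat set \<Rightarrow> nat \<Rightarrow> 'a" where
  "dual_vector h V J i =
     (THE v. v \<in> V \<and> (\<forall>j\<in>J. h j v - h j 0 = (if j = i then 1 else 0)))"

text \<open>The ordered basis
  \<open>(\<partial>h\<^sub>1, \<dots>, \<partial>h\<^sub>\<ell>, \<i> \<partial>h\<^sub>q\<^sub>+\<^sub>1, \<dots>, \<i> \<partial>h\<^sub>\<ell>)\<close>;
  the last \<open>\<ell> - q\<close> vectors are taken from the basis of \<open>\<tau>(X)\<close> dual to the restrictions of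
  \<open>dh\<^sub>q\<^sub>+\<^sub>1, \<dots>, dh\<^sub>\<ell>\<close>.\<close>

definition orientation_basis ::
    "(nat \<Rightarrow> real ^ 'n \<Rightarrow> real) \<Rightarrow> nat \<Rightarrow> (real ^ 'n) set \<Rightarrow> (complex ^ 'n) list" where
  "orientation_basis h q X =
     map (\<lambda>i. cvec (dual_vector h UNIV {1..CARD('n)} i) 0) [1..<CARD('n) + 1] @
     map (\<lambda>i. cvec 0 (dual_vector h (direction X) {q+1..CARD('n)} i)) [q+1..<CARD('n) + 1]"

definition S_class ::
    "(real ^ 'n) set set \<Rightarrow> (nat \<Rightarrow> (real ^ 'n) set) \<Rightarrow> (nat \<Rightarrow> real ^ 'n \<Rightarrow> real) \<Rightarrow> nat \<Rightarrow>
     ((real ^ 'n) set \<Rightarrow> real ^ 'n) \<Rightarrow> (real ^ 'n) set \<Rightarrow> (complex ^ 'n) lf_chain set" where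
  "S_class A F h q p C =
     BM_fundamental_class (arr_complement A)
       (cl_complement A (S_set A (chamber_flat A F h q C) (p C)))
       (orientation_basis h q (chamber_flat A F h q C))"

end

theory Submission
  imports Defs "HOL-Library.Function_Algebras"
begin

text \<open>Order the chambers of all \<open>ch\<^sup>q\<close> by \<open>q\<close> and the height of the lowest vertex.  The complement is the
  disjoint union of the sets \<open>S(C)\<close>, and the closure of \<open>S(C)\<close> adds only parts of sets of later
  chambers, so the unions of final segments of the \<open>S(C)\<close> form a filtration by closed sets.
  Relative to the next step of the filtration, \<open>S(C)\<close> behaves like an open cell of dimension
  \<open>2\<ell> - q\<close>: locally finite chains of a convex piece can be pushed radially to infinity, and the
  hyperplanes through the imaginary part cut \<open>S(C)\<close> into convex pieces that collapse in pairs, an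
  open half together with its facet.  A fundamental class of the closure of \<open>S(C)\<close>, glued from large
  simplices by excision, restricts to the generator of the cell \<open>S(C)\<close>.  Hence these classes are
  triangular with respect to the filtration and form a basis.\<close>

section \<open>Locally finite chains\<close>

text \<open>The sets \<open>S(C)\<close> are not convex: the real part of a point is restricted only
  by the hyperplanes whose direction contains its imaginary part, so the real conditions jump when
  the imaginary part crosses such a direction. One radial push therefore cannot treat
  \<open>S(C)\<close> at once. On a facet there are more real conditions than on the two adjacent
  halves, yet near a suitable facet point the three pieces form an affine space split by a
  hyperplane. One half with its facet is then locally a half space with boundary, and the boundary
  map matches their two classes.

  Classes are tested at single points: a cell is controlled by local homology at one interior point,
  where an affine simplex gives the generator. No connecting map between cells of the filtration has
  to be computed, because each generator is represented by an absolute cycle of \<open>M\<close>.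

  The fundamental class is a definite description, so uniqueness is needed as well. Inside the
  closure of \<open>S(C)\<close> the pieces of later chambers have other dimensions; hence two
  fundamental cycles with the same local class at one point of \<open>S(C)\<close> differ by a
  boundary.\<close>

definition lfs :: "'a::euclidean_space set \<Rightarrow> nat \<Rightarrow> 'a set \<Rightarrow> 'a lf_chain \<Rightarrow> bool" where
  "lfs M k S w \<longleftrightarrow> lf_singular_chain k (top_of_set M) w \<and>
     (\<forall>f. w f \<noteq> 0 \<longrightarrow> f ` standard_simplex k \<subseteq> S)"

abbreviation (input) ch :: "nat \<Rightarrow> 'a::topological_space set \<Rightarrow> 'a chain \<Rightarrow> bool" where
  "ch k S c \<equiv> singular_chain k (top_of_set S) c"

abbreviation lk :: "'a chain \<Rightarrow> 'a lf_chain" where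
  "lk \<equiv> Poly_Mapping.lookup"

definition lf_scale :: "int \<Rightarrow> 'a lf_chain \<Rightarrow> 'a lf_chain" where
  "lf_scale n w = (\<lambda>f. n * w f)"

lemma lk_add: "lk (a + b) = lk a + lk b" by (simp add: fun_eq_iff lookup_add)

lemma lk_diff: "lk (a - b) = lk a - lk b" by (simp add: fun_eq_iff lookup_minus)

lemma lk_zero: "lk 0 = 0" by (simp add: fun_eq_iff)

lemma lk_cmul: "lk (frag_cmul n a) = lf_scale n (lk a)" by (simp add: fun_eq_iff lf_scale_def)

lemma singular_chain_keys:
  assumes "ch k S c" "lk c f \<noteq> 0"
  shows "singular_simplex k (top_of_set S) f" "f ` standard_simplex k \<subseteq> S"
proof -
  show *: "singular_simplex k (top_of_set S) f"
    using assms by (auto simp: singular_chain_def in_keys_iff)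
  then show "f ` standard_simplex k \<subseteq> S" by (simp add: singular_simplex_subtopology)
qed

lemma singular_chain_subsetI:
  assumes "ch k T c" "\<And>f. lk c f \<noteq> 0 \<Longrightarrow> f ` standard_simplex k \<subseteq> S"
  shows "ch k S c"
  using assms by (auto simp: singular_chain_def in_keys_iff singular_simplex_subtopology subset_iff)

lemma lfs_singular: "lfs M k S w \<Longrightarrow> w f \<noteq> 0 \<Longrightarrow> singular_simplex k (top_of_set S) f"
  by (auto simp: lfs_def lf_singular_chain_def singular_simplex_subtopology)

lemma lfs_subset: "lfs M k S w \<Longrightarrow> w f \<noteq> 0 \<Longrightarrow> f ` standard_simplex k \<subseteq> S"
  by (auto simp: lfs_def)

lemma lfs_finite:
  "lfs M k S w \<Longrightarrow> compact K \<Longrightarrow> K \<subseteq> M \<Longrightarrow> finite {f. w f \<noteq> 0 \<and> f ` standard_simplex k \<inter> K \<noteq> {}}"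
  by (auto simp: lfs_def lf_singular_chain_def compactin_subtopology)

lemma lfs_mono: "lfs M k S w \<Longrightarrow> S \<subseteq> T \<Longrightarrow> lfs M k T w"
  by (auto simp: lfs_def)

lemma lfs_lf: "lfs M k S w \<Longrightarrow> lf_singular_chain k (top_of_set M) w" by (simp add: lfs_def)

lemma lfs_0 [simp]: "lfs M k S 0" by (simp add: lfs_def lf_singular_chain_def)

lemma lfs_add: assumes "lfs M k S a" "lfs M k S b" shows "lfs M k S (a + b)"
proof -
  have "lf_singular_chain k (top_of_set M) (\<lambda>f. 1 * a f + 1 * b f)"
    using assms by (intro lf_singular_chain_lincomb) (auto simp: lfs_def)
  moreover have "f ` standard_simplex k \<subseteq> S" if "(a + b) f \<noteq> 0" for f
  proof -
    have "a f \<noteq> 0 \<or> b f \<noteq> 0" using that by auto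
    then show ?thesis using assms unfolding lfs_def by blast
  qed
  ultimately show ?thesis by (auto simp: lfs_def plus_fun_def)
qed

lemma lfs_scale: assumes "lfs M k S a" shows "lfs M k S (lf_scale n a)"
proof -
  have "lf_singular_chain k (top_of_set M) (\<lambda>f. n * a f + 0 * a f)"
    using assms by (intro lf_singular_chain_lincomb) (auto simp: lfs_def)
  then show ?thesis using assms by (auto simp: lfs_def lf_scale_def)
qed

lemma uminus_lf: "- a = lf_scale (-1) a" by (auto simp: lf_scale_def)

lemma lfs_uminus: "lfs M k S a \<Longrightarrow> lfs M k S (- a)"
  unfolding uminus_lf by (rule lfs_scale)

lemma lfs_diff: "lfs M k S a \<Longrightarrow> lfs M k S b \<Longrightarrow> lfs M k S (a - b)"
  using lfs_add[OF _ lfs_uminus, of M k S a b] by simp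

lemma lfs_lookup: assumes "ch k S c" "S \<subseteq> M" shows "lfs M k S (lk c)"
proof -
  have "singular_simplex k (top_of_set M) f" if "lk c f \<noteq> 0" for f
    using singular_chain_keys[OF assms(1) that] assms(2) by (auto simp: singular_simplex_subtopology)
  moreover have "finite {f. lk c f \<noteq> 0 \<and> f ` standard_simplex k \<inter> K \<noteq> {}}" for K
    by (rule finite_subset[OF _ finite_keys[of c]]) (auto simp: in_keys_iff)
  ultimately show ?thesis
    using singular_chain_keys[OF assms(1)] by (auto simp: lfs_def lf_singular_chain_def)
qed

lemma bd_lookup: "lf_boundary k (lk c) = lk (chain_boundary k c)" by (rule lf_boundary_lookup)

lemma bd_add:
  assumes "lfs M k S a" "lfs M k T b"
  shows "lf_boundary k (a + b) = lf_boundary k a + lf_boundary k b"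
  using lf_boundary_lincomb[OF lfs_lf[OF assms(1)] lfs_lf[OF assms(2)], of 1 1]
  by (simp add: plus_fun_def)

lemma bd_scale:
  assumes "lfs M k S a"
  shows "lf_boundary k (lf_scale n a) = lf_scale n (lf_boundary k a)"
  using lf_boundary_lincomb[OF lfs_lf[OF assms(1)] lfs_lf[OF assms(1)], of n 0]
  by (simp add: lf_scale_def)

lemma bd_uminus: "lfs M k S a \<Longrightarrow> lf_boundary k (- a) = - lf_boundary k a"
  unfolding uminus_lf by (rule bd_scale)

lemma bd_diff:
  assumes "lfs M k S a" "lfs M k T b"
  shows "lf_boundary k (a - b) = lf_boundary k a - lf_boundary k b"
  using bd_add[OF assms(1) lfs_uminus[OF assms(2)]] bd_uminus[OF assms(2)] by simp

lemma bd_zero [simp]: "lf_boundary k 0 = 0"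
  using lf_boundary_zero[of k] by (simp add: zero_fun_def)

lemma bd_nonzero:
  assumes "lf_boundary k w g \<noteq> 0"
  obtains f j where "k > 0" "j \<le> k" "w f \<noteq> 0" "singular_face k j f = g"
proof -
  have k: "k > 0" using assms by (auto simp: lf_boundary_def split: if_splits)
  then have nz: "(\<Sum>j\<le>k. (-1) ^ j * (\<Sum>f | w f \<noteq> 0 \<and> singular_face k j f = g. w f)) \<noteq> 0"
    using assms by (simp add: lf_boundary_def)
  have "\<exists>j\<le>k. {f. w f \<noteq> 0 \<and> singular_face k j f = g} \<noteq> {}"
  proof (rule ccontr)
    assume *: "\<not> ?thesis"
    have "(\<Sum>j\<le>k. (-1) ^ j * (\<Sum>f | w f \<noteq> 0 \<and> singular_face k j f = g. w f)) = 0"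
    proof (rule sum.neutral, rule ballI)
      fix j assume "j \<in> {..k}"
      then have "{f. w f \<noteq> 0 \<and> singular_face k j f = g} = {}" using * by auto
      then show "(-1) ^ j * (\<Sum>f | w f \<noteq> 0 \<and> singular_face k j f = g. w f) = 0"
        by (simp only: sum.empty mult_zero_right)
    qed
    with nz show False by contradiction
  qed
  then show thesis using that k by blast
qed

lemma lfs_bd: assumes "lfs M k S w" shows "lfs M (k - Suc 0) S (lf_boundary k w)"
proof -
  have "g ` standard_simplex (k - Suc 0) \<subseteq> S" if "lf_boundary k w g \<noteq> 0" for g
  proof -
    obtain f j where "k > 0" "j \<le> k" "w f \<noteq> 0" "singular_face k j f = g"
      using bd_nonzero[OF \<open>lf_boundary k w g \<noteq> 0\<close>] .
    then show ?thesis using image_singular_face_subset[of k j f] lfs_subset[OF assms] by force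
  qed
  then show ?thesis using lf_singular_chain_boundary[OF lfs_lf[OF assms]] by (auto simp: lfs_def)
qed

lemma lfs_bd': "lfs M (Suc k) S w \<Longrightarrow> lfs M k S (lf_boundary (Suc k) w)"
  using lfs_bd[of M "Suc k" S w] by simp

lemma bd_bd: "lfs M (Suc k) S w \<Longrightarrow> lf_boundary k (lf_boundary (Suc k) w) = 0"
  using lf_boundary_boundary[OF lfs_lf] by (simp add: zero_fun_def)

text \<open>The infinite sum of finite chains \<open>c i\<close>, the \<open>i\<close>-th of which avoids \<open>K i\<close>: on a simplex
  that meets \<open>K j\<close> only the first \<open>j\<close> summands contribute.\<close>

definition lfsum :: "nat \<Rightarrow> (nat \<Rightarrow> 'a set) \<Rightarrow> (nat \<Rightarrow> 'a chain) \<Rightarrow> 'a lf_chain" where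
  "lfsum k K c = (\<lambda>f. lk (\<Sum>i<(LEAST j. f ` standard_simplex k \<inter> K j \<noteq> {}). c i) f)"

section \<open>Infinite chains along a compact exhaustion\<close>

locale exhaustion =
  fixes P :: "'a::euclidean_space set" and K :: "nat \<Rightarrow> 'a set"
  assumes cK: "\<And>i. compact (K i)" and KP: "\<And>i. K i \<subseteq> P"
    and K_Suc: "\<And>i. \<exists>O'. openin (top_of_set P) O' \<and> K i \<subseteq> O' \<and> O' \<subseteq> K (Suc i)"
    and K_ex: "\<And>C. compact C \<Longrightarrow> C \<subseteq> P \<Longrightarrow> \<exists>i. C \<subseteq> K i"
begin

lemma K_mono: "i \<le> j \<Longrightarrow> K i \<subseteq> K j"
proof (rule lift_Suc_mono_le[of K])
  fix n show "K n \<subseteq> K (Suc n)" using K_Suc[of n] by auto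
qed

lemma meets: "singular_simplex k (top_of_set P) f \<Longrightarrow> \<exists>j. f ` standard_simplex k \<inter> K j \<noteq> {}"
proof -
  assume "singular_simplex k (top_of_set P) f"
  then have "compact (f ` standard_simplex k)" "f ` standard_simplex k \<subseteq> P"
    using compactin_singular_simplex_image[of k "top_of_set P" f] by (simp_all add: compactin_subtopology)
  then obtain i where "f ` standard_simplex k \<subseteq> K i" using K_ex by blast
  then show ?thesis using nonempty_standard_simplex[of k] by (intro exI[of _ i]) auto
qed

lemma lfsum_eq:
  assumes c: "\<And>i. ch k (P - K i) (c i)" and f: "f ` standard_simplex k \<inter> K j \<noteq> {}"
  shows "lfsum k K c f = lk (\<Sum>i<j. c i) f"
proof -
  define l where "l = (LEAST j. f ` standard_simplex k \<inter> K j \<noteq> {})"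
  have l: "f ` standard_simplex k \<inter> K l \<noteq> {}" "l \<le> j"
    unfolding l_def using f LeastI[of "\<lambda>j. f ` standard_simplex k \<inter> K j \<noteq> {}" j]
      Least_le[of "\<lambda>j. f ` standard_simplex k \<inter> K j \<noteq> {}" j] by metis+
  have "lk (c i) f = 0" if "i \<ge> l" for i
  proof (rule ccontr)
    assume "lk (c i) f \<noteq> 0"
    from singular_chain_keys(2)[OF c this] K_mono[OF that] l(1) show False by auto
  qed
  then have "(\<Sum>i<j. lk (c i) f) = (\<Sum>i<l. lk (c i) f)"
    using l(2) by (intro sum.mono_neutral_right) auto
  then show ?thesis unfolding lfsum_def l_def[symmetric] by (simp add: lookup_sum)
qed

lemma lfsum_simplex:
  assumes c: "\<And>i. ch k (S - K i) (c i)" and nz: "lfsum k K c f \<noteq> 0"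
  shows "singular_simplex k (top_of_set S) f"
proof -
  have "\<exists>i. lk (c i) f \<noteq> 0"
  proof (rule ccontr)
    assume "\<not> ?thesis"
    then have "lfsum k K c f = 0" by (simp add: lfsum_def lookup_sum)
    with nz show False by contradiction
  qed
  then show ?thesis using singular_chain_keys(1)[OF c] by (auto simp: singular_simplex_subtopology)
qed

text \<open>Because \<open>P\<close> is closed in \<open>M\<close>, a compact set of
  \<open>M\<close> meets \<open>P\<close> in a compact set, hence inside some \<open>K j\<close>. On
  simplices meeting \<open>K j\<close> the sum is the finite chain of its first \<open>j\<close>
  terms, which gives local finiteness in all of \<open>M\<close> and not only in
  \<open>P\<close>.\<close>

lemma lfs_lfsum:
  assumes c: "\<And>i. ch k (S - K i) (c i)" and S: "S \<subseteq> P" and P: "closedin (top_of_set M) P"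
  shows "lfs M k S (lfsum k K c)"
proof -
  have c': "ch k (P - K i) (c i)" for i
    using singular_chain_mono[of k euclidean] c[of i] S by (metis Diff_mono subset_refl)
  have PM: "P \<subseteq> M" using P closedin_imp_subset by blast
  have sx: "singular_simplex k (top_of_set S) f" if "lfsum k K c f \<noteq> 0" for f
    using lfsum_simplex[OF c that] .
  have "finite {f. lfsum k K c f \<noteq> 0 \<and> f ` standard_simplex k \<inter> C \<noteq> {}}" if C: "compact C" "C \<subseteq> M" for C
  proof -
    have "compact (P \<inter> C)"
    proof -
      obtain T where T: "closed T" "P = M \<inter> T" using P by (auto simp: closedin_closed)
      then have "P \<inter> C = C \<inter> T" using C(2) by auto
      then show ?thesis using compact_Int_closed[OF C(1) T(1)] by simp
    qed
    then obtain j where j: "P \<inter> C \<subseteq> K j" using K_ex[of "P \<inter> C"] by blast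
    have "{f. lfsum k K c f \<noteq> 0 \<and> f ` standard_simplex k \<inter> C \<noteq> {}} \<subseteq> Poly_Mapping.keys (\<Sum>i<j. c i)"
    proof clarify
      fix f assume f: "lfsum k K c f \<noteq> 0" "f ` standard_simplex k \<inter> C \<noteq> {}"
      have "f ` standard_simplex k \<subseteq> P"
        using sx[OF f(1)] S by (auto simp: singular_simplex_subtopology)
      then have "f ` standard_simplex k \<inter> K j \<noteq> {}" using f(2) j by blast
      from lfsum_eq[OF c' this] f(1) show "f \<in> Poly_Mapping.keys (\<Sum>i<j. c i)"
        by (simp add: in_keys_iff)
    qed
    then show ?thesis using finite_keys finite_subset by blast
  qed
  moreover have "singular_simplex k (top_of_set M) f" "f ` standard_simplex k \<subseteq> S"
    if "lfsum k K c f \<noteq> 0" for f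
    using sx[OF that] S PM unfolding singular_simplex_subtopology by blast+
  ultimately show ?thesis unfolding lfs_def lf_singular_chain_def by (simp add: compactin_subtopology)
qed

text \<open>Every simplex with face \<open>g\<close> contains the image of \<open>g\<close> and so
  meets \<open>K j\<close>; the boundary at \<open>g\<close> therefore sees only a finite partial
  sum.\<close>

lemma bd_lfsum:
  assumes c: "\<And>i. ch (Suc k) (P - K i) (c i)" and g: "g ` standard_simplex k \<inter> K j \<noteq> {}"
  shows "lf_boundary (Suc k) (lfsum (Suc k) K c) g = lk (\<Sum>i<j. chain_boundary (Suc k) (c i)) g"
proof -
  have "lf_boundary (Suc k) (lfsum (Suc k) K c) g = lf_boundary (Suc k) (lk (\<Sum>i<j. c i)) g"
    by (rule lf_boundary_local) (use g in \<open>auto intro!: lfsum_eq[OF c]\<close>)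
  also have "\<dots> = lk (\<Sum>i<j. chain_boundary (Suc k) (c i)) g"
    by (simp add: bd_lookup chain_boundary_sum)
  finally show ?thesis .
qed

end

lemma lf_truncate_finite:
  assumes w: "lfs M k S w" and C: "compact C" "C \<subseteq> M"
  obtains c where "ch k S c"
    "\<And>f. lk c f = (if f ` standard_simplex k \<inter> C \<noteq> {} then w f else 0)"
proof -
  have lk: "lk (lf_truncate k C w) = (\<lambda>f. if f ` standard_simplex k \<inter> C \<noteq> {} then w f else 0)"
    using lookup_lf_truncate[OF lfs_lf[OF w]] C by (simp add: compactin_subtopology)
  have "ch k S (lf_truncate k C w)"
    using lfs_singular[OF w] by (auto simp: singular_chain_def in_keys_iff lk split: if_splits)
  then show thesis by (rule that) (simp add: lk)
qed

lemma fun_sum_apply: "(\<Sum>i\<in>I. F i) x = (\<Sum>i\<in>I. (F i) x)" for F :: "'i \<Rightarrow> 'b \<Rightarrow> 'c::comm_monoid_add"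
  by (induction I rule: infinite_finite_induct) auto

lemma singular_chain_split:
  assumes "\<And>f. lk c f \<noteq> 0 \<Longrightarrow> singular_simplex k X f \<or> singular_simplex k Y f"
  obtains d e where "singular_chain k X d" "singular_chain k Y e" "c = d + e"
proof -
  have "Poly_Mapping.keys c \<subseteq> singular_simplex_set k X \<union> singular_simplex_set k Y"
    using assms by (auto simp: in_keys_iff)
  then obtain d e where "Poly_Mapping.keys d \<subseteq> singular_simplex_set k X"
      "Poly_Mapping.keys e \<subseteq> singular_simplex_set k Y" "d + e = c" by (rule frag_split)
  then show thesis by (intro that[of d e]) (simp_all add: singular_chain_def)
qed

lemma ch_mono: "ch k S c \<Longrightarrow> S \<subseteq> T \<Longrightarrow> ch k T c"
  using singular_chain_mono[of k euclidean] by blast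

text \<open>Cutting off the part of \<open>t\<close> that comes close to \<open>K i\<close>: after subdivision each simplex lies
  in \<open>Q\<close> or avoids \<open>K (Suc i)\<close>.\<close>

lemma (in exhaustion) subdivide_split:
  assumes t: "ch k T t" and T: "T = (Q - K i) \<union> (P - K (Suc (Suc i)))" and Q: "Q \<subseteq> P"
    and dt: "\<And>g. lk (chain_boundary k t) g \<noteq> 0 \<Longrightarrow>
        g ` standard_simplex (k - Suc 0) \<subseteq> Q - K i \<or> g ` standard_simplex (k - Suc 0) \<subseteq> P - K (Suc (Suc i))"
  obtains b B r where "ch (Suc k) T b" "ch k (Q - K i) B" "ch k (P - K (Suc i)) r"
    "t = chain_boundary (Suc k) b + B + r"
proof -
  obtain O' where O': "openin (top_of_set P) O'" "K (Suc i) \<subseteq> O'" "O' \<subseteq> K (Suc (Suc i))"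
    using K_Suc by blast
  obtain O2 where O2: "open O2" "O' = P \<inter> O2" using O'(1) by (auto simp: openin_open)
  have TP: "T \<subseteq> P" using T Q by auto
  \<comment> \<open>Subdividing with respect to these two open sets leaves every small simplex
    either clear of \<open>K (Suc i)\<close> or inside \<open>O'\<close>.\<close>
  let ?C = "{T \<inter> - K (Suc i), T \<inter> O2}"
  have op: "openin (top_of_set T) U" if "U \<in> ?C" for U
    using that O2(1) compact_imp_closed[OF cK[of "Suc i"]] by (auto intro!: openin_open_Int)
  have cov: "topspace (top_of_set T) \<subseteq> \<Union>?C" using O' O2 TP by auto
  have "\<exists>n. \<forall>m\<ge>n. \<forall>f \<in> Poly_Mapping.keys ((singular_subdivision k ^^ m) t).
                      \<exists>V \<in> ?C. f \<in> (standard_simplex k) \<rightarrow> V"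
    by (rule sufficient_iterated_singular_subdivision_exists[OF op cov t]) blast+
  then obtain n where n: "\<And>f. f \<in> Poly_Mapping.keys ((singular_subdivision k ^^ n) t)
                      \<Longrightarrow> \<exists>V \<in> ?C. f \<in> (standard_simplex k) \<rightarrow> V"
    by blast
  obtain H where H: "\<And>p. H p 0 = (0 :: 'a chain)"
        "\<And>p c1 c2. H p (c1-c2) = H p c1 - H p c2"
        "\<And>p X c. singular_chain p X c \<Longrightarrow> singular_chain (Suc p) X (H p c)"
        "\<And>p X c. singular_chain p X c
                 \<Longrightarrow> chain_boundary (Suc p) (H p c) + H (p - Suc 0) (chain_boundary p c)
                   = (singular_subdivision p ^^ n) c - c"
    by (rule chain_homotopic_iterated_singular_subdivision[of n]) (rule that; assumption)
  have Hadd: "H p (a + b) = H p a + H p b" for p a b using H(2)[of p "a + b" b] by simp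
  define s where "s = (singular_subdivision k ^^ n) t"
  have s_eq: "chain_boundary (Suc k) (H k t) + H (k - Suc 0) (chain_boundary k t) = s - t"
    unfolding s_def by (rule H(4)[OF t])
  have st: "ch k T s"
  proof -
    have "ch k T ((singular_subdivision k ^^ m) t)" for m
      by (induction m) (auto simp: t singular_chain_singular_subdivision)
    then show ?thesis by (simp add: s_def)
  qed
  \<comment> \<open>\<open>O'\<close> is contained in \<open>K (Suc (Suc i))\<close>, so a point of
    \<open>T\<close> in it can only come from the part \<open>Q - K i\<close> of
    \<open>T\<close>.\<close>
  have TO: "T \<inter> O2 \<subseteq> Q - K i" using T TP O2(2) O'(3) by blast
  have "singular_simplex k (top_of_set (Q - K i)) f \<or> singular_simplex k (top_of_set (P - K (Suc i))) f"
    if "lk s f \<noteq> 0" for f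
  proof -
    have f: "singular_simplex k euclidean f" "f ` standard_simplex k \<subseteq> T"
      using singular_chain_keys[OF st that] by (simp_all add: singular_simplex_subtopology)
    have "f \<in> Poly_Mapping.keys ((singular_subdivision k ^^ n) t)"
      using that by (simp add: s_def in_keys_iff)
    from n[OF this] obtain V where "V \<in> ?C" "f \<in> standard_simplex k \<rightarrow> V" ..
    then have "f ` standard_simplex k \<subseteq> Q - K i \<or> f ` standard_simplex k \<subseteq> P - K (Suc i)"
      using TO f(2) TP by blast
    then show ?thesis using f(1) by (auto simp: singular_simplex_subtopology)
  qed
  then obtain s1 s2 where s12: "ch k (Q - K i) s1" "ch k (P - K (Suc i)) s2" "s = s1 + s2"
    by (rule singular_chain_split)
  have KK: "K i \<subseteq> K (Suc (Suc i))" "K (Suc i) \<subseteq> K (Suc (Suc i))" by (rule K_mono; simp)+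
  \<comment> \<open>In degree 0 the index \<open>k - Suc 0\<close> is again 0 and \<open>H\<close>
    would raise it to degree 1. There the boundary is zero and the term drops out, so this degree is
    treated separately.\<close>
  show thesis
  proof (cases "k = 0")
    case True
    then have "H (k - Suc 0) (chain_boundary k t) = 0" by (simp add: chain_boundary_def H(1))
    then have "t = chain_boundary (Suc k) (- H k t) + s1 + s2"
      using s_eq s12(3) by (simp add: chain_boundary_minus algebra_simps)
    then show thesis using that[of "- H k t" s1 s2] s12 H(3)[OF t] by (simp add: singular_chain_minus)
  next
    case False
    have dtT: "ch (k - Suc 0) T (chain_boundary k t)" by (rule singular_chain_boundary[OF t])
    have "singular_simplex (k - Suc 0) (top_of_set (Q - K i)) g
        \<or> singular_simplex (k - Suc 0) (top_of_set (P - K (Suc (Suc i)))) g"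
      if "lk (chain_boundary k t) g \<noteq> 0" for g
      using dt[OF that] singular_chain_keys(1)[OF dtT that] by (auto simp: singular_simplex_subtopology)
    \<comment> \<open>\<open>H\<close> preserves the support in every subspace, so it can be applied
      to the two parts of the boundary separately.\<close>
    then obtain p1 p2 where p12: "ch (k - Suc 0) (Q - K i) p1" "ch (k - Suc 0) (P - K (Suc (Suc i))) p2"
        "chain_boundary k t = p1 + p2" by (rule singular_chain_split)
    have hp: "ch k (Q - K i) (H (k - Suc 0) p1)" "ch k (P - K (Suc (Suc i))) (H (k - Suc 0) p2)"
      using H(3)[OF p12(1)] H(3)[OF p12(2)] False by simp_all
    have hp2: "ch k (P - K (Suc i)) (H (k - Suc 0) p2)" by (rule ch_mono[OF hp(2)]) (use KK in auto)
    have "t = chain_boundary (Suc k) (- H k t) + (s1 - H (k - Suc 0) p1) + (s2 - H (k - Suc 0) p2)"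
      using s_eq s12(3) p12(3) by (simp add: chain_boundary_minus Hadd algebra_simps)
    then show thesis
      using that[of "- H k t" "s1 - H (k - Suc 0) p1" "s2 - H (k - Suc 0) p2"] s12 hp hp2 H(3)[OF t]
      by (simp add: singular_chain_minus singular_chain_diff)
  qed
qed

text \<open>Only the simplices meeting \<open>K (Suc (Suc i))\<close> have to be moved. They form a
  finite chain whose boundary lies in \<open>T\<close>, that is, a relative cycle modulo
  \<open>T\<close>. The homotopy ends in \<open>T\<close>, so this chain is homologous to one in
  \<open>T\<close>, which subdivision separates into a part in \<open>Q\<close> and a part that has
  left \<open>K (Suc i)\<close>.\<close>

lemma (in exhaustion) push_step:
  assumes P: "closedin (top_of_set M) P" and Q: "Q \<subseteq> P"
    and T: "T = (Q - K i) \<union> (P - K (Suc (Suc i)))"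
    and hom: "homotopic_with (\<lambda>h. h \<in> T \<rightarrow> T) (top_of_set (P - K i)) (top_of_set (P - K i)) id \<phi>"
    and \<phi>: "\<phi> \<in> (P - K i) \<rightarrow> T"
    and a: "lfs M k (P - K i) a" and da: "lfs M (k - Suc 0) Q (lf_boundary k a)"
  obtains b B where "ch (Suc k) (P - K i) b" "ch k (Q - K i) B"
    "lfs M k (P - K (Suc i)) (a - lf_boundary (Suc k) (lk b) - lk B)"
proof -
  have PM: "P \<subseteq> M" using P closedin_imp_subset by blast
  have TPi: "T \<subseteq> P - K i" using T Q K_mono[of i "Suc (Suc i)"] by auto
  let ?K2 = "K (Suc (Suc i))"
  obtain a1 where a1: "ch k (P - K i) a1"
      "\<And>f. lk a1 f = (if f ` standard_simplex k \<inter> ?K2 \<noteq> {} then a f else 0)"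
    using lf_truncate_finite[OF a cK[of "Suc (Suc i)"]] KP PM by blast
  define a2 where "a2 = a - lk a1"
  have a2: "lfs M k (P - ?K2) a2"
  proof -
    have "lfs M k (P - K i) a2" unfolding a2_def using a a1(1) PM by (intro lfs_diff lfs_lookup) auto
    moreover have "f ` standard_simplex k \<inter> ?K2 = {}" if "a2 f \<noteq> 0" for f
      using that a1(2)[of f] by (auto simp: a2_def split: if_splits)
    ultimately show ?thesis unfolding lfs_def by blast
  qed
  have da2: "lfs M (k - Suc 0) (P - ?K2) (lf_boundary k a2)" by (rule lfs_bd[OF a2])
  have da1: "g ` standard_simplex (k - Suc 0) \<subseteq> Q - K i \<or> g ` standard_simplex (k - Suc 0) \<subseteq> P - ?K2"
    if "lk (chain_boundary k a1) g \<noteq> 0" for g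
  proof -
    have "lf_boundary k a = lk (chain_boundary k a1) + lf_boundary k a2"
    proof -
      have "lfs M k (P - K i) (lk a1)" using a1(1) PM by (intro lfs_lookup) auto
      from bd_diff[OF a this] show ?thesis by (simp add: a2_def bd_lookup)
    qed
    then have "lk (chain_boundary k a1) g = lf_boundary k a g - lf_boundary k a2 g" by simp
    then have "lf_boundary k a g \<noteq> 0 \<or> lf_boundary k a2 g \<noteq> 0" using that by auto
    then show ?thesis using lfs_subset[OF da] lfs_subset[OF da2] lfs_subset[OF lfs_bd[OF a]] by blast
  qed
  have rc: "singular_relcycle k (top_of_set (P - K i)) T a1"
  proof -
    have "ch (k - Suc 0) T (chain_boundary k a1)"
      by (rule singular_chain_subsetI[OF singular_chain_boundary[OF a1(1)]]) (use da1 T in blast)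
    then show ?thesis
      using a1(1) TPi by (simp add: singular_relcycle subtopology_subtopology inf.absorb2)
  qed
  have "homologous_rel k (top_of_set (P - K i)) T (chain_map k id a1) (chain_map k \<phi> a1)"
    by (rule homotopic_imp_homologous_rel_chain_maps[OF hom rc])
  then have h1: "homologous_rel k (top_of_set (P - K i)) T a1 (chain_map k \<phi> a1)"
    using a1(1) by (simp add: chain_map_ident)
  have c\<phi>: "continuous_map (top_of_set (P - K i)) (top_of_set (P - K i)) \<phi>"
    using homotopic_with_imp_continuous_maps[OF hom] by blast
  have "continuous_map (top_of_set (P - K i)) (top_of_set T) \<phi>"
    using c\<phi> \<phi> TPi by (auto simp: continuous_map_in_subtopology)
  then have "ch k T (chain_map k \<phi> a1)" using singular_chain_chain_map[OF a1(1)] by blast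
  with h1 obtain d t0 where d: "ch (Suc k) (P - K i) d" "ch k T t0"
      "chain_boundary (Suc k) d + t0 = a1 - chain_map k \<phi> a1"
    unfolding homologous_rel_def singular_relboundary
    using TPi by (auto simp: subtopology_subtopology inf.absorb2)
  define t where "t = t0 + chain_map k \<phi> a1"
  have t: "ch k T t" "a1 = chain_boundary (Suc k) d + t"
    using d \<open>ch k T (chain_map k \<phi> a1)\<close> by (auto simp: t_def singular_chain_add algebra_simps)
  have dt: "chain_boundary k t = chain_boundary k a1"
    using chain_boundary_boundary_alt[OF d(1)] by (simp add: t(2) chain_boundary_add)
  obtain b B r where b: "ch (Suc k) T b" "ch k (Q - K i) B" "ch k (P - K (Suc i)) r"
      "t = chain_boundary (Suc k) b + B + r"
    by (rule subdivide_split[OF t(1) T Q, of thesis]) (use da1 dt in auto)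
  show thesis
  proof (rule that[of "d + b" B])
    show "ch (Suc k) (P - K i) (d + b)" using d(1) ch_mono[OF b(1) TPi] by (rule singular_chain_add)
    show "ch k (Q - K i) B" by fact
    have "a - lf_boundary (Suc k) (lk (d + b)) - lk B = a2 + lk r"
    proof -
      have "lk a1 = lf_boundary (Suc k) (lk (d + b)) + lk B + lk r"
        unfolding bd_lookup t(2) b(4) chain_boundary_add by (simp add: lk_add algebra_simps)
      then show ?thesis by (simp add: a2_def algebra_simps)
    qed
    moreover have "lfs M k (P - K (Suc i)) a2"
      by (rule lfs_mono[OF a2]) (use K_mono[of "Suc i" "Suc (Suc i)"] in auto)
    moreover have "lfs M k (P - K (Suc i)) (lk r)" by (rule lfs_lookup[OF b(3)]) (use PM in auto)
    ultimately show "lfs M k (P - K (Suc i)) (a - lf_boundary (Suc k) (lk (d + b)) - lk B)"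
      by (simp add: lfs_add)
  qed
qed

text \<open>Pushing a relative cycle to infinity: what is pushed out of \<open>K i\<close> in the \<open>i\<close>-th step either
  ends up in \<open>Q\<close> or leaves \<open>K (Suc i)\<close> too, so the infinite sum of the finite homologies is
  locally finite.\<close>

lemma (in exhaustion) push_off:
  assumes P: "closedin (top_of_set M) P" and Q: "Q \<subseteq> P"
    and hom: "\<And>i. \<exists>\<phi>. homotopic_with (\<lambda>h. h \<in> (Q - K i) \<union> (P - K (Suc (Suc i))) \<rightarrow> (Q - K i) \<union> (P - K (Suc (Suc i))))
                 (top_of_set (P - K i)) (top_of_set (P - K i)) id \<phi>
               \<and> \<phi> \<in> (P - K i) \<rightarrow> (Q - K i) \<union> (P - K (Suc (Suc i)))"
    and w: "lfs M k (P - K 0) w" and dw: "lfs M (k - Suc 0) Q (lf_boundary k w)"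
  obtains u w' where "lfs M (Suc k) (P - K 0) u" "lfs M k Q w'" "w = lf_boundary (Suc k) u + w'"
proof -
  have PM: "P \<subseteq> M" using P closedin_imp_subset by blast
  \<comment> \<open>The invariant of the iteration: nothing is left on \<open>K i\<close>, and the
    boundary still lies in \<open>Q\<close>.\<close>
  define good where "good i a \<longleftrightarrow> lfs M k (P - K i) a \<and> lfs M (k - Suc 0) Q (lf_boundary k a)" for i a
  have step: "\<exists>b B. ch (Suc k) (P - K i) b \<and> ch k (Q - K i) B \<and>
      good (Suc i) (a - lf_boundary (Suc k) (lk b) - lk B)" if g: "good i a" for i a
  proof -
    obtain \<phi> where h: "homotopic_with (\<lambda>h. h \<in> (Q - K i) \<union> (P - K (Suc (Suc i))) \<rightarrow> (Q - K i) \<union> (P - K (Suc (Suc i))))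
                 (top_of_set (P - K i)) (top_of_set (P - K i)) id \<phi>"
        "\<phi> \<in> (P - K i) \<rightarrow> (Q - K i) \<union> (P - K (Suc (Suc i)))"
      using hom by blast
    obtain b B where b: "ch (Suc k) (P - K i) b" "ch k (Q - K i) B"
        "lfs M k (P - K (Suc i)) (a - lf_boundary (Suc k) (lk b) - lk B)"
      using push_step[OF P Q refl h] g unfolding good_def by blast
    have lb: "lfs M (Suc k) (P - K i) (lk b)" and lB: "lfs M k (Q - K i) (lk B)"
      using b PM Q by (auto intro!: lfs_lookup)
    have lbb: "lfs M k (P - K i) (lf_boundary (Suc k) (lk b))" by (rule lfs_bd'[OF lb])
    have "lf_boundary k (a - lf_boundary (Suc k) (lk b) - lk B)
       = lf_boundary k a - lf_boundary k (lk B)"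
      using bd_diff[OF lfs_diff[of M k "P - K i" a] lB] bd_diff[of M k "P - K i" a, OF _ lbb] g lbb
      by (simp add: good_def bd_bd[OF lb])
    moreover have "lfs M (k - Suc 0) Q (lf_boundary k a - lf_boundary k (lk B))"
      using g lfs_mono[OF lfs_bd[OF lB], of Q] by (intro lfs_diff) (auto simp: good_def)
    ultimately have "good (Suc i) (a - lf_boundary (Suc k) (lk b) - lk B)"
      using b(3) by (simp add: good_def)
    with b show ?thesis by blast
  qed
  then obtain bf Bf where bB: "\<And>i a. good i a \<Longrightarrow> ch (Suc k) (P - K i) (bf i a) \<and> ch k (Q - K i) (Bf i a) \<and>
      good (Suc i) (a - lf_boundary (Suc k) (lk (bf i a)) - lk (Bf i a))" by metis
  define a where "a = rec_nat w (\<lambda>i a. a - lf_boundary (Suc k) (lk (bf i a)) - lk (Bf i a))"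
  have a0: "a 0 = w" and aS: "a (Suc i) = a i - lf_boundary (Suc k) (lk (bf i (a i))) - lk (Bf i (a i))" for i
    by (simp_all add: a_def)
  have good: "good i (a i)" for i
  proof (induction i)
    case 0
    show ?case using w dw by (simp add: a0 good_def)
  next
    case (Suc i)
    from bB[OF this] show ?case unfolding aS by blast
  qed
  define b where "b i = bf i (a i)" for i
  define B where "B i = Bf i (a i)" for i
  have b: "ch (Suc k) (P - K i) (b i)" and B: "ch k (Q - K i) (B i)" for i
    using bB[OF good[of i]] by (auto simp: b_def B_def)
  have part: "w = a j + (\<Sum>i<j. lf_boundary (Suc k) (lk (b i))) + (\<Sum>i<j. lk (B i))" for j
    by (induction j) (auto simp: a0 aS b_def B_def algebra_simps)
  have bound: "ch (Suc k) ((P - K 0) - K i) (b i)" for i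
    by (rule ch_mono[OF b]) (use K_mono[of 0 i] in auto)
  have BP: "ch k (P - K i) (B i)" for i by (rule ch_mono[OF B]) (use Q in auto)
  show thesis
  proof (rule that[of "lfsum (Suc k) K b" "lfsum k K B"])
    show l1: "lfs M (Suc k) (P - K 0) (lfsum (Suc k) K b)" by (rule lfs_lfsum[OF bound _ P]) auto
    show l2: "lfs M k Q (lfsum k K B)" by (rule lfs_lfsum[OF B Q P])
    show "w = lf_boundary (Suc k) (lfsum (Suc k) K b) + lfsum k K B"
    proof
      fix f
      show "w f = (lf_boundary (Suc k) (lfsum (Suc k) K b) + lfsum k K B) f"
      proof (cases "singular_simplex k (top_of_set P) f")
        case True
        \<comment> \<open>The remainder \<open>a j\<close> is supported off \<open>K j\<close>. At
          this simplex the telescoping identity \<open>part\<close> thus has no remainder, and its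
          finite sums equal the infinite ones.\<close>
        from meets[OF True] obtain j where j: "f ` standard_simplex k \<inter> K j \<noteq> {}" by blast
        have "a j f = 0"
          using good[of j] j lfs_subset[of M k "P - K j" "a j" f] unfolding good_def by blast
        then have "w f = (\<Sum>i<j. lf_boundary (Suc k) (lk (b i)) f) + (\<Sum>i<j. lk (B i) f)"
          using fun_cong[OF part[of j], of f] by (simp add: fun_sum_apply)
        moreover have "(lf_boundary (Suc k) (lfsum (Suc k) K b) + lfsum k K B) f
            = lk (\<Sum>i<j. chain_boundary (Suc k) (b i)) f + lk (\<Sum>i<j. B i) f"
          using bd_lfsum[OF b j] lfsum_eq[OF BP j] by simp
        ultimately show ?thesis by (simp add: lookup_sum bd_lookup)
      next
        case False
        have z: "v f = 0" if "lfs M k P v" for v using lfs_singular[OF that] False by blast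
        have "lfs M k P w" by (rule lfs_mono[OF w]) auto
        moreover have "lfs M k P (lf_boundary (Suc k) (lfsum (Suc k) K b))"
          by (rule lfs_bd', rule lfs_mono[OF l1]) auto
        moreover have "lfs M k P (lfsum k K B)" by (rule lfs_mono[OF l2 Q])
        ultimately show ?thesis by (simp only: plus_fun_apply z add_0)
      qed
    qed
  qed
qed

section \<open>Relative homology\<close>

abbreviation (input) rc :: "nat \<Rightarrow> 'a::topological_space set \<Rightarrow> 'a set \<Rightarrow> 'a chain \<Rightarrow> bool" where
  "rc k P T c \<equiv> singular_relcycle k (top_of_set P) T c"

abbreviation (input) rb :: "nat \<Rightarrow> 'a::topological_space set \<Rightarrow> 'a set \<Rightarrow> 'a chain \<Rightarrow> bool" where
  "rb k P T c \<equiv> singular_relboundary k (top_of_set P) T c"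

lemma rc_iff:
  assumes "T \<subseteq> P"
  shows "rc k P T c \<longleftrightarrow> ch k P c \<and> ch (k - Suc 0) T (chain_boundary k c)"
  using assms by (simp add: singular_relcycle subtopology_subtopology inf.absorb2)

lemma rb_iff:
  assumes "T \<subseteq> P"
  shows "rb k P T c \<longleftrightarrow> (\<exists>d e. ch (Suc k) P d \<and> ch k T e \<and> c = chain_boundary (Suc k) d + e)"
  using assms by (auto simp: singular_relboundary subtopology_subtopology inf.absorb2)

lemma rb_ch: "T \<subseteq> P \<Longrightarrow> ch k T c \<Longrightarrow> rb k P T c"
  using singular_chain_imp_relboundary[of k "top_of_set P" T c]
  by (simp add: subtopology_subtopology inf.absorb2)

lemma rc_mono: "rc k P' T' c \<Longrightarrow> P' \<subseteq> P \<Longrightarrow> T' \<subseteq> T \<Longrightarrow> T' \<subseteq> P' \<Longrightarrow> T \<subseteq> P \<Longrightarrow> rc k P T c"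
  by (auto simp: rc_iff intro: ch_mono)

lemma rb_mono: "rb k P' T' c \<Longrightarrow> P' \<subseteq> P \<Longrightarrow> T' \<subseteq> T \<Longrightarrow> T' \<subseteq> P' \<Longrightarrow> T \<subseteq> P \<Longrightarrow> rb k P T c"
  unfolding rb_iff by (elim exE conjE, intro exI conjI) (auto intro: ch_mono)

text \<open>The class of \<open>c\<close> freely generates the relative homology group; unique
  existence of the multiple expresses generation and infinite order together.\<close>

definition rel_gen :: "nat \<Rightarrow> 'a::topological_space set \<Rightarrow> 'a set \<Rightarrow> 'a chain \<Rightarrow> bool" where
  "rel_gen k P T c \<longleftrightarrow> rc k P T c \<and> (\<forall>z. rc k P T z \<longrightarrow> (\<exists>!n. rb k P T (z - frag_cmul n c)))"

definition rel_trivial :: "nat \<Rightarrow> 'a::topological_space set \<Rightarrow> 'a set \<Rightarrow> bool" where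
  "rel_trivial k P T \<longleftrightarrow> (\<forall>z. rc k P T z \<longrightarrow> rb k P T z)"

text \<open>The inclusion of pairs induces an isomorphism in degree \<open>k\<close>; the two
  quantified clauses are surjectivity and injectivity on representatives. Staying with chains lets a
  given generator be carried along unchanged.\<close>

definition incl_iso :: "nat \<Rightarrow> 'a::topological_space set \<Rightarrow> 'a set \<Rightarrow> 'a set \<Rightarrow> 'a set \<Rightarrow> bool" where
  "incl_iso k P' T' P T \<longleftrightarrow> P' \<subseteq> P \<and> T' \<subseteq> T \<and> T' \<subseteq> P' \<and> T \<subseteq> P \<and>
     (\<forall>z. rc k P T z \<longrightarrow> (\<exists>z'. rc k P' T' z' \<and> rb k P T (z - z'))) \<and>
     (\<forall>z'. rc k P' T' z' \<and> rb k P T z' \<longrightarrow> rb k P' T' z')"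

lemma rb_diff_sym: "rb k P T (a - b) \<Longrightarrow> rb k P T (b - a)"
  using singular_relboundary_minus[of k "top_of_set P" T "a - b"] by simp

lemma rb_diff_trans: "rb k P T (a - b) \<Longrightarrow> rb k P T (b - c) \<Longrightarrow> rb k P T (a - c)"
  using singular_relboundary_add[of k "top_of_set P" T "a - b" "b - c"] by simp

lemma rb_diff_iff: "rb k P T (a - b) \<Longrightarrow> rb k P T (a - c) \<longleftrightarrow> rb k P T (b - c)"
  using rb_diff_trans rb_diff_sym by blast

lemma rb_cmul: "rb k P T c \<Longrightarrow> rb k P T (frag_cmul n c)"
  by (rule singular_relboundary_cmul)

lemma rc_diff_cmul: "rc k P T a \<Longrightarrow> rc k P T b \<Longrightarrow> rc k P T (a - frag_cmul n b)"
  by (intro singular_relcycle_diff singular_relcycle_cmul)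

lemma frag_cmul_diff: "frag_cmul (m - n) c = frag_cmul m c - frag_cmul n c"
  by (rule poly_mapping_eqI) (simp add: lookup_minus algebra_simps)

lemma frag_cmul_diff_right: "frag_cmul n (c - d) = frag_cmul n c - frag_cmul n d"
  by (rule poly_mapping_eqI) (simp add: lookup_minus algebra_simps)

lemma rel_gen_uniq:
  assumes "rel_gen k P T c" "rb k P T (frag_cmul n c)"
  shows "n = 0"
proof -
  note * = assms(1)[unfolded rel_gen_def, THEN conjunct2, rule_format]
  have "\<exists>!m. rb k P T (0 - frag_cmul m c)" by (rule *) (rule singular_relcycle_0)
  then obtain m where m: "\<And>n. rb k P T (0 - frag_cmul n c) \<Longrightarrow> n = m" by (elim ex1E) blast
  have "rb k P T (0 - frag_cmul 0 c)" by simp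
  moreover have "rb k P T (0 - frag_cmul n c)" unfolding diff_0 singular_relboundary_minus by fact
  ultimately show ?thesis using m[of 0] m[of n] by simp
qed

lemma rel_genI:
  assumes "rc k P T c" "\<And>z. rc k P T z \<Longrightarrow> \<exists>n. rb k P T (z - frag_cmul n c)"
    "\<And>n. rb k P T (frag_cmul n c) \<Longrightarrow> n = 0"
  shows "rel_gen k P T c"
  unfolding rel_gen_def
proof (intro conjI allI impI)
  fix z assume "rc k P T z"
  then obtain n where n: "rb k P T (z - frag_cmul n c)" using assms(2) by blast
  show "\<exists>!n. rb k P T (z - frag_cmul n c)"
  proof (rule ex1I[of _ n])
    fix m assume m: "rb k P T (z - frag_cmul m c)"
    have "frag_cmul (n - m) c = (z - frag_cmul m c) - (z - frag_cmul n c)"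
      unfolding frag_cmul_diff by (simp only: algebra_simps)
    then have "rb k P T (frag_cmul (n - m) c)" using singular_relboundary_diff[OF m n] by simp
    from assms(3)[OF this] show "m = n" by simp
  qed fact
qed fact

lemma rel_gen_cong:
  assumes "rel_gen k P T c" "rc k P T c'" "rb k P T (c - c')"
  shows "rel_gen k P T c'"
proof (rule rel_genI)
  have *: "rb k P T (frag_cmul n c - frag_cmul n c')" for n
    using rb_cmul[OF assms(3), of n] by (simp add: frag_cmul_diff_right)
  { fix z assume "rc k P T z"
    then obtain n where "rb k P T (z - frag_cmul n c)" using assms(1) unfolding rel_gen_def by blast
    then show "\<exists>n. rb k P T (z - frag_cmul n c')" using rb_diff_trans[OF _ *] by blast }
  fix n assume "rb k P T (frag_cmul n c')"
  with *[of n] have "rb k P T (frag_cmul n c)" 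
    using singular_relboundary_add[of k "top_of_set P" T "frag_cmul n c - frag_cmul n c'"] by fastforce
  then show "n = 0" using rel_gen_uniq[OF assms(1)] by blast
qed fact

lemma incl_iso_subsets: "incl_iso k P' T' P T \<Longrightarrow> P' \<subseteq> P \<and> T' \<subseteq> T \<and> T' \<subseteq> P' \<and> T \<subseteq> P"
  by (simp add: incl_iso_def)

lemma incl_iso_rb:
  assumes "incl_iso k P' T' P T" "rc k P' T' z"
  shows "rb k P T z \<longleftrightarrow> rb k P' T' z"
  using assms rb_mono[of k P' T' z P T] unfolding incl_iso_def by blast

lemma incl_iso_gen:
  assumes i: "incl_iso k P' T' P T" and c: "rc k P' T' c"
  shows "rel_gen k P T c \<longleftrightarrow> rel_gen k P' T' c"
proof
  have up: "rc k P T z" if "rc k P' T' z" for z using rc_mono[OF that] i by (auto simp: incl_iso_def)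
  { assume g: "rel_gen k P T c"
    show "rel_gen k P' T' c" unfolding rel_gen_def
    proof (intro conjI c allI impI)
      fix z assume z: "rc k P' T' z"
      have "\<exists>!n. rb k P T (z - frag_cmul n c)" using g up[OF z] by (auto simp: rel_gen_def)
      then show "\<exists>!n. rb k P' T' (z - frag_cmul n c)"
        using incl_iso_rb[OF i rc_diff_cmul[OF z c]] by simp
    qed }
  assume g: "rel_gen k P' T' c"
  show "rel_gen k P T c" unfolding rel_gen_def
  proof (intro conjI up[OF c] allI impI)
    fix z assume z: "rc k P T z"
    then obtain z' where z': "rc k P' T' z'" "rb k P T (z - z')" using i by (auto simp: incl_iso_def)
    have "\<exists>!n. rb k P' T' (z' - frag_cmul n c)" using g z'(1) by (auto simp: rel_gen_def)
    then show "\<exists>!n. rb k P T (z - frag_cmul n c)"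
      using incl_iso_rb[OF i rc_diff_cmul[OF z'(1) c]] rb_diff_iff[OF z'(2)] by simp
  qed
qed

lemma incl_iso_trivial:
  assumes i: "incl_iso k P' T' P T"
  shows "rel_trivial k P T \<longleftrightarrow> rel_trivial k P' T'"
proof
  assume t: "rel_trivial k P' T'"
  show "rel_trivial k P T" unfolding rel_trivial_def
  proof (intro allI impI)
    fix z assume z: "rc k P T z"
    then obtain z' where z': "rc k P' T' z'" "rb k P T (z - z')" using i by (auto simp: incl_iso_def)
    then have "rb k P T z'" using t incl_iso_rb[OF i] by (auto simp: rel_trivial_def)
    then show "rb k P T z" using singular_relboundary_add[OF z'(2)] by fastforce
  qed
next
  assume t: "rel_trivial k P T"
  show "rel_trivial k P' T'" unfolding rel_trivial_def
  proof (intro allI impI)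
    fix z assume z: "rc k P' T' z"
    then have "rc k P T z" using rc_mono[OF z] i by (auto simp: incl_iso_def)
    then show "rb k P' T' z" using t incl_iso_rb[OF i z] by (auto simp: rel_trivial_def)
  qed
qed

section \<open>Isomorphisms from deformation, excision and contractible pairs\<close>

lemma homotopic_with_linear_rel:
  fixes f g :: "'a::topological_space \<Rightarrow> 'b::real_normed_vector"
  assumes f: "continuous_on P f" and g: "continuous_on P g"
    and sub: "\<And>x t. x \<in> P \<Longrightarrow> 0 \<le> t \<Longrightarrow> t \<le> 1 \<Longrightarrow> (1 - t) *\<^sub>R f x + t *\<^sub>R g x \<in> P'"
    and T: "\<And>x t. x \<in> T \<Longrightarrow> 0 \<le> t \<Longrightarrow> t \<le> 1 \<Longrightarrow> (1 - t) *\<^sub>R f x + t *\<^sub>R g x \<in> T'"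
  shows "homotopic_with (\<lambda>h. h \<in> T \<rightarrow> T') (top_of_set P) (top_of_set P') f g"
proof -
  define h where "h = (\<lambda>z. (1 - fst z) *\<^sub>R f (snd z) + fst z *\<^sub>R g (snd z))"
  have "continuous_on ({0..1} \<times> P) h" unfolding h_def
    by (intro continuous_intros continuous_on_compose2[OF f] continuous_on_compose2[OF g]) auto
  moreover have "h ` ({0..1} \<times> P) \<subseteq> P'" using sub by (auto simp: h_def)
  ultimately have "continuous_map (prod_topology (top_of_set {0..1}) (top_of_set P)) (top_of_set P') h"
    by (auto simp: image_subset_iff)
  then show ?thesis unfolding homotopic_with_def using T by (intro exI[of _ h]) (auto simp: h_def)
qed

text \<open>A relative cycle is homologous to its image under \<open>r\<close>, and \<open>r\<close>
  is the identity on chains of \<open>P'\<close>. The intermediate stages of the homotopy only have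
  to respect \<open>T\<close>; they may move points of \<open>P'\<close>.\<close>

lemma incl_iso_deformation:
  assumes sub: "P' \<subseteq> P" "T' \<subseteq> T" "T' \<subseteq> P'" "T \<subseteq> P"
    and h: "homotopic_with (\<lambda>h. h \<in> T \<rightarrow> T) (top_of_set P) (top_of_set P) id r"
    and r: "r \<in> P \<rightarrow> P'" "r \<in> T \<rightarrow> T'" "\<And>x. x \<in> P' \<Longrightarrow> r x = x"
  shows "incl_iso k P' T' P T"
proof -
  have "continuous_map (top_of_set P) (top_of_set P) r"
    using homotopic_with_imp_continuous_maps[OF h] by blast
  then have cr: "continuous_map (top_of_set P) (top_of_set P') r"
    using r(1) sub(1) by (auto simp: continuous_map_in_subtopology)
  show ?thesis unfolding incl_iso_def
  proof (intro conjI sub allI impI)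
    fix z assume z: "rc k P T z"
    have "homologous_rel k (top_of_set P) T (chain_map k id z) (chain_map k r z)"
      by (rule homotopic_imp_homologous_rel_chain_maps[OF h z])
    then have "rb k P T (z - chain_map k r z)"
      using z chain_map_ident[of k "top_of_set P" z] by (simp add: homologous_rel_def singular_relcycle_def)
    then show "\<exists>z'. rc k P' T' z' \<and> rb k P T (z - z')"
      using singular_relcycle_chain_map[OF z cr r(2)] by blast
  next
    fix z assume z: "rc k P' T' z \<and> rb k P T z"
    then have "rb k P' T' (chain_map k r z)" using singular_relboundary_chain_map[OF _ cr r(2)] by blast
    moreover have "chain_map k r z = z"
      by (rule chain_map_id_gen[of k "top_of_set P'"]) (use z r(3) in \<open>auto simp: singular_relcycle_def\<close>)
    ultimately show "rb k P' T' z" by simp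
  qed
qed

lemma homologous_rel_set_eq_iff:
  "homologous_rel_set k X T a = homologous_rel_set k X T b \<longleftrightarrow> homologous_rel k X T a b"
  by (rule homologous_rel_set_eq)

lemma incl_isoI_hom_induced:
  assumes sub: "P' \<subseteq> P" "T' \<subseteq> T" "T' \<subseteq> P'" "T \<subseteq> P"
    and iso: "hom_induced (int k) (top_of_set P') T' (top_of_set P) T id
      \<in> iso (relative_homology_group (int k) (top_of_set P') T')
          (relative_homology_group (int k) (top_of_set P) T)"
  shows "incl_iso k P' T' P T"
proof -
  let ?h = "hom_induced (int k) (top_of_set P') T' (top_of_set P) T id"
  let ?G = "relative_homology_group (int k) (top_of_set P') T'"
  let ?H = "relative_homology_group (int k) (top_of_set P) T"
  have cid: "continuous_map (top_of_set P') (top_of_set P) id"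
    using sub(1) by (auto simp: continuous_map_in_subtopology)
  have bij: "bij_betw ?h (carrier ?G) (carrier ?H)" and hom: "?h \<in> hom ?G ?H"
    using iso by (auto simp: iso_def)
  have eq: "?h (homologous_rel_set k (top_of_set P') T' z) = homologous_rel_set k (top_of_set P) T z"
    if "rc k P' T' z" for z
  proof -
    have "id \<in> T' \<rightarrow> T" using sub(2) by auto
    moreover have "chain_map k id z = z"
      using that chain_map_ident[of k "top_of_set P'" z] by (simp add: singular_relcycle_def)
    ultimately show ?thesis using hom_induced_chain_map[OF cid _ that, of T] by simp
  qed
  show ?thesis unfolding incl_iso_def
  proof (intro conjI sub allI impI)
    fix z assume z: "rc k P T z"
    then have "homologous_rel_set k (top_of_set P) T z \<in> ?h ` carrier ?G"
      using bij by (auto simp: bij_betw_def carrier_relative_homology_group)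
    then obtain z' where z': "rc k P' T' z'"
        "homologous_rel_set k (top_of_set P) T z = ?h (homologous_rel_set k (top_of_set P') T' z')"
      by (auto simp: carrier_relative_homology_group)
    then show "\<exists>z'. rc k P' T' z' \<and> rb k P T (z - z')"
      using eq[OF z'(1)] by (auto simp: homologous_rel_set_eq homologous_rel_def)
  next
    fix z assume z: "rc k P' T' z \<and> rb k P T z"
    then have "?h (homologous_rel_set k (top_of_set P') T' z) = \<one>\<^bsub>?H\<^esub>"
      using eq homologous_rel_set_eq_relboundary[of k "top_of_set P" T z] by simp
    moreover have "?h \<one>\<^bsub>?G\<^esub> = \<one>\<^bsub>?H\<^esub>"
      by (rule hom_one[OF hom]) (rule group_relative_homology_group)+
    moreover have "homologous_rel_set k (top_of_set P') T' z \<in> carrier ?G"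
      using z by (auto simp: carrier_relative_homology_group)
    moreover have "\<one>\<^bsub>?G\<^esub> \<in> carrier ?G"
      by (rule monoid.one_closed[OF group.is_monoid]) simp
    ultimately have "homologous_rel_set k (top_of_set P') T' z = \<one>\<^bsub>?G\<^esub>"
      using bij by (metis bij_betw_imp_inj_on inj_onD)
    then show "rb k P' T' z" using homologous_rel_set_eq_relboundary[of k "top_of_set P'" T' z] by simp
  qed
qed

lemma incl_iso_excision:
  assumes U: "closed U" and V: "open V" and "U \<inter> P \<subseteq> V" "P \<inter> V \<subseteq> T" "T \<subseteq> P"
  shows "incl_iso k (P - U) (T - U) P T"
proof (rule incl_isoI_hom_induced)
  have c: "top_of_set P closure_of (P \<inter> U) \<subseteq> top_of_set P interior_of T"
  proof -
    have "top_of_set P closure_of (P \<inter> U) = P \<inter> U"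
      by (intro closure_of_eq[THEN iffD2] closedin_closed_Int U)
    moreover have "P \<inter> V \<subseteq> top_of_set P interior_of T"
      by (intro interior_of_maximal openin_open_Int) (use assms in auto)
    ultimately show ?thesis using assms by auto
  qed
  have e: "P - P \<inter> U = P - U" "T - P \<inter> U = T - U" "P \<inter> (P - U) = P - U" using assms by auto
  show "hom_induced (int k) (top_of_set (P - U)) (T - U) (top_of_set P) T id
    \<in> iso (relative_homology_group (int k) (top_of_set (P - U)) (T - U))
       (relative_homology_group (int k) (top_of_set P) T)"
    using homology_excision_axiom[OF c \<open>T \<subseteq> P\<close>, of "int k"]
    by (simp add: subtopology_subtopology e)
qed (use assms in auto)

text \<open>The complement of \<open>B\<close> is excised; it is closed and lies inside the open set
  \<open>- C\<close>.\<close>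

lemma incl_iso_local:
  assumes "closed C" "open B" "C \<subseteq> B"
  shows "incl_iso k (P \<inter> B) (P \<inter> B - C) P (P - C)"
proof -
  have "incl_iso k (P - - B) (P - C - - B) P (P - C)"
    by (rule incl_iso_excision[of _ "- C"]) (use assms in auto)
  moreover have "P - - B = P \<inter> B" "P - C - - B = P \<inter> B - C" by auto
  ultimately show ?thesis by simp
qed

text \<open>Exact sequence of the triple \<open>T\<close>, \<open>S\<close>, \<open>E\<close>: the
  homology of (\<open>E\<close>, \<open>T\<close>) vanishes since both sets are contractible and
  \<open>T\<close> is nonempty, so the connecting map from (\<open>E\<close>, \<open>S\<close>) to
  (\<open>S\<close>, \<open>T\<close>) is bijective. In degree 0 its target is the zero group of
  degree -1.\<close>

lemma relboundary_iso:
  assumes E: "contractible E" and T: "contractible T" and sub: "T \<subseteq> S" "S \<subseteq> E" "T \<noteq> {}"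
  shows "rc k S T z \<Longrightarrow> \<exists>c. rc (Suc k) E S c \<and> rb k S T (z - chain_boundary (Suc k) c)"
    and "rc (Suc k) E S c \<Longrightarrow> rb k S T (chain_boundary (Suc k) c) \<Longrightarrow> rb (Suc k) E S c"
    and "rel_trivial 0 E S"
proof -
  have st: "subtopology (top_of_set E) S = top_of_set S" "subtopology (top_of_set E) T = top_of_set T"
    using sub by (auto simp: subtopology_subtopology inf.absorb2)
  have iso: "hom_relboundary p (top_of_set E) S T
         \<in> iso (relative_homology_group p (top_of_set E) S) (relative_homology_group (p - 1) (top_of_set S) T)" for p
    using iso_hom_relboundary_contractible[of "top_of_set E" T S p] E T sub by (simp add: st inf.absorb2)
  let ?h = "hom_relboundary (int (Suc k)) (top_of_set E) S T"
  let ?G = "relative_homology_group (int (Suc k)) (top_of_set E) S"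
  let ?H = "relative_homology_group (int k) (top_of_set S) T"
  have isok: "?h \<in> iso ?G ?H" using iso[of "int (Suc k)"] by simp
  then have bij: "bij_betw ?h (carrier ?G) (carrier ?H)" and hom: "?h \<in> hom ?G ?H"
    by (auto simp: iso_def)
  have eq: "?h (homologous_rel_set (Suc k) (top_of_set E) S c)
      = homologous_rel_set k (top_of_set S) T (chain_boundary (Suc k) c)"
    if c: "rc (Suc k) E S c" for c
  proof -
    have cyc: "rc k S {} (chain_boundary (Suc k) c)"
      using c sub chain_boundary_boundary_alt[of k "top_of_set E" c] by (simp add: singular_cycle rc_iff)
    have "hom_boundary (int (Suc k)) (top_of_set E) S (homologous_rel_set (Suc k) (top_of_set E) S c)
       = homologous_rel_set k (top_of_set S) {} (chain_boundary (Suc k) c)"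
      using hom_boundary_chain_boundary[OF c] by (simp add: st)
    moreover have "hom_induced (int k) (top_of_set S) {} (top_of_set S) T id
        (homologous_rel_set k (top_of_set S) {} (chain_boundary (Suc k) c))
       = homologous_rel_set k (top_of_set S) T (chain_boundary (Suc k) c)"
      using hom_induced_chain_map[OF continuous_map_id _ cyc, of T] cyc
        chain_map_ident[of k "top_of_set S"] by (simp add: singular_cycle)
    ultimately show ?thesis by (simp add: hom_relboundary_def st)
  qed
  { assume z: "rc k S T z"
    then have "homologous_rel_set k (top_of_set S) T z \<in> ?h ` carrier ?G"
      using bij by (auto simp: bij_betw_def carrier_relative_homology_group)
    then obtain c where c: "rc (Suc k) E S c"
        "homologous_rel_set k (top_of_set S) T z = ?h (homologous_rel_set (Suc k) (top_of_set E) S c)"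
      unfolding carrier_relative_homology_group by blast
    then show "\<exists>c. rc (Suc k) E S c \<and> rb k S T (z - chain_boundary (Suc k) c)"
      using eq[OF c(1)] by (auto simp: homologous_rel_set_eq homologous_rel_def) }
  { assume c: "rc (Suc k) E S c" "rb k S T (chain_boundary (Suc k) c)"
    then have "?h (homologous_rel_set (Suc k) (top_of_set E) S c) = \<one>\<^bsub>?H\<^esub>"
      using eq homologous_rel_set_eq_relboundary[of k "top_of_set S" T "chain_boundary (Suc k) c"] by simp
    moreover have "?h \<one>\<^bsub>?G\<^esub> = \<one>\<^bsub>?H\<^esub>"
      by (rule hom_one[OF hom]) (rule group_relative_homology_group)+
    moreover have "homologous_rel_set (Suc k) (top_of_set E) S c \<in> carrier ?G"
      using c unfolding carrier_relative_homology_group by blast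
    moreover have "\<one>\<^bsub>?G\<^esub> \<in> carrier ?G"
      by (rule monoid.one_closed[OF group.is_monoid]) simp
    ultimately have "homologous_rel_set (Suc k) (top_of_set E) S c = \<one>\<^bsub>?G\<^esub>"
      using bij by (metis bij_betw_imp_inj_on inj_onD)
    then show "rb (Suc k) E S c" using homologous_rel_set_eq_relboundary[of "Suc k" "top_of_set E" S c]
      unfolding one_relative_homology_group by blast }
  show "rel_trivial 0 E S" unfolding rel_trivial_def
  proof (intro allI impI)
    fix z assume z: "rc 0 E S z"
    let ?G0 = "relative_homology_group (int 0) (top_of_set E) S"
    have "trivial_group (relative_homology_group (int 0 - 1) (top_of_set S) T)" by simp
    then have "trivial_group ?G0" using iso[of "int 0"] isomorphic_group_triviality1 is_isoI
      by (metis group_relative_homology_group isomorphic_group_triviality)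
    then have "carrier ?G0 = {\<one>\<^bsub>?G0\<^esub>}" by (simp only: trivial_group_def)
    moreover have "homologous_rel_set 0 (top_of_set E) S z \<in> carrier ?G0"
      unfolding carrier_relative_homology_group by (rule imageI) (simp add: z)
    ultimately have "homologous_rel_set 0 (top_of_set E) S z = \<one>\<^bsub>?G0\<^esub>" by (simp only: singleton_iff)
    then show "rb 0 E S z" using homologous_rel_set_eq_relboundary[of 0 "top_of_set E" S z]
      unfolding one_relative_homology_group by blast
  qed
qed

section \<open>Local homology of affine spaces\<close>

text \<open>The affine singular simplex with vertices \<open>v 0\<close>, ...,
  \<open>v p\<close>.\<close>

definition asx :: "nat \<Rightarrow> (nat \<Rightarrow> 'a::real_vector) \<Rightarrow> (nat \<Rightarrow> real) \<Rightarrow> 'a" where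
  "asx p v = (\<lambda>t\<in>standard_simplex p. \<Sum>i\<le>p. t i *\<^sub>R v i)"

lemma affine_form_comb:
  assumes "affine_form f" "sum c I = 1"
  shows "f (\<Sum>i\<in>I. c i *\<^sub>R v i) = (\<Sum>i\<in>I. c i * f (v i))"
proof -
  obtain g d where g: "linear g" "f = (\<lambda>x. g x + d)" using assms(1) by (auto simp: affine_form_def)
  have "(\<Sum>i\<in>I. c i * (g (v i) + d)) = (\<Sum>i\<in>I. c i * g (v i)) + d"
    using assms(2) by (simp add: distrib_left sum.distrib flip: sum_distrib_right)
  then show ?thesis by (simp add: g(2) linear_sum[OF g(1)] linear_scale[OF g(1)])
qed

lemma affine_form_line:
  assumes "affine_form f"
  shows "f (x + t *\<^sub>R (y - x)) = f x + t * (f y - f x)"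
proof -
  obtain g d where g: "linear g" "f = (\<lambda>x. g x + d)" using assms(1) by (auto simp: affine_form_def)
  show ?thesis by (simp add: g(2) linear_add[OF g(1)] linear_scale[OF g(1)] linear_diff[OF g(1)])
qed

lemma affine_form_const: "affine_form (\<lambda>_. c)"
  unfolding affine_form_def by (intro exI[of _ "\<lambda>_. 0"] exI[of _ c]) (simp add: linear_zero)

lemma affine_form_linear: "linear g \<Longrightarrow> affine_form (\<lambda>z. g (z - y))"
  unfolding affine_form_def by (intro exI[of _ g] exI[of _ "- g y"]) (simp add: linear_diff)

lemma affine_form_add: "affine_form f \<Longrightarrow> affine_form g \<Longrightarrow> affine_form (\<lambda>z. f z + g z)"
proof -
  assume "affine_form f" "affine_form g"
  then obtain f' c g' d where *: "linear f'" "f = (\<lambda>x. f' x + c)" "linear g'" "g = (\<lambda>x. g' x + d)"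
    unfolding affine_form_def by blast
  show ?thesis
    unfolding affine_form_def *(2,4)
    by (intro exI[of _ "\<lambda>x. f' x + g' x"] exI[of _ "c + d"] conjI linear_compose_add *(1,3)) auto
qed

lemma affine_form_cmul: "affine_form f \<Longrightarrow> affine_form (\<lambda>z. c * f z)"
proof -
  assume "affine_form f"
  then obtain g d where *: "linear g" "f = (\<lambda>x. g x + d)" unfolding affine_form_def by blast
  have "linear (\<lambda>x. c * g x)" using linear_compose_scale_right[OF *(1), of c] by simp
  then show ?thesis unfolding affine_form_def *(2) by (intro exI[of _ "\<lambda>x. c * g x"] exI[of _ "c * d"]) (simp add: distrib_left)
qed

lemma affine_form_sum: "finite J \<Longrightarrow> (\<And>j. j \<in> J \<Longrightarrow> affine_form (f j)) \<Longrightarrow> affine_form (\<lambda>z. \<Sum>j\<in>J. f j z)"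
  by (induction J rule: finite_induct) (auto intro: affine_form_const affine_form_add)

lemmas affine_form_intros = affine_form_const affine_form_linear affine_form_add affine_form_cmul affine_form_sum

lemma affine_form_continuous:
  fixes f :: "'a::euclidean_space \<Rightarrow> real"
  assumes "affine_form f" shows "continuous_on S f"
  using assms linear_continuous_on linear_conv_bounded_linear
  by (auto simp: affine_form_def intro!: continuous_intros)

lemma continuous_on_asx:
  fixes v :: "nat \<Rightarrow> 'a::real_normed_vector"
  shows "continuous_on (standard_simplex p) (\<lambda>t. \<Sum>i\<le>p. t i *\<^sub>R v i)"
  by (intro continuous_intros continuous_on_subset[OF continuous_on_product_coordinates]) auto

lemma singular_simplex_asx:
  fixes v :: "nat \<Rightarrow> 'a::real_normed_vector"
  shows "singular_simplex p (top_of_set S) (asx p v) \<longleftrightarrow> asx p v ` standard_simplex p \<subseteq> S"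
proof -
  have "continuous_on (standard_simplex p) (asx p v)"
    using continuous_on_asx[of p v] by (simp add: asx_def cong: continuous_on_cong)
  then show ?thesis unfolding singular_simplex_def euclidean_product_topology
    by (simp add: image_subset_iff_funcset) (simp add: asx_def)
qed

lemma asx_image: "asx p v ` standard_simplex p = {\<Sum>i\<le>p. t i *\<^sub>R v i | t. t \<in> standard_simplex p}"
  by (auto simp: asx_def image_iff)

lemma singular_face_asx:
  assumes "j \<le> Suc p"
  shows "singular_face (Suc p) j (asx (Suc p) v) = asx p (\<lambda>i. if i < j then v i else v (Suc i))"
proof -
  have "(\<Sum>i\<le>Suc p. simplical_face j t i *\<^sub>R v i) = (\<Sum>i\<le>p. t i *\<^sub>R (if i < j then v i else v (Suc i)))" for t
  proof -
    have "(\<Sum>i\<le>Suc p. simplical_face j t i *\<^sub>R v i)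
       = (\<Sum>i\<le>Suc p. if i < j then t i *\<^sub>R v i else if i = j then 0 else t (i - Suc 0) *\<^sub>R v (Suc (i - Suc 0)))"
      by (rule sum.cong) (auto simp: simplical_face_def)
    also have "\<dots> = (\<Sum>i\<le>p. if i < j then t i *\<^sub>R v i else t i *\<^sub>R v (Suc i))"
      using sum.zero_middle[of "Suc p" j "\<lambda>i. t i *\<^sub>R v i" "\<lambda>i. t i *\<^sub>R v (Suc i)"] assms by simp
    finally show ?thesis by (simp add: if_distrib cong: if_cong)
  qed
  then show ?thesis using simplical_face_in_standard_simplex[of "Suc p" j] assms
    by (auto simp: singular_face_def asx_def restrict_def fun_eq_iff)
qed

text \<open>Affine forms \<open>b i\<close> extending the barycentric coordinates of the simplex with vertices \<open>v i\<close>,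
  and the affine hull of the vertices.\<close>

definition bary :: "nat \<Rightarrow> (nat \<Rightarrow> 'a::euclidean_space) \<Rightarrow> (nat \<Rightarrow> 'a \<Rightarrow> real) \<Rightarrow> bool" where
  "bary p v b \<longleftrightarrow> (\<forall>i\<le>p. affine_form (b i)) \<and> (\<forall>i\<le>p. \<forall>j\<le>p. b i (v j) = (if i = j then 1 else 0))"

definition bsp :: "nat \<Rightarrow> (nat \<Rightarrow> 'a::euclidean_space) \<Rightarrow> (nat \<Rightarrow> 'a \<Rightarrow> real) \<Rightarrow> 'a set" where
  "bsp p v b = {z. z = (\<Sum>i\<le>p. b i z *\<^sub>R v i) \<and> (\<Sum>i\<le>p. b i z) = 1}"

lemma bary_comb:
  assumes "bary p v b" "sum c {..p} = 1"
  shows "j \<le> p \<Longrightarrow> b j (\<Sum>i\<le>p. c i *\<^sub>R v i) = c j" "(\<Sum>i\<le>p. c i *\<^sub>R v i) \<in> bsp p v b"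
proof -
  show *: "b j (\<Sum>i\<le>p. c i *\<^sub>R v i) = c j" if "j \<le> p" for j
  proof -
    have "b j (\<Sum>i\<le>p. c i *\<^sub>R v i) = (\<Sum>i\<le>p. c i * b j (v i))"
      using assms that by (intro affine_form_comb) (auto simp: bary_def)
    also have "\<dots> = (\<Sum>i\<le>p. if i = j then c i else 0)"
      using assms that by (intro sum.cong) (auto simp: bary_def)
    also have "\<dots> = c j" using that by simp
    finally show ?thesis .
  qed
  show "(\<Sum>i\<le>p. c i *\<^sub>R v i) \<in> bsp p v b"
  proof -
    let ?z = "\<Sum>i\<le>p. c i *\<^sub>R v i"
    have "(\<Sum>i\<le>p. b i ?z *\<^sub>R v i) = ?z" by (rule sum.cong) (auto simp: *)
    moreover have "(\<Sum>i\<le>p. b i ?z) = sum c {..p}" by (rule sum.cong) (auto simp: *)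
    ultimately show ?thesis using assms(2) by (simp add: bsp_def)
  qed
qed

lemma bsp_iff: "bary p v b \<Longrightarrow> z \<in> bsp p v b \<longleftrightarrow> (\<exists>c. sum c {..p} = 1 \<and> z = (\<Sum>i\<le>p. c i *\<^sub>R v i))"
  using bary_comb(2)[of p v b] by (auto simp: bsp_def)

lemma bsp_affine:
  assumes "bary p v b" "x \<in> bsp p v b" "y \<in> bsp p v b"
  shows "x + t *\<^sub>R (y - x) \<in> bsp p v b"
proof -
  obtain c d where c: "sum c {..p} = 1" "x = (\<Sum>i\<le>p. c i *\<^sub>R v i)"
      and d: "sum d {..p} = 1" "y = (\<Sum>i\<le>p. d i *\<^sub>R v i)"
    using assms by (auto simp: bsp_iff)
  have "(\<Sum>i\<le>p. c i + t * (d i - c i)) = 1"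
    using c(1) d(1) by (simp add: sum.distrib sum_subtractf flip: sum_distrib_left)
  moreover have "x + t *\<^sub>R (y - x) = (\<Sum>i\<le>p. (c i + t * (d i - c i)) *\<^sub>R v i)"
    by (simp add: c(2) d(2) scaleR_add_left scaleR_diff_left sum.distrib sum_subtractf scaleR_sum_right
        right_diff_distrib scaleR_diff_right)
  ultimately show ?thesis using assms(1) bsp_iff by blast
qed

lemma affine_bsp: "bary p v b \<Longrightarrow> affine (bsp p v b)"
  unfolding affine_alt using bsp_affine[of p v b]
  by (metis (no_types, lifting) add_diff_cancel_left' add_diff_eq scaleR_collapse scaleR_left.diff scaleR_one scaleR_right_diff_distrib diff_add_eq)

lemma asx_weights:
  assumes "bary p v b" "z \<in> asx p v ` standard_simplex p"
  shows "z \<in> bsp p v b" "j \<le> p \<Longrightarrow> 0 \<le> b j z"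
proof -
  obtain t where t: "t \<in> standard_simplex p" "z = (\<Sum>i\<le>p. t i *\<^sub>R v i)"
    using assms(2) by (auto simp: asx_image)
  then have "sum t {..p} = 1" by (simp add: standard_simplex_def)
  from bary_comb[OF assms(1) this] t show "z \<in> bsp p v b" "j \<le> p \<Longrightarrow> 0 \<le> b j z"
    by (auto simp: standard_simplex_def)
qed

lemma bsp_in_asx:
  assumes "z \<in> bsp p v b" "\<And>j. j \<le> p \<Longrightarrow> 0 \<le> b j z"
  shows "z \<in> asx p v ` standard_simplex p"
proof -
  define t where "t i = (if i \<le> p then b i z else 0)" for i
  have s: "(\<Sum>i\<le>p. t i) = 1" using assms(1) by (simp add: bsp_def t_def)
  have "t i \<le> 1" for i
  proof (cases "i \<le> p")
    case True
    have "t i \<le> (\<Sum>i\<le>p. t i)"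
      by (rule member_le_sum) (use True assms(2) in \<open>auto simp: t_def\<close>)
    then show ?thesis using s by simp
  qed (simp add: t_def)
  then have "t \<in> standard_simplex p" using s assms(2) by (auto simp: standard_simplex_def t_def)
  moreover have "z = (\<Sum>i\<le>p. t i *\<^sub>R v i)" using assms(1) by (simp add: bsp_def t_def)
  ultimately show ?thesis by (auto simp: asx_image)
qed

lemma chain_boundary_asx:
  "chain_boundary (Suc p) (frag_of (asx (Suc p) v))
     = frag_of (asx p (v \<circ> Suc)) + (\<Sum>j\<in>{1..Suc p}. frag_cmul ((-1) ^ j) (frag_of (asx p (\<lambda>i. if i < j then v i else v (Suc i)))))"
proof -
  have "chain_boundary (Suc p) (frag_of (asx (Suc p) v))
     = (\<Sum>j\<le>Suc p. frag_cmul ((-1) ^ j) (frag_of (asx p (\<lambda>i. if i < j then v i else v (Suc i)))))"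
    by (simp only: chain_boundary_of nat.distinct(2) if_False)
       (intro sum.cong refl, simp add: singular_face_asx)
  also have "{..Suc p} = insert 0 {1..Suc p}" by auto
  finally show ?thesis by (simp add: comp_def)
qed

lemma asx_face_subset:
  assumes "bary (Suc p) v b" "j \<le> Suc p" "z \<in> asx p (\<lambda>i. if i < j then v i else v (Suc i)) ` standard_simplex p"
  shows "z \<in> asx (Suc p) v ` standard_simplex (Suc p)" "b j z = 0"
proof -
  have "singular_face (Suc p) j (asx (Suc p) v) ` standard_simplex p \<subseteq> asx (Suc p) v ` standard_simplex (Suc p)"
    using image_singular_face_subset[of "Suc p" j "asx (Suc p) v"] assms(2) by simp
  then show z: "z \<in> asx (Suc p) v ` standard_simplex (Suc p)"
    using assms by (auto simp: singular_face_asx)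
  obtain t where t: "t \<in> standard_simplex p" "z = (\<Sum>i\<le>p. t i *\<^sub>R (if i < j then v i else v (Suc i)))"
    using assms(3) by (auto simp: asx_image)
  have "b j z = (\<Sum>i\<le>p. t i * b j (if i < j then v i else v (Suc i)))"
    unfolding t(2) using assms(1,2) t(1)
    by (intro affine_form_comb) (auto simp: bary_def standard_simplex_def)
  also have "\<dots> = 0"
    using assms(1,2) by (intro sum.neutral) (auto simp: bary_def)
  finally show "b j z = 0" .
qed

lemma bary_Suc: "bary (Suc p) v b \<Longrightarrow> bary p (v \<circ> Suc) (b \<circ> Suc)"
  by (auto simp: bary_def)

lemma bsp_Suc:
  assumes "bary (Suc p) v b"
  shows "bsp p (v \<circ> Suc) (b \<circ> Suc) = {z \<in> bsp (Suc p) v b. b 0 z = 0}"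
proof (intro equalityI subsetI)
  fix z assume z: "z \<in> bsp p (v \<circ> Suc) (b \<circ> Suc)"
  define c where "c i = (case i of 0 \<Rightarrow> 0 | Suc j \<Rightarrow> b i z)" for i
  have s: "sum c {..Suc p} = 1" using z by (simp add: sum.atMost_Suc_shift c_def bsp_def del: sum.atMost_Suc)
  have "z = (\<Sum>i\<le>Suc p. c i *\<^sub>R v i)"
    using z by (simp add: sum.atMost_Suc_shift c_def bsp_def del: sum.atMost_Suc)
  then have zc: "z = (\<Sum>i\<le>Suc p. c i *\<^sub>R v i)" .
  have "b 0 z = c 0" unfolding zc by (rule bary_comb(1)[OF assms s]) simp
  moreover have "z \<in> bsp (Suc p) v b" unfolding zc by (rule bary_comb(2)[OF assms s])
  ultimately show "z \<in> {z \<in> bsp (Suc p) v b. b 0 z = 0}" by (simp add: c_def)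
next
  fix z assume "z \<in> {z \<in> bsp (Suc p) v b. b 0 z = 0}"
  then have z: "b 0 z = 0" "z = (\<Sum>i\<le>Suc p. b i z *\<^sub>R v i)" "(\<Sum>i\<le>Suc p. b i z) = 1"
    by (auto simp only: bsp_def mem_Collect_eq)
  have "(\<Sum>i\<le>Suc p. b i z *\<^sub>R v i) = (\<Sum>i\<le>p. b (Suc i) z *\<^sub>R v (Suc i))"
    "(\<Sum>i\<le>Suc p. b i z) = (\<Sum>i\<le>p. b (Suc i) z)"
    unfolding sum.atMost_Suc_shift by (simp_all add: z(1))
  then show "z \<in> bsp p (v \<circ> Suc) (b \<circ> Suc)"
    using z(2,3) by (simp only: bsp_def mem_Collect_eq comp_apply)
qed

lemma closed_ray:
  fixes e :: "'a::euclidean_space"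
  assumes "e \<noteq> 0"
  shows "closed {y + t *\<^sub>R e | t. t \<ge> 0}"
proof -
  have "{y + t *\<^sub>R e | t. t \<ge> 0} = {z. z = y + ((z - y) \<bullet> e / (e \<bullet> e)) *\<^sub>R e} \<inter> {z. 0 \<le> (z - y) \<bullet> e}"
  proof (intro equalityI subsetI)
    fix z assume "z \<in> {z. z = y + ((z - y) \<bullet> e / (e \<bullet> e)) *\<^sub>R e} \<inter> {z. 0 \<le> (z - y) \<bullet> e}"
    then have "z = y + ((z - y) \<bullet> e / (e \<bullet> e)) *\<^sub>R e" "(z - y) \<bullet> e / (e \<bullet> e) \<ge> 0" by auto
    then show "z \<in> {y + t *\<^sub>R e | t. t \<ge> 0}" by blast
  qed (use assms in auto)
  moreover have "closed ({z. z = y + ((z - y) \<bullet> e / (e \<bullet> e)) *\<^sub>R e} \<inter> {z. 0 \<le> (z - y) \<bullet> e})"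
    by (intro closed_Int closed_Collect_eq closed_Collect_le continuous_intros) (use assms in auto)
  ultimately show ?thesis by simp
qed

text \<open>Induction on the dimension. Let \<open>R1\<close> be the ray from \<open>y\<close> away
  from the vertex \<open>v 0\<close> and \<open>A1\<close> its complement. \<open>A1\<close> is
  contractible, so local homology at \<open>y\<close> is the homology of (\<open>?E - {y}\<close>,
  \<open>A1\<close>) one degree lower. Excising the opposite ray and projecting along the line
  identifies that pair with the local homology of the affine hull of the facet opposite to
  \<open>v 0\<close>. In the boundary of the simplex exactly this facet survives, because the other
  faces miss \<open>R1\<close>.\<close>

theorem affine_local_homology:
  assumes "bary p v b" "y \<in> bsp p v b" "\<And>i. i \<le> p \<Longrightarrow> b i y > 0"
  shows "rel_gen p (bsp p v b) (bsp p v b - {y}) (frag_of (asx p v))"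
    and "k \<noteq> p \<Longrightarrow> rel_trivial k (bsp p v b) (bsp p v b - {y})"
proof -
  have "rel_gen p (bsp p v b) (bsp p v b - {y}) (frag_of (asx p v)) \<and>
     (\<forall>k. k \<noteq> p \<longrightarrow> rel_trivial k (bsp p v b) (bsp p v b - {y}))"
    using assms
  proof (induction p arbitrary: v b y)
    case (0 v b y)
    have "bsp 0 v b = {v 0}" using 0(1) by (auto simp: bsp_def bary_def)
    with 0(2) have E: "bsp 0 v b = {y}" "v 0 = y" by auto
    have one: "topspace (top_of_set {y}) = {y}" by simp
    have asx0: "asx 0 v = (\<lambda>t\<in>standard_simplex 0. y)"
      by (auto simp: asx_def standard_simplex_0 E(2) restrict_def)
    have c0: "frag_cmul n (frag_of (asx 0 v)) = 0 \<Longrightarrow> n = 0" for n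
      by (metis frag_cmul_eq_0_iff frag_of_nonzero)
    have "rel_gen 0 {y} {} (frag_of (asx 0 v))"
    proof (rule rel_genI)
      show "rc 0 {y} {} (frag_of (asx 0 v))"
        by (simp add: singular_cycle singular_chain_of singular_simplex_singleton[OF one] asx0 chain_boundary_def)
    next
      fix z assume "rc 0 {y} {} z"
      then obtain n where "z = frag_cmul n (frag_of (asx 0 v))"
        using singular_chain_singleton[OF one, of 0 z] by (auto simp: singular_cycle asx0)
      then show "\<exists>n. rb 0 {y} {} (z - frag_cmul n (frag_of (asx 0 v)))"
        by (intro exI[of _ n]) simp
    next
      fix n assume "rb 0 {y} {} (frag_cmul n (frag_of (asx 0 v)))"
      then show "n = 0" using c0 by (simp add: singular_boundary_singleton[OF one])
    qed
    moreover have "rel_trivial k {y} {}" if "k \<noteq> 0" for k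
      using singular_boundary_eq_cycle_singleton[OF one, of k] that by (auto simp: rel_trivial_def)
    ultimately show ?case by (simp add: E)
  next
    case (Suc p v b y)
    let ?E = "bsp (Suc p) v b" and ?v = "v \<circ> Suc" and ?b = "b \<circ> Suc"
    let ?E' = "bsp p ?v ?b"
    note B = Suc.prems(1)
    have aff: "affine_form (b i)" if "i \<le> Suc p" for i using B that by (simp add: bary_def)
    define m where "m = b 0 y"
    have m0: "m > 0" using Suc.prems(3) by (simp add: m_def)
    have "(\<Sum>i\<le>Suc p. b i y) = 1" using Suc.prems(2) by (simp add: bsp_def)
    then have "m + (\<Sum>i\<le>p. b (Suc i) y) = 1" by (simp add: m_def sum.atMost_Suc_shift del: sum.atMost_Suc)
    moreover have "(\<Sum>i\<le>p. b (Suc i) y) > 0" using Suc.prems(3) by (intro sum_pos) auto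
    ultimately have m1: "m < 1" by linarith
    have v0: "v 0 \<in> ?E" "b 0 (v 0) = 1" "\<And>i. i \<le> p \<Longrightarrow> b (Suc i) (v 0) = 0"
    proof -
      show "v 0 \<in> ?E" using bsp_iff[OF B, of "v 0"]
        by (intro iffD2[OF bsp_iff[OF B]] exI[of _ "\<lambda>i. if i = 0 then 1 else 0"])
           (simp add: sum.atMost_Suc_shift del: sum.atMost_Suc)
    qed (use B in \<open>auto simp: bary_def\<close>)
    \<comment> \<open>\<open>y'\<close> is where the line from \<open>v 0\<close> through
      \<open>y\<close> meets \<open>b 0 = 0\<close>: that form is 1 at \<open>v 0\<close> and
      \<open>m\<close> at \<open>y\<close>.\<close>
    define y' where "y' = v 0 + (1 / (1 - m)) *\<^sub>R (y - v 0)"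
    define e where "e = y' - y"
    have e_eq: "e = (m / (1 - m)) *\<^sub>R (y - v 0)"
    proof -
      have "(1 / (1 - m) - 1) = m / (1 - m)" using m1 by (simp add: field_simps)
      then have "(m / (1 - m)) *\<^sub>R (y - v 0) = (1 / (1 - m)) *\<^sub>R (y - v 0) - (y - v 0)"
        by (metis scaleR_left.diff scaleR_one)
      then show ?thesis by (simp add: e_def y'_def)
    qed
    have yv: "y - v 0 = ((1 - m) / m) *\<^sub>R e" using m0 m1 by (simp add: e_eq)
    have y'E: "y' \<in> ?E" unfolding y'_def by (rule bsp_affine[OF B v0(1) Suc.prems(2)])
    have b0y': "b 0 y' = 0"
      unfolding y'_def using affine_form_line[OF aff[of 0], of "v 0" "1 / (1 - m)" y] m1 v0(2)
      by (simp add: m_def[symmetric] field_simps)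
    have biy': "b (Suc i) y' = b (Suc i) y / (1 - m)" if "i \<le> p" for i
      unfolding y'_def using affine_form_line[OF aff[of "Suc i"], of "v 0" "1 / (1 - m)" y] v0(3)[OF that] that
      by simp
    have bline0: "b 0 (y + t *\<^sub>R e) = m * (1 - t)" for t
      using affine_form_line[OF aff[of 0], of y t y'] by (simp add: e_def b0y' m_def algebra_simps)
    have blinei: "b (Suc i) (y + t *\<^sub>R e) > 0" if "t \<ge> 0" "i \<le> p" for t i
    proof -
      have pos: "b (Suc i) y > 0" using Suc.prems(3) that by simp
      have "b (Suc i) y' \<ge> b (Suc i) y"
      proof -
        have "b (Suc i) y * (1 - m) \<le> b (Suc i) y * 1" using pos m0 by (intro mult_left_mono) auto
        then show ?thesis using m1 unfolding biy'[OF that(2)] by (simp add: le_divide_eq)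
      qed
      then have "b (Suc i) y + t * (b (Suc i) y' - b (Suc i) y) > 0"
        using pos that(1) by (intro add_pos_nonneg mult_nonneg_nonneg) auto
      then show ?thesis using affine_form_line[OF aff[of "Suc i"], of y t y'] that by (simp add: e_def)
    qed
    have e0: "e \<noteq> 0" using bline0[of 1] m0 by (auto simp: m_def)
    have inj_e: "y + s *\<^sub>R e = y + t *\<^sub>R e \<longleftrightarrow> s = t" for s t using e0 by simp
    \<comment> \<open>\<open>R1\<close> leaves \<open>y\<close> through \<open>y'\<close>, and
      \<open>R2\<close> is the opposite ray, which passes through \<open>v 0\<close>.\<close>
    define R1 where "R1 = {y + t *\<^sub>R e | t. t \<ge> 0}"
    define R2 where "R2 = {y + t *\<^sub>R (- e) | t. t \<ge> 0}"
    have cl: "closed R1" "closed R2"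
      unfolding R1_def R2_def using e0 by (auto intro!: closed_ray simp del: scaleR_minus_right)
    define A1 where "A1 = ?E - R1"
    define A2 where "A2 = ?E - R2"
    let ?S = "?E - {y}"
    have yR: "y \<in> R1" "y \<in> R2" by (auto simp: R1_def R2_def intro!: exI[of _ 0])
    have R12: "R1 \<inter> R2 = {y}"
    proof -
      have "z = y" if z: "z \<in> R1" "z \<in> R2" for z
      proof -
        obtain s t where "s \<ge> 0" "t \<ge> 0" "z = y + s *\<^sub>R e" "z = y + (- t) *\<^sub>R e"
          using z by (auto simp: R1_def R2_def)
        then have "s = - t" using inj_e by metis
        then show ?thesis using \<open>s \<ge> 0\<close> \<open>t \<ge> 0\<close> \<open>z = y + s *\<^sub>R e\<close> by simp
      qed
      then show ?thesis using yR by blast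
    qed
    have v0A: "v 0 \<in> A1"
    proof -
      have "v 0 \<notin> R1"
      proof
        assume "v 0 \<in> R1"
        then obtain t where t: "t \<ge> 0" "v 0 = y + t *\<^sub>R e" by (auto simp: R1_def)
        have "v 0 = y + (- ((1 - m) / m)) *\<^sub>R e" using yv by (simp add: algebra_simps)
        then have "t = - ((1 - m) / m)" using inj_e t(2) by metis
        moreover have "(1 - m) / m > 0" using m0 m1 by simp
        ultimately show False using t(1) by linarith
      qed
      then show ?thesis using v0(1) by (simp add: A1_def)
    qed
    \<comment> \<open>\<open>v 0\<close> lies on the line of \<open>R1\<close>, behind its origin. A
      segment from \<open>v 0\<close> that touches \<open>R1\<close> is therefore part of this line
      and ends on \<open>R1\<close>.\<close>
    have cA1: "contractible A1"
    proof (rule starlike_imp_contractible, unfold starlike_def, intro bexI[OF _ v0A] ballI subsetI)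
      fix x z assume x: "x \<in> A1" and z: "z \<in> closed_segment (v 0) x"
      then obtain u where u: "0 \<le> u" "u \<le> 1" "z = (1 - u) *\<^sub>R v 0 + u *\<^sub>R x"
        by (auto simp: closed_segment_def)
      then have zu: "z = v 0 + u *\<^sub>R (x - v 0)" by (simp add: algebra_simps)
      have zE: "z \<in> ?E" unfolding zu using x v0(1) by (intro bsp_affine[OF B]) (auto simp: A1_def)
      have "z \<notin> R1"
      proof
        assume zR: "z \<in> R1"
        then obtain t where t: "t \<ge> 0" "z = y + t *\<^sub>R e" by (auto simp: R1_def)
        have u0: "u > 0" using u v0A zR by (cases "u = 0") (auto simp: zu A1_def)
        have v0e: "v 0 = y - ((1 - m) / m) *\<^sub>R e" using yv by (simp add: algebra_simps)
        have "u *\<^sub>R (x - v 0) = z - v 0" using zu by simp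
        also have "\<dots> = (t + (1 - m) / m) *\<^sub>R e" by (simp add: t(2) v0e algebra_simps)
        finally have "x - v 0 = ((t + (1 - m) / m) / u) *\<^sub>R e"
          using u0 by (metis (no_types, lifting) divide_inverse_commute less_numeral_extra(3) scaleR_scaleR vector_fraction_eq_iff real_vector_affinity_eq scaleR_cancel_left right_inverse scaleR_one nonzero_eq_divide_eq mult.commute)
        then have "x = y + ((t + (1 - m) / m) / u - (1 - m) / m) *\<^sub>R e"
          by (simp add: v0e algebra_simps)
        moreover have "(t + (1 - m) / m) / u - (1 - m) / m \<ge> 0"
        proof -
          have c: "(1 - m) / m > 0" using m0 m1 by simp
          have "u * ((1 - m) / m) \<le> 1 * ((1 - m) / m)" using u c by (intro mult_right_mono) auto
          then have "((1 - m) / m) * u \<le> t + (1 - m) / m" using t(1) unfolding mult.commute[of "(1 - m) / m" u] by linarith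
          then show ?thesis using pos_le_divide_eq[OF u0] by (simp only: diff_ge_0_iff_ge)
        qed
        ultimately have "x \<in> R1" by (auto simp: R1_def)
        then show False using x by (simp add: A1_def)
      qed
      then show "z \<in> A1" using zE by (simp add: A1_def)
    qed
    have cE: "contractible ?E" by (intro convex_imp_contractible affine_imp_convex affine_bsp[OF B])
    have A1S: "A1 \<subseteq> ?S" and SE: "?S \<subseteq> ?E" and A1ne: "A1 \<noteq> {}" using yR v0A by (auto simp: A1_def)
    note RI = relboundary_iso[OF cE cA1 A1S SE A1ne]
    \<comment> \<open>The rays meet only in \<open>y\<close>, so inside \<open>?E - {y}\<close> the
      closed set \<open>R2\<close> is contained in the open complement of \<open>R1\<close>, as
      excision requires.\<close>
    have exc: "incl_iso k A2 (A1 \<inter> A2) ?S A1" for k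
    proof -
      have "incl_iso k (?S - R2) (A1 - R2) ?S A1"
        by (rule incl_iso_excision[OF cl(2), of "- R1"]) (use cl(1) R12 yR in \<open>auto simp: A1_def open_Compl\<close>)
      moreover have "?S - R2 = A2" "A1 - R2 = A1 \<inter> A2" using yR by (auto simp: A1_def A2_def)
      ultimately show ?thesis by simp
    qed
    have E'_iff: "z \<in> ?E' \<longleftrightarrow> z \<in> ?E \<and> b 0 z = 0" for z using bsp_Suc[OF B] by auto
    have y'E': "y' \<in> ?E'" using y'E b0y' by (simp add: E'_iff)
    have E'A2: "?E' \<subseteq> A2"
    proof
      fix z assume z: "z \<in> ?E'"
      have "z \<notin> R2"
      proof
        assume "z \<in> R2"
        then obtain t where t: "t \<ge> 0" "z = y + (- t) *\<^sub>R e" by (auto simp: R2_def)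
        have "b 0 z = m * (1 + t)" unfolding t(2) bline0 by simp
        moreover have "m * (1 + t) > 0" using m0 t(1) by simp
        moreover have "b 0 z = 0" using z by (simp add: E'_iff)
        ultimately show False by linarith
      qed
      then show "z \<in> A2" using z by (simp add: A2_def E'_iff)
    qed
    have E'R1: "z = y'" if "z \<in> ?E'" "z = y + t *\<^sub>R e" for z t
    proof -
      have "m * (1 - t) = 0" using that bline0[of t] by (simp add: E'_iff)
      then have "t = 1" using m0 by simp
      then show ?thesis using that by (simp add: e_def)
    qed
    \<comment> \<open>Along \<open>e\<close> the form \<open>b 0\<close> drops by \<open>m\<close>
      per unit, so this is the projection onto \<open>?E'\<close> in direction
      \<open>e\<close>.\<close>
    define r where "r z = z + (b 0 z / m) *\<^sub>R e" for z
    have bre: "z + s *\<^sub>R e \<in> ?E" "b 0 (z + s *\<^sub>R e) = b 0 z - s * m" if "z \<in> ?E" for z s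
    proof -
      have "affine ?E" by (rule affine_bsp[OF B])
      then have "1 *\<^sub>R z + s *\<^sub>R y' + (- s) *\<^sub>R y \<in> ?E"
        using that y'E Suc.prems(2) by (intro mem_affine_3) auto
      then show "z + s *\<^sub>R e \<in> ?E" by (simp add: e_def algebra_simps)
      obtain g d where g: "linear g" "b 0 = (\<lambda>x. g x + d)" using aff[of 0] by (auto simp: affine_form_def)
      have "g e = - m" unfolding e_def linear_diff[OF g(1)] using b0y' by (simp add: m_def g(2))
      then show "b 0 (z + s *\<^sub>R e) = b 0 z - s * m"
        by (simp add: g(2) linear_add[OF g(1)] linear_scale[OF g(1)])
    qed
    have rE': "r z \<in> ?E'" if "z \<in> ?E" for z
      using bre[OF that, of "b 0 z / m"] m0 by (simp add: E'_iff r_def)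
    have seg: "(1 - s) *\<^sub>R z + s *\<^sub>R r z = z + (s * (b 0 z / m)) *\<^sub>R e" for z s
      by (simp add: r_def algebra_simps)
    \<comment> \<open>Only the line through \<open>y\<close> is critical. There \<open>z\<close> has
      a positive parameter \<open>u\<close> and the path runs from \<open>u\<close> towards 1, while
      \<open>R2\<close> consists of the parameters at most 0.\<close>
    have pathA2: "z + (s * (b 0 z / m)) *\<^sub>R e \<in> A2" if z: "z \<in> A2" and s: "0 \<le> s" "s \<le> 1" for z s
    proof -
      have zE: "z \<in> ?E" using z by (simp add: A2_def)
      have "z + (s * (b 0 z / m)) *\<^sub>R e \<notin> R2"
      proof
        assume "z + (s * (b 0 z / m)) *\<^sub>R e \<in> R2"
        then obtain t where t: "t \<ge> 0" "z + (s * (b 0 z / m)) *\<^sub>R e = y + (- t) *\<^sub>R e" by (auto simp: R2_def)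
        define u where "u = - t - s * (b 0 z / m)"
        have zu: "z = y + u *\<^sub>R e" using t(2) by (simp add: u_def algebra_simps)
        have bz: "b 0 z = m * (1 - u)" unfolding zu bline0 by simp
        have "u > 0"
        proof (rule ccontr)
          assume "\<not> u > 0"
          then have "z \<in> R2" unfolding R2_def zu by (intro CollectI exI[of _ "- u"]) auto
          then show False using z by (simp add: A2_def)
        qed
        moreover have "u + s * (1 - u) = - t"
        proof -
          have q: "b 0 z / m = 1 - u" using bz m0 by simp
          have "u = - t - s * (1 - u)" unfolding q[symmetric] by (fact u_def)
          then show ?thesis by linarith
        qed
        moreover have "u + s * (1 - u) > 0"
        proof (cases "s = 1")
          case False
          then have "(1 - s) * u > 0" using s \<open>u > 0\<close> by simp
          then have "(1 - s) * u + s > 0" using s by linarith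
          then show ?thesis by (simp add: algebra_simps)
        qed simp
        ultimately show False using t(1) by linarith
      qed
      then show ?thesis using bre(1)[OF zE] by (simp add: A2_def)
    qed
    have off: "z + s *\<^sub>R e \<noteq> y + t *\<^sub>R e" if z: "z \<in> A1 \<inter> A2" for z s t
    proof
      assume "z + s *\<^sub>R e = y + t *\<^sub>R e"
      then have zz: "z = y + (t - s) *\<^sub>R e" by (simp add: algebra_simps)
      show False
      proof (cases "t - s \<ge> 0")
        case True
        then show False using z zz by (auto simp: A1_def R1_def)
      next
        case False
        then have "z \<in> R2" unfolding R2_def zz by (intro CollectI exI[of _ "s - t"]) (auto simp: algebra_simps)
        then show False using z by (auto simp: A2_def)
      qed
    qed
    have pathL: "z + (s * (b 0 z / m)) *\<^sub>R e \<in> A1 \<inter> A2" if z: "z \<in> A1 \<inter> A2" and s: "0 \<le> s" "s \<le> 1" for z s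
      using pathA2[of z s] z s off[OF z, of "s * (b 0 z / m)"] unfolding A1_def R1_def A2_def by blast
    have cr: "continuous_on U r" for U
      unfolding r_def using affine_form_continuous[OF aff[of 0]] m0 by (intro continuous_intros) auto
    have E'T: "?E' - {y'} \<subseteq> A1 \<inter> A2"
      using E'A2 E'R1 unfolding A1_def R1_def A2_def by blast
    have def: "incl_iso k ?E' (?E' - {y'}) A2 (A1 \<inter> A2)" for k
    proof (rule incl_iso_deformation)
      show "homotopic_with (\<lambda>h. h \<in> A1 \<inter> A2 \<rightarrow> A1 \<inter> A2) (top_of_set A2) (top_of_set A2) id r"
        by (rule homotopic_with_linear_rel) (use pathA2 pathL cr seg in auto)
      show "r \<in> A2 \<rightarrow> ?E'" using rE' by (auto simp: A2_def)
      show "r \<in> A1 \<inter> A2 \<rightarrow> ?E' - {y'}"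
      proof
        fix z assume z: "z \<in> A1 \<inter> A2"
        have "r z \<noteq> y'" using off[OF z, of "b 0 z / m" 1] by (simp add: r_def e_def)
        then show "r z \<in> ?E' - {y'}" using rE' z by (auto simp: A1_def)
      qed
      show "r x = x" if "x \<in> ?E'" for x using that by (simp add: r_def E'_iff)
    qed (use E'A2 E'T in auto)
    have IH: "rel_gen p ?E' (?E' - {y'}) (frag_of (asx p ?v))"
        "k \<noteq> p \<Longrightarrow> rel_trivial k ?E' (?E' - {y'})" for k
    proof -
      have "?b i y' > 0" if "i \<le> p" for i
        using biy'[OF that] Suc.prems(3)[of "Suc i"] that m1 by simp
      then have "rel_gen p ?E' (?E' - {y'}) (frag_of (asx p ?v)) \<and>
         (\<forall>k. k \<noteq> p \<longrightarrow> rel_trivial k ?E' (?E' - {y'}))"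
        by (rule Suc.IH[OF bary_Suc[OF B] y'E'])
      then show "rel_gen p ?E' (?E' - {y'}) (frag_of (asx p ?v))"
        "k \<noteq> p \<Longrightarrow> rel_trivial k ?E' (?E' - {y'})" for k by (blast elim: conjE)+
    qed
    have triv1: "rel_trivial k ?S A1" if "k \<noteq> p" for k
      using IH(2)[OF that] incl_iso_trivial[OF def] incl_iso_trivial[OF exc] by blast
    let ?\<sigma> = "frag_of (asx (Suc p) v)" and ?\<tau> = "frag_of (asx p ?v)"
    have rc1: "rc p ?E' (?E' - {y'}) ?\<tau>" using IH(1) by (simp add: rel_gen_def)
    have gen1: "rel_gen p ?S A1 ?\<tau>"
      using incl_iso_gen[OF def rc1] incl_iso_gen[OF exc, of p ?\<tau>] IH(1) rel_gen_def by blast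
    have sx: "asx (Suc p) v ` standard_simplex (Suc p) \<subseteq> ?E" using asx_weights(1)[OF B] by blast
    \<comment> \<open>The faces containing \<open>v 0\<close>. On the \<open>j\<close>-th one
      \<open>b j\<close> vanishes, whereas \<open>b j\<close> is positive on all of
      \<open>R1\<close>; so they lie in \<open>A1\<close>.\<close>
    define rest where "rest = (\<Sum>j\<in>{1..Suc p}. frag_cmul ((-1) ^ j) (frag_of (asx p (\<lambda>i. if i < j then v i else v (Suc i)))))"
    have bdr: "chain_boundary (Suc p) ?\<sigma> = ?\<tau> + rest" unfolding rest_def by (rule chain_boundary_asx)
    have rest: "ch p A1 rest" unfolding rest_def
    proof (intro singular_chain_sum singular_chain_cmul singular_chain_of[THEN iffD2] singular_simplex_asx[THEN iffD2] subsetI)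
      fix j z assume j: "j \<in> {1..Suc p}" and z: "z \<in> asx p (\<lambda>i. if i < j then v i else v (Suc i)) ` standard_simplex p"
      have "z \<in> ?E" "b j z = 0" using asx_face_subset[OF B _ z] j sx by auto
      moreover have "z \<notin> R1"
        using blinei[of _ "j - 1"] j \<open>b j z = 0\<close> by (fastforce simp: R1_def)
      ultimately show "z \<in> A1" by (simp add: A1_def)
    qed
    have \<tau>S: "ch p ?S ?\<tau>" using gen1 A1S by (simp add: rel_gen_def rc_iff)
    have bdS: "ch p ?S (chain_boundary (Suc p) ?\<sigma>)"
      unfolding bdr by (intro singular_chain_add \<tau>S ch_mono[OF rest A1S])
    have rc\<sigma>: "rc (Suc p) ?E ?S ?\<sigma>"
      using bdS sx by (simp add: rc_iff[OF SE] singular_chain_of singular_simplex_asx)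
    have cyc: "rc k ?S A1 (chain_boundary (Suc k) z)" if "rc (Suc k) ?E ?S z" for k z
      using that chain_boundary_boundary_alt[of k "top_of_set ?E" z] by (simp add: rc_iff[OF SE] rc_iff[OF A1S])
    have gen2: "rel_gen p ?S A1 (chain_boundary (Suc p) ?\<sigma>)"
    proof (rule rel_gen_cong[OF gen1 cyc[OF rc\<sigma>]])
      have "?\<tau> - chain_boundary (Suc p) ?\<sigma> = - rest" by (simp add: bdr)
      then show "rb p ?S A1 (?\<tau> - chain_boundary (Suc p) ?\<sigma>)"
        using rb_ch[OF A1S] rest by (simp add: singular_chain_minus)
    qed
    have down: "rb p ?S A1 (chain_boundary (Suc p) z)" if zb: "rb (Suc p) ?E ?S z" for z
    proof -
      obtain d f where d: "ch (Suc (Suc p)) ?E d" "ch (Suc p) ?S f" "z = chain_boundary (Suc (Suc p)) d + f"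
        using zb unfolding rb_iff[OF SE] by blast
      then have "chain_boundary (Suc p) z = chain_boundary (Suc p) f"
        using chain_boundary_boundary_alt[OF d(1)] by (simp add: chain_boundary_add)
      then show ?thesis unfolding rb_iff[OF A1S] using d(2) by (intro exI[of _ f] exI[of _ 0]) simp
    qed
    have "rel_gen (Suc p) ?E ?S ?\<sigma>"
    proof (rule rel_genI[OF rc\<sigma>])
      fix z assume z: "rc (Suc p) ?E ?S z"
      obtain n where "rb p ?S A1 (chain_boundary (Suc p) z - frag_cmul n (chain_boundary (Suc p) ?\<sigma>))"
        using gen2 cyc[OF z] unfolding rel_gen_def by blast
      then have "rb p ?S A1 (chain_boundary (Suc p) (z - frag_cmul n ?\<sigma>))"
        by (simp add: chain_boundary_diff chain_boundary_cmul)
      then show "\<exists>n. rb (Suc p) ?E ?S (z - frag_cmul n ?\<sigma>)"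
        using RI(2)[OF rc_diff_cmul[OF z rc\<sigma>]] by blast
    next
      fix n assume "rb (Suc p) ?E ?S (frag_cmul n ?\<sigma>)"
      from down[OF this] have "rb p ?S A1 (frag_cmul n (chain_boundary (Suc p) ?\<sigma>))"
        by (simp add: chain_boundary_cmul)
      then show "n = 0" by (rule rel_gen_uniq[OF gen2])
    qed
    moreover have "rel_trivial k ?E ?S" if "k \<noteq> Suc p" for k
    proof (cases k)
      case 0
      then show ?thesis using RI(3) by simp
    next
      case (Suc k')
      then have "rel_trivial k' ?S A1" using triv1 that by simp
      then show ?thesis unfolding Suc using RI(2) cyc by (auto simp: rel_trivial_def)
    qed
    ultimately show ?case by blast
  qed
  then show "rel_gen p (bsp p v b) (bsp p v b - {y}) (frag_of (asx p v))"
    and "k \<noteq> p \<Longrightarrow> rel_trivial k (bsp p v b) (bsp p v b - {y})" by auto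
qed

section \<open>Locally finite chains near a point\<close>

definition avoids :: "nat \<Rightarrow> 'a \<Rightarrow> 'a lf_chain \<Rightarrow> bool" where
  "avoids k y w \<longleftrightarrow> (\<forall>f. y \<in> f ` standard_simplex k \<longrightarrow> w f = 0)"

text \<open>For a locally finite chain \<open>w\<close> whose boundary avoids \<open>y\<close>, \<open>loc\<close> says that the image of \<open>w\<close>
  in \<open>H\<^sub>k(P, P - {y})\<close> vanishes, and \<open>lgen\<close> that it freely generates this group.\<close>

definition loc :: "nat \<Rightarrow> 'a::euclidean_space set \<Rightarrow> 'a \<Rightarrow> 'a lf_chain \<Rightarrow> bool" where
  "loc k P y w \<longleftrightarrow> (\<exists>b. ch (Suc k) P b \<and> avoids k y (w - lk (chain_boundary (Suc k) b)))"

definition lgen :: "'a::euclidean_space set \<Rightarrow> nat \<Rightarrow> 'a set \<Rightarrow> 'a \<Rightarrow> 'a lf_chain \<Rightarrow> bool" where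
  "lgen M k P y w \<longleftrightarrow> lfs M k P w \<and> avoids (k - Suc 0) y (lf_boundary k w) \<and>
     (\<forall>z. lfs M k P z \<and> avoids (k - Suc 0) y (lf_boundary k z) \<longrightarrow> (\<exists>!n. loc k P y (z - lf_scale n w)))"

text \<open>\<open>relc\<close> and \<open>triv\<close> describe cycles and boundaries of the pair
  (\<open>P\<close>, \<open>Q\<close>) in locally finite homology, by chains supported in
  \<open>P\<close> with error terms supported in \<open>Q\<close>.\<close>

definition relc :: "'a::euclidean_space set \<Rightarrow> nat \<Rightarrow> 'a set \<Rightarrow> 'a set \<Rightarrow> 'a lf_chain \<Rightarrow> bool" where
  "relc M k P Q w \<longleftrightarrow> lfs M k P w \<and> lfs M (k - Suc 0) Q (lf_boundary k w)"

definition triv :: "'a::euclidean_space set \<Rightarrow> nat \<Rightarrow> 'a set \<Rightarrow> 'a set \<Rightarrow> 'a lf_chain \<Rightarrow> bool" where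
  "triv M k P Q w \<longleftrightarrow> (\<exists>u w'. lfs M (Suc k) P u \<and> lfs M k Q w' \<and> w = lf_boundary (Suc k) u + w')"

text \<open>\<open>(P, Q)\<close> behaves like a \<open>d\<close>-cell \<open>P - Q\<close>: its locally finite homology is freely generated
  by one class of degree \<open>d\<close>, which is detected at the point \<open>y\<close>.\<close>

definition ncell :: "'a::euclidean_space set \<Rightarrow> 'a set \<Rightarrow> 'a set \<Rightarrow> nat \<Rightarrow> 'a \<Rightarrow> bool" where
  "ncell M P Q d y \<longleftrightarrow> Q \<subseteq> P \<and> y \<in> P - Q \<and>
     (\<forall>k w. k \<noteq> d \<longrightarrow> relc M k P Q w \<longrightarrow> triv M k P Q w) \<and>
     (\<forall>w. relc M d P Q w \<longrightarrow> loc d P y w \<longrightarrow> triv M d P Q w) \<and>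
     (\<exists>e. relc M d P Q e \<and> lgen M d P y e)"

text \<open>The local homology at \<open>y\<close> is that of a manifold of dimension
  \<open>d\<close>.\<close>

definition lman :: "nat \<Rightarrow> 'a::euclidean_space set \<Rightarrow> 'a \<Rightarrow> bool" where
  "lman d P y \<longleftrightarrow> (\<forall>k. k \<noteq> d \<longrightarrow> rel_trivial k P (P - {y})) \<and> (\<exists>c. rel_gen d P (P - {y}) c)"

lemma avoids_diff: "avoids k y v \<Longrightarrow> avoids k y w \<Longrightarrow> avoids k y (v - w)"
  and avoids_add: "avoids k y v \<Longrightarrow> avoids k y w \<Longrightarrow> avoids k y (v + w)"
  and avoids_scale: "avoids k y v \<Longrightarrow> avoids k y (lf_scale n v)"
  and avoids_0 [simp]: "avoids k y 0" by (auto simp: avoids_def lf_scale_def)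

lemma avoids_lfs: "lfs M k Q w \<Longrightarrow> y \<notin> Q \<Longrightarrow> avoids k y w"
  unfolding avoids_def lfs_def by blast

lemma lf_scale_lincomb:
  "lf_scale n (a + b) = lf_scale n a + lf_scale n b"
  "lf_scale n (a - b) = lf_scale n a - lf_scale n b"
  "lf_scale (m - n) a = lf_scale m a - lf_scale n a"
  "lf_scale (m * n) a = lf_scale m (lf_scale n a)"
  "lf_scale 1 a = a" "lf_scale 0 a = 0" "lf_scale (- n) a = - lf_scale n a"
  by (auto simp: lf_scale_def fun_eq_iff algebra_simps)

lemma avoids_lk_iff: "ch k P c \<Longrightarrow> avoids k y (lk c) \<longleftrightarrow> ch k (P - {y}) c"
  using singular_chain_keys(2)[of k "P - {y}" c] singular_chain_keys(2)[of k P c]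
  unfolding avoids_def by (blast intro: singular_chain_subsetI)

lemma loc_cong_avoids:
  assumes "avoids k y (v - w)" "loc k P y v"
  shows "loc k P y w"
proof -
  obtain b where b: "ch (Suc k) P b" "avoids k y (v - lk (chain_boundary (Suc k) b))"
    using assms(2) unfolding loc_def by blast
  have eq: "w - lk (chain_boundary (Suc k) b) = (v - lk (chain_boundary (Suc k) b)) - (v - w)" by simp
  then have "avoids k y (w - lk (chain_boundary (Suc k) b))" unfolding eq by (intro avoids_diff b assms)
  then show ?thesis using b(1) unfolding loc_def by blast
qed

lemma loc_avoids: "avoids k y w \<Longrightarrow> loc k P y w"
  unfolding loc_def by (intro exI[of _ 0]) (simp add: lk_zero)

lemma loc_add: "loc k P y v \<Longrightarrow> loc k P y w \<Longrightarrow> loc k P y (v + w)"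
proof -
  assume "loc k P y v" "loc k P y w"
  then obtain b c where *: "ch (Suc k) P b" "avoids k y (v - lk (chain_boundary (Suc k) b))"
      "ch (Suc k) P c" "avoids k y (w - lk (chain_boundary (Suc k) c))"
    unfolding loc_def by blast
  have eq: "v + w - lk (chain_boundary (Suc k) (b + c))
      = (v - lk (chain_boundary (Suc k) b)) + (w - lk (chain_boundary (Suc k) c))"
    by (simp add: chain_boundary_add lk_add)
  then have "avoids k y (v + w - lk (chain_boundary (Suc k) (b + c)))"
    unfolding eq by (intro avoids_add *)
  then show ?thesis using singular_chain_add[OF *(1,3)] unfolding loc_def by blast
qed

lemma loc_scale: "loc k P y v \<Longrightarrow> loc k P y (lf_scale n v)"
proof -
  assume "loc k P y v"
  then obtain b where *: "ch (Suc k) P b" "avoids k y (v - lk (chain_boundary (Suc k) b))"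
    unfolding loc_def by blast
  have eq: "lf_scale n v - lk (chain_boundary (Suc k) (frag_cmul n b))
      = lf_scale n (v - lk (chain_boundary (Suc k) b))"
    by (simp add: chain_boundary_cmul lk_cmul lf_scale_lincomb)
  then have "avoids k y (lf_scale n v - lk (chain_boundary (Suc k) (frag_cmul n b)))"
    unfolding eq by (intro avoids_scale *)
  then show ?thesis using singular_chain_cmul[OF *(1)] unfolding loc_def by blast
qed

lemma loc_diff: "loc k P y v \<Longrightarrow> loc k P y w \<Longrightarrow> loc k P y (v - w)"
  using loc_add[of k P y v "- w"] loc_scale[of k P y w "-1"] by (simp add: lf_scale_lincomb)

lemma loc_0 [simp]: "loc k P y 0" by (rule loc_avoids) simp

lemma loc_mono: "loc k P y w \<Longrightarrow> P \<subseteq> P' \<Longrightarrow> loc k P' y w"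
  unfolding loc_def using ch_mono by blast

text \<open>Local finiteness on the compact set \<open>{y}\<close> leaves finitely many simplices
  through \<open>y\<close>. They carry the whole local class, which makes finite relative cycles
  available.\<close>

lemma trunc_point:
  assumes w: "lfs M k P w" and y: "y \<in> M"
  obtains c where "ch k P c" "avoids k y (w - lk c)"
    "avoids (k - Suc 0) y (lf_boundary k w) \<Longrightarrow> rc k P (P - {y}) c"
proof -
  obtain c where c: "ch k P c" "\<And>f. lk c f = (if f ` standard_simplex k \<inter> {y} \<noteq> {} then w f else 0)"
    using lf_truncate_finite[OF w, of "{y}"] y by auto
  have av: "avoids k y (w - lk c)" by (auto simp: avoids_def c(2))
  moreover have "rc k P (P - {y}) c" if "avoids (k - Suc 0) y (lf_boundary k w)"
  proof -
    have "lk (chain_boundary k c) g = 0" if g: "y \<in> g ` standard_simplex (k - Suc 0)" for g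
    proof (cases "k = 0")
      case True then show ?thesis by (simp add: chain_boundary_def)
    next
      case False
      have "lf_boundary k (lk c) g = lf_boundary k w g"
        by (rule lf_boundary_local) (use False g c(2) in auto)
      then show ?thesis using \<open>avoids (k - Suc 0) y (lf_boundary k w)\<close> g
        by (simp add: bd_lookup avoids_def)
    qed
    then have "ch (k - Suc 0) (P - {y}) (chain_boundary k c)"
      using avoids_lk_iff[OF singular_chain_boundary[OF c(1)]] by (auto simp: avoids_def)
    then show ?thesis using c(1) by (simp add: rc_iff)
  qed
  ultimately show thesis by (intro that[OF c(1)])
qed

lemma loc_lk:
  assumes "ch k P c" shows "loc k P y (lk c) \<longleftrightarrow> rb k P (P - {y}) c"
proof
  assume "loc k P y (lk c)"
  then obtain b where b: "ch (Suc k) P b" "avoids k y (lk c - lk (chain_boundary (Suc k) b))"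
    unfolding loc_def by blast
  have "ch k (P - {y}) (c - chain_boundary (Suc k) b)"
    using avoids_lk_iff[of k P "c - chain_boundary (Suc k) b" y] b assms singular_chain_boundary_alt[OF b(1)]
    by (simp add: lk_diff singular_chain_diff)
  then show "rb k P (P - {y}) c"
    using b(1) unfolding rb_iff[OF Diff_subset] by (intro exI[of _ b] exI[of _ "c - chain_boundary (Suc k) b"]) simp
next
  assume "rb k P (P - {y}) c"
  then obtain d e where d: "ch (Suc k) P d" "ch k (P - {y}) e" "c = chain_boundary (Suc k) d + e"
    unfolding rb_iff[OF Diff_subset] by blast
  have "avoids k y (lk e)" using avoids_lk_iff[OF ch_mono[OF d(2) Diff_subset]] d(2) by blast
  then show "loc k P y (lk c)" unfolding loc_def using d by (intro exI[of _ d]) (simp add: lk_add)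
qed

lemma loc_bd:
  assumes "lfs M (Suc k) P u" "y \<in> M"
  shows "loc k P y (lf_boundary (Suc k) u)"
proof -
  obtain c where c: "ch (Suc k) P c" "\<And>f. lk c f = (if f ` standard_simplex (Suc k) \<inter> {y} \<noteq> {} then u f else 0)"
    using lf_truncate_finite[OF assms(1), of "{y}"] assms(2) by auto
  have "lf_boundary (Suc k) u g = lf_boundary (Suc k) (lk c) g" if "y \<in> g ` standard_simplex k" for g
    by (rule lf_boundary_local) (use that c(2) in auto)
  then show ?thesis unfolding loc_def using c(1) by (auto simp: avoids_def bd_lookup)
qed

lemma lgen_lk:
  assumes c: "ch k P c" and PM: "P \<subseteq> M" and y: "y \<in> P"
  shows "lgen M k P y (lk c) \<longleftrightarrow> rel_gen k P (P - {y}) c"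
proof -
  have rc: "avoids (k - Suc 0) y (lf_boundary k (lk z)) \<longleftrightarrow> rc k P (P - {y}) z" if "ch k P z" for z
    using that avoids_lk_iff[OF singular_chain_boundary[OF that]] by (simp add: rc_iff bd_lookup)
  have l: "loc k P y (lk z - lf_scale n (lk c)) \<longleftrightarrow> rb k P (P - {y}) (z - frag_cmul n c)" if "ch k P z" for z n
    using loc_lk[of k P "z - frag_cmul n c" y] that c
    by (simp add: lk_diff lk_cmul singular_chain_diff singular_chain_cmul)
  show ?thesis
  proof
    assume L: "lgen M k P y (lk c)"
    show "rel_gen k P (P - {y}) c" unfolding rel_gen_def
    proof (intro conjI allI impI)
      show "rc k P (P - {y}) c" using L rc[OF c] by (simp add: lgen_def)
      fix z assume z: "rc k P (P - {y}) z"
      then have zc: "ch k P z" by (simp add: rc_iff)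
      have "\<exists>!n. loc k P y (lk z - lf_scale n (lk c))"
        using L rc[OF zc] z lfs_lookup[OF zc PM] unfolding lgen_def by blast
      then show "\<exists>!n. rb k P (P - {y}) (z - frag_cmul n c)" using l[OF zc] by simp
    qed
  next
    assume R: "rel_gen k P (P - {y}) c"
    show "lgen M k P y (lk c)" unfolding lgen_def
    proof (intro conjI allI impI)
      show "lfs M k P (lk c)" by (rule lfs_lookup[OF c PM])
      show "avoids (k - Suc 0) y (lf_boundary k (lk c))" using R rc[OF c] by (simp add: rel_gen_def)
      fix z assume z: "lfs M k P z \<and> avoids (k - Suc 0) y (lf_boundary k z)"
      have z1: "lfs M k P z" and z2: "avoids (k - Suc 0) y (lf_boundary k z)" and yM: "y \<in> M"
        using z y PM by auto
      obtain z' where z': "ch k P z'" "avoids k y (z - lk z')" "rc k P (P - {y}) z'"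
        by (rule trunc_point[OF z1 yM]) (use z2 in simp)
      have "\<exists>!n. rb k P (P - {y}) (z' - frag_cmul n c)" using R z'(3) by (simp add: rel_gen_def)
      moreover have "loc k P y (z - lf_scale n (lk c)) \<longleftrightarrow> rb k P (P - {y}) (z' - frag_cmul n c)" for n
      proof -
        have 1: "avoids k y ((z - lf_scale n (lk c)) - (lk z' - lf_scale n (lk c)))" using z'(2) by simp
        have 2: "avoids k y ((lk z' - lf_scale n (lk c)) - (z - lf_scale n (lk c)))"
          using avoids_scale[OF z'(2), of "-1"] by (simp add: lf_scale_lincomb)
        show ?thesis unfolding l[OF z'(1), symmetric] using loc_cong_avoids[OF 1] loc_cong_avoids[OF 2] by blast
      qed
      ultimately show "\<exists>!n. loc k P y (z - lf_scale n (lk c))" by simp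
    qed
  qed
qed

lemma lgen_ex: "lgen M k P y w \<Longrightarrow> lfs M k P z \<Longrightarrow> avoids (k - Suc 0) y (lf_boundary k z) \<Longrightarrow>
    \<exists>n. loc k P y (z - lf_scale n w)"
  unfolding lgen_def by blast

lemma lgen_uniq:
  assumes "lgen M k P y w" "loc k P y (lf_scale n w)"
  shows "n = 0"
proof -
  have "\<exists>!n. loc k P y (0 - lf_scale n w)"
    using assms(1) unfolding lgen_def by (metis avoids_0 bd_zero lfs_0)
  moreover have "loc k P y (0 - lf_scale n w)" using loc_scale[OF assms(2), of "-1"] by (simp add: lf_scale_lincomb)
  moreover have "loc k P y (0 - lf_scale 0 w)" by (simp add: lf_scale_lincomb)
  ultimately show ?thesis by blast
qed

lemma lgenI:
  assumes "lfs M k P w" "avoids (k - Suc 0) y (lf_boundary k w)"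
    "\<And>z. lfs M k P z \<Longrightarrow> avoids (k - Suc 0) y (lf_boundary k z) \<Longrightarrow> \<exists>n. loc k P y (z - lf_scale n w)"
    "\<And>n. loc k P y (lf_scale n w) \<Longrightarrow> n = 0"
  shows "lgen M k P y w"
  unfolding lgen_def
proof (intro conjI allI impI assms(1,2))
  fix z assume "lfs M k P z \<and> avoids (k - Suc 0) y (lf_boundary k z)"
  then obtain n where n: "loc k P y (z - lf_scale n w)" using assms(3) by blast
  show "\<exists>!n. loc k P y (z - lf_scale n w)"
  proof (rule ex1I[of _ n])
    fix m assume m: "loc k P y (z - lf_scale m w)"
    have "loc k P y (lf_scale (n - m) w)" using loc_diff[OF m n] by (simp add: lf_scale_lincomb)
    from assms(4)[OF this] show "m = n" by simp
  qed fact
qed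

text \<open>The condition on \<open>s\<close> says that it is a sign. Generators are insensitive to
  signs and to changes by locally trivial chains.\<close>

lemma lgen_cong:
  assumes g: "lgen M k P y w" and v: "lfs M k P v" "avoids (k - Suc 0) y (lf_boundary k v)"
    and l: "loc k P y (w - lf_scale s v)" and s: "s * s = 1"
  shows "lgen M k P y v"
proof (rule lgenI[OF v])
  fix z assume "lfs M k P z" "avoids (k - Suc 0) y (lf_boundary k z)"
  then obtain n where n: "loc k P y (z - lf_scale n w)" using lgen_ex[OF g] by blast
  have eq: "z - lf_scale (n * s) v = (z - lf_scale n w) + lf_scale n (w - lf_scale s v)"
    by (simp add: lf_scale_lincomb)
  then have "loc k P y (z - lf_scale (n * s) v)" unfolding eq by (intro loc_add n loc_scale l)
  then show "\<exists>n. loc k P y (z - lf_scale n v)" ..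
next
  fix n assume n: "loc k P y (lf_scale n v)"
  have "lf_scale (n * s) w = lf_scale (n * s) (w - lf_scale s v) + lf_scale (n * (s * s)) v"
    by (simp add: lf_scale_lincomb)
  then have "loc k P y (lf_scale (n * s) w)"
    using loc_add[OF loc_scale[OF l, of "n * s"] n] by (simp add: s)
  then have "n * s = 0" by (rule lgen_uniq[OF g])
  then show "n = 0" using s by auto
qed

lemma lgen_exists: assumes "lman d P y" "P \<subseteq> M" "y \<in> P" shows "\<exists>c. ch d P c \<and> lgen M d P y (lk c)"
proof -
  obtain c where c: "rel_gen d P (P - {y}) c" using assms(1) by (auto simp: lman_def)
  then have "ch d P c" by (simp add: rel_gen_def rc_iff)
  then show ?thesis using lgen_lk[of d P c M y] assms c by blast
qed

lemma lman_loc: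
  assumes "lman d P y" "k \<noteq> d" "lfs M k P w" "avoids (k - Suc 0) y (lf_boundary k w)" "y \<in> M"
  shows "loc k P y w"
proof -
  obtain c where c: "ch k P c" "avoids k y (w - lk c)" "rc k P (P - {y}) c"
    by (rule trunc_point[OF assms(3,5)]) (use assms(4) in simp)
  then have "rb k P (P - {y}) c" using assms(1,2) by (auto simp: lman_def rel_trivial_def)
  then have "loc k P y (lk c)" using loc_lk[OF c(1)] by blast
  moreover have "avoids k y (lk c - w)" using avoids_scale[OF c(2), of "-1"] by (simp add: lf_scale_lincomb)
  ultimately show ?thesis using loc_cong_avoids by blast
qed

text \<open>Local homology only sees \<open>U\<close>: excision compares both \<open>P\<close> and
  the affine space \<open>bsp p v b\<close> with their common part in \<open>U\<close>.\<close>

lemma bary_local: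
  assumes B: "bary p v b" and y: "y \<in> bsp p v b" "\<And>i. i \<le> p \<Longrightarrow> b i y > 0"
    and U: "open U" "y \<in> U" "P \<inter> U = bsp p v b \<inter> U"
  shows "asx p v ` standard_simplex p \<subseteq> U \<Longrightarrow> rel_gen p P (P - {y}) (frag_of (asx p v))"
    and "k \<noteq> p \<Longrightarrow> rel_trivial k P (P - {y})"
proof -
  let ?E = "bsp p v b"
  have i1: "incl_iso k (P \<inter> U) (P \<inter> U - {y}) P (P - {y})" for k
    by (rule incl_iso_local) (use U in auto)
  have i2: "incl_iso k (P \<inter> U) (P \<inter> U - {y}) ?E (?E - {y})" for k
    unfolding U(3) by (rule incl_iso_local) (use U in auto)
  show "rel_trivial k P (P - {y})" if "k \<noteq> p"
    using affine_local_homology(2)[OF B y that] incl_iso_trivial[OF i1] incl_iso_trivial[OF i2] by blast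
  assume im: "asx p v ` standard_simplex p \<subseteq> U"
  have g: "rel_gen p ?E (?E - {y}) (frag_of (asx p v))" by (rule affine_local_homology(1)[OF B y])
  have "ch p (P \<inter> U) (frag_of (asx p v))"
    using im asx_weights(1)[OF B] unfolding U(3) singular_chain_of singular_simplex_asx by blast
  moreover have "ch (p - Suc 0) (P \<inter> U - {y}) (chain_boundary p (frag_of (asx p v)))"
  proof (rule singular_chain_subsetI)
    show "ch (p - Suc 0) (P \<inter> U) (chain_boundary p (frag_of (asx p v)))"
      by (rule singular_chain_boundary) fact
    have *: "ch (p - Suc 0) (?E - {y}) (chain_boundary p (frag_of (asx p v)))"
      using g by (simp add: rel_gen_def rc_iff)
    fix f assume "lk (chain_boundary p (frag_of (asx p v))) f \<noteq> 0"
    from singular_chain_keys(2)[OF * this]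
      singular_chain_keys(2)[OF \<open>ch (p - Suc 0) (P \<inter> U) (chain_boundary p (frag_of (asx p v)))\<close> this]
    show "f ` standard_simplex (p - Suc 0) \<subseteq> P \<inter> U - {y}" by blast
  qed
  ultimately have "rc p (P \<inter> U) (P \<inter> U - {y}) (frag_of (asx p v))" unfolding rc_iff[OF Diff_subset] by blast
  then show "rel_gen p P (P - {y}) (frag_of (asx p v))"
    using g incl_iso_gen[OF i1] incl_iso_gen[OF i2] by blast
qed

section \<open>Orientation simplices\<close>

lemma local_orientation_simplex_asx:
  "local_orientation_simplex bs y eps = asx (length bs) (oriented_vertex bs y eps)"
  by (simp add: local_orientation_simplex_def asx_def)

lemma oriented_vertex_bary:
  fixes bs :: "'a::euclidean_space list"
  assumes ind: "independent (set bs)" and dist: "distinct bs" and eps: "eps > 0"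
  obtains b where "bary (length bs) (oriented_vertex bs y eps) b"
    "bsp (length bs) (oriented_vertex bs y eps) b = {z. z - y \<in> span (set bs)}"
    "\<And>i. i \<le> length bs \<Longrightarrow> b i y > 0"
proof -
  define d where "d = length bs"
  have "\<exists>g. linear g \<and> (\<forall>x\<in>set bs. g x = (if x = bs ! i then 1 else (0::real)))" for i
    using linear_independent_extend[OF ind, of "\<lambda>x. if x = bs ! i then 1 else (0::real)"] by auto
  then obtain g where g: "\<And>i. linear (g i)"
      "\<And>i x. x \<in> set bs \<Longrightarrow> g i x = (if x = bs ! i then 1 else (0::real))" by metis
  have gb: "g i (bs ! j) = (if i = j then 1 else 0)" if "i < d" "j < d" for i j
    using that g(2)[of "bs ! j" i] dist nth_eq_iff_index_eq[of bs j i] by (auto simp: d_def)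
  have sl: "sum_list bs = (\<Sum>i<d. bs ! i)" by (simp add: sum_list_sum_nth d_def atLeast0LessThan)
  have gs: "g i (sum_list bs) = 1" if "i < d" for i
    unfolding sl linear_sum[OF g(1)] using that by (simp add: gb)
  have gsp: "x = (\<Sum>i<d. g i x *\<^sub>R bs ! i)" if "x \<in> span (set bs)" for x using that
  proof (induction rule: span_induct_alt)
    case base then show ?case by (simp add: linear_0[OF g(1)])
  next
    case (step c x y)
    obtain j where j: "j < d" "x = bs ! j" using step(1) by (auto simp: in_set_conv_nth d_def)
    have "(\<Sum>i<d. g i x *\<^sub>R bs ! i) = (\<Sum>i<d. if i = j then bs ! i else 0)"
      by (intro sum.cong) (auto simp: j gb)
    then have "(\<Sum>i<d. g i x *\<^sub>R bs ! i) = x" using j by simp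
    moreover have "(\<Sum>i<d. g i (c *\<^sub>R x + y) *\<^sub>R bs ! i)
       = c *\<^sub>R (\<Sum>i<d. g i x *\<^sub>R bs ! i) + (\<Sum>i<d. g i y *\<^sub>R bs ! i)"
      by (simp add: linear_add[OF g(1)] linear_scale[OF g(1)] scaleR_add_left sum.distrib scaleR_sum_right)
    ultimately show ?case using step(2) by simp
  qed
  \<comment> \<open>Solving for barycentric coordinates: the coefficient of the \<open>j\<close>-th
    basis vector forces \<open>b (Suc j) z - b 0 z = g j (z - y) / eps\<close>, and the condition
    that all coordinates sum to 1 then determines \<open>b 0 z\<close>. At \<open>y\<close> all of
    them equal \<open>1 / (real d + 1)\<close>.\<close>
  define b0 where "b0 z = (1 - (\<Sum>j<d. g j (z - y) / eps)) / (real d + 1)" for z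
  define b where "b i z = (case i of 0 \<Rightarrow> b0 z | Suc j \<Rightarrow> b0 z + g j (z - y) / eps)" for i z
  let ?v = "oriented_vertex bs y eps"
  have v: "?v 0 = y - eps *\<^sub>R sum_list bs" "?v (Suc i) = y + eps *\<^sub>R bs ! i" for i
    by (simp_all add: oriented_vertex_def)
  have gv0: "g i (?v 0 - y) / eps = -1" if "i < d" for i
    using eps gs[OF that] by (simp add: v linear_neg[OF g(1)] linear_scale[OF g(1)])
  have gvS: "g i (?v (Suc j) - y) / eps = (if i = j then 1 else 0)" if "i < d" "j < d" for i j
    using eps gb[OF that] by (simp add: v linear_scale[OF g(1)])
  have b0v0: "b0 (?v 0) = 1" unfolding b0_def by (simp add: gv0)
  have b0vS: "b0 (?v (Suc j)) = 0" if "j < d" for j unfolding b0_def using that by (simp add: gvS)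
  have aff: "affine_form (\<lambda>z. (1 / eps) * g j (z - y))" for j by (intro affine_form_intros g(1))
  have aff0: "affine_form (\<lambda>z. (1 / (real d + 1)) * (1 + -1 * (\<Sum>j<d. (1 / eps) * g j (z - y))))"
    by (intro affine_form_intros aff finite_lessThan)
  then have aff0: "affine_form b0" by (simp add: b0_def[abs_def])
  then have affS: "affine_form (\<lambda>z. b0 z + g j (z - y) / eps)" for j using affine_form_add[OF aff0 aff[of j]] by simp
  have bary: "bary d ?v b" unfolding bary_def
  proof (intro conjI allI impI)
    fix i assume "i \<le> d"
    show "affine_form (b i)" by (cases i) (simp_all add: b_def[abs_def] aff0 affS)
    fix j assume "j \<le> d"
    show "b i (?v j) = (if i = j then 1 else 0)" using \<open>i \<le> d\<close> \<open>j \<le> d\<close>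
      by (cases i; cases j) (auto simp: b_def b0v0 b0vS gv0 gvS simp del: divide_eq_eq_1 divide_eq_0_iff)
  qed
  have sum1: "(\<Sum>i\<le>d. b i z) = 1" for z
  proof -
    have "(\<Sum>i\<le>d. b i z) = b0 z + (\<Sum>i<d. b0 z + g i (z - y) / eps)"
      by (subst lessThan_Suc_atMost[symmetric], subst sum.lessThan_Suc_shift) (simp add: b_def)
    also have "\<dots> = (real d + 1) * b0 z + (\<Sum>i<d. g i (z - y) / eps)"
      by (simp add: sum.distrib algebra_simps)
    also have "\<dots> = 1" by (simp add: b0_def)
    finally show ?thesis .
  qed
  have comb: "(\<Sum>i\<le>d. b i z *\<^sub>R ?v i) = y + (\<Sum>i<d. g i (z - y) *\<^sub>R bs ! i)" for z
  proof -
    have "(\<Sum>i\<le>d. b i z *\<^sub>R ?v i) = (\<Sum>i\<le>d. b i z *\<^sub>R (?v i - y)) + (\<Sum>i\<le>d. b i z) *\<^sub>R y"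
      by (simp add: scaleR_diff_right sum_subtractf scaleR_sum_left)
    moreover have "(\<Sum>i\<le>d. b i z *\<^sub>R (?v i - y)) = (\<Sum>i<d. g i (z - y) *\<^sub>R bs ! i)"
    proof -
      have "(\<Sum>i\<le>d. b i z *\<^sub>R (?v i - y))
        = b0 z *\<^sub>R (- (eps *\<^sub>R sum_list bs)) + (\<Sum>i<d. (b0 z + g i (z - y) / eps) *\<^sub>R (eps *\<^sub>R bs ! i))"
        by (subst lessThan_Suc_atMost[symmetric], subst sum.lessThan_Suc_shift) (simp add: b_def v)
      also have "\<dots> = (\<Sum>i<d. (g i (z - y) / eps) *\<^sub>R (eps *\<^sub>R bs ! i))"
      proof -
        have "b0 z *\<^sub>R (- (eps *\<^sub>R sum_list bs)) = (\<Sum>i<d. - (b0 z *\<^sub>R (eps *\<^sub>R bs ! i)))"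
          by (simp add: sl scaleR_sum_right sum_negf)
        then show ?thesis by (simp add: scaleR_add_left flip: sum.distrib del: scaleR_scaleR)
      qed
      also have "\<dots> = (\<Sum>i<d. g i (z - y) *\<^sub>R bs ! i)" using eps by simp
      finally show ?thesis .
    qed
    ultimately show ?thesis by (simp add: sum1)
  qed
  have bsp: "bsp d ?v b = {z. z - y \<in> span (set bs)}"
  proof (intro equalityI subsetI)
    fix z assume "z \<in> bsp d ?v b"
    then have "z - y = (\<Sum>i<d. g i (z - y) *\<^sub>R bs ! i)" by (simp add: bsp_def comb algebra_simps)
    moreover have "\<dots> \<in> span (set bs)"
      by (intro span_sum span_scale span_base) (auto simp: d_def)
    ultimately show "z \<in> {z. z - y \<in> span (set bs)}" by simp
  next
    fix z assume "z \<in> {z. z - y \<in> span (set bs)}"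
    then have "z - y = (\<Sum>i<d. g i (z - y) *\<^sub>R bs ! i)" using gsp by blast
    then have "z = y + (\<Sum>i<d. g i (z - y) *\<^sub>R bs ! i)" by (simp add: algebra_simps)
    then show "z \<in> bsp d ?v b" by (simp add: bsp_def comb sum1)
  qed
  have pos: "b i y > 0" if "i \<le> d" for i by (cases i) (auto simp: b_def b0_def linear_0[OF g(1)])
  show thesis using that[of b] bary bsp pos by (simp add: d_def)
qed

lemma asx_in_convex:
  assumes "convex C" "\<And>i. i \<le> p \<Longrightarrow> v i \<in> C"
  shows "asx p v ` standard_simplex p \<subseteq> C"
proof
  fix z assume "z \<in> asx p v ` standard_simplex p"
  then obtain t where t: "t \<in> standard_simplex p" "z = (\<Sum>i\<le>p. t i *\<^sub>R v i)" by (auto simp: asx_image)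
  show "z \<in> C" unfolding t(2)
    by (rule convex_sum[OF _ assms(1)]) (use t(1) assms(2) in \<open>auto simp: standard_simplex_def\<close>)
qed

lemma local_orientation_simplex_small:
  fixes bs :: "'a::euclidean_space list"
  assumes "r > 0"
  obtains eps0 where "eps0 > 0" "\<And>eps. 0 < eps \<Longrightarrow> eps < eps0 \<Longrightarrow>
     local_orientation_simplex bs y eps ` standard_simplex (length bs) \<subseteq> ball y r"
proof -
  define C where "C = norm (sum_list bs) + (\<Sum>i<length bs. norm (bs ! i)) + 1"
  have C: "C > 0" unfolding C_def by (intro add_nonneg_pos add_nonneg_nonneg sum_nonneg) auto
  have "local_orientation_simplex bs y eps ` standard_simplex (length bs) \<subseteq> ball y r"
    if eps: "0 < eps" "eps < r / C" for eps
    unfolding local_orientation_simplex_asx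
  proof (rule asx_in_convex)
    fix i assume i: "i \<le> length bs"
    have "eps * C < r" using eps C by (simp add: pos_less_divide_eq)
    moreover have "dist y (oriented_vertex bs y eps i) \<le> eps * C"
    proof (cases i)
      case 0
      have "0 \<le> (\<Sum>i<length bs. norm (bs ! i))" by (intro sum_nonneg) auto
      then show ?thesis using 0 eps(1) by (simp add: oriented_vertex_def dist_norm C_def)
    next
      case (Suc j)
      have "norm (bs ! j) \<le> (\<Sum>i<length bs. norm (bs ! i))"
        by (rule member_le_sum) (use Suc i in auto)
      then have "norm (bs ! j) \<le> C" unfolding C_def using norm_ge_zero[of "sum_list bs"] by linarith
      then show ?thesis using Suc eps(1) by (simp add: oriented_vertex_def dist_norm)
    qed
    ultimately show "oriented_vertex bs y eps i \<in> ball y r" by simp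
  qed simp
  then show thesis using that[of "r / C"] C assms by simp
qed

lemma local_orientation_gen:
  fixes bs :: "'a::euclidean_space list"
  assumes ind: "independent (set bs)" and dist: "distinct bs"
    and U: "open U" "y \<in> U" "P \<inter> U = {z. z - y \<in> span (set bs)} \<inter> U"
  shows "eps > 0 \<Longrightarrow> local_orientation_simplex bs y eps ` standard_simplex (length bs) \<subseteq> U
      \<Longrightarrow> rel_gen (length bs) P (P - {y}) (frag_of (local_orientation_simplex bs y eps))"
    and "lman (length bs) P y"
proof -
  show *: "rel_gen (length bs) P (P - {y}) (frag_of (local_orientation_simplex bs y eps))"
    if eps: "eps > 0" "local_orientation_simplex bs y eps ` standard_simplex (length bs) \<subseteq> U" for eps
  proof -
    obtain b where b: "bary (length bs) (oriented_vertex bs y eps) b"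
      "bsp (length bs) (oriented_vertex bs y eps) b = {z. z - y \<in> span (set bs)}"
      "\<And>i. i \<le> length bs \<Longrightarrow> b i y > 0"
      using oriented_vertex_bary[OF ind dist eps(1)] by metis
    have "y \<in> bsp (length bs) (oriented_vertex bs y eps) b" unfolding b(2) by (simp add: span_zero)
    then show ?thesis using bary_local(1)[OF b(1) _ b(3) U(1,2)] U(3) eps(2)
      unfolding b(2) local_orientation_simplex_asx by blast
  qed
  obtain r where r: "r > 0" "ball y r \<subseteq> U" using U(1,2) open_contains_ball by blast
  obtain eps0 where e0: "eps0 > 0" "\<And>eps. 0 < eps \<Longrightarrow> eps < eps0 \<Longrightarrow>
     local_orientation_simplex bs y eps ` standard_simplex (length bs) \<subseteq> ball y r"
    using local_orientation_simplex_small[OF r(1)] by metis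
  have g: "rel_gen (length bs) P (P - {y}) (frag_of (local_orientation_simplex bs y (eps0 / 2)))"
    using *[of "eps0 / 2"] e0(1) e0(2)[of "eps0 / 2"] r(2) by auto
  obtain b where b: "bary (length bs) (oriented_vertex bs y 1) b"
      "bsp (length bs) (oriented_vertex bs y 1) b = {z. z - y \<in> span (set bs)}"
      "\<And>i. i \<le> length bs \<Longrightarrow> b i y > 0"
    using oriented_vertex_bary[OF ind dist, of 1] by (metis zero_less_one)
  have "y \<in> bsp (length bs) (oriented_vertex bs y 1) b" unfolding b(2) by (simp add: span_zero)
  then have "rel_trivial k P (P - {y})" if "k \<noteq> length bs" for k
    using bary_local(2)[OF b(1) _ b(3) U(1,2) _ that] U(3) unfolding b(2) by blast
  then show "lman (length bs) P y" using g by (auto simp: lman_def)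
qed

section \<open>Convex cells\<close>

lemma continuous_on_Max_insert:
  fixes f :: "'i \<Rightarrow> 'a::topological_space \<Rightarrow> real"
  assumes "finite I" "\<And>i. i \<in> I \<Longrightarrow> continuous_on S (f i)"
  shows "continuous_on S (\<lambda>z. Max (insert 0 ((\<lambda>i. f i z) ` I)))"
  using assms
proof (induction I rule: finite_induct)
  case (insert i I)
  have "(\<lambda>z. Max (insert 0 ((\<lambda>j. f j z) ` insert i I))) = (\<lambda>z. max (f i z) (Max (insert 0 ((\<lambda>j. f j z) ` I))))"
  proof
    fix z
    have "insert 0 ((\<lambda>j. f j z) ` insert i I) = insert (f i z) (insert 0 ((\<lambda>j. f j z) ` I))" by auto
    then show "Max (insert 0 ((\<lambda>j. f j z) ` insert i I)) = max (f i z) (Max (insert 0 ((\<lambda>j. f j z) ` I)))"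
      using Max_insert[of "insert 0 ((\<lambda>j. f j z) ` I)" "f i z"] insert(1) by simp
  qed
  moreover have "continuous_on S (\<lambda>z. max (f i z) (Max (insert 0 ((\<lambda>j. f j z) ` I))))"
    by (intro continuous_on_max insert.IH insert.prems) auto
  ultimately show ?case by (simp only:)
qed simp

lemma open_gauge:
  fixes M :: "'a::euclidean_space set"
  assumes "open M"
  obtains \<delta> where "continuous_on M \<delta>" "\<And>z. z \<in> M \<Longrightarrow> 0 < (\<delta> z :: real)" "\<And>z. z \<in> M \<Longrightarrow> ball z (\<delta> z) \<subseteq> M"
proof (cases "M = UNIV")
  case True
  \<comment> \<open>The distance to the empty complement is 0 by convention, so the whole space gets
    a radius of its own.\<close>
  then show thesis by (intro that[of "\<lambda>_. 1"]) auto
next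
  case False
  then have ne: "- M \<noteq> {}" and cl: "closed (- M)" using assms by auto
  show thesis
  proof (rule that[of "\<lambda>z. infdist z (- M)"])
    show "continuous_on M (\<lambda>z. infdist z (- M))" by (intro continuous_intros)
    show "0 < infdist z (- M)" if "z \<in> M" for z
      using in_closed_iff_infdist_zero[OF cl ne, of z] infdist_nonneg[of z "- M"] that by auto
    show "ball z (infdist z (- M)) \<subseteq> M" for z
      using infdist_le[of _ "- M" z] by (force simp: not_less[symmetric])
  qed
qed

lemma closedin_compact_Int:
  assumes "closedin (top_of_set M) P" "compact C" "C \<subseteq> M"
  shows "compact (P \<inter> C)"
proof -
  obtain T where T: "closed T" "P = M \<inter> T" using assms(1) by (auto simp: closedin_closed)
  then have "P \<inter> C = C \<inter> T" using assms(3) by auto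
  then show ?thesis using compact_Int_closed[OF assms(2) T(1)] by simp
qed

text \<open>The gauge with respect to \<open>y\<close> of the polyhedron on which all \<open>g i\<close> are nonnegative,
  restricted to nonnegative values.\<close>

locale gauge =
  fixes I :: "'i set" and g :: "'i \<Rightarrow> 'a::euclidean_space \<Rightarrow> real" and y :: 'a
  assumes fin_I: "finite I" and g_affine: "\<And>i. i \<in> I \<Longrightarrow> affine_form (g i)" and g_pos: "\<And>i. i \<in> I \<Longrightarrow> g i y > 0"
begin

definition mg :: "'a \<Rightarrow> real" where "mg z = Max (insert 0 ((\<lambda>i. 1 - g i z / g i y) ` I))"

lemma mg_cont: "continuous_on U mg"
  unfolding mg_def
proof (rule continuous_on_Max_insert[OF fin_I])
  fix i assume i: "i \<in> I"
  have "g i y \<noteq> 0" using g_pos[OF i] by simp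
  then show "continuous_on U (\<lambda>z. 1 - g i z / g i y)"
    by (intro continuous_on_diff continuous_on_const continuous_on_divide affine_form_continuous[OF g_affine[OF i]]) auto
qed

lemma mg_ge: "0 \<le> mg z" "i \<in> I \<Longrightarrow> 1 - g i z / g i y \<le> mg z"
  unfolding mg_def using fin_I by (intro Max_ge; simp)+

lemma mg_cases: "mg z = 0 \<or> (\<exists>i\<in>I. mg z = 1 - g i z / g i y)"
proof -
  have "mg z \<in> insert 0 ((\<lambda>i. 1 - g i z / g i y) ` I)" unfolding mg_def using fin_I by (intro Max_in) auto
  then show ?thesis by auto
qed

lemma mg_le_1: assumes "\<And>i. i \<in> I \<Longrightarrow> 0 \<le> g i z" shows "mg z \<le> 1"
proof -
  have "1 - g i z / g i y \<le> 1" if "i \<in> I" for i using assms[OF that] g_pos[OF that] by simp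
  then show ?thesis using mg_cases[of z] by force
qed

lemma mg_eq_1: "(\<And>i. i \<in> I \<Longrightarrow> 0 \<le> g i z) \<Longrightarrow> i \<in> I \<Longrightarrow> g i z = 0 \<Longrightarrow> mg z = 1"
  using mg_ge(2)[of i z] mg_le_1[of z] by simp

end

text \<open>The cell \<open>S\<close> is convex and relatively open in the translate of
  \<open>L\<close> through \<open>y\<close>; \<open>Z\<close> collects the points of
  \<open>M\<close> that satisfy the weak inequalities. As \<open>P\<close> is closed in
  \<open>M\<close>, all of \<open>Z - S\<close> lies in \<open>Q\<close>. The cell may be unbounded
  or approach the complement of \<open>M\<close>; both count as infinity for locally finite
  chains.\<close>

locale convex_cell =
  fixes M Q L :: "'a::euclidean_space set" and y :: 'a and I :: "'i set" and g :: "'i \<Rightarrow> 'a \<Rightarrow> real"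
    and S Z P :: "'a set"
  assumes M: "open M" and I: "finite I" and aff: "\<And>i. i \<in> I \<Longrightarrow> affine_form (g i)"
    and L: "subspace L" and S_def: "S = {z. z - y \<in> L \<and> (\<forall>i\<in>I. g i z > 0)}"
    and Z_def: "Z = {z \<in> M. z - y \<in> L \<and> (\<forall>i\<in>I. g i z \<ge> 0)}"
    and P_def: "P = Q \<union> S"
    and yS: "y \<in> S" and SM: "S \<subseteq> M"
    and Q: "closedin (top_of_set M) Q" and QS: "Q \<inter> S = {}" and P: "closedin (top_of_set M) P"
begin

lemma QM: "Q \<subseteq> M" using Q closedin_imp_subset by blast
lemma PM: "P \<subseteq> M" using QM SM P_def by auto
lemma SZ: "S \<subseteq> Z" using SM by (auto simp: S_def Z_def less_imp_le)
lemma gy: "i \<in> I \<Longrightarrow> g i y > 0" using yS by (auto simp: S_def)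
lemma gline: "i \<in> I \<Longrightarrow> g i (y + t *\<^sub>R (z - y)) = g i y + t * (g i z - g i y)"
  by (rule affine_form_line[OF aff])
lemma Lline: "z - y \<in> L \<Longrightarrow> y + t *\<^sub>R (z - y) - y \<in> L" using L by (simp add: subspace_scale)

lemma Zstar_S: assumes "z \<in> Z" "0 \<le> s" "s < 1" shows "y + s *\<^sub>R (z - y) \<in> S"
proof -
  have "g i (y + s *\<^sub>R (z - y)) > 0" if i: "i \<in> I" for i
  proof -
    have "(1 - s) * g i y > 0" "s * g i z \<ge> 0" using assms gy[OF i] i by (auto simp: Z_def)
    then show ?thesis unfolding gline[OF i] by (simp add: algebra_simps)
  qed
  then show ?thesis using assms(1) Lline by (auto simp: S_def Z_def)
qed

lemma Zstar: assumes "z \<in> Z" "0 \<le> s" "s \<le> 1" shows "y + s *\<^sub>R (z - y) \<in> Z"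
  using Zstar_S[OF assms(1,2)] SZ assms(1,3) by (cases "s = 1") auto

lemma Z_closed: "closedin (top_of_set M) Z"
proof -
  have "closed ({z. z - y \<in> L} \<inter> (\<Inter>i\<in>I. {z. 0 \<le> g i z}))"
  proof (intro closed_Int closed_INT ballI)
    have "closed ((\<lambda>z. y + z) ` L)" using closed_translation[OF closed_subspace[OF L], of y] by (simp add: image_def)
    moreover have "(\<lambda>z. y + z) ` L = {z. z - y \<in> L}" by (auto simp: image_iff) (metis add.commute diff_add_cancel)
    ultimately show "closed {z. z - y \<in> L}" by simp
    show "closed {z. 0 \<le> g i z}" if "i \<in> I" for i
      using affine_form_continuous[OF aff[OF that], of UNIV] by (intro closed_Collect_le) auto
  qed
  moreover have "Z = M \<inter> ({z. z - y \<in> L} \<inter> (\<Inter>i\<in>I. {z. 0 \<le> g i z}))" by (auto simp: Z_def)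
  ultimately show ?thesis by (metis closedin_closed_Int)
qed

lemma ZP: "Z \<subseteq> P"
proof
  fix z assume z: "z \<in> Z"
  obtain T where T: "closed T" "P = M \<inter> T" using P by (auto simp: closedin_closed)
  have lim: "(\<lambda>n. y + (1 - inverse (real (Suc n))) *\<^sub>R (z - y)) \<longlonglongrightarrow> y + (1 - 0) *\<^sub>R (z - y)"
    by (intro tendsto_intros LIMSEQ_inverse_real_of_nat)
  have mem: "y + (1 - inverse (real (Suc n))) *\<^sub>R (z - y) \<in> T" for n
  proof -
    have "y + (1 - inverse (real (Suc n))) *\<^sub>R (z - y) \<in> S"
      using z by (rule Zstar_S) (auto simp: field_simps)
    then show ?thesis using T(2) P_def by auto
  qed
  have "y + (1 - 0) *\<^sub>R (z - y) \<in> T" by (rule closed_sequentially[OF T(1) mem lim])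
  then show "z \<in> P" using z T(2) by (auto simp: Z_def)
qed

sublocale gauge I g y by unfold_locales (use I aff gy in auto)

lemma mg_le: "z \<in> Z \<Longrightarrow> mg z \<le> 1"
  by (rule mg_le_1) (auto simp: Z_def)

lemma mg_1: assumes "z \<in> Z" "z \<notin> S" shows "mg z = 1"
proof -
  obtain i where i: "i \<in> I" "g i z \<le> 0" using assms by (auto simp: S_def Z_def not_less)
  then show ?thesis using assms(1) by (intro mg_eq_1[of z i]) (auto simp: Z_def)
qed

text \<open>\<open>mg z\<close> is the largest relative decrease of the forms on the way from
  \<open>y\<close> to \<open>z\<close>. Scaling the ray by \<open>\<mu>\<close> scales the decrease,
  and a form stays nonnegative while the decrease is at most 1.\<close>

lemma move_Z:
  assumes z: "z \<in> Z" and \<mu>: "1 \<le> \<mu>" "\<mu> * mg z \<le> 1" and M': "y + \<mu> *\<^sub>R (z - y) \<in> M"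
  shows "y + \<mu> *\<^sub>R (z - y) \<in> Z"
proof -
  have "g i (y + \<mu> *\<^sub>R (z - y)) \<ge> 0" if i: "i \<in> I" for i
  proof -
    have "\<mu> * (1 - g i z / g i y) \<le> \<mu> * mg z" using mg_ge(2)[OF i] \<mu>(1) by (intro mult_left_mono) auto
    then have "g i y * (1 - \<mu> * (1 - g i z / g i y)) \<ge> 0" using \<mu>(2) gy[OF i] by (intro mult_nonneg_nonneg) auto
    moreover have "g i y * (1 - \<mu> * (1 - g i z / g i y)) = g i y + \<mu> * (g i z - g i y)"
      using gy[OF i] by (simp add: field_simps)
    ultimately show ?thesis by (simp add: gline[OF i])
  qed
  then show ?thesis using z Lline M' by (auto simp: Z_def)
qed

lemma lman_y: "lman (dim L) P y"
proof -
  obtain B where B: "independent B" "span B = L" "card B = dim L" "B \<subseteq> L"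
    using basis_exists[of L] by (metis L span_subspace)
  obtain bs where bs: "set bs = B" "distinct bs"
    using finite_distinct_list[OF independent_imp_finite[OF B(1)]] by blast
  have len: "length bs = dim L" using bs B(3) distinct_card by metis
  define U where "U = (M - Q) \<inter> (\<Inter>i\<in>I. {z. 0 < g i z})"
  have "open U" unfolding U_def
  proof (intro open_Int open_INT ballI I)
    obtain T where T: "closed T" "Q = M \<inter> T" using Q by (auto simp: closedin_closed)
    have "M - Q = M \<inter> - T" using T(2) by auto
    then show "open (M - Q)" using M T(1) by (simp add: open_Int open_Compl)
    show "open {z. 0 < g i z}" if "i \<in> I" for i
      using affine_form_continuous[OF aff[OF that], of UNIV] by (intro open_Collect_less) auto
  qed
  moreover have "y \<in> U" using yS SM QS by (auto simp: U_def S_def)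
  moreover have "P \<inter> U = {z. z - y \<in> span (set bs)} \<inter> U"
    using SM by (auto simp: U_def P_def S_def bs B)
  ultimately show ?thesis using local_orientation_gen(2)[of bs U y P] B(1) bs len by simp
qed

text \<open>The flow moves points of \<open>S\<close> away from \<open>y\<close>, slowly near the complement of \<open>M\<close>, and stops
  at \<open>Q\<close>.\<close>

lemma push_cell:
  assumes r: "r > 0" "cball y r \<subseteq> M" and w: "lfs M k P w" and dw: "lfs M (k - Suc 0) Q (lf_boundary k w)"
    and wr: "\<And>f. w f \<noteq> 0 \<Longrightarrow> f ` standard_simplex k \<inter> cball y r = {}"
  obtains u w' where "lfs M (Suc k) P u" "avoids (Suc k) y u" "lfs M k Q w'" "w = lf_boundary (Suc k) u + w'"
proof -
  obtain \<delta> where \<delta>: "continuous_on M \<delta>" "\<And>z. z \<in> M \<Longrightarrow> 0 < (\<delta> z :: real)" "\<And>z. z \<in> M \<Longrightarrow> ball z (\<delta> z) \<subseteq> M"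
    using open_gauge[OF M] by metis
  obtain C where C: "\<And>n. compact (C n)" "\<And>n. C n \<subseteq> M" "\<And>n. C n \<subseteq> interior (C (Suc n))"
      "\<And>K. \<lbrakk>compact K; K \<subseteq> M\<rbrakk> \<Longrightarrow> \<exists>N. \<forall>n\<ge>N. K \<subseteq> C n"
    using open_Union_compact_subsets[OF M] by metis
  \<comment> \<open>Adding the segments to \<open>y\<close> makes these compact sets starlike about
    \<open>y\<close> within \<open>Z\<close>. A flow that moves away from \<open>y\<close> can then
    not enter them from outside.\<close>
  define con where "con D = D \<union> (\<lambda>x. y + fst x *\<^sub>R (snd x - y)) ` ({0..1} \<times> (Z \<inter> D))" for D
  define nxt where "nxt i K = (SOME n. n \<ge> i \<and> K \<subseteq> interior (C n))" for i :: nat and K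
  have nxt: "nxt i K \<ge> i" "K \<subseteq> interior (C (nxt i K))" if K: "compact K" "K \<subseteq> M" for i K
  proof -
    obtain N where N: "\<forall>n\<ge>N. K \<subseteq> C n" using C(4)[OF K] by blast
    have "Suc (max i N) \<ge> i \<and> K \<subseteq> interior (C (Suc (max i N)))"
      using N[rule_format, of "max i N"] C(3)[of "max i N"] by auto
    then show "nxt i K \<ge> i" "K \<subseteq> interior (C (nxt i K))"
      unfolding nxt_def using someI[of "\<lambda>n. n \<ge> i \<and> K \<subseteq> interior (C n)"] by blast+
  qed
  \<comment> \<open>\<open>K 0\<close> lies in the ball that the simplices of \<open>w\<close>
    avoid. The later sets run through the exhaustion \<open>C\<close>, with \<open>nxt\<close>
    chosen such that each one contains a neighbourhood of its predecessor in
    \<open>P\<close>.\<close>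
  define K where "K = rec_nat (Z \<inter> cball y r) (\<lambda>i Ki. con (P \<inter> C (nxt i Ki)))"
  have K0: "K 0 = Z \<inter> cball y r" and KS: "K (Suc i) = con (P \<inter> C (nxt i (K i)))" for i
    by (simp_all add: K_def)
  have cK: "compact (K i)" for i
  proof (cases i)
    case 0 then show ?thesis using closedin_compact_Int[OF Z_closed _ r(2)] by (simp add: K0)
  next
    case (Suc j)
    have c1: "compact (P \<inter> C (nxt j (K j)))" by (rule closedin_compact_Int[OF P C(1,2)])
    have "compact (Z \<inter> (P \<inter> C (nxt j (K j))))"
      using closedin_compact_Int[OF Z_closed c1] C(2) by blast
    then have "compact ((\<lambda>x. y + fst x *\<^sub>R (snd x - y)) ` ({0..1} \<times> (Z \<inter> (P \<inter> C (nxt j (K j))))))"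
      by (intro compact_continuous_image continuous_intros compact_Times) auto
    then show ?thesis using c1 unfolding Suc KS con_def by (rule compact_Un[rotated])
  qed
  have KP: "K i \<subseteq> P" for i
  proof (cases i)
    case 0 then show ?thesis using ZP by (auto simp: K0)
  next
    case (Suc j)
    have "y + s *\<^sub>R (z - y) \<in> P" if "z \<in> Z" "s \<in> {0..1}" for s z
      using Zstar[OF that(1), of s] that(2) ZP by auto
    then show ?thesis unfolding Suc KS con_def by auto
  qed
  have conic: "y + s *\<^sub>R (z - y) \<in> K i" if z: "z \<in> K i" "z \<in> Z" and s: "0 \<le> s" "s \<le> 1" for z s i
  proof (cases i)
    case 0
    have "dist y (y + s *\<^sub>R (z - y)) \<le> dist y z"
      using s by (simp add: dist_norm mult_left_le_one_le norm_minus_commute)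
    then show ?thesis using z Zstar[OF z(2) s] by (auto simp: 0 K0)
  next
    case (Suc j)
    let ?D = "P \<inter> C (nxt j (K j))"
    have "\<exists>t z'. 0 \<le> t \<and> t \<le> 1 \<and> z' \<in> Z \<inter> ?D \<and> z = y + t *\<^sub>R (z' - y)"
    proof (cases "z \<in> ?D")
      case True then show ?thesis using z(2) by (intro exI[of _ 1] exI[of _ z]) auto
    next
      case False
      then have "z \<in> (\<lambda>x. y + fst x *\<^sub>R (snd x - y)) ` ({0..1} \<times> (Z \<inter> ?D))"
        using z(1) unfolding Suc KS con_def by blast
      then obtain t z' where "t \<in> {0..1}" "z' \<in> Z \<inter> ?D" "z = y + t *\<^sub>R (z' - y)" by force
      then show ?thesis by (intro exI[of _ t] exI[of _ z']) simp
    qed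
    then obtain t z' where t: "0 \<le> t" "t \<le> 1" "z' \<in> Z \<inter> ?D" "z = y + t *\<^sub>R (z' - y)" by blast
    have "y + s *\<^sub>R (z - y) = y + (s * t) *\<^sub>R (z' - y)" by (simp add: t(4))
    moreover have "s * t \<in> {0..1}" using s t by (auto simp: mult_le_one)
    ultimately have "y + s *\<^sub>R (z - y) \<in> (\<lambda>x. y + fst x *\<^sub>R (snd x - y)) ` ({0..1} \<times> (Z \<inter> ?D))"
      using t(3) by (intro image_eqI[of _ _ "(s * t, z')"]) auto
    then show ?thesis unfolding Suc KS con_def by blast
  qed
  interpret E: exhaustion P K
  proof
    show "compact (K i)" "K i \<subseteq> P" for i by (rule cK, rule KP)
    show "\<exists>O'. openin (top_of_set P) O' \<and> K i \<subseteq> O' \<and> O' \<subseteq> K (Suc i)" for i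
    proof (intro exI[of _ "P \<inter> interior (C (nxt i (K i)))"] conjI)
      show "openin (top_of_set P) (P \<inter> interior (C (nxt i (K i))))" by (intro openin_open_Int) auto
      show "K i \<subseteq> P \<inter> interior (C (nxt i (K i)))" using nxt(2)[OF cK subset_trans[OF KP PM]] KP by (intro Int_greatest)
      show "P \<inter> interior (C (nxt i (K i))) \<subseteq> K (Suc i)" using interior_subset unfolding KS con_def by blast
    qed
    show "\<exists>i. D \<subseteq> K i" if "compact D" "D \<subseteq> P" for D
    proof -
      have "D \<subseteq> M" using that(2) PM by (rule subset_trans)
      from C(4)[OF that(1) this] obtain N where N: "\<forall>n\<ge>N. D \<subseteq> C n" ..
      have "nxt N (K N) \<ge> N" by (rule nxt(1)[OF cK subset_trans[OF KP PM]])
      then have "D \<subseteq> P \<inter> C (nxt N (K N))" using N that(2) by blast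
      then have "D \<subseteq> K (Suc N)" unfolding KS con_def by (rule le_supI1)
      then show ?thesis ..
    qed
  qed
  \<comment> \<open>The denominator makes \<open>s z * norm (z - y)\<close> smaller than
    \<open>\<delta> z\<close>, so that a step by a factor at most \<open>1 + s z\<close> stays in
    \<open>M\<close>; the summand 1 avoids a division by zero at \<open>y\<close>.\<close>
  define s where "s z = \<delta> z / (2 * (1 + norm (z - y)))" for z
  \<comment> \<open>The smaller of \<open>1 + s z\<close> and \<open>1 / mg z\<close>, where the
    latter is the factor at which the ray leaves the polyhedron. The form with a maximum covers rays
    with \<open>mg z = 0\<close>, which never leave it, and makes continuity evident.\<close>
  define \<Lambda> where "\<Lambda> z = 1 / max (1 / (1 + s z)) (mg z)" for z
  define \<Phi> where "\<Phi> z = (if z \<in> Z then y + \<Lambda> z *\<^sub>R (z - y) else z)" for z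
  have ZM: "Z \<subseteq> M" by (auto simp: Z_def)
  have csM: "continuous_on M s"
  proof -
    have nz: "2 * (1 + norm (z - y)) \<noteq> 0" for z using norm_ge_zero[of "z - y"] by (smt (verit))
    show ?thesis unfolding s_def
      by (intro continuous_on_divide \<delta>(1) continuous_intros) (use nz in blast)
  qed
  have s_pos: "s z > 0" if "z \<in> M" for z
    unfolding s_def using \<delta>(2)[OF that] by (intro divide_pos_pos) (auto simp: add_pos_nonneg)
  have den: "max (1 / (1 + s z)) (mg z) > 0" if "z \<in> M" for z
    using s_pos[OF that] by (auto simp: less_max_iff_disj)
  have \<Lambda>1: "1 \<le> \<Lambda> z" "\<Lambda> z \<le> 1 + s z" "\<Lambda> z * mg z \<le> 1" if z: "z \<in> Z" for z
  proof -
    have sp: "s z > 0" using s_pos z ZM by blast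
    have d: "max (1 / (1 + s z)) (mg z) > 0" using den z ZM by blast
    have "max (1 / (1 + s z)) (mg z) \<le> 1" using mg_le[OF z] sp by simp
    then show "1 \<le> \<Lambda> z" using d by (simp add: \<Lambda>_def)
    have "0 < 1 / (1 + s z)" using sp by simp
    then have "\<Lambda> z \<le> 1 / (1 / (1 + s z))"
      unfolding \<Lambda>_def by (rule frac_le[OF zero_le_one order_refl _ max.cobounded1])
    then show "\<Lambda> z \<le> 1 + s z" by simp
    have "\<Lambda> z * mg z \<le> \<Lambda> z * max (1 / (1 + s z)) (mg z)"
      using \<open>1 \<le> \<Lambda> z\<close> by (intro mult_left_mono) auto
    also have "\<dots> = 1" using d by (simp add: \<Lambda>_def)
    finally show "\<Lambda> z * mg z \<le> 1" .
  qed
  have mv: "y + \<mu> *\<^sub>R (z - y) \<in> Z" if z: "z \<in> Z" and \<mu>: "1 \<le> \<mu>" "\<mu> \<le> \<Lambda> z" for z \<mu>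
  proof (rule move_Z[OF z \<mu>(1)])
    have "\<mu> * mg z \<le> \<Lambda> z * mg z" using \<mu> mg_ge(1) by (intro mult_right_mono)
    then show "\<mu> * mg z \<le> 1" using \<Lambda>1(3)[OF z] by linarith
    have eq: "y + \<mu> *\<^sub>R (z - y) - z = (\<mu> - 1) *\<^sub>R (z - y)" by (simp add: algebra_simps)
    have "dist z (y + \<mu> *\<^sub>R (z - y)) = (\<mu> - 1) * norm (z - y)"
    proof -
      have "dist z (y + \<mu> *\<^sub>R (z - y)) = norm (y + \<mu> *\<^sub>R (z - y) - z)"
        by (simp only: dist_norm norm_minus_commute)
      also have "\<dots> = (\<mu> - 1) * norm (z - y)" unfolding eq using \<mu>(1) by simp
      finally show ?thesis .
    qed
    also have "\<dots> \<le> s z * norm (z - y)" using \<mu> \<Lambda>1(2)[OF z] by (intro mult_right_mono) auto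
    also have "\<dots> < \<delta> z"
    proof -
      have zM: "z \<in> M" using z ZM by blast
      have "s z * norm (z - y) \<le> s z * (1 + norm (z - y))" using s_pos[OF zM] by (intro mult_left_mono) auto
      also have "\<dots> = \<delta> z / 2"
      proof -
        have "1 + norm (z - y) > 0" by (simp add: add_pos_nonneg)
        then show ?thesis by (simp add: s_def field_simps)
      qed
      finally show ?thesis using \<delta>(2)[OF zM] by linarith
    qed
    finally have "y + \<mu> *\<^sub>R (z - y) \<in> ball z (\<delta> z)" by simp
    then show "y + \<mu> *\<^sub>R (z - y) \<in> M" using \<delta>(3) z ZM by blast
  qed
  \<comment> \<open>A point of \<open>Z\<close> in \<open>Q\<close> lies outside \<open>S\<close>,
    so its gauge is 1: the flow stops there, and the two pieces of \<open>\<Phi>\<close> agree where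
    they overlap.\<close>
  have \<Lambda>Q: "\<Lambda> z = 1" if "z \<in> Z" "z \<in> Q" for z
  proof -
    have "mg z = 1" using mg_1[OF that(1)] that(2) QS by blast
    moreover have "1 / (1 + s z) \<le> 1" using s_pos[of z] that ZM by auto
    ultimately show ?thesis by (simp add: \<Lambda>_def)
  qed
  have cont\<Phi>: "continuous_on P \<Phi>"
  proof -
    have PZQ: "P = Z \<union> Q" using ZP SZ P_def by auto
    have cs: "continuous_on Z s" by (rule continuous_on_subset[OF csM ZM])
    have c\<Lambda>: "continuous_on Z \<Lambda>"
    proof -
      have "1 + s z \<noteq> 0" "max (1 / (1 + s z)) (mg z) \<noteq> 0" if "z \<in> Z" for z
        using s_pos[of z] den[of z] that ZM by auto
      then show ?thesis unfolding \<Lambda>_def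
        by (intro continuous_intros cs mg_cont continuous_on_max) auto
    qed
    have sub: "Z \<subseteq> P" "Q \<subseteq> P" using PZQ by auto
    have clZ: "closedin (top_of_set P) Z" and clQ: "closedin (top_of_set P) Q"
      using closedin_subset_trans[OF Z_closed sub(1) PM] closedin_subset_trans[OF Q sub(2) PM] by auto
    have "continuous_on (Z \<union> Q) \<Phi>" unfolding \<Phi>_def
    proof (rule continuous_on_cases_local)
      show "closedin (top_of_set (Z \<union> Q)) Z" "closedin (top_of_set (Z \<union> Q)) Q"
        using clZ clQ PZQ by auto
      show "continuous_on Z (\<lambda>z. y + \<Lambda> z *\<^sub>R (z - y))" by (intro continuous_intros c\<Lambda>)
    qed (use \<Lambda>Q in auto)
    then show ?thesis using PZQ by simp
  qed
  have path: "(1 - t) *\<^sub>R z + t *\<^sub>R \<Phi> z = (if z \<in> Z then y + (1 + t * (\<Lambda> z - 1)) *\<^sub>R (z - y) else z)" for z t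
    by (simp add: \<Phi>_def algebra_simps)
  have \<mu>: "1 \<le> 1 + t * (\<Lambda> z - 1)" "1 + t * (\<Lambda> z - 1) \<le> \<Lambda> z" if "z \<in> Z" "0 \<le> t" "t \<le> 1" for t z
    using \<Lambda>1(1)[OF that(1)] that mult_right_mono[of t 1 "\<Lambda> z - 1"] by auto
  \<comment> \<open>If the path entered \<open>K j\<close>, starlikeness would put its starting
    point into \<open>K j\<close> as well.\<close>
  have pathK: "(1 - t) *\<^sub>R z + t *\<^sub>R \<Phi> z \<in> P - K j" if z: "z \<in> P - K j" and t: "0 \<le> t" "t \<le> 1" for z t j
  proof (cases "z \<in> Z")
    case True
    let ?\<mu> = "1 + t * (\<Lambda> z - 1)" and ?z = "y + (1 + t * (\<Lambda> z - 1)) *\<^sub>R (z - y)"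
    have zZ: "?z \<in> Z" using mv[OF True] \<mu>[OF True t] by blast
    have "?z \<notin> K j"
    proof
      assume zK: "?z \<in> K j"
      have "y + (1 / ?\<mu>) *\<^sub>R (?z - y) \<in> K j"
        using \<mu>[OF True t] by (intro conic[OF zK zZ]) auto
      moreover have "y + (1 / ?\<mu>) *\<^sub>R (?z - y) = z" using \<mu>[OF True t] by simp
      ultimately show False using z by simp
    qed
    then show ?thesis using zZ ZP True unfolding path by auto
  next
    case False
    then show ?thesis using z unfolding path by simp
  qed
  have pathQ: "(1 - t) *\<^sub>R z + t *\<^sub>R \<Phi> z = z" if "z \<in> Q" for z t
    unfolding path using \<Lambda>Q that by simp
  define T where "T i = (Q - K i) \<union> (P - K (Suc (Suc i)))" for i
  have QP: "Q \<subseteq> P" by (simp add: P_def)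
  have pathT: "(1 - t) *\<^sub>R z + t *\<^sub>R \<Phi> z \<in> T i" if "z \<in> T i" "0 \<le> t" "t \<le> 1" for z t i
    using that pathQ pathK unfolding T_def by auto
  have \<Phi>K: "\<Phi> z \<in> P - K i" if "z \<in> P - K i" for z i using pathK[OF that, of 1] by simp
  have \<Phi>T: "\<Phi> z \<in> T i" if "z \<in> T i" for z i using pathT[OF that, of 1] by simp
  have hom1: "homotopic_with (\<lambda>h. h \<in> T i \<rightarrow> T i) (top_of_set (P - K i)) (top_of_set (P - K i)) id \<Phi>" for i
    by (rule homotopic_with_linear_rel)
       (use pathK pathT continuous_on_subset[OF cont\<Phi> Diff_subset] in auto)
  have homn: "homotopic_with (\<lambda>h. h \<in> T i \<rightarrow> T i) (top_of_set (P - K i)) (top_of_set (P - K i)) id (\<Phi> ^^ n)" for i n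
  proof (induction n)
    case 0
    show ?case by (simp add: id_def[symmetric] homotopic_with_refl)
  next
    case (Suc n)
    have c: "continuous_map (top_of_set (P - K i)) (top_of_set (P - K i)) \<Phi>"
      using continuous_on_subset[OF cont\<Phi> Diff_subset] \<Phi>K by auto
    have "homotopic_with (\<lambda>h. h \<in> T i \<rightarrow> T i) (top_of_set (P - K i)) (top_of_set (P - K i)) (\<Phi> \<circ> id) (\<Phi> \<circ> (\<Phi> ^^ n))"
    proof (rule homotopic_with_compose_continuous_map_left[OF Suc c])
      show "\<Phi> \<circ> j \<in> T i \<rightarrow> T i" if "j \<in> T i \<rightarrow> T i" for j
        using that \<Phi>T unfolding Pi_def comp_def by blast
    qed
    from homotopic_with_trans[OF hom1 this[unfolded comp_id]] show ?case unfolding funpow.simps .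
  qed
  \<comment> \<open>While an orbit stays in \<open>S\<close> and in the compact set
    \<open>?K\<close>, its distance to \<open>y\<close> grows by at least the factor
    \<open>1 + s0\<close> in every step. Distances on \<open>?K\<close> are bounded, so one iterate
    serves all points at once.\<close>
  have fin: "\<exists>n. (\<Phi> ^^ n) \<in> (P - K i) \<rightarrow> T i" for i
  proof -
    let ?K = "K (Suc (Suc i))"
    obtain s0 where s0: "s0 > 0" "\<And>z. z \<in> ?K \<Longrightarrow> s0 \<le> s z"
    proof (cases "?K = {}")
      case False
      have "continuous_on ?K s" by (rule continuous_on_subset[OF csM subset_trans[OF KP PM]])
      from continuous_attains_inf[OF cK False this] obtain z0 where "z0 \<in> ?K" "\<forall>z\<in>?K. s z0 \<le> s z" by blast
      then show ?thesis using that[of "s z0"] s_pos[of z0] KP PM by blast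
    qed (use that[of 1] in simp)
    obtain R where R: "\<And>z. z \<in> ?K \<Longrightarrow> norm (z - y) \<le> R"
      using compact_imp_bounded[OF cK] by (metis bounded_any_center dist_norm norm_minus_commute)
    have claim: "(\<Phi> ^^ n) z \<in> S \<inter> ?K \<and> norm ((\<Phi> ^^ n) z - y) \<ge> (1 + s0) ^ n * r"
      if z: "z \<in> P - K i" and nT: "(\<Phi> ^^ n) z \<notin> T i" for z n
      using nT
    proof (induction n)
      case 0
      then have zS: "z \<in> S" "z \<in> ?K" using z by (auto simp: T_def P_def)
      have "z \<notin> K 0" using z E.K_mono[of 0 i] by auto
      then have "norm (z - y) \<ge> r" using zS(1) SZ by (auto simp: K0 dist_norm norm_minus_commute)
      then show ?case using zS by simp
    next
      case (Suc n)
      define v where "v = (\<Phi> ^^ n) z"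
      have vT: "v \<notin> T i" using Suc.prems \<Phi>T by (auto simp: v_def)
      from Suc.IH vT have IH: "v \<in> S" "v \<in> ?K" "norm (v - y) \<ge> (1 + s0) ^ n * r" by (auto simp: v_def)
      have vPK: "v \<in> P - K i"
      proof -
        have "(\<Phi> ^^ m) z \<in> P - K i" for m by (induction m) (use z \<Phi>K in auto)
        then show ?thesis by (simp add: v_def)
      qed
      have eq: "(\<Phi> ^^ Suc n) z = \<Phi> v" by (simp add: v_def)
      have vZ: "v \<in> Z" using IH(1) SZ by blast
      have \<Phi>v: "\<Phi> v = y + \<Lambda> v *\<^sub>R (v - y)" using vZ by (simp add: \<Phi>_def)
      have vS: "\<Phi> v \<in> S" "\<Phi> v \<in> ?K" using Suc.prems \<Phi>K[OF vPK] unfolding eq by (auto simp: T_def P_def)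
      \<comment> \<open>Otherwise the step would be cut short by the polyhedron and end where some
        form vanishes, hence outside \<open>S\<close>.\<close>
      have "\<not> mg v \<ge> 1 / (1 + s v)"
      proof
        assume m: "mg v \<ge> 1 / (1 + s v)"
        then have L: "\<Lambda> v = 1 / mg v" by (simp add: \<Lambda>_def max_def)
        have "1 / (1 + s v) > 0" using s_pos[of v] vZ ZM by auto
        then have mpos: "mg v > 0" using m by linarith
        then obtain j where j: "j \<in> I" "mg v = 1 - g j v / g j y" using mg_cases[of v] by auto
        have "g j (\<Phi> v) = g j y * (1 - \<Lambda> v * (1 - g j v / g j y))"
          unfolding \<Phi>v gline[OF j(1)] using gy[OF j(1)] by (simp add: field_simps)
        also have "\<dots> = 0" using mpos by (simp add: L flip: j(2))
        finally show False using vS(1) j(1) by (auto simp: S_def)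
      qed
      then have "\<Lambda> v = 1 + s v" by (simp add: \<Lambda>_def max_def)
      then have "norm (\<Phi> v - y) = (1 + s v) * norm (v - y)" using s_pos[of v] vZ ZM by (auto simp: \<Phi>v)
      moreover have "(1 + s0) * ((1 + s0) ^ n * r) \<le> (1 + s v) * norm (v - y)"
        using s0(2)[OF IH(2)] s0(1) IH(3) r(1) by (intro mult_mono) auto
      ultimately show ?case unfolding eq using vS by simp
    qed
    obtain n where n: "(1 + s0) ^ n > R / r"
      using real_arch_pow[of "1 + s0" "R / r"] s0(1) by auto
    have "(\<Phi> ^^ n) z \<in> T i" if z: "z \<in> P - K i" for z
    proof (rule ccontr)
      assume "(\<Phi> ^^ n) z \<notin> T i"
      from claim[OF z this] R have "(1 + s0) ^ n * r \<le> R" by force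
      then show False using n r(1) by (simp add: pos_divide_less_eq)
    qed
    then show ?thesis by blast
  qed
  have "\<exists>\<phi>. homotopic_with (\<lambda>h. h \<in> T i \<rightarrow> T i) (top_of_set (P - K i)) (top_of_set (P - K i)) id \<phi>
     \<and> \<phi> \<in> (P - K i) \<rightarrow> T i" for i
    using fin[of i] homn by blast
  then have hh: "\<exists>\<phi>. homotopic_with (\<lambda>h. h \<in> (Q - K i) \<union> (P - K (Suc (Suc i))) \<rightarrow> (Q - K i) \<union> (P - K (Suc (Suc i))))
                 (top_of_set (P - K i)) (top_of_set (P - K i)) id \<phi>
               \<and> \<phi> \<in> (P - K i) \<rightarrow> (Q - K i) \<union> (P - K (Suc (Suc i)))" for i
    unfolding T_def .
  have w0: "lfs M k (P - K 0) w" using w wr unfolding lfs_def K0 by blast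
  obtain u w' where u: "lfs M (Suc k) (P - K 0) u" "lfs M k Q w'" "w = lf_boundary (Suc k) u + w'"
    by (rule E.push_off[OF P QP hh w0 dw])
  show thesis
  proof (rule that[OF _ _ u(2,3)])
    show "lfs M (Suc k) P u" by (rule lfs_mono[OF u(1)]) auto
    have "y \<in> K 0" using yS SZ r(1) by (auto simp: K0)
    then show "avoids (Suc k) y u" using avoids_lfs[OF u(1)] by blast
  qed
qed

text \<open>Finitely many simplices meet a small closed ball about \<open>y\<close>. Their union is
  closed and misses \<open>y\<close>, so a smaller ball is disjoint from every simplex and
  \<open>push_cell\<close> applies.\<close>

lemma push_cell_avoiding:
  assumes w: "lfs M k P w" "avoids k y w" and dw: "lfs M (k - Suc 0) Q (lf_boundary k w)"
  obtains u w' where "lfs M (Suc k) P u" "avoids (Suc k) y u" "lfs M k Q w'" "w = lf_boundary (Suc k) u + w'"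
proof -
  have yM: "y \<in> M" using yS SM by blast
  obtain r1 where r1: "r1 > 0" "cball y r1 \<subseteq> M" using M yM open_contains_cball by blast
  let ?F = "{f. w f \<noteq> 0 \<and> f ` standard_simplex k \<inter> cball y r1 \<noteq> {}}"
  have fin: "finite ?F" by (rule lfs_finite[OF w(1) _ r1(2)]) simp
  have "closed (\<Union>f\<in>?F. f ` standard_simplex k)"
  proof (intro closed_UN fin ballI)
    fix f assume "f \<in> ?F"
    then have "singular_simplex k (top_of_set P) f" using lfs_singular[OF w(1)] by blast
    then have "compact (f ` standard_simplex k)"
      using compactin_singular_simplex_image[of k "top_of_set P" f] by (simp add: compactin_subtopology)
    then show "closed (f ` standard_simplex k)" by (rule compact_imp_closed)
  qed
  then have op: "open (- (\<Union>f\<in>?F. f ` standard_simplex k))" by (rule open_Compl)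
  have yF: "y \<in> - (\<Union>f\<in>?F. f ` standard_simplex k)" using w(2) by (auto simp: avoids_def)
  obtain r2 where r2: "r2 > 0" "cball y r2 \<subseteq> - (\<Union>f\<in>?F. f ` standard_simplex k)"
    using op[unfolded open_contains_cball, rule_format, OF yF] by (elim exE conjE)
  define r where "r = min r1 r2"
  have r: "r > 0" "cball y r \<subseteq> M" using r1 r2(1) by (auto simp: r_def)
  have "f ` standard_simplex k \<inter> cball y r = {}" if "w f \<noteq> 0" for f
  proof (rule ccontr)
    assume "f ` standard_simplex k \<inter> cball y r \<noteq> {}"
    then obtain x where x: "x \<in> f ` standard_simplex k" "x \<in> cball y r" by blast
    then have "f \<in> ?F" using that by (auto simp: r_def)
    then have "x \<in> (\<Union>f\<in>?F. f ` standard_simplex k)" using x(1) by blast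
    moreover have "x \<in> cball y r2" using x(2) by (simp add: r_def)
    ultimately show False using r2(2) by (blast dest: subsetD)
  qed
  from push_cell[OF r w(1) dw this] show thesis using that by blast
qed

text \<open>If the local class at \<open>y\<close> is trivial, subtracting a boundary leaves a chain
  that avoids \<open>y\<close>, and this is pushed into \<open>Q\<close>. For the generator, the
  boundary of a local generator avoids \<open>y\<close> and is pushed into \<open>Q\<close> by a
  chain that avoids \<open>y\<close> too; correcting by that chain does not change the local
  class.\<close>

theorem ncell: "ncell M P Q (dim L) y"
  unfolding ncell_def
proof (intro conjI allI impI)
  show "Q \<subseteq> P" by (simp add: P_def)
  show yP: "y \<in> P - Q" using yS QS by (auto simp: P_def)
  have yM: "y \<in> M" and yQ: "y \<notin> Q" using yP PM by auto
  have main: "triv M k P Q w" if w: "relc M k P Q w" and l: "loc k P y w" for k w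
  proof -
    obtain b where b: "ch (Suc k) P b" "avoids k y (w - lk (chain_boundary (Suc k) b))"
      using l unfolding loc_def by blast
    have w': "lfs M k P w" "lfs M (k - Suc 0) Q (lf_boundary k w)" using w by (auto simp: relc_def)
    have lb: "lfs M (Suc k) P (lk b)" by (rule lfs_lookup[OF b(1) PM])
    have lbb: "lfs M k P (lf_boundary (Suc k) (lk b))" by (rule lfs_bd'[OF lb])
    define v where "v = w - lf_boundary (Suc k) (lk b)"
    have v: "lfs M k P v" unfolding v_def by (intro lfs_diff w' lbb)
    have "lf_boundary k v = lf_boundary k w"
      unfolding v_def using bd_diff[OF w'(1) lbb] bd_bd[OF lb] by simp
    then have dv: "lfs M (k - Suc 0) Q (lf_boundary k v)" using w'(2) by simp
    have av: "avoids k y v" using b(2) by (simp add: v_def bd_lookup)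
    obtain u w1 where u: "lfs M (Suc k) P u" "lfs M k Q w1" "v = lf_boundary (Suc k) u + w1"
      using push_cell_avoiding[OF v av dv] by metis
    have "w = lf_boundary (Suc k) (lk b + u) + w1"
      using u(3) bd_add[OF lb u(1)] by (simp add: v_def algebra_simps)
    then show ?thesis using lfs_add[OF lb u(1)] u(2) unfolding triv_def by blast
  qed
  show "triv M k P Q w" if "k \<noteq> dim L" "relc M k P Q w" for k w
  proof (rule main[OF that(2)], rule lman_loc[OF lman_y that(1)])
    show "lfs M k P w" using that(2) by (simp add: relc_def)
    show "avoids (k - Suc 0) y (lf_boundary k w)" using that(2) avoids_lfs yQ unfolding relc_def by blast
  qed fact
  show "triv M (dim L) P Q w" if "relc M (dim L) P Q w" "loc (dim L) P y w" for w
    using main that by blast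
  show "\<exists>e. relc M (dim L) P Q e \<and> lgen M (dim L) P y e"
  proof -
    let ?d = "dim L"
    obtain c where c: "ch ?d P c" "lgen M ?d P y (lk c)"
      using lgen_exists[OF lman_y PM] yP by blast
    show ?thesis
    proof (cases "?d = 0")
      case True
      then have "lf_boundary ?d (lk c) = 0" by (simp add: lf_boundary_def fun_eq_iff)
      then show ?thesis using c lfs_lookup[OF c(1) PM] by (auto simp: relc_def)
    next
      case False
      then have S: "Suc (?d - Suc 0) = ?d" by linarith
      define w where "w = lf_boundary ?d (lk c)"
      have lc: "lfs M ?d P (lk c)" by (rule lfs_lookup[OF c(1) PM])
      have w: "lfs M (?d - Suc 0) P w" unfolding w_def by (rule lfs_bd[OF lc])
      have "lf_boundary (?d - Suc 0) w = 0"
        using bd_bd[of M "?d - Suc 0" P "lk c"] lc unfolding S by (simp add: w_def)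
      moreover have "avoids (?d - Suc 0) y w" using c(2) by (simp add: lgen_def w_def)
      ultimately obtain u w1 where u: "lfs M (Suc (?d - Suc 0)) P u" "avoids (Suc (?d - Suc 0)) y u"
          "lfs M (?d - Suc 0) Q w1" "w = lf_boundary (Suc (?d - Suc 0)) u + w1"
        using push_cell_avoiding[OF w, of thesis] by auto
      note u = u[unfolded S]
      define e where "e = lk c - u"
      have e: "lfs M ?d P e" unfolding e_def by (intro lfs_diff lc u)
      have de: "lf_boundary ?d e = w1"
        unfolding e_def using bd_diff[OF lc u(1)] u(4) by (simp add: w_def[symmetric])
      have "lgen M ?d P y e"
      proof (rule lgen_cong[OF c(2) e, of 1])
        show "avoids (?d - Suc 0) y (lf_boundary ?d e)" unfolding de by (rule avoids_lfs[OF u(3) yQ])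
        show "loc ?d P y (lk c - lf_scale 1 e)" 
          using loc_avoids[OF u(2)] by (simp add: e_def lf_scale_lincomb)
      qed simp
      then show ?thesis using e de u(3) by (auto simp: relc_def)
    qed
  qed
qed

end

section \<open>Combining cells\<close>

lemma incl_iso_cancel:
  assumes ab: "incl_iso k A A' B B'" and ac: "incl_iso k A A' C C'" and sub: "B \<subseteq> C" "B' \<subseteq> C'"
  shows "incl_iso k B B' C C'"
proof -
  have s: "A \<subseteq> B" "A' \<subseteq> B'" "A' \<subseteq> A" "B' \<subseteq> B" "C' \<subseteq> C"
    using incl_iso_subsets[OF ab] incl_iso_subsets[OF ac] by auto
  show ?thesis unfolding incl_iso_def
  proof (intro conjI sub s allI impI)
    fix z assume "rc k C C' z"
    then obtain z' where z': "rc k A A' z'" "rb k C C' (z - z')" using ac by (auto simp: incl_iso_def)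
    then show "\<exists>z'. rc k B B' z' \<and> rb k C C' (z - z')"
      using rc_mono[OF z'(1) s(1,2,3,4)] by blast
  next
    fix z assume z: "rc k B B' z \<and> rb k C C' z"
    then obtain z' where z': "rc k A A' z'" "rb k B B' (z - z')" using ab by (auto simp: incl_iso_def)
    have zC: "rb k C C' z" using z by blast
    have "rb k C C' (z - z')" by (rule rb_mono[OF z'(2) sub s(4,5)])
    from singular_relboundary_diff[OF zC this] have "rb k C C' z'" by simp
    then have "rb k B B' z'" using incl_iso_rb[OF ac z'(1)] incl_iso_rb[OF ab z'(1)] by blast
    from singular_relboundary_add[OF z'(2) this] show "rb k B B' z" by simp
  qed
qed

lemma triv_trans:
  assumes w: "relc M k P Q w" and t: "triv M k P P1 w" and QP: "Q \<subseteq> P1" "P1 \<subseteq> P"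
    and t1: "\<And>w. relc M k P1 Q w \<Longrightarrow> triv M k P1 Q w"
  shows "triv M k P Q w"
proof -
  obtain u w1 where u: "lfs M (Suc k) P u" "lfs M k P1 w1" "w = lf_boundary (Suc k) u + w1"
    using t by (auto simp: triv_def)
  have "lf_boundary k w1 = lf_boundary k w"
    unfolding u(3) using bd_add[OF lfs_bd'[OF u(1)] u(2)] bd_bd[OF u(1)] by simp
  then have "relc M k P1 Q w1" using w u(2) by (simp add: relc_def)
  from t1[OF this] obtain u1 w2 where u1: "lfs M (Suc k) P1 u1" "lfs M k Q w2" "w1 = lf_boundary (Suc k) u1 + w2"
    by (auto simp: triv_def)
  have u1P: "lfs M (Suc k) P u1" by (rule lfs_mono[OF u1(1) QP(2)])
  have "w = lf_boundary (Suc k) (u + u1) + w2"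
    using bd_add[OF u(1) u1P] by (simp add: u(3) u1(3) algebra_simps)
  then show ?thesis unfolding triv_def using lfs_add[OF u(1) u1P] u1(2) by blast
qed

text \<open>Exact sequence of the triple \<open>Q\<close>, \<open>P1\<close>, \<open>P\<close> with
  vanishing homology of (\<open>P1\<close>, \<open>Q\<close>). The generator is corrected by a chain
  supported in \<open>P1\<close>, which misses \<open>y\<close>, so it is still detected
  there.\<close>

lemma ncell_extend:
  assumes c: "ncell M P P1 d y" and Q: "Q \<subseteq> P1"
    and t: "\<And>k w. relc M k P1 Q w \<Longrightarrow> triv M k P1 Q w"
  shows "ncell M P Q d y"
  unfolding ncell_def
proof (intro conjI allI impI)
  have P1: "P1 \<subseteq> P" and y: "y \<in> P" "y \<notin> P1" using c by (auto simp: ncell_def)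
  show "Q \<subseteq> P" "y \<in> P - Q" using P1 y Q by auto
  have up: "relc M k P P1 w" if "relc M k P Q w" for k w
    using that lfs_mono[OF _ Q] by (auto simp: relc_def)
  show "triv M k P Q w" if "k \<noteq> d" "relc M k P Q w" for k w
    using triv_trans[OF that(2) _ Q P1 t] c that up by (auto simp: ncell_def)
  show "triv M d P Q w" if "relc M d P Q w" "loc d P y w" for w
    using triv_trans[OF that(1) _ Q P1 t] c that up by (auto simp: ncell_def)
  obtain e where e: "relc M d P P1 e" "lgen M d P y e" using c by (auto simp: ncell_def)
  show "\<exists>e. relc M d P Q e \<and> lgen M d P y e"
  proof (cases d)
    case 0
    then have "lf_boundary d e = 0" by (simp add: lf_boundary_def fun_eq_iff)
    then show ?thesis using e by (auto simp: relc_def)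
  next
    case (Suc p)
    have le: "lfs M (Suc p) P e" and ld: "lfs M p P1 (lf_boundary (Suc p) e)"
      using e(1) by (auto simp: relc_def Suc)
    have "relc M p P1 Q (lf_boundary (Suc p) e)" using ld bd_bd[OF le] by (simp add: relc_def)
    from t[OF this] obtain u w' where u: "lfs M (Suc p) P1 u" "lfs M p Q w'"
        "lf_boundary (Suc p) e = lf_boundary (Suc p) u + w'" by (auto simp: triv_def)
    define f where "f = e - u"
    have lf: "lfs M (Suc p) P f" unfolding f_def by (intro lfs_diff le lfs_mono[OF u(1) P1])
    have bf: "lf_boundary (Suc p) f = w'" unfolding f_def bd_diff[OF le u(1)] u(3) by simp
    have "lgen M (Suc p) P y f"
    proof (rule lgen_cong[OF e(2)[unfolded Suc] lf, of 1])
      show "avoids (Suc p - Suc 0) y (lf_boundary (Suc p) f)"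
        using avoids_lfs[OF u(2)] y(2) Q by (auto simp: bf)
      show "loc (Suc p) P y (e - lf_scale 1 f)"
        using loc_avoids[OF avoids_lfs[OF u(1) y(2)]] by (simp add: f_def lf_scale_lincomb)
    qed simp
    then show ?thesis using lf bf u(2) by (auto simp: relc_def Suc)
  qed
qed

text \<open>The collapse of an open cell of dimension \<open>p + 1\<close> together with a facet of dimension \<open>p\<close>.\<close>

lemma ncell_pair_trivial:
  assumes c1: "ncell M P1 Q p y1" and c2: "ncell M P P1 (Suc p) y" and PM: "P \<subseteq> M"
    and e: "relc M (Suc p) P P1 e" "lgen M (Suc p) P y e" and g: "lgen M p P1 y1 (lf_boundary (Suc p) e)"
    and w: "relc M k P Q w"
  shows "triv M k P Q w"
proof -
  have P1: "P1 \<subseteq> P" and y: "y \<in> P" "y \<notin> P1" and Q: "Q \<subseteq> P1" and y1: "y1 \<in> P1" "y1 \<notin> Q"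
    using c1 c2 by (auto simp: ncell_def)
  have a1: "triv M k P1 Q w" if "k \<noteq> p" "relc M k P1 Q w" for k w
    using c1 that by (auto simp: ncell_def)
  have b1: "triv M p P1 Q w" if "relc M p P1 Q w" "loc p P1 y1 w" for w
    using c1 that by (auto simp: ncell_def)
  have a2: "triv M k P P1 w" if "k \<noteq> Suc p" "relc M k P P1 w" for k w
    using c2 that by (auto simp: ncell_def)
  have b2: "triv M (Suc p) P P1 w" if "relc M (Suc p) P P1 w" "loc (Suc p) P y w" for w
    using c2 that by (auto simp: ncell_def)
  have up: "relc M k P P1 w" if "relc M k P Q w" for k w
    using that lfs_mono[OF _ Q] by (auto simp: relc_def)
  have le: "lfs M (Suc p) P e" and lde: "lfs M p P1 (lf_boundary (Suc p) e)" using e(1) by (auto simp: relc_def)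
  have lw: "lfs M k P w" and ldw: "lfs M (k - Suc 0) Q (lf_boundary k w)" using w by (auto simp: relc_def)
  consider "k = p" | "k = Suc p" | "k \<noteq> p" "k \<noteq> Suc p" by blast
  then show ?thesis
  proof cases
    case 1
    have t: "triv M p P P1 w" using a2[OF _ up[OF w]] 1 by simp
    then obtain u w1 where u: "lfs M (Suc p) P u" "lfs M p P1 w1" "w = lf_boundary (Suc p) u + w1"
      by (auto simp: triv_def)
    have dw1: "lf_boundary p w1 = lf_boundary p w"
      unfolding u(3) using bd_add[OF lfs_bd'[OF u(1)] u(2)] bd_bd[OF u(1)] by simp
    have av: "avoids (p - Suc 0) y1 (lf_boundary p w1)"
      unfolding dw1 using avoids_lfs[OF ldw y1(2)] 1 by simp
    \<comment> \<open>In degree \<open>p\<close> the chain has been pushed into \<open>P1\<close>.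
      Subtracting a multiple of the boundary of \<open>e\<close>, which is a local generator at
      \<open>y1\<close>, removes its local class there, and the rest can be pushed into
      \<open>Q\<close>.\<close>
    obtain n where n: "loc p P1 y1 (w1 - lf_scale n (lf_boundary (Suc p) e))"
      using lgen_ex[OF g u(2) av] by blast
    define v where "v = w1 - lf_scale n (lf_boundary (Suc p) e)"
    have lv: "lfs M p P1 v" unfolding v_def by (intro lfs_diff u lfs_scale lde)
    have "lf_boundary p v = lf_boundary p w"
      unfolding v_def bd_diff[OF u(2) lfs_scale[OF lde]] bd_scale[OF lde] bd_bd[OF le] dw1
      by (simp add: lf_scale_def fun_eq_iff)
    then have "relc M p P1 Q v" using lv ldw 1 by (simp add: relc_def)
    from b1[OF this] n obtain u2 w2 where u2: "lfs M (Suc p) P1 u2" "lfs M p Q w2" "v = lf_boundary (Suc p) u2 + w2"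
      by (auto simp: triv_def v_def)
    have u2P: "lfs M (Suc p) P u2" by (rule lfs_mono[OF u2(1) P1])
    have "w1 = lf_scale n (lf_boundary (Suc p) e) + (lf_boundary (Suc p) u2 + w2)"
      using u2(3) by (simp add: v_def algebra_simps)
    then have "w = lf_boundary (Suc p) (u + lf_scale n e + u2) + w2"
      unfolding u(3) bd_add[OF lfs_add[OF u(1) lfs_scale[OF le]] u2P] bd_add[OF u(1) lfs_scale[OF le]] bd_scale[OF le]
      by (simp add: algebra_simps)
    moreover have "lfs M (Suc p) P (u + lf_scale n e + u2)" by (intro lfs_add lfs_scale u le u2P)
    ultimately show ?thesis using u2(2) 1 unfolding triv_def by blast
  next
    case 2
    have av: "avoids (Suc p - Suc 0) y (lf_boundary (Suc p) w)" using avoids_lfs[OF ldw] y(2) Q 2 by auto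
    have lw2: "lfs M (Suc p) P w" using lw 2 by simp
    obtain n where n: "loc (Suc p) P y (w - lf_scale n e)" using lgen_ex[OF e(2) lw2 av] by blast
    define v where "v = w - lf_scale n e"
    have lv: "lfs M (Suc p) P v" unfolding v_def by (intro lfs_diff lw2 lfs_scale le)
    have dv: "lf_boundary (Suc p) v = lf_boundary (Suc p) w - lf_scale n (lf_boundary (Suc p) e)"
      unfolding v_def bd_diff[OF lw2 lfs_scale[OF le]] bd_scale[OF le] ..
    have ldw1: "lfs M p P1 (lf_boundary (Suc p) w)" using ldw 2 lfs_mono[OF _ Q] by simp
    have "relc M (Suc p) P P1 v"
      unfolding relc_def dv using lv by (simp add: lfs_diff lfs_scale lde ldw1)
    from b2[OF this] n obtain u w1 where u: "lfs M (Suc (Suc p)) P u" "lfs M (Suc p) P1 w1" "v = lf_boundary (Suc (Suc p)) u + w1"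
      by (auto simp: triv_def v_def)
    have "lf_boundary (Suc p) v = lf_boundary (Suc p) w1"
      unfolding u(3) using bd_add[OF lfs_bd'[OF u(1)] u(2)] bd_bd[OF u(1)] by simp
    then have eq: "lf_scale n (lf_boundary (Suc p) e) = lf_boundary (Suc p) w - lf_boundary (Suc p) w1"
      using dv by (simp add: algebra_simps)
    \<comment> \<open>At \<open>y1\<close> the boundary of \<open>w\<close> is trivial because it
      lies in \<open>Q\<close>, and that of \<open>w1\<close> because \<open>w1\<close> is a chain
      in \<open>P1\<close>. So \<open>n\<close> times the boundary of \<open>e\<close> is locally
      trivial, which forces \<open>n = 0\<close>.\<close>
    have "loc p P1 y1 (lf_scale n (lf_boundary (Suc p) e))" unfolding eq
    proof (rule loc_diff)
      show "loc p P1 y1 (lf_boundary (Suc p) w)" by (rule loc_avoids, rule avoids_lfs[OF _ y1(2)]) (use ldw 2 in simp)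
      show "loc p P1 y1 (lf_boundary (Suc p) w1)" by (rule loc_bd[OF u(2)]) (use y1 P1 PM in auto)
    qed
    then have "n = 0" by (rule lgen_uniq[OF g])
    then have "v = w" by (simp add: v_def lf_scale_lincomb)
    then have "triv M (Suc p) P P1 w" unfolding triv_def using u by blast
    then show ?thesis using triv_trans[OF w _ Q P1 a1[of k]] 2 by simp
  next
    case 3
    then show ?thesis using triv_trans[OF w a2[OF _ up[OF w]] Q P1 a1] by blast
  qed
qed

text \<open>Near a point \<open>y1\<close> of the facet, \<open>P\<close> is a half space bounded by \<open>P1\<close>, and the simplex has
  \<open>y1\<close> in its face opposite to the first vertex.\<close>

lemma boundary_lgen:
  assumes B: "bary (Suc p) v b" and y: "y \<in> bsp (Suc p) v b" "\<And>i. i \<le> Suc p \<Longrightarrow> b i y > 0"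
    and y1: "y1 \<in> bsp (Suc p) v b" "b 0 y1 = 0" "\<And>i. i \<le> p \<Longrightarrow> b (Suc i) y1 > 0"
    and U: "open U" "asx (Suc p) v ` standard_simplex (Suc p) \<subseteq> U"
    and PU: "P \<inter> U = {z \<in> bsp (Suc p) v b. b 0 z \<ge> 0} \<inter> U"
    and P1U: "P1 \<inter> U = {z \<in> bsp (Suc p) v b. b 0 z = 0} \<inter> U" and PM: "P \<subseteq> M" "P1 \<subseteq> P"
    and e: "relc M (Suc p) P P1 e" "lgen M (Suc p) P y e"
  shows "lgen M p P1 y1 (lf_boundary (Suc p) e)"
proof -
  let ?E = "bsp (Suc p) v b" and ?E1 = "bsp p (v \<circ> Suc) (b \<circ> Suc)"
  have aff: "affine_form (b i)" if "i \<le> Suc p" for i using B that by (simp add: bary_def)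
  have bc: "continuous_on X (b i)" if "i \<le> Suc p" for i X by (rule affine_form_continuous[OF aff[OF that]])
  have E1: "?E1 = {z \<in> ?E. b 0 z = 0}" by (rule bsp_Suc[OF B])
  let ?\<sigma> = "frag_of (asx (Suc p) v)" and ?\<tau> = "frag_of (asx p (v \<circ> Suc))"
  define D where "D = asx (Suc p) v ` standard_simplex (Suc p)"
  have D_iff: "z \<in> D \<longleftrightarrow> z \<in> ?E \<and> (\<forall>i\<le>Suc p. 0 \<le> b i z)" for z
  proof
    assume "z \<in> D"
    then show "z \<in> ?E \<and> (\<forall>i\<le>Suc p. 0 \<le> b i z)"
      unfolding D_def by (intro conjI allI impI asx_weights[OF B]) assumption+
  next
    assume "z \<in> ?E \<and> (\<forall>i\<le>Suc p. 0 \<le> b i z)"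
    then show "z \<in> D" unfolding D_def by (intro bsp_in_asx) auto
  qed
  define D0 where "D0 = {z \<in> ?E. \<forall>i\<le>Suc p. 0 < b i z}"
  have D0D: "D0 \<subseteq> D" by (auto simp: D0_def D_iff less_imp_le)
  have DU: "D \<subseteq> U" using U(2) by (simp add: D_def)
  have PU_iff: "z \<in> P \<longleftrightarrow> z \<in> ?E \<and> 0 \<le> b 0 z" if "z \<in> U" for z
  proof -
    have "z \<in> P \<inter> U \<longleftrightarrow> z \<in> {z \<in> ?E. 0 \<le> b 0 z} \<inter> U" by (simp only: PU)
    then show ?thesis using that by simp
  qed
  have PUE: "P \<inter> U \<subseteq> ?E" unfolding PU by blast
  have DP: "D \<subseteq> P"
  proof
    fix z assume z: "z \<in> D"
    then have "z \<in> U" using DU by blast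
    then show "z \<in> P" using z PU_iff by (auto simp: D_iff)
  qed
  have cD: "compact D"
  proof -
    have "singular_simplex (Suc p) (top_of_set D) (asx (Suc p) v)" by (simp add: singular_simplex_asx D_def)
    from compactin_singular_simplex_image[OF this] show ?thesis by (simp add: compactin_subtopology D_def)
  qed
  have yD: "y \<in> D0" "y \<in> D" "y \<in> P" using y D0D DP by (auto simp: D0_def)
  have y1D: "y1 \<in> D" "y1 \<notin> D0"
  proof -
    have "0 \<le> b i y1" if "i \<le> Suc p" for i
      using that y1(2) y1(3)[of "i - 1"] by (cases i) (auto simp: less_imp_le)
    then show "y1 \<in> D" using y1(1) by (simp add: D_iff)
    show "y1 \<notin> D0" using y1(2) by (auto simp: D0_def)
  qed
  have P1U_iff: "z \<in> P1 \<longleftrightarrow> z \<in> ?E \<and> b 0 z = 0" if "z \<in> U" for z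
  proof -
    have "z \<in> P1 \<inter> U \<longleftrightarrow> z \<in> {z \<in> ?E. b 0 z = 0} \<inter> U" by (simp only: P1U)
    then show ?thesis using that by simp
  qed
  have y1P: "y1 \<in> P1" using P1U_iff[of y1] y1D(1) DU y1 by auto
  have P1D0: "P1 \<inter> D0 = {}"
  proof -
    have False if "z \<in> P1" "z \<in> D0" for z
    proof -
      have "z \<in> U" using that(2) D0D DU by blast
      then have "b 0 z = 0" using that(1) P1U_iff by blast
      then show False using that(2) by (auto simp: D0_def)
    qed
    then show ?thesis by blast
  qed
  have bpos_open: "open {z. 0 < b i z}" if "i \<le> Suc p" for i
    using bc[OF that, of UNIV] by (intro open_Collect_less) auto
  have le: "lfs M (Suc p) P e" and lde: "lfs M p P1 (lf_boundary (Suc p) e)" using e(1) by (auto simp: relc_def)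

  have \<sigma>U: "ch (Suc p) (P \<inter> U) ?\<sigma>"
    using DP DU by (auto simp: singular_chain_of singular_simplex_asx D_def)
  have gE: "rel_gen (Suc p) ?E (?E - {y}) ?\<sigma>" by (rule affine_local_homology(1)[OF B y])
  have rc\<sigma>: "rc (Suc p) (P \<inter> U) (P \<inter> U - {y}) ?\<sigma>"
    unfolding rc_iff[OF Diff_subset]
  proof (rule conjI, rule \<sigma>U, rule singular_chain_subsetI)
    show b1: "ch (Suc p - Suc 0) (P \<inter> U) (chain_boundary (Suc p) ?\<sigma>)" by (rule singular_chain_boundary[OF \<sigma>U])
    have b2: "ch (Suc p - Suc 0) (?E - {y}) (chain_boundary (Suc p) ?\<sigma>)"
      using gE by (simp add: rel_gen_def rc_iff)
    fix f assume "lk (chain_boundary (Suc p) ?\<sigma>) f \<noteq> 0"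
    from singular_chain_keys(2)[OF b1 this] singular_chain_keys(2)[OF b2 this]
    show "f ` standard_simplex (Suc p - Suc 0) \<subseteq> P \<inter> U - {y}" by blast
  qed
  have gP: "rel_gen (Suc p) P (P - {y}) ?\<sigma>"
  proof -
    \<comment> \<open>\<open>P \<inter> U\<close> ends at the facet and need not be open in the
      affine space. The comparison therefore passes through the smaller open part where
      \<open>b 0\<close> is positive.\<close>
    define U1 where "U1 = U \<inter> {z. 0 < b 0 z}"
    have U1: "open U1" "y \<in> U1" using U(1) bpos_open[of 0] yD DU y(2)[of 0] by (auto simp: U1_def)
    have eq: "P \<inter> U \<inter> U1 = ?E \<inter> U1" unfolding PU by (auto simp: U1_def)
    have i1: "incl_iso (Suc p) (?E \<inter> U1) (?E \<inter> U1 - {y}) ?E (?E - {y})"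
      by (rule incl_iso_local) (use U1 in auto)
    have i2: "incl_iso (Suc p) (?E \<inter> U1) (?E \<inter> U1 - {y}) (P \<inter> U) (P \<inter> U - {y})"
      unfolding eq[symmetric] by (rule incl_iso_local) (use U1 in auto)
    have i3: "incl_iso (Suc p) (P \<inter> U) (P \<inter> U - {y}) ?E (?E - {y})"
      by (rule incl_iso_cancel[OF i2 i1]) (use PUE in blast)+
    have i4: "incl_iso (Suc p) (P \<inter> U) (P \<inter> U - {y}) P (P - {y})"
      by (rule incl_iso_local) (use U yD DU in auto)
    show ?thesis using gE incl_iso_gen[OF i3 rc\<sigma>] incl_iso_gen[OF i4 rc\<sigma>] by blast
  qed
  have \<sigma>P: "ch (Suc p) P ?\<sigma>" by (rule ch_mono[OF \<sigma>U]) auto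
  have lg\<sigma>: "lgen M (Suc p) P y (lk ?\<sigma>)" using lgen_lk[OF \<sigma>P PM(1) yD(3)] gP by blast
  obtain n where n: "loc (Suc p) P y (e - lf_scale n (lk ?\<sigma>))"
    using lgen_ex[OF lg\<sigma> le] e(2) by (auto simp: lgen_def)
  obtain m where m: "loc (Suc p) P y (lk ?\<sigma> - lf_scale m e)"
    using lgen_ex[OF e(2), of "lk ?\<sigma>"] lg\<sigma> by (auto simp: lgen_def)
  \<comment> \<open>Both \<open>e\<close> and the simplex generate the local homology at
    \<open>y\<close>, so the factor \<open>n\<close> between them is a sign.\<close>
  have nn: "n * n = 1"
  proof -
    have "lf_scale (1 - n * m) e = (e - lf_scale n (lk ?\<sigma>)) + lf_scale n (lk ?\<sigma> - lf_scale m e)"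
      by (simp add: lf_scale_lincomb)
    then have "loc (Suc p) P y (lf_scale (1 - n * m) e)" using loc_add[OF n loc_scale[OF m]] by metis
    then have "n * m = 1" using lgen_uniq[OF e(2)] by force
    then show ?thesis using zmult_eq_1_iff[of n m] by auto
  qed

  obtain c where c: "ch (Suc p) P c" "\<And>f. lk c f = (if f ` standard_simplex (Suc p) \<inter> D \<noteq> {} then e f else 0)"
    using lf_truncate_finite[OF le cD] DP PM by blast
  have dc: "lk (chain_boundary (Suc p) c) g = lf_boundary (Suc p) e g" if "g ` standard_simplex p \<inter> D \<noteq> {}" for g
  proof -
    have "lf_boundary (Suc p) (lk c) g = lf_boundary (Suc p) e g"
      by (rule lf_boundary_local) (use that c(2) in auto)
    then show ?thesis by (simp add: bd_lookup)
  qed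
  \<comment> \<open>With the open simplex removed, the boundary of the truncation of
    \<open>e\<close> and all faces of the simplex still lie in \<open>?W\<close>, and chains that
    avoid \<open>y\<close> can be retracted into it.\<close>
  let ?W = "P - D0"
  have dcW: "ch p ?W (chain_boundary (Suc p) c)"
  proof (rule singular_chain_subsetI)
    show dcP: "ch p P (chain_boundary (Suc p) c)" using singular_chain_boundary[OF c(1)] by simp
    fix g assume nz: "lk (chain_boundary (Suc p) c) g \<noteq> 0"
    show "g ` standard_simplex p \<subseteq> ?W"
    proof (cases "g ` standard_simplex p \<inter> D = {}")
      case True then show ?thesis using singular_chain_keys(2)[OF dcP nz] D0D by blast
    next
      case False
      then have "lf_boundary (Suc p) e g \<noteq> 0" using dc nz by simp
      then show ?thesis using lfs_subset[OF lde] P1D0 PM(2) by blast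
    qed
  qed
  define rest where "rest = (\<Sum>j\<in>{1..Suc p}. frag_cmul ((-1) ^ j) (frag_of (asx p (\<lambda>i. if i < j then v i else v (Suc i)))))"
  have d\<sigma>: "chain_boundary (Suc p) ?\<sigma> = ?\<tau> + rest" unfolding rest_def by (rule chain_boundary_asx)
  have rest: "ch p (?W - {y1}) rest" unfolding rest_def
  proof (intro singular_chain_sum singular_chain_cmul singular_chain_of[THEN iffD2] singular_simplex_asx[THEN iffD2] subsetI)
    fix j z assume j: "j \<in> {1..Suc p}" and z: "z \<in> asx p (\<lambda>i. if i < j then v i else v (Suc i)) ` standard_simplex p"
    have zz: "z \<in> D" "b j z = 0" using asx_face_subset[OF B _ z] j by (auto simp: D_def)
    have "b j y1 > 0" using y1(3)[of "j - 1"] j by (cases j) auto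
    then show "z \<in> ?W - {y1}" using zz DP j by (auto simp: D0_def)
  qed
  have \<tau>D: "z \<in> D \<and> b 0 z = 0" if "z \<in> asx p (v \<circ> Suc) ` standard_simplex p" for z
    using asx_face_subset[OF B, of 0 z] that by (simp add: comp_def D_def)
  have \<tau>P1: "ch p P1 ?\<tau>" unfolding singular_chain_of singular_simplex_asx
  proof
    fix z assume "z \<in> asx p (v \<circ> Suc) ` standard_simplex p"
    from \<tau>D[OF this] show "z \<in> P1" using DU P1U_iff D_iff by blast
  qed
  have \<tau>W: "ch p ?W ?\<tau>" by (rule ch_mono[OF \<tau>P1]) (use P1D0 PM in auto)
  have d\<sigma>W: "ch p ?W (chain_boundary (Suc p) ?\<sigma>)"
    unfolding d\<sigma> by (intro singular_chain_add \<tau>W ch_mono[OF rest]) auto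

  have "loc (Suc p) P y (lk (c - frag_cmul n ?\<sigma>))"
  proof (rule loc_cong_avoids[OF _ n])
    have "e f = lk c f" if "y \<in> f ` standard_simplex (Suc p)" for f
    proof -
      have "f ` standard_simplex (Suc p) \<inter> D \<noteq> {}" using that yD by blast
      then show ?thesis by (simp add: c(2))
    qed
    then show "avoids (Suc p) y (e - lf_scale n (lk ?\<sigma>) - lk (c - frag_cmul n ?\<sigma>))"
      by (auto simp: avoids_def lk_diff lk_cmul)
  qed
  then have "rb (Suc p) P (P - {y}) (c - frag_cmul n ?\<sigma>)"
    using loc_lk[of "Suc p" P "c - frag_cmul n ?\<sigma>" y] c(1) \<sigma>P
    by (simp add: singular_chain_diff singular_chain_cmul)
  then obtain d r where d: "ch (Suc (Suc p)) P d" "ch (Suc p) (P - {y}) r"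
      "c - frag_cmul n ?\<sigma> = chain_boundary (Suc (Suc p)) d + r"
    unfolding rb_iff[OF Diff_subset] by blast
  have dr: "chain_boundary (Suc p) r = chain_boundary (Suc p) c - frag_cmul n (chain_boundary (Suc p) ?\<sigma>)"
  proof -
    have "chain_boundary (Suc p) (c - frag_cmul n ?\<sigma>) = chain_boundary (Suc p) r"
      unfolding d(3) using chain_boundary_boundary_alt[OF d(1)] by (simp add: chain_boundary_add)
    then show ?thesis by (simp add: chain_boundary_diff chain_boundary_cmul)
  qed
  have drW: "ch p ?W (chain_boundary (Suc p) r)"
    unfolding dr by (intro singular_chain_diff dcW singular_chain_cmul d\<sigma>W)

  \<comment> \<open>\<open>\<rho>\<close> pushes the simplex radially from \<open>y\<close> onto its
    boundary and fixes everything else.\<close>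
  obtain \<rho> where \<rho>: "continuous_on (P - {y}) \<rho>" "\<And>z. z \<in> P - {y} \<Longrightarrow> \<rho> z \<in> ?W" "\<And>z. z \<in> ?W \<Longrightarrow> \<rho> z = z"
  proof -
    interpret gauge "{..Suc p}" b y by unfold_locales (use aff y(2) in auto)
    \<comment> \<open>The coordinates of \<open>z\<close> and of \<open>y\<close> have the same sum.
      If none of those of \<open>z\<close> were smaller, all would be equal and \<open>z\<close>
      would be \<open>y\<close>.\<close>
    have mg_pos: "mg z > 0" if z: "z \<in> D" "z \<noteq> y" for z
    proof (rule ccontr)
      assume "\<not> 0 < mg z"
      then have ge: "b i z \<ge> b i y" if "i \<le> Suc p" for i
      proof -
        have "1 \<le> b i z / b i y" using mg_ge(2)[of i z] that \<open>\<not> 0 < mg z\<close> by simp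
        then show ?thesis using y(2)[OF that] by (simp add: le_divide_eq)
      qed
      have s: "(\<Sum>i\<le>Suc p. b i z) = 1" "(\<Sum>i\<le>Suc p. b i y) = 1" using z(1) y(1) by (auto simp: D_iff bsp_def)
      have eq: "b i z = b i y" if "i \<le> Suc p" for i
      proof (rule ccontr)
        assume "b i z \<noteq> b i y"
        then have "(\<Sum>i\<le>Suc p. b i y) < (\<Sum>i\<le>Suc p. b i z)"
          using ge that by (intro sum_strict_mono_ex1) (auto intro!: bexI[of _ i] simp: less_le)
        then show False using s by simp
      qed
      have "z = (\<Sum>i\<le>Suc p. b i z *\<^sub>R v i)" using z(1) by (simp add: D_iff bsp_def)
      also have "\<dots> = (\<Sum>i\<le>Suc p. b i y *\<^sub>R v i)" by (rule sum.cong) (auto simp: eq)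
      also have "\<dots> = y" using y(1) by (simp add: bsp_def)
      finally show False using z(2) by simp
    qed
    have mg_le: "mg z \<le> 1" if "z \<in> D" for z by (rule mg_le_1) (use that in \<open>auto simp: D_iff\<close>)
    have mg_1: "mg z = 1" if z: "z \<in> D" "z \<notin> D0" for z
    proof -
      obtain i where i: "i \<le> Suc p" "b i z = 0" using z by (force simp: D_iff D0_def)
      then show ?thesis using z(1) by (intro mg_eq_1[of z i]) (auto simp: D_iff)
    qed
    define \<rho> where "\<rho> z = (if z \<in> D then y + (1 / mg z) *\<^sub>R (z - y) else z)" for z
    have "continuous_on ((D - {y}) \<union> ?W) \<rho>" unfolding \<rho>_def
    proof (rule continuous_on_cases_local)
      have "D - {y} = (D - {y} \<union> ?W) \<inter> D" using y1D yD by auto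
      then show "closedin (top_of_set (D - {y} \<union> ?W)) (D - {y})"
        using closedin_closed_Int[OF compact_imp_closed[OF cD]] by metis
      define O' where "O' = U \<inter> (\<Inter>i\<in>{..Suc p}. {z. 0 < b i z})"
      have "open O'" unfolding O'_def by (intro open_Int U(1) open_INT ballI bpos_open) auto
      moreover have "?W = (D - {y} \<union> ?W) \<inter> - O'"
      proof -
        have "z \<in> O'" if "z \<in> D0" for z using that D0D DU unfolding O'_def D0_def by blast
        moreover have "z \<notin> O'" if z: "z \<in> P" "z \<notin> D0" for z
        proof
          assume "z \<in> O'"
          then have "z \<in> U" "\<forall>i\<le>Suc p. 0 < b i z" by (auto simp: O'_def)
          then show False using z PU_iff by (auto simp: D0_def)
        qed
        ultimately show ?thesis using DP by blast
      qed
      ultimately show "closedin (top_of_set (D - {y} \<union> ?W)) ?W"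
        using closedin_closed_Int[of "- O'" "D - {y} \<union> ?W"] by (simp add: closed_Compl)
      show "continuous_on (D - {y}) (\<lambda>z. y + (1 / mg z) *\<^sub>R (z - y))"
      proof (intro continuous_intros mg_cont ballI)
        show "mg z \<noteq> 0" if "z \<in> D - {y}" for z using mg_pos[of z] that by auto
      qed
      show "continuous_on ?W (\<lambda>z. z)" by (rule continuous_on_id)
      show "y + (1 / mg z) *\<^sub>R (z - y) = z" if "z \<in> D - {y} \<and> z \<notin> D \<or> z \<in> ?W \<and> z \<in> D" for z
        using that mg_1[of z] by auto
    qed
    moreover have "(D - {y}) \<union> ?W = P - {y}" using DP yD D0D by auto
    moreover have "\<rho> z \<in> ?W" if z: "z \<in> P - {y}" for z
    proof (cases "z \<in> D")
      case True
      have mp: "mg z > 0" "mg z \<le> 1" using mg_pos mg_le True z by auto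
      have bi: "b i (\<rho> z) = b i y + (1 / mg z) * (b i z - b i y)" if "i \<le> Suc p" for i
        using True affine_form_line[OF aff[OF that], of y "1 / mg z" z] by (simp add: \<rho>_def)
      have bi2: "b i (\<rho> z) = b i y * (1 - (1 - b i z / b i y) / mg z)" if "i \<le> Suc p" for i
        unfolding bi[OF that] using y(2)[OF that] mp by (simp add: field_simps)
      have "b i (\<rho> z) \<ge> 0" if "i \<le> Suc p" for i
        unfolding bi2[OF that] using mg_ge(2)[of i z] that mp y(2)[OF that]
        by (intro mult_nonneg_nonneg) (auto simp: divide_le_eq)
      moreover have "\<rho> z \<in> ?E"
        using True bsp_affine[OF B y(1), of z "1 / mg z"] by (auto simp: \<rho>_def D_iff)
      ultimately have "\<rho> z \<in> D" by (simp add: D_iff)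
      moreover have "\<rho> z \<notin> D0"
      proof -
        obtain i where i: "i \<le> Suc p" "mg z = 1 - b i z / b i y" using mg_cases[of z] mp by auto
        have "b i (\<rho> z) = 0" unfolding bi2[OF i(1)] i(2)[symmetric] using mp by simp
        then show ?thesis using i(1) by (auto simp: D0_def)
      qed
      ultimately show ?thesis using DP by auto
    next
      case False
      then show ?thesis using z D0D by (auto simp: \<rho>_def)
    qed
    moreover have "\<rho> z = z" if "z \<in> ?W" for z using that mg_1[of z] by (auto simp: \<rho>_def)
    ultimately show thesis using that[of \<rho>] by simp
  qed
  \<comment> \<open>The retraction fixes the boundary of \<open>r\<close>, which already lies in
    \<open>?W\<close>; so \<open>r1\<close> has the same boundary and stays off the open
    simplex.\<close>
  define r1 where "r1 = chain_map (Suc p) \<rho> r"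
  have c\<rho>: "continuous_map (top_of_set (P - {y})) (top_of_set ?W) \<rho>" using \<rho>(1,2) by auto
  have r1: "ch (Suc p) ?W r1" unfolding r1_def by (rule singular_chain_chain_map[OF d(2) c\<rho>])
  have dr1: "chain_boundary (Suc p) r1 = chain_boundary (Suc p) r"
  proof -
    have "chain_boundary (Suc p) r1 = chain_map p \<rho> (chain_boundary (Suc p) r)"
      unfolding r1_def using chain_boundary_chain_map[OF d(2)] by simp
    also have "\<dots> = chain_boundary (Suc p) r"
      by (rule chain_map_id_gen[OF drW]) (simp add: \<rho>(3))
    finally show ?thesis .
  qed

  have y1M: "y1 \<in> M" using y1P PM by auto
  obtain c1 where c1: "ch p P1 c1" "avoids p y1 (lf_boundary (Suc p) e - lk c1)"
      "rc p P1 (P1 - {y1}) c1"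
    using trunc_point[OF lde y1M] bd_bd[OF le] avoids_0 by metis
  have \<tau>g: "rel_gen p P1 (P1 - {y1}) ?\<tau>"
  proof (rule bary_local(1)[OF bary_Suc[OF B] _ _ U(1)])
    show "y1 \<in> ?E1" unfolding E1 using y1 by simp
    show "0 < (b \<circ> Suc) i y1" if "i \<le> p" for i using y1(3)[OF that] by simp
    show "y1 \<in> U" using y1D DU by auto
    show "P1 \<inter> U = ?E1 \<inter> U" unfolding E1 by (rule P1U)
    show "asx p (v \<circ> Suc) ` standard_simplex p \<subseteq> U" using \<tau>D DU by blast
  qed
  have WP1: "P1 \<subseteq> ?W" using PM(2) P1D0 by auto
  have "rb p ?W (?W - {y1}) (c1 - frag_cmul n ?\<tau>)"
  proof -
    define s where "s = (c1 - chain_boundary (Suc p) c) + frag_cmul n rest"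
    have "c1 - frag_cmul n ?\<tau> = chain_boundary (Suc p) r1 + s" unfolding dr1 dr d\<sigma> s_def
      by (rule poly_mapping_eqI) (simp add: lookup_add lookup_minus algebra_simps)
    moreover have "ch p (?W - {y1}) s" unfolding s_def
    proof (intro singular_chain_add singular_chain_cmul rest)
      have "ch p ?W (c1 - chain_boundary (Suc p) c)"
        by (intro singular_chain_diff dcW ch_mono[OF c1(1) WP1])
      moreover have "avoids p y1 (lk (c1 - chain_boundary (Suc p) c))" unfolding avoids_def
      proof (intro allI impI)
        fix f assume f: "y1 \<in> f ` standard_simplex p"
        have "lf_boundary (Suc p) e f - lk c1 f = 0" using c1(2) f by (auto simp: avoids_def)
        moreover have "lk (chain_boundary (Suc p) c) f = lf_boundary (Suc p) e f"
          using dc[of f] f y1D by blast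
        ultimately show "lk (c1 - chain_boundary (Suc p) c) f = 0" by (simp add: lookup_minus)
      qed
      ultimately show "ch p (?W - {y1}) (c1 - chain_boundary (Suc p) c)" using avoids_lk_iff by blast
    qed
    ultimately show ?thesis unfolding rb_iff[OF Diff_subset] using r1 by blast
  qed
  \<comment> \<open>Near \<open>y1\<close> the coordinates other than \<open>b 0\<close> are
    positive, so points of \<open>P\<close> with \<open>b 0\<close> positive belong to the removed
    simplex: there \<open>?W\<close> and \<open>P1\<close> coincide.\<close>
  moreover have "incl_iso p P1 (P1 - {y1}) ?W (?W - {y1})"
  proof -
    define U2 where "U2 = U \<inter> (\<Inter>i\<in>{..p}. {z. 0 < b (Suc i) z})"
    have U2: "open U2" unfolding U2_def by (intro open_Int U(1) open_INT ballI bpos_open) auto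
    have y1U2: "y1 \<in> U2" using y1D DU y1(3) by (auto simp: U2_def)
    have eq: "?W \<inter> U2 = P1 \<inter> U2"
    proof
      show "P1 \<inter> U2 \<subseteq> ?W \<inter> U2" using WP1 by auto
      show "?W \<inter> U2 \<subseteq> P1 \<inter> U2"
      proof
        fix z assume z: "z \<in> ?W \<inter> U2"
        then have zU: "z \<in> U" "z \<in> P" by (auto simp: U2_def)
        then have zE: "z \<in> ?E" "b 0 z \<ge> 0" "z \<in> U" using PU_iff by auto
        have "b 0 z = 0"
        proof (rule ccontr)
          assume "b 0 z \<noteq> 0"
          then have "b i z > 0" if "i \<le> Suc p" for i
            using z zE(2) that by (cases i) (auto simp: U2_def)
          then show False using z zE(1) by (auto simp: D0_def)
        qed
        then show "z \<in> P1 \<inter> U2" using z zE P1U_iff by blast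
      qed
    qed
    have i1: "incl_iso p (P1 \<inter> U2) (P1 \<inter> U2 - {y1}) P1 (P1 - {y1})"
      by (rule incl_iso_local) (use U2 y1U2 in auto)
    have i2: "incl_iso p (P1 \<inter> U2) (P1 \<inter> U2 - {y1}) ?W (?W - {y1})"
      unfolding eq[symmetric] by (rule incl_iso_local) (use U2 y1U2 in auto)
    show ?thesis by (rule incl_iso_cancel[OF i1 i2]) (use WP1 in auto)
  qed
  moreover have "rc p P1 (P1 - {y1}) (c1 - frag_cmul n ?\<tau>)"
    using c1(3) \<tau>g by (intro rc_diff_cmul) (auto simp: rel_gen_def)
  ultimately have "rb p P1 (P1 - {y1}) (c1 - frag_cmul n ?\<tau>)" using incl_iso_rb by blast
  then have l1: "loc p P1 y1 (lk (c1 - frag_cmul n ?\<tau>))"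
    using loc_lk[of p P1 "c1 - frag_cmul n ?\<tau>" y1] c1(1) \<tau>P1 by (simp add: singular_chain_diff singular_chain_cmul)
  have l2: "loc p P1 y1 (lf_boundary (Suc p) e - lf_scale n (lk ?\<tau>))"
  proof (rule loc_cong_avoids[OF _ l1])
    show "avoids p y1 (lk (c1 - frag_cmul n ?\<tau>) - (lf_boundary (Suc p) e - lf_scale n (lk ?\<tau>)))"
      using avoids_scale[OF c1(2), of "-1"] by (simp add: lk_diff lk_cmul lf_scale_lincomb)
  qed
  have "lk ?\<tau> - lf_scale n (lf_boundary (Suc p) e) = lf_scale (- n) (lf_boundary (Suc p) e - lf_scale n (lk ?\<tau>))"
    using nn by (simp add: lf_scale_lincomb flip: lf_scale_lincomb(4))
  then have l3: "loc p P1 y1 (lk ?\<tau> - lf_scale n (lf_boundary (Suc p) e))"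
    using loc_scale[OF l2, of "- n"] by metis
  show ?thesis
  proof (rule lgen_cong[OF _ lde _ l3 nn])
    show "lgen M p P1 y1 (lk ?\<tau>)" using lgen_lk[OF \<tau>P1 _ y1P] PM \<tau>g by blast
    show "avoids (p - Suc 0) y1 (lf_boundary p (lf_boundary (Suc p) e))" by (simp add: bd_bd[OF le])
  qed
qed

section \<open>Cells of an arrangement\<close>

text \<open>The cone with apex \<open>w\<close> over the given simplex. The coordinate of the apex
  is \<open>f\<close>; the other ones project \<open>z\<close> to the base along
  \<open>w - y1\<close> and subtract \<open>f z * b' i y1\<close>, which makes them vanish at
  \<open>w\<close>.\<close>

lemma bary_cone:
  assumes B: "bary p v' b'" and f: "affine_form f" "\<And>i. i \<le> p \<Longrightarrow> f (v' i) = 0" "f w = 1"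
    and y1: "y1 \<in> bsp p v' b'"
  obtains b where "bary (Suc p) (case_nat w v') b" "b 0 = f"
    "bsp (Suc p) (case_nat w v') b = {z. z - f z *\<^sub>R (w - y1) \<in> bsp p v' b'}"
    "\<And>i z. i \<le> p \<Longrightarrow> f z = 0 \<Longrightarrow> b (Suc i) z = b' i z"
    "\<And>i t. i \<le> p \<Longrightarrow> b (Suc i) (y1 + t *\<^sub>R (w - y1)) = (1 - t) * b' i y1"
proof -
  define b where "b i z = (case i of 0 \<Rightarrow> f z | Suc j \<Rightarrow> b' j (z - f z *\<^sub>R (w - y1)) - f z * b' j y1)" for i z
  have b0: "b 0 = f" and bS: "\<And>j z. b (Suc j) z = b' j (z - f z *\<^sub>R (w - y1)) - f z * b' j y1"
    by (auto simp: b_def)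
  have y1c: "y1 = (\<Sum>i\<le>p. b' i y1 *\<^sub>R v' i)" "(\<Sum>i\<le>p. b' i y1) = 1" using y1 by (auto simp: bsp_def)
  have fy1: "f y1 = 0" by (subst y1c(1), subst affine_form_comb[OF f(1)]) (simp_all add: y1c(2) f(2))
  obtain g c where g: "linear g" "f = (\<lambda>x. g x + c)" using f(1) by (auto simp: affine_form_def)
  have aff: "affine_form (b (Suc j))" if "j \<le> p" for j
  proof -
    have "affine_form (b' j)" using B that by (simp add: bary_def)
    then obtain h d where h: "linear h" "b' j = (\<lambda>x. h x + d)" by (auto simp: affine_form_def)
    have "linear (\<lambda>z. h z - g z * h (w - y1) - g z * b' j y1)" by (intro linearI)
        (simp_all add: linear_add[OF h(1)] linear_scale[OF h(1)] linear_add[OF g(1)] linear_scale[OF g(1)] algebra_simps)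
    moreover have "b (Suc j) = (\<lambda>z. (h z - g z * h (w - y1) - g z * b' j y1) + (d - c * h (w - y1) - c * b' j y1))"
      unfolding bS g(2) h(2)
      by (auto simp: fun_eq_iff linear_diff[OF h(1)] linear_add[OF h(1)] linear_scale[OF h(1)] algebra_simps)
    ultimately show ?thesis unfolding affine_form_def by blast
  qed
  have bary: "bary (Suc p) (case_nat w v') b" unfolding bary_def
  proof (intro conjI allI impI)
    fix i assume i: "i \<le> Suc p"
    show "affine_form (b i)" using aff f(1) b0 i by (cases i) auto
    fix j assume j: "j \<le> Suc p"
    have "b' k (v' l) = (if k = l then 1 else 0)" if "k \<le> p" "l \<le> p" for k l using B that by (simp add: bary_def)
    then show "b i (case_nat w v' j) = (if i = j then 1 else 0)"
      using i j f by (cases i; cases j) (auto simp: b0 bS)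
  qed
  have bsp: "z \<in> bsp (Suc p) (case_nat w v') b \<longleftrightarrow> z - f z *\<^sub>R (w - y1) \<in> bsp p v' b'" for z
  proof -
    let ?z = "z - f z *\<^sub>R (w - y1)"
    have 1: "(\<Sum>i\<le>Suc p. b i z *\<^sub>R case_nat w v' i) = f z *\<^sub>R (w - y1) + (\<Sum>i\<le>p. b' i ?z *\<^sub>R v' i)"
    proof -
      have "(\<Sum>i\<le>Suc p. b i z *\<^sub>R case_nat w v' i) = f z *\<^sub>R w + (\<Sum>i\<le>p. b (Suc i) z *\<^sub>R v' i)"
        by (simp add: sum.atMost_Suc_shift b0 del: sum.atMost_Suc)
      also have "(\<Sum>i\<le>p. b (Suc i) z *\<^sub>R v' i) = (\<Sum>i\<le>p. b' i ?z *\<^sub>R v' i) - f z *\<^sub>R (\<Sum>i\<le>p. b' i y1 *\<^sub>R v' i)"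
        by (simp add: bS scaleR_diff_left sum_subtractf scaleR_sum_right)
      also have "(\<Sum>i\<le>p. b' i y1 *\<^sub>R v' i) = y1" by (rule y1c(1)[symmetric])
      finally show ?thesis by (simp add: algebra_simps)
    qed
    have 2: "(\<Sum>i\<le>Suc p. b i z) = (\<Sum>i\<le>p. b' i ?z)"
    proof -
      have "(\<Sum>i\<le>Suc p. b i z) = f z + (\<Sum>i\<le>p. b (Suc i) z)"
        by (simp add: sum.atMost_Suc_shift b0 del: sum.atMost_Suc)
      also have "(\<Sum>i\<le>p. b (Suc i) z) = (\<Sum>i\<le>p. b' i ?z) - f z * (\<Sum>i\<le>p. b' i y1)"
        by (simp add: bS sum_subtractf sum_distrib_left)
      finally show ?thesis by (simp add: y1c(2))
    qed
    have "z = f z *\<^sub>R (w - y1) + (\<Sum>i\<le>p. b' i ?z *\<^sub>R v' i) \<longleftrightarrow> ?z = (\<Sum>i\<le>p. b' i ?z *\<^sub>R v' i)"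
      by (auto simp: algebra_simps)
    then show ?thesis unfolding bsp_def mem_Collect_eq 1 2 by blast
  qed
  show thesis
  proof (rule that[OF bary b0])
    show "bsp (Suc p) (case_nat w v') b = {z. z - f z *\<^sub>R (w - y1) \<in> bsp p v' b'}" using bsp by blast
    show "b (Suc i) z = b' i z" if "i \<le> p" "f z = 0" for i z using that by (simp add: bS)
    show "b (Suc i) (y1 + t *\<^sub>R (w - y1)) = (1 - t) * b' i y1" if "i \<le> p" for i t
    proof -
      have "f (y1 + t *\<^sub>R (w - y1)) = t" using affine_form_line[OF f(1), of y1 t w] by (simp add: fy1 f(3))
      then show ?thesis by (simp add: bS algebra_simps)
    qed
  qed
qed

section \<open>Real and imaginary parts\<close>

definition re_vec :: "complex ^ 'n \<Rightarrow> real ^ 'n" where "re_vec z = (\<chi> j. Re (z $ j))"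
definition im_vec :: "complex ^ 'n \<Rightarrow> real ^ 'n" where "im_vec z = (\<chi> j. Im (z $ j))"

lemma cvec_simps [simp]: "re_vec (cvec x v) = x" "im_vec (cvec x v) = v" "cvec (re_vec z) (im_vec z) = z"
  by (simp_all add: re_vec_def im_vec_def cvec_def vec_eq_iff)

lemma cvec_eq_iff: "cvec x v = cvec x' v' \<longleftrightarrow> x = x' \<and> v = v'"
  by (metis cvec_simps(1,2))

lemma linear_re_vec: "linear re_vec" and linear_im_vec: "linear im_vec"
  by (auto intro!: linearI simp: re_vec_def im_vec_def vec_eq_iff)

lemma cvec_lincomb:
  "cvec (x + x') (v + v') = cvec x v + cvec x' v'" "cvec (c *\<^sub>R x) (c *\<^sub>R v) = c *\<^sub>R cvec x v"
  "cvec (x - x') (v - v') = cvec x v - cvec x' v'" "cvec 0 0 = 0"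
  by (simp_all add: cvec_def vec_eq_iff complex_eq_iff)

lemma re_im_simps [simp]:
  "re_vec (z + w) = re_vec z + re_vec w" "im_vec (z + w) = im_vec z + im_vec w"
  "re_vec (z - w) = re_vec z - re_vec w" "im_vec (z - w) = im_vec z - im_vec w"
  "re_vec (c *\<^sub>R z) = c *\<^sub>R re_vec z" "im_vec (c *\<^sub>R z) = c *\<^sub>R im_vec z"
  "re_vec 0 = 0" "im_vec 0 = 0" by (simp_all add: re_vec_def im_vec_def vec_eq_iff)

lemma continuous_re_vec: "continuous_on S re_vec" and continuous_im_vec: "continuous_on S im_vec"
  by (auto intro!: linear_continuous_on simp: linear_conv_bounded_linear[symmetric] linear_re_vec linear_im_vec)

lemma complex_vec_eqI: "re_vec z = re_vec w \<Longrightarrow> im_vec z = im_vec w \<Longrightarrow> z = w"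
  by (metis cvec_simps(3))

definition imsub :: "(real ^ 'n) set \<Rightarrow> (complex ^ 'n) set" where
  "imsub V = {z. im_vec z \<in> V}"

lemma subspace_imsub: "subspace V \<Longrightarrow> subspace (imsub V)"
  by (auto simp: subspace_def imsub_def)

lemma dim_imsub:
  fixes V :: "(real ^ 'n) set"
  assumes "subspace V" shows "dim (imsub V) = CARD('n) + dim V"
proof -
  let ?f = "\<lambda>p. cvec (fst p) (snd p :: real ^ 'n)"
  have lin: "linear ?f" by (intro linearI) (simp_all add: cvec_lincomb)
  have inj: "inj_on ?f (span (UNIV \<times> V))" by (rule inj_onI) (auto simp: cvec_eq_iff prod_eq_iff)
  have "imsub V = ?f ` (UNIV \<times> V)" by (auto simp: imsub_def image_iff) (metis cvec_simps(3))
  then have "dim (imsub V) = dim ((UNIV :: (real ^ 'n) set) \<times> V)"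
    using dim_image_eq[OF lin inj] by simp
  also have "\<dots> = dim (UNIV :: (real ^ 'n) set) + dim V" by (rule dim_Times[OF subspace_UNIV assms])
  finally show ?thesis by simp
qed

section \<open>Sign conditions of an arrangement\<close>

locale arrangement =
  fixes A :: "(real ^ 'n) set set" and a :: "(real ^ 'n) set \<Rightarrow> real ^ 'n" and b :: "(real ^ 'n) set \<Rightarrow> real"
  assumes finA: "finite A" and a0: "\<And>H. H \<in> A \<Longrightarrow> a H \<noteq> 0" and Heq: "\<And>H. H \<in> A \<Longrightarrow> H = {x. a H \<bullet> x = b H}"
begin

definition val :: "(real ^ 'n) set \<Rightarrow> real ^ 'n \<Rightarrow> real" where "val H x = a H \<bullet> x - b H"
definition dir :: "(real ^ 'n) set \<Rightarrow> real ^ 'n \<Rightarrow> real" where "dir H v = a H \<bullet> v"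

lemma dir_simps [simp]: "dir H (v + w) = dir H v + dir H w" "dir H (v - w) = dir H v - dir H w" "dir H (c *\<^sub>R v) = c * dir H v"
  "dir H 0 = 0" "dir H (- v) = - dir H v"
  by (simp_all add: dir_def inner_add_right inner_diff_right)

lemma val_add: "val H (x + v) = val H x + dir H v"
  by (simp add: dir_def val_def inner_add_right)

lemma val_diff: "val H x - val H y = dir H (x - y)"
  by (simp add: dir_def val_def inner_diff_right)

lemma mem_H: "H \<in> A \<Longrightarrow> x \<in> H \<longleftrightarrow> val H x = 0"
  using Heq[of H] by (auto simp: val_def)

lemma cont_dir: "continuous_on S f \<Longrightarrow> continuous_on S (\<lambda>x. dir H (f x))"
  and cont_val: "continuous_on S f \<Longrightarrow> continuous_on S (\<lambda>x. val H (f x))"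
  unfolding dir_def val_def by (intro continuous_intros; assumption)+

lemma H_point: assumes "H \<in> A" obtains x where "x \<in> H" "x = (b H / (a H \<bullet> a H)) *\<^sub>R a H"
  using Heq[OF assms] a0[OF assms] by fastforce

lemma mem_direction_H: assumes "H \<in> A" shows "v \<in> direction H \<longleftrightarrow> dir H v = 0"
proof
  assume "v \<in> direction H"
  then obtain x y where "v = x - y" "x \<in> H" "y \<in> H" by (auto simp: direction_def)
  then show "dir H v = 0" using mem_H[OF assms] val_diff[of H x y] by simp
next
  assume "dir H v = 0"
  obtain x where x: "x \<in> H" using H_point[OF assms] .
  have "x + v \<in> H" using x \<open>dir H v = 0\<close> by (simp add: mem_H[OF assms] val_add)
  then show "v \<in> direction H" unfolding direction_def using x by (intro CollectI exI[of _ "x + v"] exI[of _ x]) simp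
qed

abbreviation M :: "(complex ^ 'n) set" where "M \<equiv> arr_complement A"

lemma mem_M: "z \<in> M \<longleftrightarrow> (\<forall>H\<in>A. dir H (im_vec z) = 0 \<longrightarrow> val H (re_vec z) \<noteq> 0)"
proof -
  have "z \<in> complexification H \<longleftrightarrow> val H (re_vec z) = 0 \<and> dir H (im_vec z) = 0" if "H \<in> A" for H
  proof
    assume "z \<in> complexification H"
    then show "val H (re_vec z) = 0 \<and> dir H (im_vec z) = 0"
      using mem_H[OF that] mem_direction_H[OF that] by (auto simp: complexification_def)
  next
    assume "val H (re_vec z) = 0 \<and> dir H (im_vec z) = 0"
    then have "z = cvec (re_vec z) (im_vec z) \<and> re_vec z \<in> H \<and> im_vec z \<in> direction H"
      using mem_H[OF that] mem_direction_H[OF that] by simp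
    then show "z \<in> complexification H" unfolding complexification_def by blast
  qed
  then show ?thesis by (auto simp: arr_complement_def)
qed

lemma open_M: "open M"
proof -
  have "M = (\<Inter>H\<in>A. - {z. dir H (im_vec z) = 0} \<union> - {z. val H (re_vec z) = 0})"
    using mem_M by blast
  moreover have op: "open (- {z. dir H (im_vec z) = 0} \<union> - {z. val H (re_vec z) = 0})" for H
    by (intro open_Un open_Compl closed_Collect_eq cont_dir cont_val continuous_re_vec continuous_im_vec continuous_on_const)
  ultimately show ?thesis using open_INT[OF finA, of "\<lambda>H. - {z. dir H (im_vec z) = 0} \<union> - {z. val H (re_vec z) = 0}"] op by simp
qed

lemma perturb:
  obtains t0 where "t0 > 0" "\<And>t H. \<bar>t\<bar> < t0 \<Longrightarrow> H \<in> A \<Longrightarrow> dir H v \<noteq> 0 \<Longrightarrow> sgn (dir H (v + t *\<^sub>R u)) = sgn (dir H v)"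
proof -
  have "\<forall>\<^sub>F t in nhds (0::real). \<forall>H\<in>A. dir H v \<noteq> 0 \<longrightarrow> sgn (dir H (v + t *\<^sub>R u)) = sgn (dir H v)"
  proof (intro eventually_ball_finite finA ballI)
    fix H assume "H \<in> A"
    have lim: "((\<lambda>t. dir H v + t * dir H u) \<longlongrightarrow> dir H v + 0 * dir H u) (nhds 0)"
      by (intro tendsto_intros filterlim_ident)
    show "\<forall>\<^sub>F t in nhds 0. dir H v \<noteq> 0 \<longrightarrow> sgn (dir H (v + t *\<^sub>R u)) = sgn (dir H v)"
    proof (cases "dir H v" "0::real" rule: linorder_cases)
      case less
      then have "\<forall>\<^sub>F t in nhds 0. dir H v + t * dir H u < 0" using order_tendstoD(2)[OF lim] by simp
      then show ?thesis by eventually_elim (use less in simp)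
    next
      case greater
      then have "\<forall>\<^sub>F t in nhds 0. dir H v + t * dir H u > 0" using order_tendstoD(1)[OF lim] by simp
      then show ?thesis by eventually_elim (use greater in simp)
    qed simp
  qed
  then obtain t0 where "t0 > 0" "\<forall>t. dist t 0 < t0 \<longrightarrow> (\<forall>H\<in>A. dir H v \<noteq> 0 \<longrightarrow> sgn (dir H (v + t *\<^sub>R u)) = sgn (dir H v))"
    unfolding eventually_nhds_metric by blast
  then show thesis using that[of t0] by (simp add: dist_norm)
qed

text \<open>The direction space of the cone \<open>vcone V J s\<close>: a nonempty cone is
  relatively open in this subspace.\<close>

definition vsub :: "(real ^ 'n) set \<Rightarrow> (real ^ 'n) set set \<Rightarrow> ((real ^ 'n) set \<Rightarrow> real) \<Rightarrow> (real ^ 'n) set" where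
  "vsub V J s = {u \<in> V. \<forall>H\<in>J. s H = 0 \<longrightarrow> dir H u = 0}"

definition vcone :: "(real ^ 'n) set \<Rightarrow> (real ^ 'n) set set \<Rightarrow> ((real ^ 'n) set \<Rightarrow> real) \<Rightarrow> (real ^ 'n) set" where
  "vcone V J s = {u \<in> V. \<forall>H\<in>J. sgn (dir H u) = s H}"

definition vgen :: "(real ^ 'n) set \<Rightarrow> real ^ 'n \<Rightarrow> bool" where
  "vgen L v \<longleftrightarrow> (\<forall>H\<in>A. dir H v = 0 \<longrightarrow> (\<forall>u\<in>L. dir H u = 0))"

text \<open>Part of the set \<open>S(C)\<close> with base point \<open>p\<close> and \<open>\<tau>(X\<^sub>C) = V\<close>: the imaginary part is
  restricted to a cone cut out by sign conditions.\<close>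

definition wset :: "(real ^ 'n) set \<Rightarrow> (real ^ 'n) set set \<Rightarrow> ((real ^ 'n) set \<Rightarrow> real) \<Rightarrow> real ^ 'n \<Rightarrow> (complex ^ 'n) set" where
  "wset V J s p = {z. im_vec z \<in> vcone V J s \<and> (\<forall>H\<in>A. dir H (im_vec z) = 0 \<longrightarrow> val H (re_vec z) * val H p > 0)}"

lemma wset_M: "wset V J s p \<subseteq> M" by (force simp: wset_def mem_M)

lemma subspace_vsub: "subspace V \<Longrightarrow> subspace (vsub V J s)"
  by (auto simp: subspace_def vsub_def)

lemma vcone_vsub: "vcone V J s \<subseteq> vsub V J s"
proof
  fix u assume u: "u \<in> vcone V J s"
  have "dir H u = 0" if "H \<in> J" "s H = 0" for H
  proof -
    have "sgn (dir H u) = 0" using u that by (simp add: vcone_def)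
    then show ?thesis by (simp only: sgn_eq_0_iff)
  qed
  then show "u \<in> vsub V J s" using u by (simp add: vcone_def vsub_def)
qed

lemma vcone_perturb:
  assumes V: "subspace V" and J: "J \<subseteq> A" and v: "v \<in> vcone V J s" and u: "u \<in> vsub V J s"
  obtains t0 where "t0 > 0" "\<And>t. \<bar>t\<bar> < t0 \<Longrightarrow> v + t *\<^sub>R u \<in> vcone V J s"
    "\<And>t H. \<bar>t\<bar> < t0 \<Longrightarrow> H \<in> A \<Longrightarrow> dir H v \<noteq> 0 \<Longrightarrow> sgn (dir H (v + t *\<^sub>R u)) = sgn (dir H v)"
proof -
  obtain t0 where t0: "t0 > 0" "\<And>t H. \<bar>t\<bar> < t0 \<Longrightarrow> H \<in> A \<Longrightarrow> dir H v \<noteq> 0 \<Longrightarrow> sgn (dir H (v + t *\<^sub>R u)) = sgn (dir H v)"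
    by (rule perturb[of v u]) (rule that; assumption)
  have "v + t *\<^sub>R u \<in> vcone V J s" if t: "\<bar>t\<bar> < t0" for t unfolding vcone_def
  proof (intro CollectI conjI ballI)
    show "v + t *\<^sub>R u \<in> V" using v u V by (auto simp: vcone_def vsub_def subspace_def)
    fix H assume H: "H \<in> J"
    show "sgn (dir H (v + t *\<^sub>R u)) = s H"
    proof (cases "dir H v = 0")
      case True
      then have "s H = 0" using v H by (auto simp: vcone_def)
      then show ?thesis using u H True by (simp add: vsub_def)
    next
      case False
      then show ?thesis using t0(2)[OF t _ False] H J v by (auto simp: vcone_def)
    qed
  qed
  with t0 show thesis by (intro that[of t0])
qed

text \<open>Perturbation one hyperplane at a time: on a hyperplane direction that does not contain
  the whole subspace, a short move along a vector leaving it stays in the cone and keeps all signs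
  that are already nonzero.\<close>

lemma vgen_exists:
  assumes V: "subspace V" and J: "J \<subseteq> A" and v: "v \<in> vcone V J s"
  obtains v' where "v' \<in> vcone V J s" "vgen (vsub V J s) v'"
proof -
  have "\<exists>v' \<in> vcone V J s. \<forall>H\<in>F. dir H v' = 0 \<longrightarrow> (\<forall>u\<in>vsub V J s. dir H u = 0)" if "finite F" "F \<subseteq> A" for F
    using that
  proof (induction F rule: finite_induct)
    case empty then show ?case using v by blast
  next
    case (insert H F)
    then obtain w where w: "w \<in> vcone V J s" "\<forall>H\<in>F. dir H w = 0 \<longrightarrow> (\<forall>u\<in>vsub V J s. dir H u = 0)" by auto
    show ?case
    proof (cases "dir H w = 0 \<and> (\<exists>u\<in>vsub V J s. dir H u \<noteq> 0)")
      case False then show ?thesis using w by (intro bexI[of _ w]) auto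
    next
      case True
      then obtain u where u: "u \<in> vsub V J s" "dir H u \<noteq> 0" by blast
      obtain t0 where t0: "t0 > 0" "\<And>t. \<bar>t\<bar> < t0 \<Longrightarrow> w + t *\<^sub>R u \<in> vcone V J s"
          "\<And>t H. \<bar>t\<bar> < t0 \<Longrightarrow> H \<in> A \<Longrightarrow> dir H w \<noteq> 0 \<Longrightarrow> sgn (dir H (w + t *\<^sub>R u)) = sgn (dir H w)"
        by (rule vcone_perturb[OF V J w(1) u(1)]) (rule that; assumption)
      define w' where "w' = w + (t0 / 2) *\<^sub>R u"
      have t: "\<bar>t0 / 2\<bar> < t0" using t0(1) by simp
      have "w' \<in> vcone V J s" unfolding w'_def by (rule t0(2)[OF t])
      moreover have "\<forall>u\<in>vsub V J s. dir G u = 0" if G: "G \<in> insert H F" "dir G w' = 0" for G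
      proof (cases "G = H")
        case True2: True
        have "dir H w' = (t0 / 2) * dir H u" using True by (simp add: w'_def)
        then show ?thesis using G True2 u t0(1) by simp
      next
        case False
        then have GF: "G \<in> F" "G \<in> A" using G insert.prems by auto
        have "dir G w = 0"
        proof (rule ccontr)
          assume "dir G w \<noteq> 0"
          from t0(3)[OF t GF(2) this] have "sgn (dir G w') = sgn (dir G w)" by (simp add: w'_def)
          then show False using G(2) \<open>dir G w \<noteq> 0\<close> by (simp add: sgn_eq_0_iff)
        qed
        then show ?thesis using w(2) GF by blast
      qed
      ultimately show ?thesis by blast
    qed
  qed
  from this[OF finA subset_refl] show thesis using that by (auto simp: vgen_def)
qed

end

context arrangement
begin

text \<open>With every sign prescribed, it is fixed which hyperplane directions contain the
  imaginary part. The conditions become affine inequalities on the real and the imaginary part, and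
  the set is a convex cell.\<close>

lemma wset_ncell_base:
  assumes V: "subspace V" and p: "\<And>H. H \<in> A \<Longrightarrow> val H p \<noteq> 0" and v: "v \<in> vcone V A s"
    and Q: "closedin (top_of_set M) Q" "Q \<inter> wset V A s p = {}" "closedin (top_of_set M) (Q \<union> wset V A s p)"
  shows "ncell M (Q \<union> wset V A s p) Q (CARD('n) + dim (vsub V A s)) (cvec p v)"
proof -
  \<comment> \<open>A hyperplane with nonzero sign restricts the imaginary part, one with sign 0
    restricts the real part.\<close>
  define g where "g H z = (if s H \<noteq> 0 then s H * dir H (im_vec z) else val H (re_vec z) * val H p)" for H and z :: "complex ^ 'n"
  let ?L = "imsub (vsub V A s)" and ?y = "cvec p v"
  have vv: "v \<in> vsub V A s" using v vcone_vsub by blast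
  have sv: "sgn (dir H v) = s H" if "H \<in> A" for H using v that by (simp add: vcone_def)
  have S: "wset V A s p = {z. z - ?y \<in> ?L \<and> (\<forall>H\<in>A. g H z > 0)}"
  proof (intro equalityI subsetI)
    fix z assume z: "z \<in> wset V A s p"
    then have zc: "im_vec z \<in> vcone V A s" by (simp add: wset_def)
    have "im_vec z - v \<in> vsub V A s"
      using zc vcone_vsub vv subspace_vsub[OF V] subspace_diff by blast
    moreover have "g H z > 0" if H: "H \<in> A" for H
    proof (cases "s H = 0")
      case True
      have "sgn (dir H (im_vec z)) = 0" using zc H True by (simp add: vcone_def)
      then have "dir H (im_vec z) = 0" by (simp only: sgn_eq_0_iff)
      then show ?thesis using z H True by (simp add: wset_def g_def)
    next
      case False
      have e: "sgn (dir H (im_vec z)) = s H" using zc H by (simp add: vcone_def)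
      then have "dir H (im_vec z) \<noteq> 0" using False by auto
      then have "sgn (dir H (im_vec z)) * dir H (im_vec z) > 0" by (simp add: sgn_if)
      then show ?thesis using e False by (simp add: g_def)
    qed
    ultimately show "z \<in> {z. z - ?y \<in> ?L \<and> (\<forall>H\<in>A. g H z > 0)}" by (simp add: imsub_def)
  next
    fix z assume "z \<in> {z. z - ?y \<in> ?L \<and> (\<forall>H\<in>A. g H z > 0)}"
    then have d: "im_vec z - v \<in> vsub V A s" and g: "\<And>H. H \<in> A \<Longrightarrow> g H z > 0" by (auto simp: imsub_def)
    have "(im_vec z - v) + v \<in> vsub V A s" by (rule subspace_add[OF subspace_vsub[OF V] d vv])
    then have zs: "im_vec z \<in> vsub V A s" by simp
    have sg: "sgn (dir H (im_vec z)) = s H" if H: "H \<in> A" for H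
    proof (cases "s H = 0")
      case True
      then show ?thesis using zs H by (simp add: vsub_def)
    next
      case False
      then have "s H * dir H (im_vec z) > 0" using g[OF H] by (simp add: g_def)
      moreover have "s H = 1 \<or> s H = -1" using sv[OF H] False by (auto simp: sgn_if split: if_splits)
      ultimately show ?thesis by auto
    qed
    have "val H (re_vec z) * val H p > 0" if H: "H \<in> A" "dir H (im_vec z) = 0" for H
      using g[OF H(1)] sg[OF H(1)] H(2) by (simp add: g_def)
    then show "z \<in> wset V A s p" using zs sg by (simp add: wset_def vcone_def vsub_def)
  qed
  have L: "subspace ?L" by (rule subspace_imsub[OF subspace_vsub[OF V]])
  interpret convex_cell M Q ?L ?y A g "wset V A s p" "{z \<in> M. z - ?y \<in> ?L \<and> (\<forall>H\<in>A. g H z \<ge> 0)}" "Q \<union> wset V A s p"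
  proof
    show "affine_form (g H)" for H
    proof (cases "s H = 0")
      case True
      have "linear (\<lambda>z :: complex ^ 'n. a H \<bullet> re_vec z)" by (intro linearI) (simp_all add: inner_add_right)
      from affine_form_linear[OF this, of 0] have "affine_form (\<lambda>z. val H p * (a H \<bullet> re_vec z + - b H))"
        by (intro affine_form_intros) simp
      then show ?thesis using True by (simp add: g_def[abs_def] val_def mult.commute)
    next
      case False
      have "linear (\<lambda>z :: complex ^ 'n. dir H (im_vec z))" by (intro linearI) simp_all
      from affine_form_cmul[OF affine_form_linear[OF this, of 0]] show ?thesis using False by (simp add: g_def[abs_def])
    qed
    show "?y \<in> wset V A s p" using v p by (simp add: wset_def not_sum_squares_lt_zero) (metis not_real_square_gt_zero)
    show "open M" "finite A" "subspace ?L" by (rule open_M finA L)+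
    show "wset V A s p = {z. z - ?y \<in> ?L \<and> (\<forall>H\<in>A. g H z > 0)}" by (rule S)
    show "wset V A s p \<subseteq> M" by (rule wset_M)
    show "closedin (top_of_set M) Q" "Q \<inter> wset V A s p = {}" "closedin (top_of_set M) (Q \<union> wset V A s p)" by (rule Q)+
  qed (rule refl)+
  show ?thesis using ncell dim_imsub[OF subspace_vsub[OF V], of A s] by simp
qed

lemma wset_insert:
  assumes "H \<notin> J"
  shows "wset V (insert H J) (s(H := e)) p = {z \<in> wset V J s p. sgn (dir H (im_vec z)) = e}"
  using assms by (auto simp: wset_def vcone_def)

lemma vcone_insert:
  assumes "H \<notin> J"
  shows "vcone V (insert H J) (s(H := e)) = {u \<in> vcone V J s. sgn (dir H u) = e}"
  using assms by (auto simp: vcone_def)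

lemma vsub_insert:
  assumes "H \<notin> J"
  shows "vsub V (insert H J) (s(H := e)) = (if e = 0 then {u \<in> vsub V J s. dir H u = 0} else vsub V J s)"
  using assms by (auto simp: vsub_def)

lemma vcone_convex:
  assumes V: "subspace V" and u: "u \<in> vcone V J s" and w: "w \<in> vcone V J s" and t: "0 < t" "t < 1"
  shows "(1 - t) *\<^sub>R u + t *\<^sub>R w \<in> vcone V J s"
proof -
  have "sgn ((1 - t) * x + t * z) = r" if "sgn x = r" "sgn z = r" for x z r :: real
  proof -
    consider "x > 0" "z > 0" | "x = 0" "z = 0" | "x < 0" "z < 0" 
      by (cases x "0 :: real" rule: linorder_cases; cases z "0 :: real" rule: linorder_cases)
        (use \<open>sgn x = r\<close> \<open>sgn z = r\<close> in auto)
    then show ?thesis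
    proof cases
      case 1
      then have "(1 - t) * x + t * z > 0" using t by (intro add_pos_pos) auto
      then show ?thesis using that 1 by simp
    next
      case 3
      then have "(1 - t) * x + t * z < 0" using t by (intro add_neg_neg) (auto simp: mult_pos_neg)
      then show ?thesis using that 3 by simp
    qed (use that in auto)
  qed
  then show ?thesis using u w V by (auto simp: vcone_def subspace_def)
qed

text \<open>Near the facet point with real part \<open>p\<close> all real conditions hold by
  continuity. There the half and its facet look like a half space and its boundary, so by
  \<open>boundary_lgen\<close> the boundary of the generator of the half generates the facet, and
  the two cells cancel.\<close>

lemma wset_half:
  assumes J: "J \<subseteq> A" "H \<in> A" "H \<notin> J" and V: "subspace V" and p: "\<And>H. H \<in> A \<Longrightarrow> val H p \<noteq> 0"
    and Q: "closedin (top_of_set M) Q" "Q \<inter> wset V J s p = {}"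
    and e: "e = 1 \<or> e = -1"
    and v1: "v1 \<in> vcone V J s" "dir H v1 = 0" and w: "w \<in> vsub V J s" "sgn (dir H w) = e"
    and t0: "t0 > 0" "\<And>t. 0 < t \<Longrightarrow> t < t0 \<Longrightarrow> v1 + t *\<^sub>R w \<in> vcone V J s"
    and c2: "\<And>t. 0 < t \<Longrightarrow> t < t0 \<Longrightarrow> ncell M (Q \<union> wset V (insert H J) (s(H := 0)) p \<union> wset V (insert H J) (s(H := e)) p)
        (Q \<union> wset V (insert H J) (s(H := 0)) p) (Suc (CARD('n) + dim {u \<in> vsub V J s. dir H u = 0})) (cvec p (v1 + t *\<^sub>R w))"
    and c1: "ncell M (Q \<union> wset V (insert H J) (s(H := 0)) p) Q (CARD('n) + dim {u \<in> vsub V J s. dir H u = 0}) (cvec p v1)"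
    and k: "relc M k (Q \<union> wset V (insert H J) (s(H := 0)) p \<union> wset V (insert H J) (s(H := e)) p) Q x"
  shows "triv M k (Q \<union> wset V (insert H J) (s(H := 0)) p \<union> wset V (insert H J) (s(H := e)) p) Q x"
proof -
  let ?W0 = "wset V (insert H J) (s(H := 0)) p" and ?W1 = "wset V (insert H J) (s(H := e)) p"
  let ?P1 = "Q \<union> ?W0" and ?P = "Q \<union> ?W0 \<union> ?W1"
  let ?VJ = "vsub V J s" and ?V0 = "{u \<in> vsub V J s. dir H u = 0}"
  let ?p = "CARD('n) + dim ?V0"
  define y1 where "y1 = cvec p v1"
  have sVJ: "subspace ?VJ" by (rule subspace_vsub[OF V])
  have sV0: "subspace ?V0" using sVJ by (auto simp: subspace_def)
  have v1s: "v1 \<in> ?VJ" using v1 vcone_vsub by blast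
  have dirw: "e * dir H w > 0" "dir H w \<noteq> 0" using w(2) e by (auto simp: sgn_if split: if_splits)
  \<comment> \<open>A neighbourhood on which all strict conditions hold, including the real ones for
    every hyperplane of \<open>A\<close>; this is possible since \<open>y1\<close> has real part
    \<open>p\<close>. Inside a ball in it, membership in the cell only means that the imaginary part
    lies in \<open>?VJ\<close>.\<close>
  define U0 where "U0 = (M - Q) \<inter> (\<Inter>G\<in>A. {z. 0 < val G (re_vec z) * val G p}) \<inter> (\<Inter>G\<in>{G\<in>J. s G \<noteq> 0}. {z. 0 < s G * dir G (im_vec z)})"
  have "open U0" unfolding U0_def
  proof (intro open_Int open_INT ballI)
    obtain T where T: "closed T" "Q = M \<inter> T" using Q(1) by (auto simp: closedin_closed)
    have "M - Q = M \<inter> - T" using T(2) by auto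
    then show "open (M - Q)" using open_M T(1) by (simp add: open_Int open_Compl)
    show "finite A" by (rule finA)
    show "finite {G \<in> J. s G \<noteq> 0}" by (rule finite_subset[OF _ finA]) (use J(1) in auto)
    show "open {z. 0 < val G (re_vec z) * val G p}" for G
      by (intro open_Collect_less continuous_on_const continuous_on_mult cont_val continuous_re_vec)
    show "open {z. 0 < s G * dir G (im_vec z)}" for G
      by (intro open_Collect_less continuous_on_const continuous_on_mult cont_dir continuous_im_vec)
  qed
  moreover have "y1 \<in> U0"
  proof -
    have "y1 \<in> wset V J s p" using v1 p by (auto simp: wset_def y1_def zero_less_mult_iff not_less linorder_neq_iff)
    then have "y1 \<in> M - Q" using wset_M[of V J s p] Q(2) by auto
    moreover have "val G p * val G p > 0" if "G \<in> A" for G using p[OF that] by (auto simp: zero_less_mult_iff linorder_neq_iff)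
    moreover have "s G * dir G v1 > 0" if "G \<in> J" "s G \<noteq> 0" for G
    proof -
      have sG: "s G = sgn (dir G v1)" using v1(1) that by (simp add: vcone_def)
      show ?thesis using that(2) unfolding sG by (auto simp: sgn_if split: if_splits)
    qed
    ultimately show ?thesis by (simp add: U0_def y1_def)
  qed
  ultimately obtain r where r: "r > 0" "ball y1 r \<subseteq> U0" using open_contains_ball by blast
  have Uin: "z \<in> wset V J s p \<longleftrightarrow> im_vec z \<in> ?VJ" if "z \<in> ball y1 r" for z
  proof
    assume "z \<in> wset V J s p"
    then show "im_vec z \<in> ?VJ" using vcone_vsub by (auto simp: wset_def)
  next
    assume z: "im_vec z \<in> ?VJ"
    have zU: "z \<in> U0" using r(2) that by blast
    have "sgn (dir G (im_vec z)) = s G" if G: "G \<in> J" for G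
    proof (cases "s G = 0")
      case True then show ?thesis using z G by (simp add: vsub_def)
    next
      case False
      then have "s G * dir G (im_vec z) > 0" using zU G by (auto simp: U0_def)
      moreover have "sgn (dir G v1) = s G" using v1(1) G by (simp add: vcone_def)
      ultimately show ?thesis by (auto simp: sgn_if zero_less_mult_iff split: if_splits)
    qed
    moreover have "val G (re_vec z) * val G p > 0" if "G \<in> A" for G using zU that by (simp add: U0_def)
    ultimately show "z \<in> wset V J s p" using z by (auto simp: wset_def vcone_def vsub_def)
  qed
  have UQ: "z \<notin> Q" if "z \<in> ball y1 r" for z using r(2) that by (auto simp: U0_def)
  obtain B where B: "independent B" "span B = imsub ?V0" "card B = dim (imsub ?V0)"
  proof -
    obtain B where B: "B \<subseteq> imsub ?V0" "independent B" "imsub ?V0 \<subseteq> span B" "card B = dim (imsub ?V0)"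
      by (rule basis_exists)
    show thesis by (rule that[OF B(2) span_subspace[OF B(1,3) subspace_imsub[OF sV0]] B(4)])
  qed
  obtain bs where bs: "set bs = B" "distinct bs"
    using finite_distinct_list[OF independent_imp_finite[OF B(1)]] by auto
  have len: "length bs = ?p" using bs B(3) distinct_card[OF bs(2)] dim_imsub[OF sV0] by simp
  have spanbs: "span (set bs) = imsub ?V0" using bs B(2) by simp
  obtain eps0 where e0: "eps0 > 0" "\<And>eps. 0 < eps \<Longrightarrow> eps < eps0 \<Longrightarrow>
     local_orientation_simplex bs y1 eps ` standard_simplex (length bs) \<subseteq> ball y1 r"
    by (rule local_orientation_simplex_small[OF r(1)]) (rule that; assumption)
  define eps where "eps = eps0 / 2"
  have eps: "eps > 0" "local_orientation_simplex bs y1 eps ` standard_simplex (length bs) \<subseteq> ball y1 r"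
    using e0 by (auto simp: eps_def)
  define v' where "v' = oriented_vertex bs y1 eps"
  obtain b' where b': "bary ?p v' b'" "bsp ?p v' b' = {z. z - y1 \<in> imsub ?V0}" "\<And>i. i \<le> ?p \<Longrightarrow> b' i y1 > 0"
  proof -
    have ind: "independent (set bs)" using bs B by simp
    show thesis
      by (rule oriented_vertex_bary[OF ind bs(2) eps(1), of y1]) (use that in \<open>simp add: len v'_def spanbs\<close>)
  qed
  have v'_ball: "v' i \<in> ball y1 r" and v'_E: "v' i \<in> bsp ?p v' b'" if "i \<le> ?p" for i
  proof -
    have "v' i = (\<Sum>j\<le>?p. (if j = i then 1 else 0) *\<^sub>R v' j)"
      using that by (simp add: if_distrib[of "\<lambda>c. c *\<^sub>R _"] cong: if_cong)
    moreover have "(\<lambda>j. if j = i then 1 else 0) \<in> standard_simplex ?p" using that by simp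
    ultimately have im: "v' i \<in> asx ?p v' ` standard_simplex ?p" 
      unfolding asx_image mem_Collect_eq by (intro exI conjI)
    then show "v' i \<in> bsp ?p v' b'" by (rule asx_weights(1)[OF b'(1)])
    show "v' i \<in> ball y1 r" using eps(2) im unfolding local_orientation_simplex_asx len v'_def by blast
  qed
  \<comment> \<open>The first bound makes \<open>c2\<close> applicable to the point \<open>y\<close>
    at height \<open>\<eta>\<close>; the second keeps the apex \<open>top\<close> at height
    \<open>2 * \<eta>\<close> inside the ball.\<close>
  define \<eta> where "\<eta> = min (t0 / 2) (r / (4 * (norm (cvec 0 w) + 1)))"
  have nw: "norm (cvec 0 w) + 1 > 0" by (simp add: add_nonneg_pos)
  have \<eta>: "\<eta> > 0" "\<eta> < t0" using t0(1) r(1) nw by (auto simp: \<eta>_def)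
  define d where "d = cvec 0 ((2 * \<eta>) *\<^sub>R w)"
  define top where "top = y1 + d"
  have d_eq: "d = (2 * \<eta>) *\<^sub>R cvec 0 w" using cvec_lincomb(2)[of "2 * \<eta>" 0 w] by (simp add: d_def)
  have top_ball: "top \<in> ball y1 r"
  proof -
    have "norm d = 2 * \<eta> * norm (cvec 0 w)" using \<eta>(1) by (simp add: d_eq)
    also have "\<dots> \<le> 2 * \<eta> * (norm (cvec 0 w) + 1)" using \<eta>(1) by simp
    also have "\<dots> \<le> 2 * (r / (4 * (norm (cvec 0 w) + 1))) * (norm (cvec 0 w) + 1)"
      using nw by (intro mult_right_mono mult_left_mono) (auto simp: \<eta>_def)
    also have "\<dots> = r / 2" using nw by (simp add: field_simps)
    also have "\<dots> < r" using r(1) by simp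
    finally show ?thesis by (simp add: top_def dist_norm)
  qed
  \<comment> \<open>Height above the facet, normalised to 1 at \<open>top\<close>; dividing by
    \<open>dir H w\<close> also absorbs the sign \<open>e\<close>.\<close>
  define f where "f z = dir H (im_vec z) / (2 * \<eta> * dir H w)" for z :: "complex ^ 'n"
  have f_aff: "affine_form f"
  proof -
    have "linear f" unfolding f_def by (intro linearI) (simp_all add: add_divide_distrib)
    then show ?thesis unfolding affine_form_def by (intro exI[of _ f] exI[of _ 0]) simp
  qed
  have f0: "f (v' i) = 0" if "i \<le> ?p" for i
  proof -
    have "v' i - y1 \<in> imsub ?V0" using v'_E[OF that] b'(2) by blast
    then have "dir H (im_vec (v' i) - v1) = 0" by (simp add: imsub_def y1_def)
    then show ?thesis using v1(2) by (simp add: f_def)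
  qed
  have f1: "f top = 1" using v1(2) \<eta>(1) dirw by (simp add: f_def top_def y1_def d_def)
  have y1E: "y1 \<in> bsp ?p v' b'" unfolding b'(2) using subspace_0[OF subspace_imsub[OF sV0]] by simp
  have td: "top - y1 = d" by (simp add: top_def)
  obtain b2 where b2: "bary (Suc ?p) (case_nat top v') b2" "b2 0 = f"
    "bsp (Suc ?p) (case_nat top v') b2 = {z. z - f z *\<^sub>R (top - y1) \<in> bsp ?p v' b'}"
    "\<And>i z. i \<le> ?p \<Longrightarrow> f z = 0 \<Longrightarrow> b2 (Suc i) z = b' i z"
    "\<And>i t. i \<le> ?p \<Longrightarrow> b2 (Suc i) (y1 + t *\<^sub>R (top - y1)) = (1 - t) * b' i y1"
    by (rule bary_cone[OF b'(1) f_aff f0 f1 y1E]) (assumption, (rule that; assumption))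
  have E: "bsp (Suc ?p) (case_nat top v') b2 = imsub ?VJ"
  proof -
    have "z - f z *\<^sub>R (top - y1) \<in> bsp ?p v' b' \<longleftrightarrow> z \<in> imsub ?VJ" for z
    proof -
      define c where "c = dir H (im_vec z) / dir H w"
      have c: "f z *\<^sub>R d = cvec 0 (c *\<^sub>R w)"
        using \<eta>(1) cvec_lincomb(2)[of c 0 w] by (simp add: f_def d_eq c_def)
      have "z - f z *\<^sub>R (top - y1) \<in> bsp ?p v' b' \<longleftrightarrow> im_vec z - c *\<^sub>R w - v1 \<in> ?V0"
        unfolding b'(2) td c by (simp add: imsub_def y1_def)
      also have "\<dots> \<longleftrightarrow> im_vec z - c *\<^sub>R w - v1 \<in> ?VJ" using dirw v1(2) by (auto simp: c_def)
      also have "\<dots> \<longleftrightarrow> im_vec z \<in> ?VJ"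
      proof
        have cw: "c *\<^sub>R w + v1 \<in> ?VJ" using sVJ w(1) v1s by (auto simp: subspace_def)
        { assume "im_vec z - c *\<^sub>R w - v1 \<in> ?VJ"
          from subspace_add[OF sVJ this cw] show "im_vec z \<in> ?VJ" by simp }
        { assume "im_vec z \<in> ?VJ"
          from subspace_diff[OF sVJ this cw] show "im_vec z - c *\<^sub>R w - v1 \<in> ?VJ" by (simp add: algebra_simps) }
      qed
      finally show ?thesis by (simp add: imsub_def)
    qed
    then show ?thesis unfolding b2(3) by blast
  qed
  have fpos: "0 \<le> f z \<longleftrightarrow> 0 \<le> e * dir H (im_vec z)" for z
    using dirw \<eta>(1) e unfolding f_def
    by (auto simp: zero_le_divide_iff mult_less_0_iff zero_less_mult_iff zero_le_mult_iff mult_le_0_iff)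
  have fzero: "f z = 0 \<longleftrightarrow> dir H (im_vec z) = 0" for z using dirw \<eta>(1) by (simp add: f_def)
  have P1_iff: "z \<in> ?P1 \<longleftrightarrow> z \<in> imsub ?VJ \<and> f z = 0" if "z \<in> ball y1 r" for z
    using UQ[OF that] Uin[OF that] unfolding wset_insert[OF J(3)] fzero by (auto simp: imsub_def sgn_eq_0_iff)
  have se: "sgn x = 0 \<or> sgn x = e \<longleftrightarrow> 0 \<le> e * x" for x :: real
    using e by (auto simp: sgn_if)
  have P_iff: "z \<in> ?P \<longleftrightarrow> z \<in> imsub ?VJ \<and> 0 \<le> f z" if "z \<in> ball y1 r" for z
    using UQ[OF that] Uin[OF that] se[of "dir H (im_vec z)"] unfolding wset_insert[OF J(3)] fpos
    by (auto simp: imsub_def)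
  \<comment> \<open>Halfway between the facet point \<open>y1\<close> and the apex, so all
    barycentric coordinates with respect to the cone are positive.\<close>
  define y where "y = y1 + (1 / 2) *\<^sub>R (top - y1)"
  have y_eq: "y = cvec p (v1 + \<eta> *\<^sub>R w)"
    unfolding y_def td unfolding d_def y1_def by (rule complex_vec_eqI) simp_all
  have PM: "?P \<subseteq> M" using closedin_imp_subset[OF Q(1)] by (intro Un_least wset_M)
  have C2: "ncell M ?P ?P1 (Suc ?p) y" unfolding y_eq by (rule c2[OF \<eta>])
  have C1: "ncell M ?P1 Q ?p y1" unfolding y1_def by (rule c1)
  obtain ee where ee: "relc M (Suc ?p) ?P ?P1 ee" "lgen M (Suc ?p) ?P y ee" using C2 unfolding ncell_def by (elim conjE exE)
  have fy: "f y = 1 / 2"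
  proof -
    have f0': "f y1 = 0" using v1(2) by (simp add: f_def y1_def)
    show ?thesis using affine_form_line[OF f_aff, of y1 "1/2" top] unfolding f1 f0' y_def by simp
  qed
  have g: "lgen M ?p ?P1 y1 (lf_boundary (Suc ?p) ee)"
  proof (rule boundary_lgen[OF b2(1) _ _ _ _ _ open_ball _ _ _ PM _ ee])
    show "y \<in> bsp (Suc ?p) (case_nat top v') b2"
      unfolding E y_eq using sVJ v1s w(1) by (auto simp: imsub_def subspace_def)
    show "0 < b2 i y" if "i \<le> Suc ?p" for i
    proof (cases i)
      case 0 then show ?thesis using b2(2) fy by simp
    next
      case (Suc j)
      then show ?thesis using b2(5)[of j "1/2"] b'(3)[of j] that by (simp add: y_def)
    qed
    show "y1 \<in> bsp (Suc ?p) (case_nat top v') b2" unfolding E using v1s by (simp add: imsub_def y1_def)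
    show "b2 0 y1 = 0" using b2(2) v1(2) by (simp add: f_def y1_def)
    then show "0 < b2 (Suc i) y1" if "i \<le> ?p" for i using b2(2,4) b'(3) that by simp
    show "asx (Suc ?p) (case_nat top v') ` standard_simplex (Suc ?p) \<subseteq> ball y1 r"
    proof (rule asx_in_convex)
      show "case_nat top v' i \<in> ball y1 r" if "i \<le> Suc ?p" for i
        using that top_ball v'_ball by (cases i) auto
    qed simp
    show "?P \<inter> ball y1 r = {z \<in> bsp (Suc ?p) (case_nat top v') b2. 0 \<le> b2 0 z} \<inter> ball y1 r"
      unfolding E b2(2) using P_iff by blast
    show "?P1 \<inter> ball y1 r = {z \<in> bsp (Suc ?p) (case_nat top v') b2. b2 0 z = 0} \<inter> ball y1 r"
      unfolding E b2(2) using P1_iff by blast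
  qed auto
  show ?thesis by (rule ncell_pair_trivial[OF C1 C2 PM ee g k])
qed

text \<open>Induction on the number of hyperplanes without prescribed sign. If \<open>H\<close> has
  constant sign on the cone, prescribing it changes nothing. Otherwise the cone splits into two open
  halves and a facet; the half away from \<open>v\<close> cancels with the facet, and the half
  containing \<open>v\<close> remains as the cell. Genericity of \<open>v\<close> ensures that it
  lies in an open half.\<close>

theorem wset_ncell:
  assumes V: "subspace V" and J: "J \<subseteq> A" and p: "\<And>H. H \<in> A \<Longrightarrow> val H p \<noteq> 0"
    and v: "v \<in> vcone V J s" "vgen (vsub V J s) v"
    and Q: "closedin (top_of_set M) Q" "Q \<inter> wset V J s p = {}" "closedin (top_of_set M) (Q \<union> wset V J s p)"
  shows "ncell M (Q \<union> wset V J s p) Q (CARD('n) + dim (vsub V J s)) (cvec p v)"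
  using J v Q
proof (induction "card (A - J)" arbitrary: J s v Q rule: less_induct)
  case (less J s v Q)
  note J = less.prems(1) and v = less.prems(2,3) and Q = less.prems(4-6)
  show ?case
  proof (cases "J = A")
    case True
    then show ?thesis using wset_ncell_base[OF V p] v Q by blast
  next
    case False
    then obtain H where H: "H \<in> A" "H \<notin> J" using J by blast
    let ?J = "insert H J"
    have J': "?J \<subseteq> A" using J H by auto
    have card: "card (A - ?J) < card (A - J)" using H finA by (intro psubset_card_mono) auto
    note IH = less.hyps[OF card J']
    let ?VJ = "vsub V J s" and ?V0 = "{u \<in> vsub V J s. dir H u = 0}"
    have sVJ: "subspace ?VJ" by (rule subspace_vsub[OF V])
    have vs: "v \<in> ?VJ" using v vcone_vsub by blast
    let ?W = "\<lambda>e. wset V ?J (s(H := e)) p"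
    show ?thesis
    proof (cases "\<exists>e. \<forall>u\<in>vcone V J s. sgn (dir H u) = e")
      case True
      then obtain e where e: "\<And>u. u \<in> vcone V J s \<Longrightarrow> sgn (dir H u) = e" by blast
      have W: "?W e = wset V J s p" unfolding wset_insert[OF H(2)] using e by (auto simp: wset_def)
      have C: "vcone V ?J (s(H := e)) = vcone V J s" unfolding vcone_insert[OF H(2)] using e by auto
      have Vs: "vsub V ?J (s(H := e)) = ?VJ"
      proof (cases "e = 0")
        case True
        have "dir H u = 0" if u: "u \<in> ?VJ" for u
        proof -
          obtain t0 where t0: "t0 > 0" "\<And>t. \<bar>t\<bar> < t0 \<Longrightarrow> v + t *\<^sub>R u \<in> vcone V J s"
            using vcone_perturb[OF V J v(1) u] by metis
          have "sgn (dir H (v + (t0 / 2) *\<^sub>R u)) = 0" using e[OF t0(2)[of "t0 / 2"]] t0(1) True by simp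
          moreover have "sgn (dir H v) = 0" using e[OF v(1)] True by simp
          ultimately show ?thesis using t0(1) by (simp add: sgn_eq_0_iff)
        qed
        then show ?thesis unfolding vsub_insert[OF H(2)] using True by auto
      qed (simp add: vsub_insert[OF H(2)])
      show ?thesis using IH[of v "s(H := e)" Q] v Q unfolding W C Vs by blast
    next
      case nex: False
      \<comment> \<open>The side of \<open>H\<close> opposite to \<open>v\<close>; this is the half
        that cancels with the facet.\<close>
      define e where "e = - sgn (dir H v)"
      have dirv: "dir H v \<noteq> 0"
      proof
        assume "dir H v = 0"
        then have "\<forall>u\<in>?VJ. dir H u = 0" using v(2) H(1) by (simp add: vgen_def)
        then have "\<forall>u\<in>vcone V J s. sgn (dir H u) = 0" using vcone_vsub by fastforce
        then show False using nex by blast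
      qed
      have e: "e = 1 \<or> e = -1" using dirv by (auto simp: e_def sgn_if)
      obtain v2 where v2: "v2 \<in> vcone V J s" "sgn (dir H v2) \<noteq> sgn (dir H v)" using nex by blast
      have v2s: "v2 \<in> ?VJ" using v2 vcone_vsub by blast
      \<comment> \<open>If \<open>v2\<close> lies on \<open>H\<close> itself, continuing a little
        beyond it, away from \<open>v\<close>, reaches the other side.\<close>
      obtain w where w: "w \<in> vcone V J s" "sgn (dir H w) = e"
      proof (cases "dir H v2 = 0")
        case True
        have d: "v2 - v \<in> ?VJ" by (rule subspace_diff[OF sVJ v2s vs])
        obtain t0 where t0: "t0 > 0" "\<And>t. \<bar>t\<bar> < t0 \<Longrightarrow> v2 + t *\<^sub>R (v2 - v) \<in> vcone V J s"
          using vcone_perturb[OF V J v2(1) d] by metis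
        have "v2 + (t0 / 2) *\<^sub>R (v2 - v) \<in> vcone V J s" using t0 by simp
        moreover have "sgn (dir H (v2 + (t0 / 2) *\<^sub>R (v2 - v))) = e"
          using t0(1) True by (simp add: e_def sgn_mult sgn_minus)
        ultimately show thesis using that by blast
      next
        case False
        then have "sgn (dir H v2) = e" using v2(2) dirv by (auto simp: e_def sgn_if split: if_splits)
        then show thesis using that v2(1) by blast
      qed
      have ws: "w \<in> ?VJ" using w vcone_vsub by blast
      have opp: "dir H v * dir H w < 0"
        using w(2) dirv unfolding e_def by (auto simp: sgn_if mult_less_0_iff split: if_splits)
      \<comment> \<open>The facet is nonempty: the segment from \<open>v\<close> to \<open>w\<close>
        crosses \<open>H\<close>.\<close>
      obtain v0 where v0: "v0 \<in> vcone V ?J (s(H := 0))"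
      proof -
        define t where "t = dir H v / (dir H v - dir H w)"
        have ne: "dir H v - dir H w \<noteq> 0" using opp by auto
        have t: "0 < t" "t < 1" using opp ne unfolding t_def
          by (auto simp: zero_less_divide_iff divide_less_eq mult_less_0_iff)
        have "(1 - t) * dir H v + t * dir H w = dir H v - t * (dir H v - dir H w)" by (simp add: algebra_simps)
        also have "\<dots> = 0" using ne by (simp add: t_def)
        finally have "dir H ((1 - t) *\<^sub>R v + t *\<^sub>R w) = 0" by simp
        then show thesis
          using that[of "(1 - t) *\<^sub>R v + t *\<^sub>R w"] vcone_convex[OF V v(1) w(1) t] by (simp add: vcone_insert[OF H(2)])
      qed
      have V0eq: "vsub V ?J (s(H := 0)) = ?V0" by (simp add: vsub_insert[OF H(2)])
      have VJeq: "vsub V ?J (s(H := c)) = ?VJ" if "c \<noteq> 0" for c using that by (simp add: vsub_insert[OF H(2)])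
      obtain v1 where v1: "v1 \<in> vcone V ?J (s(H := 0))" "vgen ?V0 v1"
        using vgen_exists[OF V J' v0] unfolding V0eq by blast
      have v1': "v1 \<in> vcone V J s" "dir H v1 = 0"
        using v1(1) unfolding vcone_insert[OF H(2)] by (auto simp: sgn_eq_0_iff)
      have v1s: "v1 \<in> ?VJ" using v1'(1) vcone_vsub by blast
      have sV0: "subspace ?V0" using sVJ by (auto simp: subspace_def)
      have dirw: "dir H w \<noteq> 0" using opp by auto
      have dimeq: "dim ?VJ = Suc (dim ?V0)"
      proof -
        have "w \<notin> span ?V0" using dirw sV0 by (simp add: span_eq_iff[THEN iffD2])
        moreover have "span (insert w ?V0) = ?VJ"
        proof
          show "span (insert w ?V0) \<subseteq> ?VJ" by (rule span_minimal[OF _ sVJ]) (use ws in auto)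
          show "?VJ \<subseteq> span (insert w ?V0)"
          proof
            fix u assume u: "u \<in> ?VJ"
            define c where "c = dir H u / dir H w"
            have "u - c *\<^sub>R w \<in> ?V0" using u ws sVJ dirw by (auto simp: c_def subspace_diff subspace_scale)
            then have "(u - c *\<^sub>R w) + c *\<^sub>R w \<in> span (insert w ?V0)"
              by (intro span_add span_scale span_base) auto
            then show "u \<in> span (insert w ?V0)" by simp
          qed
        qed
        ultimately have "dim (insert w ?V0) = Suc (dim ?V0)" by (simp add: dim_insert)
        then show ?thesis using dim_span[of "insert w ?V0"] \<open>span (insert w ?V0) = ?VJ\<close> by simp
      qed
      obtain t0 where t0: "t0 > 0" "\<And>t. \<bar>t\<bar> < t0 \<Longrightarrow> v1 + t *\<^sub>R w \<in> vcone V J s"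
          "\<And>t G. \<bar>t\<bar> < t0 \<Longrightarrow> G \<in> A \<Longrightarrow> dir G v1 \<noteq> 0 \<Longrightarrow> sgn (dir G (v1 + t *\<^sub>R w)) = sgn (dir G v1)"
        by (rule vcone_perturb[OF V J v1'(1) ws]) (rule that; assumption)
      \<comment> \<open>A hyperplane direction containing \<open>v1 + t *\<^sub>R w\<close> for
        small \<open>t\<close> contains \<open>v1\<close>, hence also \<open>w\<close>, and by
        genericity of \<open>v1\<close> all of \<open>?V0\<close>; together these span
        \<open>?VJ\<close>.\<close>
      have gen: "vgen ?VJ (v1 + t *\<^sub>R w)" if t: "0 < t" "t < t0" for t unfolding vgen_def
      proof (intro ballI impI)
        fix G u assume G: "G \<in> A" "dir G (v1 + t *\<^sub>R w) = 0" and u: "u \<in> ?VJ"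
        have z1: "dir G v1 = 0"
        proof (rule ccontr)
          assume nz: "dir G v1 \<noteq> 0"
          have "\<bar>t\<bar> < t0" using t by simp
          from t0(3)[OF this G(1) nz] G(2) nz show False by (simp only: sgn_0 sgn_eq_0_iff) (simp add: sgn_if split: if_splits)
        qed
        then have "dir G w = 0" using G(2) t(1) by simp
        have z0: "\<forall>u\<in>?V0. dir G u = 0" using v1(2) G(1) z1 by (simp add: vgen_def)
        define c where "c = dir H u / dir H w"
        have "u - c *\<^sub>R w \<in> ?V0" using u ws sVJ dirw by (auto simp: c_def subspace_diff subspace_scale)
        then have "dir G (u - c *\<^sub>R w) = 0" using z0 by blast
        then show "dir G u = 0" using \<open>dir G w = 0\<close> by simp
      qed
      let ?W0 = "?W 0" and ?W1 = "?W e" and ?W2 = "?W (- e)"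
      let ?P1 = "Q \<union> ?W0" and ?P2 = "Q \<union> ?W0 \<union> ?W1" and ?P = "Q \<union> wset V J s p"
      have Wsplit: "wset V J s p = ?W0 \<union> ?W1 \<union> ?W2"
        unfolding wset_insert[OF H(2)] using e by (auto simp: sgn_if split: if_splits)
      have QM: "Q \<subseteq> M" using Q(1) closedin_imp_subset by blast
      have cl0: "closedin (top_of_set M) ?P1"
      proof -
        have "closed {z. dir H (im_vec z) = 0}" by (intro closed_Collect_eq cont_dir continuous_im_vec continuous_on_const)
        then have "closedin (top_of_set M) (M \<inter> {z. dir H (im_vec z) = 0})" by (rule closedin_closed_Int)
        from closedin_Un[OF Q(1) closedin_Int[OF Q(3) this]]
        have "closedin (top_of_set M) (Q \<union> ?P \<inter> (M \<inter> {z. dir H (im_vec z) = 0}))" .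
        moreover have "Q \<union> ?P \<inter> (M \<inter> {z. dir H (im_vec z) = 0}) = ?P1"
          unfolding wset_insert[OF H(2)] using wset_M[of V J s p] by (auto simp: sgn_eq_0_iff)
        ultimately show ?thesis by simp
      qed
      have cl1: "closedin (top_of_set M) ?P2"
      proof -
        have "closed {z. 0 \<le> e * dir H (im_vec z)}"
          by (intro closed_Collect_le cont_dir continuous_im_vec continuous_on_const continuous_on_mult)
        then have "closedin (top_of_set M) (M \<inter> {z. 0 \<le> e * dir H (im_vec z)})" by (rule closedin_closed_Int)
        from closedin_Un[OF Q(1) closedin_Int[OF Q(3) this]]
        have "closedin (top_of_set M) (Q \<union> ?P \<inter> (M \<inter> {z. 0 \<le> e * dir H (im_vec z)}))" .
        moreover have "Q \<union> ?P \<inter> (M \<inter> {z. 0 \<le> e * dir H (im_vec z)}) = ?P2"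
        proof -
          have se: "0 \<le> e * x \<longleftrightarrow> sgn x = 0 \<or> sgn x = e" for x :: real using e by (auto simp: sgn_if)
          show ?thesis unfolding wset_insert[OF H(2)] se using wset_M[of V J s p] by auto
        qed
        ultimately show ?thesis by simp
      qed
      have disj: "Q \<inter> ?W0 = {}" "?P1 \<inter> ?W1 = {}" "?P2 \<inter> ?W2 = {}"
        using Q(2) e unfolding wset_insert[OF H(2)] by auto
      have PP: "?P2 \<union> ?W2 = ?P" using Wsplit by blast
      have c1: "ncell M ?P1 Q (CARD('n) + dim ?V0) (cvec p v1)"
        using IH[of v1 "s(H := 0)" Q] v1 Q(1) cl0 disj(1) unfolding V0eq by blast
      have e_ne: "e \<noteq> 0" "- e \<noteq> 0" using e by auto
      have c2: "ncell M ?P2 ?P1 (Suc (CARD('n) + dim ?V0)) (cvec p (v1 + t *\<^sub>R w))" if t: "0 < t" "t < t0" for t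
      proof -
        have "v1 + t *\<^sub>R w \<in> vcone V ?J (s(H := e))"
          unfolding vcone_insert[OF H(2)] using t0(2)[of t] t v1'(2) w(2) by (simp add: sgn_mult)
        from IH[OF this _ cl0 disj(2) cl1] gen[OF t] show ?thesis unfolding VJeq[OF e_ne(1)] dimeq by simp
      qed
      have c3: "ncell M ?P ?P2 (CARD('n) + dim ?VJ) (cvec p v)"
      proof -
        have "v \<in> vcone V ?J (s(H := - e))" unfolding vcone_insert[OF H(2)] using v(1) by (simp add: e_def)
        from IH[OF this _ cl1 disj(3)] v(2) Q(3) show ?thesis unfolding VJeq[OF e_ne(2)] PP by simp
      qed
      show ?thesis
      proof (rule ncell_extend[OF c3])
        show "Q \<subseteq> ?P2" by blast
        show "triv M k ?P2 Q x" if "relc M k ?P2 Q x" for k x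
          by (rule wset_half[OF J H V p Q(1,2) e v1' ws w(2) t0(1) _ c2 c1 that]) (use t0(2) in auto)
      qed
    qed
  qed
qed

end

section \<open>Fundamental cycles\<close>

context
  fixes bs :: "'a::euclidean_space list" and \<tau> :: "(nat \<Rightarrow> real) \<Rightarrow> 'a" and D :: "'a set"
  defines "\<tau> \<equiv> local_orientation_simplex bs 0 1" and "D \<equiv> \<tau> ` standard_simplex (length bs)"
begin

text \<open>All orientation simplices are images of one model simplex about 0, so an estimate made
  for the model carries over by scaling and translation.\<close>

lemma local_orientation_simplex_eq_map:
  "chain_map (length bs) (\<lambda>x. y + r *\<^sub>R x) (frag_of \<tau>) = frag_of (local_orientation_simplex bs y r)"
proof -
  have "y + r *\<^sub>R (\<Sum>i\<le>length bs. t i *\<^sub>R oriented_vertex bs 0 1 i)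
      = (\<Sum>i\<le>length bs. t i *\<^sub>R oriented_vertex bs y r i)" if "t \<in> standard_simplex (length bs)" for t
  proof -
    have "oriented_vertex bs y r i = y + r *\<^sub>R oriented_vertex bs 0 1 i" for i
      by (simp add: oriented_vertex_def algebra_simps)
    then have "(\<Sum>i\<le>length bs. t i *\<^sub>R oriented_vertex bs y r i)
       = (\<Sum>i\<le>length bs. t i *\<^sub>R y + r *\<^sub>R (t i *\<^sub>R oriented_vertex bs 0 1 i))"
      by (simp add: scaleR_add_right mult.commute)
    also have "\<dots> = (\<Sum>i\<le>length bs. t i) *\<^sub>R y + r *\<^sub>R (\<Sum>i\<le>length bs. t i *\<^sub>R oriented_vertex bs 0 1 i)"
      by (simp add: sum.distrib scaleR_sum_left scaleR_sum_right)
    finally show ?thesis using that by (simp add: standard_simplex_def)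
  qed
  then have "simplex_map (length bs) (\<lambda>x. y + r *\<^sub>R x) \<tau> = local_orientation_simplex bs y r"
    by (auto simp: simplex_map_def \<tau>_def local_orientation_simplex_def fun_eq_iff)
  then show ?thesis by simp
qed

context
  assumes ind: "independent (set bs)" and dist: "distinct bs"
begin

lemma local_orientation_simplex_span: "D \<subseteq> span (set bs)"
proof -
  have "oriented_vertex bs 0 1 i \<in> span (set bs)" if "i \<le> length bs" for i
  proof -
    have "sum_list bs \<in> span (set bs)"
      using subspace_span[of "set bs"] by (induction bs) (auto simp: span_0 intro: span_add span_base span_superset[THEN subsetD] span_mono[THEN subsetD])
    then show ?thesis using that by (auto simp: oriented_vertex_def intro: span_base span_neg)
  qed
  then show ?thesis
    unfolding D_def \<tau>_def local_orientation_simplex_asx by (intro asx_in_convex subspace_imp_convex subspace_span)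
qed

text \<open>The boundary of the model simplex is compact and misses 0, which leaves a positive
  margin \<open>\<delta>\<close>.\<close>

lemma local_orientation_simplex_boundary_gap:
  obtains \<delta> where "\<delta> > 0" "rc (length bs) D {x \<in> D. norm x \<ge> \<delta>} (frag_of \<tau>)"
proof -
  let ?E = "span (set bs)" and ?d = "length bs"
  have g: "rel_gen ?d ?E (?E - {0}) (frag_of \<tau>)"
    unfolding \<tau>_def by (rule local_orientation_gen[OF ind dist, of UNIV]) auto
  have bd: "ch (?d - Suc 0) (?E - {0}) (chain_boundary ?d (frag_of \<tau>))"
    using g by (simp add: rel_gen_def rc_iff)
  have sD: "ch ?d D (frag_of \<tau>)"
    unfolding D_def \<tau>_def local_orientation_simplex_asx singular_chain_of singular_simplex_asx by simp
  define S where "S = (\<Union>f\<in>Poly_Mapping.keys (chain_boundary ?d (frag_of \<tau>)). f ` standard_simplex (?d - Suc 0))"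
  have "compact S" unfolding S_def
  proof (intro compact_UN ballI finite_keys)
    fix f assume "f \<in> Poly_Mapping.keys (chain_boundary ?d (frag_of \<tau>))"
    then have "singular_simplex (?d - Suc 0) (top_of_set (?E - {0})) f"
      using singular_chain_keys(1)[OF bd, of f] by (simp add: in_keys_iff)
    from compactin_singular_simplex_image[OF this] show "compact (f ` standard_simplex (?d - Suc 0))"
      by (simp add: compactin_subtopology)
  qed
  moreover have "0 \<notin> S" using singular_chain_keys(2)[OF bd] by (fastforce simp: S_def in_keys_iff)
  ultimately obtain \<delta> where \<delta>: "\<delta> > 0" "\<forall>x\<in>S. \<delta> \<le> dist 0 x"
    using separate_point_closed[of S 0] compact_imp_closed by blast
  have "ch (?d - Suc 0) {x \<in> D. norm x \<ge> \<delta>} (chain_boundary ?d (frag_of \<tau>))"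
  proof (rule singular_chain_subsetI[OF bd])
    fix f assume f: "lk (chain_boundary ?d (frag_of \<tau>)) f \<noteq> 0"
    then have "f ` standard_simplex (?d - Suc 0) \<subseteq> S" by (auto simp: S_def in_keys_iff)
    moreover have "f ` standard_simplex (?d - Suc 0) \<subseteq> D"
      by (rule singular_chain_keys(2)[OF singular_chain_boundary[OF sD] f])
    ultimately show "f ` standard_simplex (?d - Suc 0) \<subseteq> {x \<in> D. norm x \<ge> \<delta>}" using \<delta>(2) by auto
  qed
  then have "rc ?d D {x \<in> D. norm x \<ge> \<delta>} (frag_of \<tau>)" using sD by (subst rc_iff) auto
  then show thesis by (rule that[OF \<delta>(1)])
qed

text \<open>While centre and size move linearly, the boundary of the simplex stays outside the open
  ball about the current centre whose radius is \<open>\<delta>\<close> times the current size. The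
  assumption keeps \<open>K\<close> inside this ball, so the motion is a homotopy relative to the
  complement of \<open>K\<close>.\<close>

lemma local_orientation_simplex_rel:
  assumes \<delta>: "rc (length bs) D {x \<in> D. norm x \<ge> \<delta>} (frag_of \<tau>)"
    and K: "\<And>k s. k \<in> K \<Longrightarrow> 0 \<le> s \<Longrightarrow> s \<le> 1 \<Longrightarrow>
      norm (k - ((1 - s) *\<^sub>R y + s *\<^sub>R y')) < ((1 - s) * r + s * r') * \<delta>"
    and y: "E = {z. z - y \<in> span (set bs)}" "y' \<in> E" and r: "r > 0" "r' > 0"
  shows "rb (length bs) E (E - K)
    (frag_of (local_orientation_simplex bs y r) - frag_of (local_orientation_simplex bs y' r'))"
proof -
  have comb: "(1 - s) *\<^sub>R (y + r *\<^sub>R x) + s *\<^sub>R (y' + r' *\<^sub>R x) = ((1 - s) *\<^sub>R y + s *\<^sub>R y') + ((1 - s) * r + s * r') *\<^sub>R x" for s x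
    by (simp add: algebra_simps)
  have inE: "(1 - s) *\<^sub>R (y + r *\<^sub>R x) + s *\<^sub>R (y' + r' *\<^sub>R x) \<in> E" if "x \<in> D" for s x
  proof -
    have "x \<in> span (set bs)" using local_orientation_simplex_span that by blast
    moreover have "((1 - s) *\<^sub>R (y + r *\<^sub>R x) + s *\<^sub>R (y' + r' *\<^sub>R x)) - y = s *\<^sub>R (y' - y) + ((1 - s) * r + s * r') *\<^sub>R x"
      by (simp add: algebra_simps)
    ultimately show ?thesis using y by (auto intro: span_add span_scale)
  qed
  have "homotopic_with (\<lambda>h. h \<in> {x \<in> D. norm x \<ge> \<delta>} \<rightarrow> E - K) (top_of_set D) (top_of_set E)
     (\<lambda>x. y + r *\<^sub>R x) (\<lambda>x. y' + r' *\<^sub>R x)"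
  proof (rule homotopic_with_linear_rel)
    fix s :: real and x :: 'a assume x: "x \<in> {x \<in> D. norm x \<ge> \<delta>}" and s: "0 \<le> s" "s \<le> 1"
    have pos: "(1 - s) * r + s * r' \<ge> 0" using r s by simp
    have "(1 - s) *\<^sub>R (y + r *\<^sub>R x) + s *\<^sub>R (y' + r' *\<^sub>R x) \<notin> K"
    proof
      assume "(1 - s) *\<^sub>R (y + r *\<^sub>R x) + s *\<^sub>R (y' + r' *\<^sub>R x) \<in> K"
      from K[OF this s] have "norm (((1 - s) * r + s * r') *\<^sub>R x) < ((1 - s) * r + s * r') * \<delta>"
        unfolding comb by simp
      then have "((1 - s) * r + s * r') * norm x < ((1 - s) * r + s * r') * \<delta>" using pos by simp
      then show False using mult_left_mono[OF _ pos, of \<delta> "norm x"] x by simp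
    qed
    then show "(1 - s) *\<^sub>R (y + r *\<^sub>R x) + s *\<^sub>R (y' + r' *\<^sub>R x) \<in> E - K" using inE x by blast
  qed (use inE in \<open>auto intro!: continuous_intros\<close>)
  from homotopic_imp_homologous_rel_chain_maps[OF this \<delta>]
  show ?thesis unfolding local_orientation_simplex_eq_map homologous_rel_def .
qed

lemma local_orientation_simplex_rc:
  assumes \<delta>: "rc (length bs) D {x \<in> D. norm x \<ge> \<delta>} (frag_of \<tau>)"
    and K: "\<And>k. k \<in> K \<Longrightarrow> norm (k - y) < r * \<delta>"
    and E: "E = {z. z - y \<in> span (set bs)}" and r: "r > 0"
  shows "rc (length bs) E (E - K) (frag_of (local_orientation_simplex bs y r))"
  unfolding local_orientation_simplex_eq_map[symmetric]
proof (rule singular_relcycle_chain_map[OF \<delta>])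
  show "continuous_map (top_of_set D) (top_of_set E) (\<lambda>x. y + r *\<^sub>R x)"
    using local_orientation_simplex_span E by (auto intro!: continuous_intros span_scale)
  show "(\<lambda>x. y + r *\<^sub>R x) \<in> {x \<in> D. norm x \<ge> \<delta>} \<rightarrow> E - K"
  proof
    fix x assume x: "x \<in> {x \<in> D. norm x \<ge> \<delta>}"
    have "y + r *\<^sub>R x \<notin> K"
    proof
      assume "y + r *\<^sub>R x \<in> K"
      from K[OF this] have "norm x < \<delta>" using r by simp
      then show False using x by simp
    qed
    then show "y + r *\<^sub>R x \<in> E - K" using x local_orientation_simplex_span E by (auto intro!: span_scale)
  qed
qed

end
end

lemma avoids_sym: "avoids k y (v - w) \<Longrightarrow> avoids k y (w - v)" by (simp add: avoids_def)

lemma incl_iso_compact: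
  fixes E :: "'a::euclidean_space set"
  assumes "open U" "compact K" "K \<subseteq> U"
  shows "incl_iso k (E \<inter> U) (E \<inter> U - K) E (E - K)"
proof -
  have "incl_iso k (E - (- U)) ((E - K) - (- U)) E (E - K)"
    by (rule incl_iso_excision[of "- U" "- K"]) (use assms compact_imp_closed in auto)
  moreover have "E - (- U) = E \<inter> U" "(E - K) - (- U) = E \<inter> U - K" by auto
  ultimately show ?thesis by simp
qed

lemma exhaustion_exists:
  fixes E :: "'a::euclidean_space set"
  assumes "open U" "closed E"
  obtains K where "exhaustion (E \<inter> U) K"
proof -
  obtain C where C: "\<And>n. compact (C n)" "\<And>n. C n \<subseteq> U" "\<And>n. C n \<subseteq> interior (C (Suc n))"
     "\<And>K. compact K \<Longrightarrow> K \<subseteq> U \<Longrightarrow> \<exists>N. \<forall>n\<ge>N. K \<subseteq> C n"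
    by (rule open_Union_compact_subsets[OF assms(1)]) (rule that; assumption)
  have "exhaustion (E \<inter> U) (\<lambda>n. E \<inter> C n)"
  proof
    show "compact (E \<inter> C n)" for n using C(1) assms(2) by (simp add: closed_Int_compact)
    show "E \<inter> C n \<subseteq> E \<inter> U" for n using C(2) by auto
    show "\<exists>O'. openin (top_of_set (E \<inter> U)) O' \<and> E \<inter> C n \<subseteq> O' \<and> O' \<subseteq> E \<inter> C (Suc n)" for n
    proof (intro exI conjI)
      show "openin (top_of_set (E \<inter> U)) (E \<inter> U \<inter> interior (C (Suc n)))" by (simp add: openin_open_Int)
      show "E \<inter> C n \<subseteq> E \<inter> U \<inter> interior (C (Suc n))" using C(2,3)[of n] by blast
      show "E \<inter> U \<inter> interior (C (Suc n)) \<subseteq> E \<inter> C (Suc n)" using interior_subset by blast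
    qed
    show "\<exists>i. L \<subseteq> E \<inter> C i" if "compact L" "L \<subseteq> E \<inter> U" for L
    proof -
      have "L \<subseteq> U" using that(2) by blast
      from C(4)[OF that(1) this] obtain N where "\<forall>n\<ge>N. L \<subseteq> C n" by blast
      then have "L \<subseteq> C N" by blast
      then show ?thesis using that(2) by blast
    qed
  qed
  then show thesis by (rule that)
qed

text \<open>In contrast to \<open>fundamental_cycle\<close>, every orientation simplex that fits
  into \<open>Y\<close> must give the local class, so a suitable one can be chosen later.\<close>

definition oriented_cycle :: "'a::euclidean_space set \<Rightarrow> 'a list \<Rightarrow> 'a lf_chain \<Rightarrow> bool" where
  "oriented_cycle Y bs z \<longleftrightarrow> lfs Y (length bs) Y z \<and> lf_boundary (length bs) z = 0 \<and>
    (\<forall>y\<in>Y. \<forall>eps>0. local_orientation_simplex bs y eps ` standard_simplex (length bs) \<subseteq> Y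
      \<longrightarrow> loc (length bs) Y y (z - lk (frag_of (local_orientation_simplex bs y eps))))"

lemma oriented_cycle_loc:
  "oriented_cycle Y bs z \<Longrightarrow> y \<in> Y \<Longrightarrow> eps > 0 \<Longrightarrow> local_orientation_simplex bs y eps ` standard_simplex (length bs) \<subseteq> Y
    \<Longrightarrow> loc (length bs) Y y (z - lk (frag_of (local_orientation_simplex bs y eps)))"
  unfolding oriented_cycle_def by blast

text \<open>A large simplex about \<open>y0\<close> covers the compact set \<open>K i\<close>, and
  excision replaces it by a chain \<open>c i\<close> inside the open set. Two successive ones agree
  near \<open>K i\<close> up to a boundary: \<open>c (Suc i) - c i\<close> is the boundary of
  \<open>e i\<close> plus a chain \<open>f i\<close> off \<open>K i\<close>. The cycle is
  \<open>c 0\<close> plus the locally finite sum of the \<open>f i\<close>; its partial sums differ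
  from \<open>c j\<close> only by boundaries.\<close>

theorem fundamental_cycle_exists:
  fixes bs :: "'a::euclidean_space list"
  assumes ind: "independent (set bs)" and dist: "distinct bs" and len: "length bs = Suc m"
    and E: "E = {z. z - y0 \<in> span (set bs)}" and U: "open U"
  shows "\<exists>z. oriented_cycle (E \<inter> U) bs z"
proof -
  let ?Y = "E \<inter> U"
  define \<sigma> where "\<sigma> y r = frag_of (local_orientation_simplex bs y r)" for y r
  let ?d = "Suc m"
  note gap = local_orientation_simplex_boundary_gap[OF ind dist, unfolded len]
    and rel = local_orientation_simplex_rel[OF ind dist, unfolded len, folded \<sigma>_def]
    and rcl = local_orientation_simplex_rc[OF ind dist, unfolded len, folded \<sigma>_def]
  obtain \<delta> where \<delta>: "\<delta> > 0" "rc ?d (local_orientation_simplex bs 0 1 ` standard_simplex ?d)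
     {x \<in> local_orientation_simplex bs 0 1 ` standard_simplex ?d. norm x \<ge> \<delta>} (frag_of (local_orientation_simplex bs 0 1))"
    by (rule gap) (rule that; assumption)
  note \<delta>\<sigma> = \<delta>(2)[folded \<sigma>_def]
  have E_eq: "E = {z. z - y \<in> span (set bs)}" if "y \<in> E" for y
  proof -
    have y: "y - y0 \<in> span (set bs)" using that E by simp
    have "z - y0 \<in> span (set bs) \<longleftrightarrow> z - y \<in> span (set bs)" for z
      using span_diff[OF _ y, of "z - y0"] span_add[OF _ y, of "z - y"] by auto
    then show ?thesis using E by blast
  qed
  have closedE: "closed E"
  proof -
    have "E = (\<lambda>x. y0 + x) ` span (set bs)" unfolding E by (auto simp: image_iff) (metis add_diff_cancel_left' diff_add_cancel add.commute)
    then show ?thesis by (simp add: closed_translation)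
  qed
  have y0E: "y0 \<in> E" by (simp add: E span_zero)
  obtain K where ex: "exhaustion ?Y K" by (rule exhaustion_exists[OF U closedE])
  interpret exhaustion ?Y K by fact
  have KU: "K i \<subseteq> U" for i using KP[of i] by blast
  have iso: "incl_iso k ?Y (?Y - K i) E (E - K i)" for k i by (rule incl_iso_compact[OF U cK KU])
  \<comment> \<open>Says that \<open>K i\<close> lies in the open ball about \<open>y0\<close> of
    radius \<open>r * \<delta>\<close>, which the boundary of the simplex of size \<open>r\<close>
    does not meet.\<close>
  define big where "big i r \<longleftrightarrow> r > 0 \<and> (\<forall>k\<in>K i. norm (k - y0) < r * \<delta>)" for i r
  have big_ex: "\<exists>r0. \<forall>r\<ge>r0. big i r" for i
  proof -
    have "bounded (K i)" using cK compact_imp_bounded by blast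
    then obtain B where B: "\<forall>k\<in>K i. norm k \<le> B" by (auto simp: bounded_iff)
    have "big i r" if r: "r \<ge> (\<bar>B\<bar> + norm y0 + 1) / \<delta>" for r
    proof -
      have 1: "(\<bar>B\<bar> + norm y0 + 1) / \<delta> > 0" using \<delta>(1) by (simp add: add_nonneg_pos)
      have 2: "\<bar>B\<bar> + norm y0 + 1 \<le> r * \<delta>" using r \<delta>(1) by (simp add: divide_le_eq)
      have "norm (k - y0) < r * \<delta>" if "k \<in> K i" for k
        using norm_triangle_ineq4[of k y0] B that 2 by fastforce
      then show ?thesis using 1 r by (simp add: big_def)
    qed
    then show ?thesis by blast
  qed
  have \<sigma>_rc: "rc ?d E (E - K i) (\<sigma> y0 r)" if "big i r" for i r
    by (rule rcl[OF \<delta>\<sigma> _ E]) (use that in \<open>auto simp: big_def\<close>)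
  have \<sigma>_hom: "rb ?d E (E - K i) (\<sigma> y0 r - \<sigma> y0 r')" if b: "big i r" "big i r'" for i r r'
  proof (rule rel[OF \<delta>\<sigma> _ E y0E])
    fix k and s :: real assume k: "k \<in> K i" and s: "0 \<le> s" "s \<le> 1"
    have "norm (k - y0) * ((1 - s) + s) < ((1 - s) * r + s * r') * \<delta>"
    proof (cases "s = 0")
      case True then show ?thesis using b k by (simp add: big_def)
    next
      case False
      have "(1 - s) * norm (k - y0) \<le> (1 - s) * (r * \<delta>)" "s * norm (k - y0) < s * (r' * \<delta>)"
        using b k s False by (auto simp: big_def less_imp_le intro!: mult_left_mono)
      then show ?thesis by (simp add: algebra_simps)
    qed
    moreover have "(1 - s) *\<^sub>R y0 + s *\<^sub>R y0 = y0" by (simp add: algebra_simps)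
    ultimately show "norm (k - ((1 - s) *\<^sub>R y0 + s *\<^sub>R y0)) < ((1 - s) * r + s * r') * \<delta>" by simp
  qed (use b in \<open>auto simp: big_def\<close>)
  have "\<exists>c r. big i r \<and> rc ?d ?Y (?Y - K i) c \<and> rb ?d E (E - K i) (\<sigma> y0 r - c)" for i
  proof -
    obtain r where r: "big i r" using big_ex[of i] by blast
    obtain c where "rc ?d ?Y (?Y - K i) c" "rb ?d E (E - K i) (\<sigma> y0 r - c)"
      using iso[of ?d i] \<sigma>_rc[OF r] unfolding incl_iso_def by blast
    then show ?thesis using r by blast
  qed
  then obtain c R where c: "\<And>i. big i (R i)" "\<And>i. rc ?d ?Y (?Y - K i) (c i)" "\<And>i. rb ?d E (E - K i) (\<sigma> y0 (R i) - c i)"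
    by metis
  have c\<sigma>: "rb ?d E (E - K i) (\<sigma> y0 r - c i)" if "big i r" for i r
    by (rule rb_diff_trans[OF \<sigma>_hom[OF that c(1)] c(3)])
  have Kss: "K i \<subseteq> K (Suc i)" for i by (rule K_mono) simp
  have step: "rb ?d ?Y (?Y - K i) (c (Suc i) - c i)" for i
  proof -
    have r: "big (Suc i) (R (Suc i))" "big i (R (Suc i))" using c(1)[of "Suc i"] Kss[of i] by (auto simp: big_def)
    have 1: "rb ?d E (E - K i) (\<sigma> y0 (R (Suc i)) - c (Suc i))"
      by (rule rb_mono[OF c(3)]) (use Kss[of i] in auto)
    have "rb ?d E (E - K i) (c (Suc i) - c i)"
      by (rule rb_diff_trans[OF rb_diff_sym[OF 1] c\<sigma>[OF r(2)]])
    moreover have "rc ?d ?Y (?Y - K i) (c (Suc i) - c i)"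
    proof (rule singular_relcycle_diff)
      show "rc ?d ?Y (?Y - K i) (c (Suc i))" by (rule rc_mono[OF c(2)]) (use Kss[of i] in auto)
    qed (rule c(2))
    ultimately show ?thesis using incl_iso_rb[OF iso] by blast
  qed
  then have "\<exists>e f. ch (Suc ?d) ?Y e \<and> ch ?d (?Y - K i) f \<and> c (Suc i) - c i = chain_boundary (Suc ?d) e + f" for i
    unfolding rb_iff[OF Diff_subset] by blast
  then obtain e f where ef: "\<And>i. ch (Suc ?d) ?Y (e i)" "\<And>i. ch ?d (?Y - K i) (f i)"
      "\<And>i. c (Suc i) - c i = chain_boundary (Suc ?d) (e i) + f i" by metis
  have partial: "c 0 + (\<Sum>i<j. f i) = c j - chain_boundary (Suc ?d) (\<Sum>i<j. e i)" for j
  proof (induction j)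
    case (Suc j)
    have "c 0 + (\<Sum>i<Suc j. f i) = (c 0 + (\<Sum>i<j. f i)) + f j" by (simp add: add.assoc)
    also have "\<dots> = c j - chain_boundary (Suc ?d) (\<Sum>i<j. e i) + ((c (Suc j) - c j) - chain_boundary (Suc ?d) (e j))"
      unfolding Suc using ef(3)[of j] by simp
    also have "\<dots> = c (Suc j) - chain_boundary (Suc ?d) (\<Sum>i<Suc j. e i)"
      by (simp add: chain_boundary_add)
    finally show ?case .
  qed simp
  define z where "z = lk (c 0) + lfsum ?d K f"
  have c0: "ch ?d ?Y (c i)" for i using c(2)[of i] unfolding rc_iff[OF Diff_subset] by blast
  have lfs_c: "lfs ?Y ?d ?Y (lk (c 0))" by (rule lfs_lookup[OF c0]) simp
  have lfs_f: "lfs ?Y ?d ?Y (lfsum ?d K f)" by (rule lfs_lfsum[OF ef(2)]) simp_all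
  have lfs_z: "lfs ?Y ?d ?Y z" unfolding z_def by (rule lfs_add[OF lfs_c lfs_f])
  have bd_z: "lf_boundary ?d z = 0"
  proof
    fix g
    have dz: "lf_boundary ?d z = lk (chain_boundary ?d (c 0)) + lf_boundary ?d (lfsum ?d K f)"
      unfolding z_def bd_add[OF lfs_c lfs_f] bd_lookup ..
    show "lf_boundary ?d z g = 0 g"
    proof (cases "singular_simplex m (top_of_set ?Y) g")
      case True
      then obtain j where j: "g ` standard_simplex m \<inter> K j \<noteq> {}" using meets by blast
      have "lf_boundary ?d z g = lk (chain_boundary ?d (c 0)) g + lk (\<Sum>i<j. chain_boundary ?d (f i)) g"
        unfolding dz using bd_lfsum[OF ef(2) j] by simp
      also have "\<dots> = lk (chain_boundary ?d (c 0 + (\<Sum>i<j. f i))) g"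
        by (simp add: chain_boundary_add chain_boundary_sum lookup_add)
      also have "\<dots> = lk (chain_boundary ?d (c j)) g"
        unfolding partial chain_boundary_diff
        using chain_boundary_boundary_alt[of ?d "top_of_set ?Y" "\<Sum>i<j. e i"] ef(1)
        by (simp add: singular_chain_sum)
      also have "\<dots> = 0"
      proof (rule ccontr)
        assume nz: "lk (chain_boundary ?d (c j)) g \<noteq> 0"
        have "ch (?d - Suc 0) (?Y - K j) (chain_boundary ?d (c j))" using c(2)[of j] unfolding rc_iff[OF Diff_subset] by blast
        from singular_chain_keys(2)[OF this nz] j show False by auto
      qed
      finally show ?thesis by simp
    next
      case False
      then show ?thesis using lfs_singular[OF lfs_bd'[OF lfs_z], of g] by auto
    qed
  qed
  have loc_z: "loc ?d ?Y y (z - lk (\<sigma> y eps))"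
    if y: "y \<in> ?Y" and eps: "eps > 0" "local_orientation_simplex bs y eps ` standard_simplex ?d \<subseteq> ?Y" for y eps
  proof -
    obtain j where "{y} \<subseteq> K j" using K_ex[of "{y}"] y by auto
    then have j: "y \<in> K j" by simp
    have r: "R j > 0" "norm (y - y0) < R j * \<delta>" using c(1)[of j] j by (auto simp: big_def)
    have yE: "y \<in> E" using y by simp
    have 1: "rb ?d E (E - {y}) (\<sigma> y0 (R j) - c j)" by (rule rb_mono[OF c(3)]) (use j in auto)
    \<comment> \<open>The large simplex about \<open>y0\<close> slides and shrinks into the given
      one about \<open>y\<close>. At time \<open>s\<close> the distance of \<open>y\<close> from the
      moving centre is \<open>(1 - s) * norm (y - y0)\<close>, which stays within the
      margin.\<close>
    have 2: "rb ?d E (E - {y}) (\<sigma> y0 (R j) - \<sigma> y eps)"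
    proof (rule rel[OF \<delta>\<sigma> _ E yE r(1) eps(1)])
      fix k and s :: real assume k: "k \<in> {y}" and s: "0 \<le> s" "s \<le> 1"
      have "k - ((1 - s) *\<^sub>R y0 + s *\<^sub>R y) = (1 - s) *\<^sub>R (y - y0)" using k by (simp add: algebra_simps)
      then have n: "norm (k - ((1 - s) *\<^sub>R y0 + s *\<^sub>R y)) = (1 - s) * norm (y - y0)" using s by simp
      show "norm (k - ((1 - s) *\<^sub>R y0 + s *\<^sub>R y)) < ((1 - s) * R j + s * eps) * \<delta>"
      proof (cases "s = 0")
        case True then show ?thesis unfolding n using r by simp
      next
        case False
        have "(1 - s) * norm (y - y0) \<le> (1 - s) * (R j * \<delta>)" "0 < s * (eps * \<delta>)"
          using r(2) s False eps(1) \<delta>(1) by (auto intro!: mult_left_mono)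
        then show ?thesis unfolding n by (simp add: algebra_simps)
      qed
    qed
    have 3: "rb ?d E (E - {y}) (c j - \<sigma> y eps)" by (rule rb_diff_trans[OF rb_diff_sym[OF 1] 2])
    have i1: "incl_iso ?d ?Y (?Y - {y}) E (E - {y})" by (rule incl_iso_compact[OF U]) (use y in auto)
    have cj: "rc ?d ?Y (?Y - {y}) (c j)" by (rule rc_mono[OF c(2)]) (use j in auto)
    have s1: "rc ?d E (E - {y}) (\<sigma> y eps)" by (rule rcl[OF \<delta>\<sigma> _ E_eq[OF yE] eps(1)]) (use eps(1) \<delta>(1) in simp)
    have s2: "ch ?d ?Y (\<sigma> y eps)"
      using eps(2) unfolding \<sigma>_def local_orientation_simplex_asx singular_chain_of len singular_simplex_asx .
    have s3: "rc ?d ?Y (?Y - {y}) (\<sigma> y eps)"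
    proof -
      have b1: "ch (?d - Suc 0) (E - {y}) (chain_boundary ?d (\<sigma> y eps))" using s1 unfolding rc_iff[OF Diff_subset] by blast
      have "ch (?d - Suc 0) (?Y - {y}) (chain_boundary ?d (\<sigma> y eps))"
      proof (rule singular_chain_subsetI[OF b1])
        fix g assume g: "lk (chain_boundary ?d (\<sigma> y eps)) g \<noteq> 0"
        from singular_chain_keys(2)[OF b1 g] singular_chain_keys(2)[OF singular_chain_boundary[OF s2] g]
        show "g ` standard_simplex (?d - Suc 0) \<subseteq> ?Y - {y}" by blast
      qed
      then show ?thesis unfolding rc_iff[OF Diff_subset] using s2 by blast
    qed
    have "rc ?d ?Y (?Y - {y}) (c j - \<sigma> y eps)" by (rule singular_relcycle_diff[OF cj s3])
    from incl_iso_rb[OF i1 this] 3 have "rb ?d ?Y (?Y - {y}) (c j - \<sigma> y eps)" by blast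
    then have 4: "loc ?d ?Y y (lk (c j - \<sigma> y eps))"
      using loc_lk[OF singular_chain_diff[OF c0 s2]] by blast
    have se: "ch (Suc ?d) ?Y (\<Sum>i<j. e i)" by (intro singular_chain_sum ef(1))
    have 5: "loc ?d ?Y y (lf_boundary (Suc ?d) (lk (\<Sum>i<j. e i)))"
      by (rule loc_bd[OF lfs_lookup[OF se subset_refl] y])
    have 6: "avoids ?d y (z - lk (c 0 + (\<Sum>i<j. f i)))" unfolding avoids_def
    proof (intro allI impI)
      fix g assume "y \<in> g ` standard_simplex ?d"
      then have "g ` standard_simplex ?d \<inter> K j \<noteq> {}" using j by auto
      from lfsum_eq[OF ef(2) this] show "(z - lk (c 0 + (\<Sum>i<j. f i))) g = 0"
        by (simp add: z_def lookup_add)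
    qed
    have eq: "z - lk (\<sigma> y eps) = (z - lk (c 0 + (\<Sum>i<j. f i))) + (lk (c j - \<sigma> y eps) - lf_boundary (Suc ?d) (lk (\<Sum>i<j. e i)))"
      unfolding partial bd_lookup by (simp add: lk_diff)
    show ?thesis unfolding eq by (rule loc_add[OF loc_avoids[OF 6] loc_diff[OF 4 5]])
  qed
  show ?thesis
    unfolding oriented_cycle_def len
    by (intro exI[of _ z] conjI ballI allI impI lfs_z bd_z loc_z[unfolded \<sigma>_def])
qed

lemma fundamental_cycle_iff:
  fixes bs :: "'a::euclidean_space list"
  shows "fundamental_cycle Y bs c \<longleftrightarrow>
    lfs Y (length bs) Y c \<and> lf_boundary (length bs) c = 0 \<and>
    (\<forall>y\<in>Y. \<exists>eps>0. local_orientation_simplex bs y eps ` standard_simplex (length bs) \<subseteq> Y \<and>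
       loc (length bs) Y y (c - lk (frag_of (local_orientation_simplex bs y eps))))"
proof -
  let ?d = "length bs"
  let ?s = "\<lambda>y eps. frag_of (local_orientation_simplex bs y eps)"
  have car: "c \<in> carrier (lf_cycle_group ?d (top_of_set Y)) \<longleftrightarrow> lfs Y ?d Y c \<and> lf_boundary ?d c = 0"
  proof -
    have "f ` standard_simplex ?d \<subseteq> Y" if "lf_singular_chain ?d (top_of_set Y) c" "c f \<noteq> 0" for f
      using that by (auto simp: lf_singular_chain_def singular_simplex_subtopology)
    then show ?thesis by (auto simp: lf_cycle_group_def lfs_def zero_fun_def)
  qed
  have "homologous_rel_set ?d (top_of_set Y) (Y - {y}) (lf_truncate ?d {y} c)
          = homologous_rel_set ?d (top_of_set Y) (Y - {y}) (?s y eps)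
      \<longleftrightarrow> loc ?d Y y (c - lk (?s y eps))"
    if c: "lfs Y ?d Y c" and y: "y \<in> Y" and s: "local_orientation_simplex bs y eps ` standard_simplex ?d \<subseteq> Y" for y eps
  proof -
    have cy: "compactin (top_of_set Y) {y}" using y by (simp add: compactin_subtopology)
    have t: "ch ?d Y (lf_truncate ?d {y} c)" by (rule singular_chain_lf_truncate[OF lfs_lf[OF c] cy])
    have s': "ch ?d Y (?s y eps)"
      using s unfolding local_orientation_simplex_asx singular_chain_of singular_simplex_asx .
    have "avoids ?d y (c - lk (lf_truncate ?d {y} c))"
      by (auto simp: avoids_def lookup_lf_truncate[OF lfs_lf[OF c] cy])
    then have 1: "avoids ?d y ((c - lk (?s y eps)) - lk (lf_truncate ?d {y} c - ?s y eps))" by (simp add: lk_diff)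
    then have 2: "avoids ?d y (lk (lf_truncate ?d {y} c - ?s y eps) - (c - lk (?s y eps)))"
      by (rule avoids_sym)
    have "rb ?d Y (Y - {y}) (lf_truncate ?d {y} c - ?s y eps) \<longleftrightarrow> loc ?d Y y (lk (lf_truncate ?d {y} c - ?s y eps))"
      using loc_lk[OF singular_chain_diff[OF t s']] by blast
    also have "\<dots> \<longleftrightarrow> loc ?d Y y (c - lk (?s y eps))"
      using loc_cong_avoids[OF 1] loc_cong_avoids[OF 2] by blast
    finally show ?thesis unfolding homologous_rel_set_eq_iff unfolding homologous_rel_def .
  qed
  moreover have "singular_simplex ?d (top_of_set Y) (local_orientation_simplex bs y eps)
     \<longleftrightarrow> local_orientation_simplex bs y eps ` standard_simplex ?d \<subseteq> Y" for y eps
    unfolding local_orientation_simplex_asx singular_simplex_asx ..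
  ultimately show ?thesis unfolding fundamental_cycle_def car by (smt (verit, best))
qed

section \<open>Cell filtrations\<close>

lemma small_orientation_simplex:
  fixes bs :: "'a::euclidean_space list"
  assumes ind: "independent (set bs)" and dist: "distinct bs"
    and U: "open U" "y \<in> U" "P \<inter> U = {z. z - y \<in> span (set bs)} \<inter> U"
  obtains eps where "eps > 0" "local_orientation_simplex bs y eps ` standard_simplex (length bs) \<subseteq> P \<inter> U"
    "rel_gen (length bs) P (P - {y}) (frag_of (local_orientation_simplex bs y eps))"
proof -
  obtain r where r: "r > 0" "ball y r \<subseteq> U" using U(1,2) open_contains_ball by blast
  obtain eps0 where e0: "eps0 > 0" "\<And>eps. 0 < eps \<Longrightarrow> eps < eps0 \<Longrightarrow>
     local_orientation_simplex bs y eps ` standard_simplex (length bs) \<subseteq> ball y r"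
    by (rule local_orientation_simplex_small[OF r(1)]) (rule that; assumption)
  define eps where "eps = eps0 / 2"
  have eps: "eps > 0" "local_orientation_simplex bs y eps ` standard_simplex (length bs) \<subseteq> U"
    using e0(1) e0(2)[of eps] r(2) by (auto simp: eps_def)
  have g: "rel_gen (length bs) P (P - {y}) (frag_of (local_orientation_simplex bs y eps))"
    by (rule local_orientation_gen(1)[OF ind dist U eps])
  then have "ch (length bs) P (frag_of (local_orientation_simplex bs y eps))"
    unfolding rel_gen_def rc_iff[OF Diff_subset] by blast
  then have "local_orientation_simplex bs y eps ` standard_simplex (length bs) \<subseteq> P"
    unfolding local_orientation_simplex_asx singular_chain_of singular_simplex_asx .
  then show thesis using that[OF eps(1) _ g] eps(2) by blast
qed

lemma oriented_cycle_fundamental: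
  fixes bs :: "'a::euclidean_space list"
  assumes "independent (set bs)" "distinct bs" and z: "oriented_cycle Y bs z" and U: "open U" "Y \<subseteq> U"
    and Y: "\<And>y. y \<in> Y \<Longrightarrow> Y \<inter> U = {z. z - y \<in> span (set bs)} \<inter> U"
  shows "fundamental_cycle Y bs z"
  unfolding fundamental_cycle_iff
proof (intro conjI ballI)
  show "lfs Y (length bs) Y z" "lf_boundary (length bs) z = 0" using z unfolding oriented_cycle_def by blast+
  fix y assume y: "y \<in> Y"
  then have yU: "y \<in> U" using U(2) by blast
  obtain eps where "eps > 0" "local_orientation_simplex bs y eps ` standard_simplex (length bs) \<subseteq> Y \<inter> U"
    by (rule small_orientation_simplex[OF assms(1,2) U(1) yU Y[OF y]]) (rule that; assumption)
  then show "\<exists>eps>0. local_orientation_simplex bs y eps ` standard_simplex (length bs) \<subseteq> Y \<and>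
      loc (length bs) Y y (z - lk (frag_of (local_orientation_simplex bs y eps)))"
    using oriented_cycle_loc[OF z y] by blast
qed

text \<open>Near \<open>y\<close> both \<open>P\<close> and \<open>Y\<close> are the affine space
  spanned by \<open>bs\<close>. A small orientation simplex generates its local homology, and the
  cycle has the same local class.\<close>

lemma oriented_cycle_lgen:
  fixes bs :: "'a::euclidean_space list"
  assumes "independent (set bs)" "distinct bs"
    and U: "open U" "y \<in> U" "P \<inter> U = {z. z - y \<in> span (set bs)} \<inter> U" "P \<inter> U \<subseteq> Y"
    and YP: "Y \<subseteq> P" "P \<subseteq> M" and z: "lfs M (length bs) P z" "oriented_cycle Y bs z"
  shows "lgen M (length bs) P y z"
proof -
  let ?d = "length bs"
  obtain eps where eps: "eps > 0" "local_orientation_simplex bs y eps ` standard_simplex ?d \<subseteq> P \<inter> U"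
      "rel_gen ?d P (P - {y}) (frag_of (local_orientation_simplex bs y eps))"
    by (rule small_orientation_simplex[OF assms(1,2) U(1-3)]) (rule that; assumption)
  let ?\<sigma> = "local_orientation_simplex bs y eps"
  have \<sigma>Y: "?\<sigma> ` standard_simplex ?d \<subseteq> Y" using eps(2) U(4) by blast
  have c: "ch ?d P (frag_of ?\<sigma>)" using eps(3) unfolding rel_gen_def rc_iff[OF Diff_subset] by blast
  have "y \<in> P \<inter> U" unfolding U(3) using U(2) by (simp add: span_zero)
  then have y: "y \<in> P" "y \<in> Y" using U(4) by blast+
  have 1: "lgen M ?d P y (lk (frag_of ?\<sigma>))" unfolding lgen_lk[OF c YP(2) y(1)] by (rule eps(3))
  have "loc ?d P y (z - lk (frag_of ?\<sigma>))"
    by (rule loc_mono[OF oriented_cycle_loc[OF z(2) y(2) eps(1) \<sigma>Y] YP(1)])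
  moreover have "lk (frag_of ?\<sigma>) - lf_scale 1 z = lf_scale (- 1) (z - lk (frag_of ?\<sigma>))"
    by (simp add: lf_scale_def fun_eq_iff)
  ultimately have "loc ?d P y (lk (frag_of ?\<sigma>) - lf_scale 1 z)"
    using loc_scale[of ?d P y "z - lk (frag_of ?\<sigma>)" "- 1"] by argo
  moreover have "avoids (?d - Suc 0) y (lf_boundary ?d z)"
    using z(2) unfolding oriented_cycle_def by simp
  ultimately show ?thesis using lgen_cong[OF 1 z(1)] by simp
qed

section \<open>Cycles in a filtration by cells\<close>

lemma ncell_push:
  assumes c: "ncell M P Q d y" and w: "relc M k P Q w" and d: "k \<noteq> d \<or> loc k P y w"
  obtains u w' where "lfs M (Suc k) P u" "lfs M k Q w'" "w = lf_boundary (Suc k) u + w'"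
    "lf_boundary k w' = lf_boundary k w"
proof -
  have c1: "\<forall>k w. k \<noteq> d \<longrightarrow> relc M k P Q w \<longrightarrow> triv M k P Q w"
    and c2: "\<forall>w. relc M d P Q w \<longrightarrow> loc d P y w \<longrightarrow> triv M d P Q w"
    using c unfolding ncell_def by blast+
  have "triv M k P Q w" using c1 c2 w d by (cases "k = d") auto
  then obtain u w' where u: "lfs M (Suc k) P u" "lfs M k Q w'" "w = lf_boundary (Suc k) u + w'"
    unfolding triv_def by blast
  have "lf_boundary k w = lf_boundary k w'"
    unfolding u(3) bd_add[OF lfs_bd'[OF u(1)] u(2)] bd_bd[OF u(1)] by simp
  then show thesis using that[OF u] by simp
qed

lemma relc_cycle: "lfs M k P w \<Longrightarrow> lf_boundary k w = 0 \<Longrightarrow> relc M k P Q w"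
  by (simp add: relc_def)

text \<open>No cell of dimension \<open>k\<close> obstructs, so the cycle is pushed from each piece
  into the next until it reaches the empty set.\<close>

lemma filtration_bounds:
  assumes step: "\<And>i. i < N \<Longrightarrow> P (Suc i) = P i \<or> (\<exists>y. ncell M (P i) (P (Suc i)) (d i) y) \<and> d i \<noteq> k"
    and i: "i \<le> N" and N: "P N = {}" and w: "lfs M k (P i) w" "lf_boundary k w = 0"
  shows "\<exists>u. lfs M (Suc k) (P i) u \<and> w = lf_boundary (Suc k) u"
  using i w
proof (induction "N - i" arbitrary: i w)
  case 0
  then have "lfs M k {} w" using N by simp
  then have "w f = 0" for f using nonempty_standard_simplex[of k] by (auto simp: lfs_def)
  then have "w = 0" by (simp add: fun_eq_iff)
  then show ?case by (intro exI[of _ 0] conjI lfs_0) (simp only: bd_zero)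
next
  case (Suc m i w)
  then have i: "i < N" "m = N - Suc i" by auto
  note IH = Suc.hyps(1)[OF i(2)]
  show ?case
  proof (cases "P (Suc i) = P i")
    case True
    have "\<exists>u. lfs M (Suc k) (P (Suc i)) u \<and> w = lf_boundary (Suc k) u"
      by (rule IH) (use Suc.prems(2,3) i(1) in \<open>simp_all add: True\<close>)
    then show ?thesis unfolding True .
  next
    case False
    then obtain y where y: "ncell M (P i) (P (Suc i)) (d i) y" "d i \<noteq> k" using step[OF i(1)] by blast
    have sub: "P (Suc i) \<subseteq> P i" using y(1) by (simp add: ncell_def)
    obtain u w' where u: "lfs M (Suc k) (P i) u" "lfs M k (P (Suc i)) w'" "w = lf_boundary (Suc k) u + w'"
        "lf_boundary k w' = lf_boundary k w"
      by (rule ncell_push[OF y(1) relc_cycle[OF Suc.prems(2,3)] disjI1[OF not_sym[OF y(2)]]]) (rule that; assumption)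
    have "\<exists>u. lfs M (Suc k) (P (Suc i)) u \<and> w' = lf_boundary (Suc k) u"
      by (rule IH[OF _ u(2)]) (use u(4) Suc.prems(3) i(1) in simp_all)
    then obtain u' where u': "lfs M (Suc k) (P (Suc i)) u'" "w' = lf_boundary (Suc k) u'" by blast
    have "w = lf_boundary (Suc k) (u + u')" unfolding u(3) u'(2) bd_add[OF u(1) u'(1)] ..
    then show ?thesis using lfs_add[OF u(1) lfs_mono[OF u'(1) sub]] by blast
  qed
qed

text \<open>The chains \<open>z i\<close> have zero boundary in \<open>M\<close>, not just relative
  to \<open>P (Suc i)\<close>. Hence all connecting maps vanish and the dimensions of successive
  cells may come in any order.\<close>

locale cell_filtration =
  fixes M :: "'a::euclidean_space set" and N :: nat and P :: "nat \<Rightarrow> 'a set" and d :: "nat \<Rightarrow> nat"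
    and y :: "nat \<Rightarrow> 'a" and z :: "nat \<Rightarrow> 'a lf_chain"
  assumes P0: "P 0 = M" and PN: "P N = {}"
    and cell: "\<And>i. i < N \<Longrightarrow> ncell M (P i) (P (Suc i)) (d i) (y i)"
    and z: "\<And>i. i < N \<Longrightarrow> lfs M (d i) (P i) (z i)" "\<And>i. i < N \<Longrightarrow> lf_boundary (d i) (z i) = 0"
    and gen: "\<And>i. i < N \<Longrightarrow> lgen M (d i) (P i) (y i) (z i)"
begin

lemma P_Suc: "i < N \<Longrightarrow> P (Suc i) \<subseteq> P i" using cell by (simp add: ncell_def)

lemma P_antimono: "i \<le> j \<Longrightarrow> j \<le> N \<Longrightarrow> P j \<subseteq> P i"
proof (induction j rule: dec_induct)
  case (step j) then show ?case using P_Suc[of j] by auto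
qed simp

lemma P_M: "i \<le> N \<Longrightarrow> P i \<subseteq> M" using P_antimono[of 0 i] P0 by simp

definition comb :: "nat \<Rightarrow> (nat \<Rightarrow> int) \<Rightarrow> nat \<Rightarrow> 'a lf_chain" where
  "comb k n i = (\<Sum>j\<in>{j\<in>{i..<N}. d j = k}. lf_scale (n j) (z j))"

lemma comb_Suc:
  assumes "i < N"
  shows "comb k n i = (if d i = k then lf_scale (n i) (z i) else 0) + comb k n (Suc i)"
proof -
  have "{j\<in>{i..<N}. d j = k} = (if d i = k then insert i {j\<in>{Suc i..<N}. d j = k} else {j\<in>{Suc i..<N}. d j = k})"
    using assms by (auto simp: le_eq_less_or_eq Suc_le_eq)
  then show ?thesis by (simp add: comb_def)
qed

lemma lfs_sum: "(\<And>j. j \<in> I \<Longrightarrow> lfs M k S (F j)) \<Longrightarrow> lfs M k S (sum F I)"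
  by (induction I rule: infinite_finite_induct) (auto intro: lfs_add)

lemma comb_lfs: "lfs M k (P i) (comb k n i)"
  unfolding comb_def
proof (rule lfs_sum)
  fix j assume "j \<in> {j\<in>{i..<N}. d j = k}"
  then have j: "i \<le> j" "j < N" "d j = k" by simp_all
  have "lfs M k (P j) (z j)" using z(1)[OF j(2)] j(3) by simp
  then show "lfs M k (P i) (lf_scale (n j) (z j))"
    using lfs_mono[OF lfs_scale P_antimono[OF j(1)]] j(2) by simp
qed

lemma scaled_cycle:
  assumes "i < N"
  shows "lfs M k (P i) (if k = d i then lf_scale a (z i) else 0)"
    and "lf_boundary k (if k = d i then lf_scale a (z i) else 0) = 0"
proof -
  have "lf_boundary (d i) (lf_scale a (z i)) = lf_scale a 0"
    unfolding bd_scale[OF z(1)[OF assms]] z(2)[OF assms] ..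
  also have "\<dots> = 0" by (simp add: lf_scale_def fun_eq_iff)
  finally show "lf_boundary k (if k = d i then lf_scale a (z i) else 0) = 0" by simp
  show "lfs M k (P i) (if k = d i then lf_scale a (z i) else 0)"
    using lfs_scale[OF z(1)[OF assms]] by simp
qed

text \<open>The local class at \<open>y i\<close> determines the coefficient of \<open>z i\<close>;
  after subtracting this multiple, the remaining cycle is pushed into
  \<open>P (Suc i)\<close>.\<close>

theorem spanning:
  assumes "i \<le> N" "lfs M k (P i) w" "lf_boundary k w = 0"
  shows "\<exists>n u. lfs M (Suc k) (P i) u \<and> w = lf_boundary (Suc k) u + comb k n i"
  using assms
proof (induction "N - i" arbitrary: i w)
  case 0
  then have "lfs M k {} w" using PN by simp
  then have "w f = 0" for f using nonempty_standard_simplex[of k] by (auto simp: lfs_def)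
  then have "w = 0" by (simp add: fun_eq_iff)
  moreover have "{j\<in>{i..<N}. d j = k} = {}" using 0 by auto
  then have "comb k n i = 0" for n unfolding comb_def by (simp only: sum.empty)
  ultimately show ?case
    by (intro exI[of _ "\<lambda>_. 0"] exI[of _ 0] conjI lfs_0) (simp only: bd_zero add_0)
next
  case (Suc m i w)
  then have i: "i < N" "m = N - Suc i" by auto
  note IH = Suc.hyps(1)[OF i(2)]
  obtain a where a: "k = d i \<Longrightarrow> loc k (P i) (y i) (w - lf_scale a (z i))"
  proof (cases "k = d i")
    case True
    then have "\<exists>a. loc (d i) (P i) (y i) (w - lf_scale a (z i))"
      by (intro lgen_ex[OF gen[OF i(1)]]) (use Suc.prems(2,3) in simp_all)
    then obtain a where "loc (d i) (P i) (y i) (w - lf_scale a (z i))" by blast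
    then have "loc k (P i) (y i) (w - lf_scale a (z i))" unfolding True .
    then show thesis by (rule that)
  qed (rule that, blast)
  define v where "v = (if k = d i then lf_scale a (z i) else 0)"
  have v: "lfs M k (P i) v" "lf_boundary k v = 0" unfolding v_def by (rule scaled_cycle[OF i(1)])+
  have wv: "lfs M k (P i) (w - v)" "lf_boundary k (w - v) = 0"
    unfolding bd_diff[OF Suc.prems(2) v(1)] v(2) Suc.prems(3)
    by (rule lfs_diff[OF Suc.prems(2) v(1)] diff_self)+
  have "k \<noteq> d i \<or> loc k (P i) (y i) (w - v)" using a by (simp add: v_def)
  then obtain u w' where u: "lfs M (Suc k) (P i) u" "lfs M k (P (Suc i)) w'" "w - v = lf_boundary (Suc k) u + w'"
      "lf_boundary k w' = lf_boundary k (w - v)"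
    by (rule ncell_push[OF cell[OF i(1)] relc_cycle[OF wv]]) (rule that; assumption)
  have "\<exists>n u. lfs M (Suc k) (P (Suc i)) u \<and> w' = lf_boundary (Suc k) u + comb k n (Suc i)"
    by (rule IH[OF _ u(2)]) (use u(4) wv(2) i(1) in simp_all)
  then obtain n u' where u': "lfs M (Suc k) (P (Suc i)) u'"
      "w' = lf_boundary (Suc k) u' + comb k n (Suc i)" by blast
  have "comb k (n(i := a)) i = v + comb k n (Suc i)"
  proof -
    have "comb k (n(i := a)) (Suc i) = comb k n (Suc i)" unfolding comb_def by (rule sum.cong) auto
    then show ?thesis unfolding comb_Suc[OF i(1)] by (auto simp: v_def)
  qed
  moreover have "w = (w - v) + v" by simp
  ultimately have "w = lf_boundary (Suc k) (u + u') + comb k (n(i := a)) i"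
    unfolding bd_add[OF u(1) u'(1)] u(3) u'(2) by (simp add: add.assoc)
  then show ?case using lfs_add[OF u(1) lfs_mono[OF u'(1) P_Suc[OF i(1)]]] by blast
qed

text \<open>Localising at \<open>y i\<close> reads off \<open>n i\<close>, since boundaries and all
  later cycles are trivial there. For the next step the bounding chain itself must be pushed into
  \<open>P (Suc i)\<close>. If it has the dimension of the cell, a multiple of the cycle
  \<open>z i\<close> is subtracted first, which leaves its boundary unchanged.\<close>

theorem independence:
  assumes "i \<le> N" "lfs M (Suc k) (P i) u" "comb k n i = lf_boundary (Suc k) u" "j \<in> {i..<N}" "d j = k"
  shows "n j = 0"
  using assms
proof (induction "N - i" arbitrary: i u)
  case 0 then show ?case by simp
next
  case (Suc m i u)
  then have i: "i < N" "m = N - Suc i" by auto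
  note IH = Suc.hyps(1)[OF i(2)]
  note c = cell[OF i(1)]
  have yi: "y i \<in> M" "y i \<notin> P (Suc i)" using c P_M[of i] i(1) by (auto simp: ncell_def)
  have ni: "n i = 0" if "d i = k"
  proof (rule lgen_uniq[OF gen[OF i(1)]])
    have "loc k (P i) (y i) (comb k n i)" unfolding Suc.prems(3) by (rule loc_bd[OF Suc.prems(2) yi(1)])
    moreover have "loc k (P i) (y i) (comb k n (Suc i))"
      by (rule loc_avoids[OF avoids_lfs[OF comb_lfs yi(2)]])
    ultimately have "loc k (P i) (y i) (comb k n i - comb k n (Suc i))" by (rule loc_diff)
    then show "loc (d i) (P i) (y i) (lf_scale (n i) (z i))" using that comb_Suc[OF i(1), of k n] by simp
  qed
  have C: "comb k n i = comb k n (Suc i)"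
    unfolding comb_Suc[OF i(1)] using ni by (auto simp: lf_scale_lincomb)
  have ub: "lfs M k (P (Suc i)) (lf_boundary (Suc k) u)"
    unfolding Suc.prems(3)[symmetric] C by (rule comb_lfs)
  obtain a where a: "Suc k = d i \<Longrightarrow> loc (Suc k) (P i) (y i) (u - lf_scale a (z i))"
  proof (cases "Suc k = d i")
    case True
    have "avoids (d i - Suc 0) (y i) (lf_boundary (d i) u)"
      using avoids_lfs[OF ub yi(2)] unfolding True[symmetric] by simp
    from lgen_ex[OF gen[OF i(1)] _ this] Suc.prems(2) True
    have "\<exists>a. loc (d i) (P i) (y i) (u - lf_scale a (z i))" by simp
    then obtain a where "loc (d i) (P i) (y i) (u - lf_scale a (z i))" by blast
    then have "loc (Suc k) (P i) (y i) (u - lf_scale a (z i))" unfolding True .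
    then show thesis by (rule that)
  qed (rule that, blast)
  define v where "v = (if Suc k = d i then lf_scale a (z i) else 0)"
  have v: "lfs M (Suc k) (P i) v" "lf_boundary (Suc k) v = 0" unfolding v_def by (rule scaled_cycle[OF i(1)])+
  have uv: "lfs M (Suc k) (P i) (u - v)" "lf_boundary (Suc k) (u - v) = lf_boundary (Suc k) u"
    unfolding bd_diff[OF Suc.prems(2) v(1)] v(2) by (rule lfs_diff[OF Suc.prems(2) v(1)] diff_zero)+
  have r: "relc M (Suc k) (P i) (P (Suc i)) (u - v)" using uv ub by (simp add: relc_def)
  have "Suc k \<noteq> d i \<or> loc (Suc k) (P i) (y i) (u - v)" using a by (simp add: v_def)
  then obtain u1 u' where "lfs M (Suc (Suc k)) (P i) u1" and u': "lfs M (Suc k) (P (Suc i)) u'"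
      and "u - v = lf_boundary (Suc (Suc k)) u1 + u'"
      and u'': "lf_boundary (Suc k) u' = lf_boundary (Suc k) (u - v)"
    by (rule ncell_push[OF c r]) (rule that; assumption)
  show ?case
  proof (cases "j = i")
    case True then show ?thesis using ni Suc.prems(5) by simp
  next
    case False
    show ?thesis by (rule IH[OF _ u']) (use False Suc.prems(3-5) i(1) C uv(2) u'' in simp_all)
  qed
qed

end

section \<open>From cycles to homology classes\<close>

lemma abelian_group_basis_BM:
  fixes M :: "'a::euclidean_space set"
  assumes I: "finite I" and z: "\<And>i. i \<in> I \<Longrightarrow> lfs M k M (z i) \<and> lf_boundary k (z i) = 0"
    and b: "\<And>i. i \<in> I \<Longrightarrow> b i = BM_class k (top_of_set M) (z i)"
    and span: "\<And>w. lfs M k M w \<Longrightarrow> lf_boundary k w = 0 \<Longrightarrow>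
       \<exists>n u. lfs M (Suc k) M u \<and> w = lf_boundary (Suc k) u + (\<Sum>i\<in>I. lf_scale (n i) (z i))"
    and indep: "\<And>n u i. lfs M (Suc k) M u \<Longrightarrow> (\<Sum>i\<in>I. lf_scale (n i) (z i)) = lf_boundary (Suc k) u \<Longrightarrow> i \<in> I \<Longrightarrow> n i = 0"
  shows "abelian_group_basis (BM_homology_group k (top_of_set M)) I b"
proof -
  let ?X = "top_of_set M"
  let ?Z = "lf_cycle_group k ?X" and ?B = "lf_boundaries k ?X" and ?G = "BM_homology_group k ?X"
  let ?cl = "BM_class k ?X"
  interpret Z: comm_group ?Z by (rule comm_group_lf_cycle_group)
  interpret G: comm_group ?G by (rule comm_group_BM_homology_group)
  have lfs_iff: "lfs M j M w \<longleftrightarrow> lf_singular_chain j ?X w" for j w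
  proof -
    have "f ` standard_simplex j \<subseteq> M" if "lf_singular_chain j ?X w" "w f \<noteq> 0" for f
      using that by (auto simp: lf_singular_chain_def singular_simplex_subtopology)
    then show ?thesis by (auto simp: lfs_def)
  qed
  have car: "w \<in> carrier ?Z \<longleftrightarrow> lfs M k M w \<and> lf_boundary k w = 0" for w
    by (simp add: lf_cycle_group_def lfs_iff zero_fun_def)
  have B: "w \<in> ?B \<longleftrightarrow> (\<exists>u. lfs M (Suc k) M u \<and> w = lf_boundary (Suc k) u)" for w
    by (auto simp: lf_boundaries_def lfs_iff)
  interpret N: normal ?B ?Z by (rule Z.subgroup_imp_normal[OF subgroup_lf_boundaries])
  have hom: "?cl \<in> hom ?Z ?G"
    unfolding BM_homology_group_def BM_class_def by (rule N.r_coset_hom_Mod)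
  interpret h: group_hom ?Z ?G ?cl by unfold_locales (rule hom)
  have mult: "x \<otimes>\<^bsub>?Z\<^esub> w = x + w" for x w by (simp add: lf_cycle_group_def plus_fun_def)
  have one: "\<one>\<^bsub>?Z\<^esub> = 0" by (simp add: lf_cycle_group_def zero_fun_def)
  have inv: "inv\<^bsub>?Z\<^esub> w = - w" if w: "w \<in> carrier ?Z" for w
  proof (rule Z.inv_equality)
    have "lfs M k M w" "lf_boundary k w = 0" using w car by blast+
    then show "- w \<in> carrier ?Z" unfolding car by (simp only: lfs_uminus bd_uminus minus_zero simp_thms)
    show "- w \<otimes>\<^bsub>?Z\<^esub> w = \<one>\<^bsub>?Z\<^esub>" unfolding mult one by (rule left_minus)
  qed (rule w)
  have pown: "w [^]\<^bsub>?Z\<^esub> (n::nat) = lf_scale (int n) w" for w n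
  proof (induction n)
    case 0 show ?case unfolding Z.nat_pow_0 one by (simp add: lf_scale_def fun_eq_iff)
  next
    case (Suc n) show ?case unfolding Z.nat_pow_Suc mult Suc by (simp add: lf_scale_def fun_eq_iff algebra_simps)
  qed
  have pow: "w [^]\<^bsub>?Z\<^esub> (n::int) = lf_scale n w" if w: "w \<in> carrier ?Z" for w n
  proof (cases "n \<ge> 0")
    case True
    then have n: "\<not> n < 0" "int (nat n) = n" by simp_all
    have "w [^]\<^bsub>?Z\<^esub> n = w [^]\<^bsub>?Z\<^esub> (nat n)" unfolding int_pow_def2 by (rule if_not_P[OF n(1)])
    then show ?thesis unfolding pown n(2) .
  next
    case False
    have c: "w [^]\<^bsub>?Z\<^esub> nat (- n) \<in> carrier ?Z" by (rule Z.nat_pow_closed[OF w])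
    have n: "n < 0" "- int (nat (- n)) = n" using False by simp_all
    have "w [^]\<^bsub>?Z\<^esub> n = inv\<^bsub>?Z\<^esub> (w [^]\<^bsub>?Z\<^esub> nat (- n))" unfolding int_pow_def2 by (rule if_P[OF n(1)])
    also have "\<dots> = lf_scale (- int (nat (- n))) w"
      unfolding inv[OF c] unfolding pown by (simp only: lf_scale_lincomb)
    finally show ?thesis unfolding n(2) .
  qed
  have comb_car: "(\<Sum>i\<in>J. lf_scale (n i) (z i)) \<in> carrier ?Z \<and>
      (\<Otimes>\<^bsub>?G\<^esub>i\<in>J. b i [^]\<^bsub>?G\<^esub> n i) = ?cl (\<Sum>i\<in>J. lf_scale (n i) (z i))" if "J \<subseteq> I" for J n
    using finite_subset[OF that I] that
  proof (induction J rule: finite_induct)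
    case empty
    show ?case using h.hom_one by (simp add: one[symmetric])
  next
    case (insert i J)
    then have i: "i \<in> I" and IH: "(\<Sum>i\<in>J. lf_scale (n i) (z i)) \<in> carrier ?Z"
        "(\<Otimes>\<^bsub>?G\<^esub>i\<in>J. b i [^]\<^bsub>?G\<^esub> n i) = ?cl (\<Sum>i\<in>J. lf_scale (n i) (z i))" by auto
    have zi: "z i \<in> carrier ?Z" using z[OF i] car by simp
    have s: "lf_scale (n i) (z i) \<in> carrier ?Z" unfolding pow[OF zi, symmetric] using zi by simp
    have bi: "b j [^]\<^bsub>?G\<^esub> n j \<in> carrier ?G" if "j \<in> insert i J" for j
      using b[of j] z[of j] car insert.prems that by auto
    have e: "b i [^]\<^bsub>?G\<^esub> n i = ?cl (lf_scale (n i) (z i))"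
      unfolding b[OF i] pow[OF zi, symmetric] by (rule h.hom_int_pow[OF zi, symmetric])
    have "(\<Otimes>\<^bsub>?G\<^esub>i\<in>insert i J. b i [^]\<^bsub>?G\<^esub> n i) = b i [^]\<^bsub>?G\<^esub> n i \<otimes>\<^bsub>?G\<^esub> (\<Otimes>\<^bsub>?G\<^esub>i\<in>J. b i [^]\<^bsub>?G\<^esub> n i)"
      by (rule G.finprod_insert) (use insert.hyps bi in auto)
    also have "\<dots> = ?cl (lf_scale (n i) (z i) + (\<Sum>i\<in>J. lf_scale (n i) (z i)))"
      unfolding e IH(2) mult[symmetric] by (rule h.hom_mult[OF s IH(1), symmetric])
    finally show ?case
      using Z.m_closed[OF s IH(1)] unfolding sum.insert[OF insert.hyps] mult by (intro conjI)
  qed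
  have cl_eq: "?cl v = ?cl w \<Longrightarrow> v - w \<in> ?B" if vw: "v \<in> carrier ?Z" "w \<in> carrier ?Z" for v w
  proof -
    assume eq: "?cl v = ?cl w"
    have "v \<in> ?cl v" unfolding BM_class_def by (rule Z.rcos_self[OF vw(1) subgroup_lf_boundaries])
    then have "v \<in> ?cl w" unfolding eq .
    then obtain x where "x \<in> ?B" "v = x \<otimes>\<^bsub>?Z\<^esub> w" unfolding BM_class_def r_coset_def by blast
    then show ?thesis by (simp add: mult)
  qed
  have cl_eq': "?cl v = ?cl w" if vw: "v - w \<in> ?B" "w \<in> carrier ?Z" for v w
  proof -
    have "v = (v - w) \<otimes>\<^bsub>?Z\<^esub> w" by (simp add: mult)
    then have "v \<in> ?B #>\<^bsub>?Z\<^esub> w" using vw(1) unfolding r_coset_def by blast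
    then show ?thesis unfolding BM_class_def
      using Z.repr_independence[OF _ vw(2) subgroup_lf_boundaries] by simp
  qed
  have keys_sum: "(\<Sum>i\<in>Poly_Mapping.keys c. lf_scale (lk' c i) (z i)) = (\<Sum>i\<in>I. lf_scale (Poly_Mapping.lookup c i) (z i))"
    if "Poly_Mapping.keys c \<subseteq> I" "lk' = Poly_Mapping.lookup" for c :: "'b \<Rightarrow>\<^sub>0 int" and lk'
    unfolding that(2) by (rule sum.mono_neutral_left[OF I that(1)]) (auto simp: in_keys_iff lf_scale_lincomb)
  show ?thesis unfolding abelian_group_basis_def
  proof (intro conjI ballI)
    show "b \<in> I \<rightarrow> carrier ?G" using b z car by auto
    fix g assume "g \<in> carrier ?G"
    then obtain w where w: "w \<in> carrier ?Z" "g = ?cl w"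
      unfolding BM_homology_group_def BM_class_def carrier_FactGroup by auto
    obtain n u where nu: "lfs M (Suc k) M u" "w = lf_boundary (Suc k) u + (\<Sum>i\<in>I. lf_scale (n i) (z i))"
      using span w(1) car by blast
    define c where "c = Abs_poly_mapping (\<lambda>i. if i \<in> I then n i else 0)"
    have lc: "Poly_Mapping.lookup c = (\<lambda>i. if i \<in> I then n i else 0)"
      unfolding c_def by (rule lookup_Abs_poly_mapping) (use I in \<open>auto intro: finite_subset[of _ I]\<close>)
    have kc: "Poly_Mapping.keys c \<subseteq> I" by (auto simp: in_keys_iff lc split: if_splits)
    show "\<exists>!c::'b \<Rightarrow>\<^sub>0 int. Poly_Mapping.keys c \<subseteq> I \<and>
        g = (\<Otimes>\<^bsub>?G\<^esub>i\<in>Poly_Mapping.keys c. b i [^]\<^bsub>?G\<^esub> Poly_Mapping.lookup c i)"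
    proof (rule ex1I[of _ c], intro conjI)
      show "Poly_Mapping.keys c \<subseteq> I" by (rule kc)
      have s: "(\<Sum>i\<in>Poly_Mapping.keys c. lf_scale (Poly_Mapping.lookup c i) (z i)) = (\<Sum>i\<in>I. lf_scale (n i) (z i))"
        unfolding keys_sum[OF kc refl] by (rule sum.cong) (auto simp: lc)
      have "w - (\<Sum>i\<in>I. lf_scale (n i) (z i)) \<in> ?B" unfolding B using nu by auto
      then show "g = (\<Otimes>\<^bsub>?G\<^esub>i\<in>Poly_Mapping.keys c. b i [^]\<^bsub>?G\<^esub> Poly_Mapping.lookup c i)"
        using comb_car[OF kc, of "Poly_Mapping.lookup c"] comb_car[OF subset_refl, of n] cl_eq' unfolding w(2) s by simp
    next
      fix c' :: "'b \<Rightarrow>\<^sub>0 int" assume c': "Poly_Mapping.keys c' \<subseteq> I \<and>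
        g = (\<Otimes>\<^bsub>?G\<^esub>i\<in>Poly_Mapping.keys c'. b i [^]\<^bsub>?G\<^esub> Poly_Mapping.lookup c' i)"
      let ?s = "\<Sum>i\<in>I. lf_scale (Poly_Mapping.lookup c' i) (z i)"
      have s: "(\<Sum>i\<in>Poly_Mapping.keys c'. lf_scale (Poly_Mapping.lookup c' i) (z i)) = ?s"
        using keys_sum[of c' Poly_Mapping.lookup] c' by simp
      have "?cl w = ?cl ?s" "?s \<in> carrier ?Z"
        using c' comb_car[of "Poly_Mapping.keys c'" "Poly_Mapping.lookup c'"] unfolding w(2) s by auto
      then have "w - ?s \<in> ?B" using cl_eq[OF w(1)] by blast
      then obtain u' where u': "lfs M (Suc k) M u'" "w - ?s = lf_boundary (Suc k) u'" using B by blast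
      have "(\<Sum>i\<in>I. lf_scale (Poly_Mapping.lookup c' i - n i) (z i)) = ?s - (\<Sum>i\<in>I. lf_scale (n i) (z i))"
        by (simp add: lf_scale_lincomb sum_subtractf)
      also have "\<dots> = lf_boundary (Suc k) (u - u')"
        unfolding bd_diff[OF nu(1) u'(1)] u'(2)[symmetric] using nu(2) by simp
      finally have "Poly_Mapping.lookup c' i - n i = 0" if "i \<in> I" for i
        using indep[OF lfs_diff[OF nu(1) u'(1)], of "\<lambda>i. Poly_Mapping.lookup c' i - n i"] that by blast
      moreover have "Poly_Mapping.lookup c' i = 0" if "i \<notin> I" for i
        using c' that by (auto simp: in_keys_iff)
      ultimately show "c' = c" by (intro poly_mapping_eqI) (auto simp: lc)
    qed
  qed
qed

text \<open>All fundamental cycles differ from \<open>z\<close> by boundaries in \<open>M\<close>,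
  so the definite description has exactly one candidate.\<close>

lemma BM_fundamental_class_eq:
  fixes M :: "'a::euclidean_space set"
  assumes z: "fundamental_cycle Y bs z" "lfs M (length bs) M z" "lf_boundary (length bs) z = 0"
    and u: "\<And>c. fundamental_cycle Y bs c \<Longrightarrow> \<exists>u. lfs M (Suc (length bs)) M u \<and> c - z = lf_boundary (Suc (length bs)) u"
  shows "BM_fundamental_class M Y bs = BM_class (length bs) (top_of_set M) z"
  unfolding BM_fundamental_class_def
proof (rule the_equality)
  let ?k = "length bs" and ?X = "top_of_set M"
  show "\<exists>c. fundamental_cycle Y bs c \<and> BM_class ?k ?X z = BM_class ?k ?X c" using z(1) by blast
  interpret Z: comm_group "lf_cycle_group ?k ?X" by (rule comm_group_lf_cycle_group)
  have zc: "z \<in> carrier (lf_cycle_group ?k ?X)"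
    using z(2,3) by (simp add: lf_cycle_group_def lfs_def zero_fun_def)
  fix \<xi> assume "\<exists>c. fundamental_cycle Y bs c \<and> \<xi> = BM_class ?k ?X c"
  then obtain c where c: "fundamental_cycle Y bs c" "\<xi> = BM_class ?k ?X c" by blast
  obtain u where u: "lfs M (Suc ?k) M u" "c - z = lf_boundary (Suc ?k) u" using assms(4)[OF c(1)] by blast
  have "c - z \<in> lf_boundaries ?k ?X" using u by (auto simp: lf_boundaries_def lfs_def)
  moreover have "c = (c - z) \<otimes>\<^bsub>lf_cycle_group ?k ?X\<^esub> z" by (simp add: lf_cycle_group_def fun_eq_iff)
  ultimately have "c \<in> lf_boundaries ?k ?X #>\<^bsub>lf_cycle_group ?k ?X\<^esub> z" unfolding r_coset_def by blast
  then show "\<xi> = BM_class ?k ?X z" unfolding BM_class_def c(2)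
    using Z.repr_independence[OF _ zc subgroup_lf_boundaries] by simp
qed

section \<open>Vertices and chambers\<close>

locale flagged_arrangement = arrangement A a b for A :: "(real ^ 'n) set set" and a b +
  fixes F :: "nat \<Rightarrow> (real ^ 'n) set" and h :: "nat \<Rightarrow> real ^ 'n \<Rightarrow> real"
  assumes gf: "generic_flag A F" and ff: "flag_forms F h" and fp: "flag_position A F h"
begin

definition lin :: "nat \<Rightarrow> real ^ 'n \<Rightarrow> real" where "lin i u = h i u - h i 0"

text \<open>The sign cell of \<open>x\<close> with respect to \<open>B\<close>, empty if
  \<open>x\<close> lies on a hyperplane of \<open>B\<close>. The product form treats both signs at
  once.\<close>

definition cell :: "(real ^ 'n) set set \<Rightarrow> real ^ 'n \<Rightarrow> (real ^ 'n) set" where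
  "cell B x = {w. \<forall>H\<in>B. val H w * val H x > 0}"

definition ccell :: "(real ^ 'n) set set \<Rightarrow> real ^ 'n \<Rightarrow> nat \<Rightarrow> (real ^ 'n) set" where
  "ccell B x q = {w \<in> F q. \<forall>H\<in>B. val H w * val H x \<ge> 0}"

lemma F_iff:
  assumes "q \<le> CARD('n)" shows "x \<in> F q \<longleftrightarrow> (\<forall>i\<in>{q+1..CARD('n)}. h i x = 0)"
proof (cases "q = CARD('n)")
  case True then show ?thesis using gf by (simp add: generic_flag_def)
next
  case False
  then have "q < DIM(real ^ 'n)" using assms by simp
  then have "F q = {x. \<forall>i\<in>{q+1..DIM(real ^ 'n)}. h i x = 0}" using ff unfolding flag_forms_def by blast
  then show ?thesis by simp
qed

lemma F_mono: "q \<le> r \<Longrightarrow> r \<le> CARD('n) \<Longrightarrow> F q \<subseteq> F r"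
  by (auto simp: F_iff)

lemma linear_lin: "i \<in> {1..CARD('n)} \<Longrightarrow> linear (lin i)"
  and h_lin: "i \<in> {1..CARD('n)} \<Longrightarrow> h i (x + u) = h i x + lin i u"
proof -
  assume "i \<in> {1..CARD('n)}"
  then have "affine_form (h i)" using ff by (simp add: flag_forms_def)
  then obtain g c where g: "linear g" "h i = (\<lambda>x. g x + c)" by (auto simp: affine_form_def)
  have "lin i = g" using linear_0[OF g(1)] by (auto simp: lin_def g(2))
  then show "linear (lin i)" "h i (x + u) = h i x + lin i u" using g by (simp_all add: linear_add)
qed

lemma lin_scale: "i \<in> {1..CARD('n)} \<Longrightarrow> lin i (t *\<^sub>R u) = t * lin i u"
  using linear_scale[OF linear_lin] by simp

lemma lin_diff: "i \<in> {1..CARD('n)} \<Longrightarrow> lin i (x - w) = h i x - h i w"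
  using h_lin[of i w "x - w"] by simp

lemma h_line: "i \<in> {1..CARD('n)} \<Longrightarrow> h i (x + t *\<^sub>R u) = h i x + t * lin i u"
  by (simp add: h_lin lin_scale)

lemma cont_h: "i \<in> {1..CARD('n)} \<Longrightarrow> continuous_on S (h i)"
  using ff by (intro affine_form_continuous) (simp add: flag_forms_def)

lemma F_line:
  assumes "q \<le> CARD('n)" "x \<in> F q" "\<And>i. i \<in> {q+1..CARD('n)} \<Longrightarrow> lin i u = 0"
  shows "x + t *\<^sub>R u \<in> F q"
  using assms by (auto simp: F_iff h_line)

lemma F_dir:
  assumes "q \<le> CARD('n)" "x \<in> F q" "w \<in> F q" "i \<in> {q+1..CARD('n)}" shows "lin i (x - w) = 0"
  using assms by (auto simp: F_iff lin_diff)

lemma F_segment: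
  assumes "q \<le> CARD('n)" "x \<in> F q" "w \<in> F q" shows "x + t *\<^sub>R (w - x) \<in> F q"
  by (rule F_line[OF assms(1,2)]) (rule F_dir[OF assms(1,3,2)])

lemma F_pred:
  assumes "1 \<le> q" "q \<le> CARD('n)" "x \<in> F q" shows "x \<in> F (q - 1) \<longleftrightarrow> h q x = 0"
proof -
  have "{q - 1 + 1..CARD('n)} = insert q {q+1..CARD('n)}" using assms by auto
  then show ?thesis using assms by (simp add: F_iff)
qed

lemma flat_through: "B \<subseteq> A \<Longrightarrow> w \<in> \<Inter>B \<Longrightarrow> \<Inter>B \<in> flats A"
  by (auto simp: flats_def)

lemma aff_dim_flat:
  assumes "X \<in> flats A" "q \<le> CARD('n)" "w \<in> X" "w \<in> F q"
  shows "aff_dim (F q \<inter> X) = int q + aff_dim X - int CARD('n)"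
proof -
  have "\<forall>q\<le>CARD('n). \<forall>X\<in>flats A. if int q + aff_dim X - int CARD('n) \<ge> 0
        then aff_dim (F q \<inter> X) = int q + aff_dim X - int CARD('n) else F q \<inter> X = {}"
    using gf by (simp add: generic_flag_def)
  moreover have "F q \<inter> X \<noteq> {}" using assms by blast
  ultimately show ?thesis using assms(1,2) by (meson)
qed

lemma flat_misses:
  assumes "X \<in> flats A" "q \<le> CARD('n)" "int q + aff_dim X < int CARD('n)"
  shows "F q \<inter> X = {}"
proof -
  have "\<forall>q\<le>CARD('n). \<forall>X\<in>flats A. if int q + aff_dim X - int CARD('n) \<ge> 0
        then aff_dim (F q \<inter> X) = int q + aff_dim X - int CARD('n) else F q \<inter> X = {}"
    using gf by (simp add: generic_flag_def)
  then show ?thesis using assms by (auto split: if_splits)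
qed

lemma flat_meets:
  assumes "X \<in> flats A" "q \<le> CARD('n)" "int q + aff_dim X \<ge> int CARD('n)"
  shows "F q \<inter> X \<noteq> {}"
proof -
  have "\<forall>q\<le>CARD('n). \<forall>X\<in>flats A. if int q + aff_dim X - int CARD('n) \<ge> 0
        then aff_dim (F q \<inter> X) = int q + aff_dim X - int CARD('n) else F q \<inter> X = {}"
    using gf by (simp add: generic_flag_def)
  then have "aff_dim (F q \<inter> X) = int q + aff_dim X - int CARD('n)" using assms by simp
  then show ?thesis using assms(3) by (auto simp: aff_dim_empty)
qed

lemma aff_dim_point_flat:
  assumes "X \<in> flats A" "q \<le> CARD('n)" "X \<inter> F q = {w}"
  shows "aff_dim X = int CARD('n) - int q"
proof -
  have w: "w \<in> X" "w \<in> F q" using assms(3) by auto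
  have "F q \<inter> X = {w}" using assms(3) by auto
  then have "aff_dim (F q \<inter> X) = 0" by (simp add: aff_dim_sing)
  then show ?thesis using aff_dim_flat[OF assms(1,2) w] by simp
qed

lemma point_flat_unique:
  assumes "X \<in> flats A" "X' \<in> flats A" "1 \<le> q" "q \<le> CARD('n)" "X \<inter> F q = {w}" "X' \<inter> F q = {w'}" "h q w = h q w'"
  shows "X = X'"
proof (rule ccontr)
  assume ne: "X \<noteq> X'"
  have "h q ` (X \<inter> F q) \<noteq> h q ` (X' \<inter> F q)"
    using fp assms(1-4) ne aff_dim_point_flat[OF assms(1,4,5)] aff_dim_point_flat[OF assms(2,4,6)]
    unfolding flag_position_def by (auto simp: atLeastAtMost_iff)
  then show False using assms(5-7) by simp
qed

text \<open>A flat that meets \<open>F q\<close> in more than a point is not parallel to \<open>F (q - 1)\<close>.\<close>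

lemma descent_direction:
  assumes K: "K \<subseteq> A" and q: "1 \<le> q" "q \<le> CARD('n)" and w: "w \<in> \<Inter>K \<inter> F q" "\<Inter>K \<inter> F q \<noteq> {w}"
  obtains u where "\<And>H. H \<in> K \<Longrightarrow> dir H u = 0" "\<And>i. i \<in> {q+1..CARD('n)} \<Longrightarrow> lin i u = 0" "lin q u < 0"
proof -
  let ?X = "\<Inter>K"
  have X: "?X \<in> flats A" using flat_through[OF K, of w] w(1) by blast
  have wX: "w \<in> ?X" "w \<in> F q" using w(1) by auto
  have e: "aff_dim (F q \<inter> ?X) = int q + aff_dim ?X - int CARD('n)" by (rule aff_dim_flat[OF X q(2) wX])
  have ne: "F q \<inter> ?X \<noteq> {}" using wX by blast
  have "aff_dim (F q \<inter> ?X) \<noteq> 0"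
  proof
    assume "aff_dim (F q \<inter> ?X) = 0"
    then obtain c where "F q \<inter> ?X = {c}" by (auto simp: aff_dim_eq_0)
    then have "\<Inter>K \<inter> F q = {c}" by blast
    then show False using w by simp
  qed
  moreover have "aff_dim (F q \<inter> ?X) \<ge> 0" using ne aff_dim_negative_iff[of "F q \<inter> \<Inter>K"] by linarith
  ultimately have e1: "int q + aff_dim ?X - int CARD('n) \<ge> 1" using e by simp
  have q1: "q - 1 \<le> CARD('n)" using q by simp
  have iq: "int (q - 1) = int q - 1" using q by simp
  have "F (q - 1) \<inter> ?X \<noteq> {}" by (rule flat_meets[OF X q1]) (use e1 iq in simp)
  then obtain y0 where y0: "y0 \<in> F (q - 1)" "y0 \<in> ?X" by blast
  have "aff_dim (F (q - 1) \<inter> ?X) = int (q - 1) + aff_dim ?X - int CARD('n)" by (rule aff_dim_flat[OF X q1 y0(2,1)])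
  then have "F (q - 1) \<inter> ?X \<noteq> F q \<inter> ?X" using e iq by auto
  moreover have "F (q - 1) \<subseteq> F q" using F_mono q by simp
  ultimately obtain y1 where y1: "y1 \<in> F q" "y1 \<in> ?X" "y1 \<notin> F (q - 1)" by blast
  have y0F: "y0 \<in> F q" using y0(1) \<open>F (q - 1) \<subseteq> F q\<close> by blast
  have h0: "h q y0 = 0" "h q y1 \<noteq> 0" using F_pred[OF q y0F] F_pred[OF q y1(1)] y0 y1 by auto
  \<comment> \<open>\<open>y0\<close> and \<open>y1\<close> lie on the flat, and \<open>h q\<close>
    is 0 at \<open>y0\<close> because \<open>y0\<close> is in \<open>F (q - 1)\<close>; the sign
    factor turns the difference downwards.\<close>
  define u where "u = (- sgn (h q y1)) *\<^sub>R (y1 - y0)"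
  have qq: "q \<in> {1..CARD('n)}" using q by simp
  have "dir H u = 0" if "H \<in> K" for H
  proof -
    have "H \<in> A" "y0 \<in> H" "y1 \<in> H" using that K y0 y1 by auto
    then have "val H y1 - val H y0 = 0" using mem_H by simp
    then show ?thesis by (simp add: u_def val_diff)
  qed
  moreover have "lin i u = 0" if "i \<in> {q+1..CARD('n)}" for i
  proof -
    have "i \<in> {1..CARD('n)}" using that by simp
    show ?thesis unfolding u_def lin_scale[OF \<open>i \<in> {1..CARD('n)}\<close>] F_dir[OF q(2) y1(1) y0F that] by (rule mult_zero_right)
  qed
  moreover have "lin q u < 0"
    unfolding u_def lin_scale[OF qq] lin_diff[OF qq] using h0 by (simp add: sgn_if)
  ultimately show thesis by (rule that)
qed

lemma cell_ccell: "cell B x \<inter> F q \<subseteq> ccell B x q"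
  by (auto simp: ccell_def cell_def less_imp_le)

lemma cell_cong: "w \<in> cell B x \<Longrightarrow> cell B w = cell B x"
proof -
  assume "w \<in> cell B x"
  then have w: "val H w * val H x > 0" if "H \<in> B" for H using that by (simp add: cell_def)
  have "val H y * val H w > 0 \<longleftrightarrow> val H y * val H x > 0" if "H \<in> B" for H y
    using w[OF that] by (auto simp: zero_less_mult_iff)
  then show ?thesis unfolding cell_def by blast
qed

text \<open>Below every point of a closed cell on which \<open>h q\<close> is bounded below there is a vertex:
  move down along the flat through the point until another hyperplane is hit.\<close>

lemma descend:
  assumes B: "B \<subseteq> A" and q: "1 \<le> q" "q \<le> CARD('n)" and x: "\<And>H. H \<in> B \<Longrightarrow> val H x \<noteq> 0"
    and bdd: "\<And>w. w \<in> ccell B x q \<Longrightarrow> c \<le> h q w" and w: "w \<in> ccell B x q"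
  shows "\<exists>w'\<in>ccell B x q. \<Inter>{H\<in>B. w' \<in> H} \<inter> F q = {w'} \<and> h q w' \<le> h q w \<and> (w' \<noteq> w \<longrightarrow> h q w' < h q w)"
  using w
proof (induction "card {H\<in>B. w \<notin> H}" arbitrary: w rule: less_induct)
  case less
  note w = less.prems
  let ?K = "{H\<in>B. w \<in> H}"
  have qq: "q \<in> {1..CARD('n)}" using q by simp
  have finB: "finite B" using finite_subset[OF B finA] .
  have wF: "w \<in> \<Inter>?K \<inter> F q" using w by (auto simp: ccell_def)
  show ?case
  proof (cases "\<Inter>?K \<inter> F q = {w}")
    case True
    then show ?thesis using w by blast
  next
    case False
    have KA: "?K \<subseteq> A" using B by blast
    obtain u where u: "\<And>H. H \<in> ?K \<Longrightarrow> dir H u = 0" "\<And>i. i \<in> {q+1..CARD('n)} \<Longrightarrow> lin i u = 0" "lin q u < 0"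
      by (rule descent_direction[OF KA q wF False]) (rule that; assumption)
    \<comment> \<open>The hyperplanes approached when moving from \<open>w\<close> along
      \<open>u\<close>. If there were none, the ray would stay in the closed cell and
      \<open>h q\<close> would be unbounded below on it.\<close>
    define T where "T = {H\<in>B. val H x * dir H u < 0}"
    have bx: "val H w * val H x \<ge> 0" if "H \<in> B" for H using w that by (simp add: ccell_def)
    have bw: "val H w * val H x > 0" if "H \<in> T" for H
    proof -
      have "H \<in> B" "dir H u \<noteq> 0" using that by (auto simp: T_def)
      then have "w \<notin> H" using u(1)[of H] by blast
      then have "val H w \<noteq> 0" using mem_H \<open>H \<in> B\<close> B by blast
      then have "val H w * val H x \<noteq> 0" using x[OF \<open>H \<in> B\<close>] by simp
      then show ?thesis using bx[OF \<open>H \<in> B\<close>] by linarith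
    qed
    have line: "w + t *\<^sub>R u \<in> F q" for t by (rule F_line[OF q(2) _ u(2)]) (use wF in simp_all)
    have beta: "val H (w + t *\<^sub>R u) * val H x = val H w * val H x + t * (val H x * dir H u)" for H t
      by (simp add: val_add algebra_simps)
    have "T \<noteq> {}"
    proof
      assume "T = {}"
      then have "w + t *\<^sub>R u \<in> ccell B x q" if "t \<ge> 0" for t
        using bx line that by (auto simp: ccell_def beta T_def not_less intro!: add_nonneg_nonneg mult_nonneg_nonneg)
      from bdd[OF this] have "c \<le> h q w + t * lin q u" if "t \<ge> 0" for t using that h_line[OF qq] by simp
      \<comment> \<open>Chosen such that \<open>t * lin q u\<close> equals
        \<open>- (\<bar>h q w - c\<bar> + 1)\<close>, which leads below the bound
        \<open>c\<close>.\<close>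
      moreover define t where "t = (\<bar>h q w - c\<bar> + 1) / - lin q u"
      moreover have "t \<ge> 0" unfolding t_def using u(3) by (intro divide_nonneg_pos) auto
      moreover have "t * lin q u = - (\<bar>h q w - c\<bar> + 1)" using u(3) by (simp add: t_def)
      ultimately have "c \<le> h q w + - (\<bar>h q w - c\<bar> + 1)" by metis
      then show False by linarith
    qed
    \<comment> \<open>Hitting times. \<open>G\<close> is hit first, and stopping there preserves all
      weak inequalities.\<close>
    define r where "r H = - (val H w * val H x) / (val H x * dir H u)" for H
    have finT: "finite T" using finB by (simp add: T_def)
    obtain G where G: "G \<in> T" "\<And>H. H \<in> T \<Longrightarrow> r G \<le> r H"
      using finite_ne_induct arg_min_if_finite[OF finT \<open>T \<noteq> {}\<close>, of r] by (metis linorder_not_le)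
    have GB: "G \<in> B" "val G x * dir G u < 0" using G(1) by (auto simp: T_def)
    have rpos: "r G > 0" unfolding r_def by (rule divide_neg_neg) (use bw[OF G(1)] GB(2) in auto)
    define w' where "w' = w + r G *\<^sub>R u"
    have w': "w' \<in> ccell B x q" unfolding ccell_def w'_def
    proof (intro CollectI conjI ballI line)
      fix H assume H: "H \<in> B"
      show "0 \<le> val H (w + r G *\<^sub>R u) * val H x"
      proof (cases "H \<in> T")
        case True
        then have neg: "val H x * dir H u < 0" by (simp add: T_def)
        have "r H * (val H x * dir H u) \<le> r G * (val H x * dir H u)"
          using mult_right_mono_neg[OF G(2)[OF True]] neg by simp
        moreover have "r H * (val H x * dir H u) = - (val H w * val H x)" 
          using nonzero_eq_divide_eq[of "val H x * dir H u" "r H" "- (val H w * val H x)"] neg by (simp only: r_def less_imp_neq) simp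
        ultimately show ?thesis unfolding beta by simp
      next
        case False
        then have "0 \<le> val H x * dir H u" using H by (simp add: T_def)
        then show ?thesis unfolding beta using bx[OF H] rpos by simp
      qed
    qed
    have Gw': "w' \<in> G" "w \<notin> G"
    proof -
      have "val G w' * val G x = 0" unfolding w'_def beta using GB(2) by (auto simp: r_def)
      then show "w' \<in> G" using x[OF GB(1)] mem_H GB(1) B by auto
      show "w \<notin> G" using bw[OF G(1)] mem_H GB(1) B by auto
    qed
    have sub: "{H\<in>B. w' \<notin> H} \<subseteq> {H\<in>B. w \<notin> H}"
    proof clarify
      fix H assume H: "H \<in> B" "w' \<notin> H" "w \<in> H"
      then have "val H w' = 0" using u(1)[of H] mem_H B by (auto simp: w'_def val_add)
      then show False using H mem_H B by auto
    qed
    have "card {H\<in>B. w' \<notin> H} < card {H\<in>B. w \<notin> H}"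
      by (rule psubset_card_mono) (use finB sub Gw' GB(1) in auto)
    from less.hyps[OF this w'] obtain w2 where w2: "w2 \<in> ccell B x q" "\<Inter>{H\<in>B. w2 \<in> H} \<inter> F q = {w2}" "h q w2 \<le> h q w'"
      by blast
    have "h q w' < h q w" using h_line[OF qq] rpos u(3) by (simp add: w'_def mult_pos_neg)
    then show ?thesis using w2 by (intro bexI[of _ w2]) auto
  qed
qed

text \<open>A vertex is determined by the hyperplanes through it, so there are finitely many, and by
  descent the lowest one bounds \<open>h q\<close> from below. Distinct vertices have distinct
  heights by the general position of \<open>h q\<close>, which makes the minimum unique.\<close>

theorem min_vertex_exists:
  assumes B: "B \<subseteq> A" and q: "1 \<le> q" "q \<le> CARD('n)" and x: "\<And>H. H \<in> B \<Longrightarrow> val H x \<noteq> 0"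
    and bdd: "\<And>w. w \<in> ccell B x q \<Longrightarrow> c \<le> h q w" and w0: "w0 \<in> ccell B x q"
  obtains m where "m \<in> ccell B x q" "\<And>w. w \<in> ccell B x q \<Longrightarrow> w \<noteq> m \<Longrightarrow> h q m < h q w"
    "\<Inter>{H\<in>B. m \<in> H} \<inter> F q = {m}"
proof -
  define Vt where "Vt = {w \<in> ccell B x q. \<Inter>{H\<in>B. w \<in> H} \<inter> F q = {w}}"
  note desc = descend[OF B q x bdd]
  have "finite Vt"
  proof (rule inj_on_finite)
    show "inj_on (\<lambda>w. {H\<in>B. w \<in> H}) Vt"
    proof (rule inj_onI)
      fix w w' assume "w \<in> Vt" "w' \<in> Vt" and eq: "{H\<in>B. w \<in> H} = {H\<in>B. w' \<in> H}"
      then have "{w} = {w'}" unfolding Vt_def mem_Collect_eq by metis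
      then show "w = w'" by simp
    qed
    show "(\<lambda>w. {H\<in>B. w \<in> H}) ` Vt \<subseteq> Pow B" by auto
    show "finite (Pow B)" using finite_subset[OF B finA] by simp
  qed
  moreover have ne: "Vt \<noteq> {}" using desc[OF _ _ w0] unfolding Vt_def by blast
  ultimately obtain m where m: "m \<in> Vt" "\<And>w. w \<in> Vt \<Longrightarrow> h q m \<le> h q w"
    using arg_min_if_finite[of Vt "h q"] by (metis linorder_not_le)
  have mc: "m \<in> ccell B x q" "\<Inter>{H\<in>B. m \<in> H} \<inter> F q = {m}" using m(1) by (auto simp: Vt_def)
  have "h q m < h q w" if w: "w \<in> ccell B x q" "w \<noteq> m" for w
  proof -
    have "\<exists>w'\<in>ccell B x q. \<Inter>{H\<in>B. w' \<in> H} \<inter> F q = {w'} \<and> h q w' \<le> h q w \<and> (w' \<noteq> w \<longrightarrow> h q w' < h q w)"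
      by (rule desc[OF _ _ w(1)])
    then obtain w' where w': "w' \<in> ccell B x q" "\<Inter>{H\<in>B. w' \<in> H} \<inter> F q = {w'}" "h q w' \<le> h q w" "w' \<noteq> w \<longrightarrow> h q w' < h q w"
      by blast
    then have mw': "h q m \<le> h q w'" using m(2) by (simp add: Vt_def)
    show ?thesis
    proof (rule ccontr)
      assume "\<not> h q m < h q w"
      then have eq: "w' = w" "h q w = h q m" using mw' w'(3,4) by auto
      have "\<Inter>{H\<in>B. m \<in> H} = \<Inter>{H\<in>B. w \<in> H}"
      proof (rule point_flat_unique[OF _ _ q mc(2)])
        show "\<Inter>{H\<in>B. w \<in> H} \<inter> F q = {w}" using w'(2) eq(1) by simp
        show "h q m = h q w" using eq(2) by simp
      qed (use B in \<open>auto intro!: flat_through\<close>)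
      then have "{w} = {m}" using mc(2) w'(2) eq(1) by metis
      then show False using w(2) by simp
    qed
  qed
  then show thesis by (intro that[OF mc(1) _ mc(2)])
qed

end

lemma square_pos: "x \<noteq> 0 \<Longrightarrow> x * x > (0::real)"
  using not_real_square_gt_zero by blast

context arrangement
begin

lemma sign_near:
  assumes "B \<subseteq> A"
  obtains t0 where "t0 > 0" "t0 \<le> 1" "\<And>t H. 0 < t \<Longrightarrow> t < t0 \<Longrightarrow> H \<in> B \<Longrightarrow> val H m \<noteq> 0 \<Longrightarrow> val H (m + t *\<^sub>R u) * val H m > 0"
proof -
  have "\<forall>\<^sub>F t in nhds (0::real). \<forall>H\<in>A. val H m \<noteq> 0 \<longrightarrow> val H (m + t *\<^sub>R u) * val H m > 0"
  proof (intro eventually_ball_finite finA ballI)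
    fix H assume "H \<in> A"
    have lim: "((\<lambda>t. (val H m + t * dir H u) * val H m) \<longlongrightarrow> (val H m + 0 * dir H u) * val H m) (nhds 0)"
      by (intro tendsto_intros filterlim_ident)
    show "\<forall>\<^sub>F t in nhds 0. val H m \<noteq> 0 \<longrightarrow> val H (m + t *\<^sub>R u) * val H m > 0"
    proof (cases "val H m = 0")
      case False
      then have "(val H m + 0 * dir H u) * val H m > 0" by (simp add: square_pos)
      from order_tendstoD(1)[OF lim this] show ?thesis by eventually_elim (simp add: val_add)
    qed simp
  qed
  then obtain t0 where t0: "t0 > 0" "\<forall>t. dist t 0 < t0 \<longrightarrow> (\<forall>H\<in>A. val H m \<noteq> 0 \<longrightarrow> val H (m + t *\<^sub>R u) * val H m > 0)"
    unfolding eventually_nhds_metric by blast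
  show thesis by (rule that[of "min t0 1"]) (use t0 assms in \<open>auto simp: dist_norm\<close>)
qed

end

context flagged_arrangement
begin

section \<open>Chambers as sign cells\<close>

lemma open_cell: "B \<subseteq> A \<Longrightarrow> open (cell B x)"
proof -
  assume B: "B \<subseteq> A"
  have eq: "cell B x = (\<Inter>H\<in>B. {w. 0 < val H w * val H x})" by (auto simp: cell_def)
  have "open {w. 0 < val H w * val H x}" for H
    by (intro open_Collect_less continuous_on_mult cont_val continuous_on_const continuous_on_id)
  then show ?thesis unfolding eq using finite_subset[OF B finA] by (intro open_INT) auto
qed

lemma cell_segment:
  assumes "\<And>H. H \<in> B \<Longrightarrow> val H w * val H x \<ge> 0" "y \<in> cell B x" "0 < t" "t \<le> 1"
  shows "w + t *\<^sub>R (y - w) \<in> cell B x"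
  unfolding cell_def
proof (intro CollectI ballI)
  fix H assume H: "H \<in> B"
  have eq: "val H (w + t *\<^sub>R (y - w)) * val H x = (1 - t) * (val H w * val H x) + t * (val H y * val H x)"
    unfolding val_add dir_simps(3) val_diff[symmetric] by (simp only: algebra_simps)
  show "val H (w + t *\<^sub>R (y - w)) * val H x > 0"
    unfolding eq by (rule add_nonneg_pos) (use assms H in \<open>auto simp: cell_def\<close>)
qed

lemma convex_cell: "convex (cell B x)"
  unfolding convex_alt
proof (intro ballI allI impI)
  fix w y and t :: real assume *: "w \<in> cell B x" "y \<in> cell B x" "0 \<le> t \<and> t \<le> 1"
  have eq: "(1 - t) *\<^sub>R w + t *\<^sub>R y = w + t *\<^sub>R (y - w)" by (simp add: algebra_simps)
  show "(1 - t) *\<^sub>R w + t *\<^sub>R y \<in> cell B x"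
  proof (cases "t = 0")
    case False
    show ?thesis unfolding eq by (rule cell_segment) (use * False in \<open>auto simp: cell_def less_imp_le\<close>)
  qed (use * in simp)
qed

text \<open>The sign cell is convex, hence connected; conversely, a connected set off the
  hyperplanes cannot change the sign of an affine form.\<close>

lemma chamber_of_point:
  assumes w: "\<And>H. H \<in> A \<Longrightarrow> val H w \<noteq> 0"
  shows "connected_component_set (- \<Union>A) w = cell A w"
proof
  have off: "y \<in> - \<Union>A \<longleftrightarrow> (\<forall>H\<in>A. val H y \<noteq> 0)" for y using mem_H by blast
  have ww: "w \<in> cell A w" using w by (simp add: cell_def square_pos)
  have "cell A w \<subseteq> - \<Union>A"
  proof
    fix y assume y: "y \<in> cell A w"
    have "val H y \<noteq> 0" if "H \<in> A" for H using y that by (force simp: cell_def)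
    then show "y \<in> - \<Union>A" using off by blast
  qed
  then show "cell A w \<subseteq> connected_component_set (- \<Union>A) w"
    by (intro connected_component_maximal ww convex_connected convex_cell)
  show "connected_component_set (- \<Union>A) w \<subseteq> cell A w"
  proof
    fix y assume y: "y \<in> connected_component_set (- \<Union>A) w"
    let ?C = "connected_component_set (- \<Union>A) w"
    have con: "connected ?C" by simp
    have wC: "w \<in> ?C" using off w by (simp add: connected_component_refl_eq)
    have sub: "?C \<subseteq> - \<Union>A" by (rule connected_component_subset)
    have "val H y * val H w > 0" if H: "H \<in> A" for H
    proof (rule ccontr)
      assume n: "\<not> val H y * val H w > 0"
      have nz: "val H u \<noteq> 0" if "u \<in> ?C" for u using sub off that H by blast
      then have "val H y < 0 \<and> val H w > 0 \<or> val H y > 0 \<and> val H w < 0"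
        using n nz[OF y] nz[OF wC] by (simp add: zero_less_mult_iff) linarith
      then have "\<exists>u\<in>?C. a H \<bullet> u = b H"
        using connected_ivt_hyperplane[OF con y wC, of "a H" "b H"] connected_ivt_hyperplane[OF con wC y, of "a H" "b H"]
        by (auto simp: val_def)
      then show False using nz by (auto simp: val_def)
    qed
    then show "y \<in> cell A w" by (simp add: cell_def)
  qed
qed

lemma chamber_cell:
  assumes "C \<in> chambers A" "w \<in> C"
  shows "C = cell A w" "H \<in> A \<Longrightarrow> val H w \<noteq> 0"
proof -
  obtain y where y: "y \<in> - \<Union>A" "C = connected_component_set (- \<Union>A) y"
    using assms(1) by (auto simp: chambers_def components_def)
  then have C: "C = connected_component_set (- \<Union>A) w"
    using assms(2) connected_component_eq by metis
  have "w \<in> - \<Union>A" using y(2) assms(2) connected_component_subset by blast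
  then have w: "val H w \<noteq> 0" if "H \<in> A" for H using that mem_H by blast
  then show "H \<in> A \<Longrightarrow> val H w \<noteq> 0" .
  show "C = cell A w" unfolding C by (rule chamber_of_point[OF w])
qed

lemma cell_chamber:
  assumes "\<And>H. H \<in> A \<Longrightarrow> val H w \<noteq> 0"
  shows "cell A w \<in> chambers A" "w \<in> cell A w"
proof -
  have "w \<in> - \<Union>A" using assms mem_H by blast
  then show "cell A w \<in> chambers A"
    using chamber_of_point[OF assms] unfolding chambers_def components_def by (intro image_eqI[of _ _ w]) simp_all
  show "w \<in> cell A w" using assms by (simp add: cell_def square_pos)
qed

text \<open>A chamber is recovered from the set of hyperplanes whose form is positive on it.\<close>

lemma finite_chambers: "finite (chambers A)"
proof (rule inj_on_finite)
  define s where "s C = {H\<in>A. \<forall>w\<in>C. val H w > 0}" for C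
  have s: "s C = {H\<in>A. val H w > 0}" if "C \<in> chambers A" "w \<in> C" for C w
  proof -
    have C: "C = cell A w" by (rule chamber_cell[OF that])
    have "(\<forall>y\<in>C. val H y > 0) \<longleftrightarrow> val H w > 0" if "H \<in> A" for H
      using \<open>w \<in> C\<close> that unfolding C by (auto simp: cell_def zero_less_mult_iff)
    then show ?thesis unfolding s_def by blast
  qed
  show "inj_on s (chambers A)"
  proof (rule inj_onI)
    fix C D assume *: "C \<in> chambers A" "D \<in> chambers A" "s C = s D"
    obtain w y where w: "w \<in> C" and y: "y \<in> D"
      using * in_components_nonempty unfolding chambers_def by blast
    have "{H\<in>A. val H w > 0} = {H\<in>A. val H y > 0}" using s[OF *(1) w] s[OF *(2) y] *(3) by simp
    then have "val H w > 0 \<longleftrightarrow> val H y > 0" if "H \<in> A" for H using that by blast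
    then have sg: "val H w > 0 \<longleftrightarrow> val H y > 0" if "H \<in> A" for H using that by blast
    have "val H u * val H w > 0 \<longleftrightarrow> val H u * val H y > 0" if "H \<in> A" for H u
      using sg[OF that] chamber_cell(2)[OF *(1) w that] chamber_cell(2)[OF *(2) y that]
      by (simp add: zero_less_mult_iff) linarith
    then have "cell A w = cell A y" unfolding cell_def by blast
    then show "C = D" using chamber_cell(1)[OF *(1) w] chamber_cell(1)[OF *(2) y] by simp
  qed
  show "s ` chambers A \<subseteq> Pow A" by (auto simp: s_def)
  show "finite (Pow A)" using finA by simp
qed

text \<open>By genericity no hyperplane contains \<open>F q\<close>. Starting in
  \<open>F q \<inter> U\<close>, the hyperplanes are left one after the other by moves inside
  \<open>F q\<close> too short to leave \<open>U\<close> or to return to a hyperplane already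
  avoided.\<close>

lemma dense_in_flag:
  assumes q: "q \<le> CARD('n)" and w0: "w0 \<in> F q" "w0 \<in> U" and U: "open U"
  shows "\<exists>w\<in>F q \<inter> U. \<forall>H\<in>A. val H w \<noteq> 0"
proof -
  have not_sub: "\<exists>g\<in>F q. val H g \<noteq> 0" if H: "H \<in> A" for H
  proof (rule ccontr)
    assume "\<not> ?thesis"
    then have sub: "F q \<subseteq> H" using mem_H[OF H] by blast
    have X: "H \<in> flats A" using flat_through[of "{H}" w0] H sub w0 by auto
    have "aff_dim H = int CARD('n) - 1" using Heq[OF H] a0[OF H] aff_dim_hyperplane[of "a H" "b H"] by simp
    moreover have "F q \<inter> H = F q" using sub by blast
    moreover have "aff_dim (F q) = int q" using gf q by (simp add: generic_flag_def)
    ultimately show False using aff_dim_flat[OF X q, of w0] sub w0 by auto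
  qed
  have "\<exists>w\<in>F q \<inter> U. \<forall>H\<in>B. val H w \<noteq> 0" if "finite B" "B \<subseteq> A" for B
    using that
  proof (induction B rule: finite_induct)
    case empty then show ?case using w0 by blast
  next
    case (insert H B)
    then obtain w where w: "w \<in> F q" "w \<in> U" "\<forall>H\<in>B. val H w \<noteq> 0" by auto
    show ?case
    proof (cases "val H w = 0")
      case False then show ?thesis using w by blast
    next
      case True
      obtain g where g: "g \<in> F q" "val H g \<noteq> 0" using not_sub[of H] insert.prems by blast
      obtain t0 where t0: "t0 > 0" "t0 \<le> 1" "\<And>t G. 0 < t \<Longrightarrow> t < t0 \<Longrightarrow> G \<in> B \<Longrightarrow> val G w \<noteq> 0 \<Longrightarrow> val G (w + t *\<^sub>R (g - w)) * val G w > 0"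
        by (rule sign_near[of B w "g - w"]) (use insert.prems in simp, (rule that; assumption))
      have "((\<lambda>t. w + t *\<^sub>R (g - w)) \<longlongrightarrow> w + 0 *\<^sub>R (g - w)) (nhds 0)"
        by (intro tendsto_intros filterlim_ident)
      then have "\<forall>\<^sub>F t in nhds 0. w + t *\<^sub>R (g - w) \<in> U" using U w(2) by (auto simp: tendsto_def)
      then obtain e where e: "e > 0" "\<forall>t. dist t 0 < e \<longrightarrow> w + t *\<^sub>R (g - w) \<in> U"
        unfolding eventually_nhds_metric by blast
      define t where "t = min e t0 / 2"
      have t: "0 < t" "t < t0" "dist t 0 < e" using t0(1) e(1) by (auto simp: t_def dist_norm)
      have "val G (w + t *\<^sub>R (g - w)) \<noteq> 0" if G: "G \<in> insert H B" for G
      proof (cases "G \<in> B")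
        case True
        from t0(3)[OF t(1,2) True] w(3) True show ?thesis by force
      next
        case False
        then have "G = H" using G by simp
        then show ?thesis using True g(2) t(1) val_diff[of H g w, symmetric] by (simp add: val_add)
      qed
      then show ?thesis using e(2) t(3) F_segment[OF q w(1) g(1)] by blast
    qed
  qed
  from this[OF finA subset_refl] show ?thesis .
qed

lemma closure_chamber:
  assumes "p \<in> cell A p"
  shows "closure (cell A p) = {w. \<forall>H\<in>A. val H w * val H p \<ge> 0}"
proof
  have "closed (\<Inter>H\<in>A. {w. 0 \<le> val H w * val H p})"
    by (intro closed_INT ballI closed_Collect_le continuous_on_mult cont_val continuous_on_const continuous_on_id)
  moreover have "(\<Inter>H\<in>A. {w. 0 \<le> val H w * val H p}) = {w. \<forall>H\<in>A. val H w * val H p \<ge> 0}" by auto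
  ultimately have "closed {w. \<forall>H\<in>A. val H w * val H p \<ge> 0}" by simp
  then show "closure (cell A p) \<subseteq> {w. \<forall>H\<in>A. val H w * val H p \<ge> 0}"
    by (intro closure_minimal) (auto simp: cell_def less_imp_le)
  show "{w. \<forall>H\<in>A. val H w * val H p \<ge> 0} \<subseteq> closure (cell A p)"
  proof
    fix w assume w: "w \<in> {w. \<forall>H\<in>A. val H w * val H p \<ge> 0}"
    have lim: "((\<lambda>t. w + t *\<^sub>R (p - w)) \<longlongrightarrow> w + 0 *\<^sub>R (p - w)) (at_right 0)"
      by (intro tendsto_intros)
    have ev: "\<forall>\<^sub>F t in at_right 0. w + t *\<^sub>R (p - w) \<in> cell A p"
      unfolding eventually_at_right_field
      by (intro exI[of _ 1] conjI allI impI cell_segment assms) (use w in auto)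
    have "w + 0 *\<^sub>R (p - w) \<in> closure (cell A p)"
      by (rule Lim_in_closed_set[OF closed_closure _ _ lim])
        (use ev closure_subset in \<open>auto elim!: eventually_mono\<close>)
    then show "w \<in> closure (cell A p)" by simp
  qed
qed

abbreviation chq :: "nat \<Rightarrow> (real ^ 'n) set set" where "chq \<equiv> flag_chambers A F"

section \<open>The lowest vertex of a chamber\<close>

definition vx :: "nat \<Rightarrow> (real ^ 'n) set \<Rightarrow> real ^ 'n" where "vx q C = min_vertex F h q C"

definition VC :: "nat \<Rightarrow> (real ^ 'n) set \<Rightarrow> (real ^ 'n) set" where "VC q C = direction (chamber_flat A F h q C)"

lemma chamber_h_pos:
  assumes "C \<in> chq q" "1 \<le> q" "q \<le> CARD('n)" "w \<in> C" "w \<in> F q"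
  shows "h q w > 0"
proof -
  have "C \<inter> F q \<subseteq> {x. (\<forall>i\<in>{q+1..DIM(real ^ 'n)}. h i x = 0) \<and> h q x > 0}"
    using fp assms(1-3) unfolding flag_position_def by simp
  then show ?thesis using assms(4,5) by blast
qed

text \<open>The segment from a point of negative height in the closed cell to the inner point
  \<open>y\<close> would cross height 0 at a point of the open cell.\<close>

lemma ccell_h_nonneg:
  assumes q: "1 \<le> q" "q \<le> CARD('n)" and y: "y \<in> cell B x" "y \<in> F q" and w: "w \<in> ccell B x q"
    and pos: "\<And>u. u \<in> cell B x \<Longrightarrow> u \<in> F q \<Longrightarrow> h q u > 0"
  shows "h q w \<ge> 0"
proof (rule ccontr)
  assume n: "\<not> h q w \<ge> 0"
  have qq: "q \<in> {1..CARD('n)}" using q by simp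
  have hy: "h q y > 0" by (rule pos[OF y])
  define t where "t = - h q w / (h q y - h q w)"
  have t: "0 < t" "t \<le> 1" using n hy by (auto simp: t_def divide_simps)
  have wF: "w \<in> F q" and wc: "\<And>H. H \<in> B \<Longrightarrow> val H w * val H x \<ge> 0" using w by (auto simp: ccell_def)
  have "h q (w + t *\<^sub>R (y - w)) > 0"
    by (rule pos[OF cell_segment[OF wc y(1) t] F_segment[OF q(2) wF y(2)]])
  moreover have "h q (w + t *\<^sub>R (y - w)) = 0"
    unfolding h_line[OF qq] lin_diff[OF qq] using n hy by (simp add: t_def)
  ultimately show False by simp
qed

lemma argmin_unique:
  assumes "m \<in> S" "\<And>w. w \<in> S \<Longrightarrow> w \<noteq> m \<Longrightarrow> h q m < h q w"
  shows "(THE p. is_arg_min (h q) (\<lambda>x. x \<in> S) p) = m"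
proof (rule the_equality)
  show "is_arg_min (h q) (\<lambda>x. x \<in> S) m" using assms by (force simp: is_arg_min_def)
  fix p assume "is_arg_min (h q) (\<lambda>x. x \<in> S) p"
  then show "p = m" using assms by (force simp: is_arg_min_def)
qed

lemma chamber_flat_eq:
  assumes q: "1 \<le> q" "q \<le> CARD('n)" and m: "min_vertex F h q C = m" "X \<in> flats A" "X \<inter> F q = {m}"
  shows "chamber_flat A F h q C = X"
proof -
  have "(THE X. X \<in> flats A \<and> X \<inter> F q = {m}) = X"
    by (rule the_equality) (use point_flat_unique[OF _ _ q _ _ refl] m in blast)+
  then show ?thesis using q m(1) by (simp add: chamber_flat_def)
qed

lemma direction_flat:
  assumes K: "K \<subseteq> A" and m: "m \<in> \<Inter>K"
  shows "direction (\<Inter>K) = {u. \<forall>H\<in>K. dir H u = 0}"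
proof (intro equalityI subsetI)
  fix u assume "u \<in> direction (\<Inter>K)"
  then obtain x y where u: "u = x - y" "x \<in> \<Inter>K" "y \<in> \<Inter>K" unfolding direction_def by blast
  have "dir H u = 0" if H: "H \<in> K" for H
  proof -
    have HA: "H \<in> A" using H K by blast
    have "val H x = 0" "val H y = 0" using mem_H[OF HA] u H by auto
    then show ?thesis using val_diff[of H x y] u(1) by simp
  qed
  then show "u \<in> {u. \<forall>H\<in>K. dir H u = 0}" by blast
next
  fix u assume u: "u \<in> {u. \<forall>H\<in>K. dir H u = 0}"
  have "m + u \<in> H" if H: "H \<in> K" for H
  proof -
    have HA: "H \<in> A" using H K by blast
    then show ?thesis using mem_H[OF HA] m u H by (auto simp: val_add)
  qed
  then show "u \<in> direction (\<Inter>K)" using m unfolding direction_def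
    by (intro CollectI exI[of _ "m + u"] exI[of _ m]) auto
qed

lemma dim_direction_flat:
  assumes K: "K \<subseteq> A" and m: "m \<in> \<Inter>K"
  shows "aff_dim (\<Inter>K) = int (dim {u. \<forall>H\<in>K. dir H u = 0})" "subspace {u. \<forall>H\<in>K. dir H u = 0}"
proof -
  show s: "subspace {u. \<forall>H\<in>K. dir H u = 0}" by (auto simp: subspace_def)
  have "\<Inter>K = (+) m ` {u. \<forall>H\<in>K. dir H u = 0}"
  proof (intro equalityI subsetI)
    fix x assume x: "x \<in> \<Inter>K"
    then have "x - m \<in> direction (\<Inter>K)" using m unfolding direction_def by blast
    then have "x - m \<in> {u. \<forall>H\<in>K. dir H u = 0}" unfolding direction_flat[OF K m] .
    then show "x \<in> (+) m ` {u. \<forall>H\<in>K. dir H u = 0}" by (intro image_eqI[of _ _ "x - m"]) simp_all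
  next
    fix x assume "x \<in> (+) m ` {u. \<forall>H\<in>K. dir H u = 0}"
    then obtain u where u: "x = m + u" "\<forall>H\<in>K. dir H u = 0" by blast
    have "x \<in> H" if H: "H \<in> K" for H
    proof -
      have HA: "H \<in> A" using H K by blast
      then show ?thesis using mem_H[OF HA] m u H by (auto simp: val_add)
    qed
    then show "x \<in> \<Inter>K" by blast
  qed
  then show "aff_dim (\<Inter>K) = int (dim {u. \<forall>H\<in>K. dir H u = 0})"
    by (simp add: aff_dim_translation_eq aff_dim_subspace[OF s])
qed

text \<open>\<open>h q\<close> is positive on \<open>C \<inter> F q\<close>, so it is bounded below
  on the closed cell and has a lowest vertex. The flat through this vertex has dimension
  \<open>CARD('n) - q\<close>: it misses \<open>F (q - 1)\<close>, which makes the height strictly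
  positive, and it meets \<open>F q\<close> in one point only, which is the final injectivity
  statement.\<close>

lemma vertex:
  assumes C: "C \<in> chq q" and q: "1 \<le> q" "q \<le> CARD('n)" and p: "p \<in> C" "p \<in> F q"
  shows "vx q C \<in> ccell A p q" "\<And>w. w \<in> ccell A p q \<Longrightarrow> w \<noteq> vx q C \<Longrightarrow> h q (vx q C) < h q w"
    "h q (vx q C) > 0" "VC q C = {u. \<forall>H\<in>A. vx q C \<in> H \<longrightarrow> dir H u = 0}" "dim (VC q C) = CARD('n) - q"
    "u \<in> VC q C \<Longrightarrow> (\<And>i. i \<in> {q+1..CARD('n)} \<Longrightarrow> lin i u = 0) \<Longrightarrow> u = 0"
proof -
  have Cc: "C \<in> chambers A" using C by (simp add: flag_chambers_def)
  have CA: "C = cell A p" by (rule chamber_cell[OF Cc p(1)])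
  have pp: "p \<in> cell A p" using p(1) CA by simp
  have nz: "val H p \<noteq> 0" if "H \<in> A" for H by (rule chamber_cell(2)[OF Cc p(1) that])
  have pos: "h q u > 0" if "u \<in> cell A p" "u \<in> F q" for u
    using chamber_h_pos[OF C q] that CA by blast
  have nn: "0 \<le> h q w" if "w \<in> ccell A p q" for w by (rule ccell_h_nonneg[OF q pp p(2) that pos])
  have pc: "p \<in> ccell A p q" using cell_ccell pp p(2) by blast
  obtain m where m: "m \<in> ccell A p q" "\<And>w. w \<in> ccell A p q \<Longrightarrow> w \<noteq> m \<Longrightarrow> h q m < h q w"
    "\<Inter>{H\<in>A. m \<in> H} \<inter> F q = {m}"
    by (rule min_vertex_exists[OF subset_refl q nz nn pc]) (assumption, assumption, (rule that; assumption))
  let ?K = "{H\<in>A. m \<in> H}"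
  have K: "?K \<subseteq> A" and mK: "m \<in> \<Inter>?K" by auto
  have cl: "closure C \<inter> F q = ccell A p q"
    unfolding CA closure_chamber[OF pp] by (auto simp: ccell_def)
  have vm: "vx q C = m" unfolding vx_def min_vertex_def
    unfolding Int_iff[symmetric] cl by (rule argmin_unique[OF m(1,2)])
  have X: "\<Inter>?K \<in> flats A" by (rule flat_through[OF K mK])
  have cf: "chamber_flat A F h q C = \<Inter>?K"
    by (rule chamber_flat_eq[OF q _ X m(3)]) (use vm in \<open>simp add: vx_def\<close>)
  have V: "VC q C = {u. \<forall>H\<in>?K. dir H u = 0}" unfolding VC_def cf by (rule direction_flat[OF K mK])
  show "h q (vx q C) < h q w" if "w \<in> ccell A p q" "w \<noteq> vx q C" for w using m that vm by auto
  show "vx q C \<in> ccell A p q" using m vm by simp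
  show "VC q C = {u. \<forall>H\<in>A. vx q C \<in> H \<longrightarrow> dir H u = 0}" unfolding V vm by blast
  have ad: "aff_dim (\<Inter>?K) = int CARD('n) - int q" by (rule aff_dim_point_flat[OF X q(2) m(3)])
  then show "dim (VC q C) = CARD('n) - q" using dim_direction_flat(1)[OF K mK] unfolding V by simp
  have "m \<notin> F (q - 1)"
  proof
    assume "m \<in> F (q - 1)"
    moreover have "F (q - 1) \<inter> \<Inter>?K = {}" by (rule flat_misses[OF X]) (use q ad in auto)
    ultimately show False using mK by blast
  qed
  moreover have mF: "m \<in> F q" using m(1) by (simp add: ccell_def)
  ultimately have "h q m \<noteq> 0" using F_pred[OF q] by blast
  then show "h q (vx q C) > 0" using nn[OF m(1)] vm by simp
  assume u: "u \<in> VC q C" "\<And>i. i \<in> {q+1..CARD('n)} \<Longrightarrow> lin i u = 0"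
  have "m + 1 *\<^sub>R u \<in> F q" by (rule F_line[OF q(2) mF u(2)])
  moreover have "m + u \<in> H" if H: "H \<in> ?K" for H
  proof -
    have HA: "H \<in> A" using H by blast
    then show ?thesis using mem_H[OF HA] u(1) H unfolding V by (auto simp: val_add)
  qed
  ultimately have "m + u \<in> \<Inter>?K \<inter> F q" by auto
  then show "u = 0" unfolding m(3) by simp
qed

lemma VC_0: "VC 0 C = UNIV"
proof -
  have "u \<in> direction UNIV" for u :: "real ^ 'n"
    unfolding direction_def by (intro CollectI exI[of _ u] exI[of _ 0]) simp
  then show ?thesis unfolding VC_def chamber_flat_def by auto
qed

lemma F0: "x \<in> F 0 \<Longrightarrow> w \<in> F 0 \<Longrightarrow> x = w"
proof -
  have "aff_dim (F 0) = 0" using gf by (simp add: generic_flag_def)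
  then show "x \<in> F 0 \<Longrightarrow> w \<in> F 0 \<Longrightarrow> x = w" by (auto simp: aff_dim_eq_0)
qed

lemma VC_facts:
  assumes C: "C \<in> chq q" and q: "q \<le> CARD('n)"
  shows "subspace (VC q C)" "dim (VC q C) = CARD('n) - q"
    "u \<in> VC q C \<Longrightarrow> (\<And>i. i \<in> {q+1..CARD('n)} \<Longrightarrow> lin i u = 0) \<Longrightarrow> u = 0"
proof -
  obtain p where p: "p \<in> C" "p \<in> F q" using C by (auto simp: flag_chambers_def)
  have "subspace (VC q C) \<and> dim (VC q C) = CARD('n) - q \<and>
     (u \<in> VC q C \<longrightarrow> (\<forall>i\<in>{q+1..CARD('n)}. lin i u = 0) \<longrightarrow> u = 0)"
  proof (cases "q = 0")
    case True
    have "u = 0" if "\<forall>i\<in>{q+1..CARD('n)}. lin i u = 0"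
    proof -
      have "p + 1 *\<^sub>R u \<in> F 0" by (rule F_line) (use True p that in auto)
      then have "p + u \<in> F 0" by simp
      from F0[OF this] have "p + u = p" using p True by simp
      then show ?thesis by simp
    qed
    then show ?thesis using True by (simp add: VC_0)
  next
    case False
    then have q1: "1 \<le> q" by simp
    show ?thesis using vertex(4-6)[OF C q1 q p] by (auto simp: subspace_def)
  qed
  then show "subspace (VC q C)" "dim (VC q C) = CARD('n) - q"
    "u \<in> VC q C \<Longrightarrow> (\<And>i. i \<in> {q+1..CARD('n)} \<Longrightarrow> lin i u = 0) \<Longrightarrow> u = 0" by blast+
qed

text \<open>The chambers inside \<open>\<widetilde>C\<close> come after \<open>C\<close>: near its vertex \<open>\<widetilde>C\<close> coincides
  with \<open>C\<close>, so the vertex is the unique minimum of \<open>h q\<close> on the closure of \<open>\<widetilde>C \<inter> F q\<close>.\<close>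

lemma chamber_order:
  assumes C: "C \<in> chq q" "q \<le> CARD('n)" "p \<in> C" "p \<in> F q"
    and C': "C' \<in> chq r" "r \<le> CARD('n)" "p' \<in> C'" "p' \<in> F r"
    and sub: "\<And>H. H \<in> A \<Longrightarrow> (\<forall>u\<in>VC q C. dir H u = 0) \<Longrightarrow> val H p' * val H p > 0"
  shows "C' = C \<and> r = q \<or> q < r \<or> q = r \<and> h q (vx q C) < h q (vx r C')"
proof (cases "q = 0")
  case True
  show ?thesis
  proof (cases "r = 0")
    case r: True
    have "p = p'" using F0 C(4) C'(4) True r by simp
    then have "C = C'" using chamber_cell(1)[of C p] chamber_cell(1)[of C' p'] C C' by (simp add: flag_chambers_def)
    then show ?thesis using True r by simp
  qed (use True in simp)
next
  case False
  then have q1: "1 \<le> q" by simp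
  have qq: "q \<in> {1..CARD('n)}" using q1 C(2) by simp
  note v = vertex[OF C(1) q1 C(2-4)]
  define m where "m = vx q C"
  \<comment> \<open>The subarrangement of the hyperplanes parallel to the flat of \<open>C\<close>;
    \<open>ccell B p q\<close> is its closed cell around \<open>C\<close>, cut with
    \<open>F q\<close>.\<close>
  define B where "B = {H\<in>A. \<forall>u\<in>VC q C. dir H u = 0}"
  have through: "H \<in> B" if "H \<in> A" "m \<in> H" for H
    using that v(4) unfolding B_def m_def by blast
  have mF: "m \<in> F q" using v(1) unfolding m_def by (simp add: ccell_def)
  have mp: "val H m * val H p \<ge> 0" if "H \<in> A" for H using v(1) that unfolding m_def by (simp add: ccell_def)
  have Cc: "C \<in> chambers A" "C' \<in> chambers A" using C(1) C'(1) by (simp_all add: flag_chambers_def)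
  have pnz: "val H p \<noteq> 0" "val H p' \<noteq> 0" if "H \<in> A" for H
    using chamber_cell(2)[OF Cc(1) C(3) that] chamber_cell(2)[OF Cc(2) C'(3) that] .
  \<comment> \<open>A short segment from \<open>m\<close> towards a point of the larger closed cell
    stays in the smaller one, because every hyperplane through \<open>m\<close> belongs to
    \<open>B\<close>. The affine form \<open>h q\<close> increases at the start of the segment,
    hence up to its end.\<close>
  have above: "h q m < h q w" if w: "w \<in> ccell B p q" "w \<noteq> m" for w
  proof -
    obtain t0 where t0: "t0 > 0" "t0 \<le> 1" "\<And>t H. 0 < t \<Longrightarrow> t < t0 \<Longrightarrow> H \<in> A \<Longrightarrow> val H m \<noteq> 0 \<Longrightarrow> val H (m + t *\<^sub>R (w - m)) * val H m > 0"
      by (rule sign_near[OF subset_refl, of m "w - m"]) (rule that; assumption)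
    define t where "t = t0 / 2"
    have t: "0 < t" "t < t0" using t0(1) by (auto simp: t_def)
    have wF: "w \<in> F q" using w(1) by (simp add: ccell_def)
    have "m + t *\<^sub>R (w - m) \<in> ccell A p q" unfolding ccell_def
    proof (intro CollectI conjI ballI F_segment[OF C(2) mF wF])
      fix H assume H: "H \<in> A"
      show "0 \<le> val H (m + t *\<^sub>R (w - m)) * val H p"
      proof (cases "val H m = 0")
        case True
        then have "H \<in> B" using through H mem_H by blast
        then have "0 \<le> val H w * val H p" using w(1) by (simp add: ccell_def)
        moreover have "val H (m + t *\<^sub>R (w - m)) = t * val H w"
          using True val_diff[of H w m, symmetric] by (simp add: val_add)
        ultimately show ?thesis using t(1) by (simp add: mult.assoc)
      next
        case False
        from t0(3)[OF t H this] mp[OF H] False show ?thesis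
          by (auto simp: zero_less_mult_iff zero_le_mult_iff)
      qed
    qed
    moreover have "m + t *\<^sub>R (w - m) \<noteq> vx q C" using t(1) w(2) by (simp add: m_def)
    ultimately have "h q m < h q (m + t *\<^sub>R (w - m))" using v(2) unfolding m_def by blast
    then have "0 < t * (h q w - h q m)" unfolding h_line[OF qq] lin_diff[OF qq] by simp
    then show ?thesis using t(1) by (simp add: zero_less_mult_iff)
  qed
  have p'B: "val H p' * val H p > 0" if "H \<in> B" for H using sub that by (simp add: B_def)
  \<comment> \<open>Otherwise \<open>p'\<close> would be a point of the larger cell in
    \<open>F (q - 1)\<close>, with height 0, below the positive minimum at \<open>m\<close>.\<close>
  have "\<not> r < q"
  proof
    assume r: "r < q"
    have "F r \<subseteq> F (q - 1)" by (rule F_mono) (use r C(2) in auto)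
    then have p'1: "p' \<in> F (q - 1)" using C'(4) by blast
    moreover have "F (q - 1) \<subseteq> F q" by (rule F_mono) (use C(2) in auto)
    ultimately have p'F: "p' \<in> F q" by blast
    then have h0: "h q p' = 0" using F_pred[OF q1 C(2)] p'1 by blast
    have "p' \<in> ccell B p q" using p'F p'B by (auto simp: ccell_def less_imp_le)
    then have "h q m \<le> h q p'" using above[of p'] by (cases "p' = m") (auto intro: less_imp_le)
    then show False using v(3) h0 by (simp add: m_def)
  qed
  moreover have "C' = C \<or> h q m < h q (vx r C')" if r: "q = r"
  proof -
    have v': "vx r C' \<in> ccell A p' q" using vertex(1)[of C' q p'] C' C(2) q1 r by simp
    let ?m' = "vx r C'"
    have m'p: "val H ?m' * val H p' \<ge> 0" if "H \<in> A" for H using v' that by (simp add: ccell_def)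
    have "?m' \<in> ccell B p q" unfolding ccell_def
    proof (intro CollectI conjI ballI)
      show "?m' \<in> F q" using v' by (simp add: ccell_def)
      fix H assume H: "H \<in> B"
      then have "H \<in> A" by (simp add: B_def)
      from m'p[OF this] p'B[OF H] show "0 \<le> val H ?m' * val H p"
        by (auto simp: zero_less_mult_iff zero_le_mult_iff)
    qed
    then have "?m' = m \<or> h q m < h q ?m'" using above by blast
    \<comment> \<open>If the lowest vertices agree, the signs agree as well: hyperplanes through the
      vertex belong to \<open>B\<close>, and at the others both chambers have the sign of the
      vertex.\<close>
    moreover have "C' = C" if eq: "?m' = m"
    proof -
      have "val H p' * val H p > 0" if H: "H \<in> A" for H
      proof (cases "val H m = 0")
        case True
        then show ?thesis using p'B through H mem_H by blast
      next
        case False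
        then show ?thesis using mp[OF H] m'p[OF H] pnz[OF H] unfolding eq
          by (auto simp: zero_less_mult_iff zero_le_mult_iff)
      qed
      then have "p' \<in> cell A p" by (simp add: cell_def)
      then have "cell A p' = cell A p" by (rule cell_cong)
      then show ?thesis using chamber_cell(1)[OF Cc(1) C(3)] chamber_cell(1)[OF Cc(2) C'(3)] by simp
    qed
    ultimately show ?thesis by blast
  qed
  ultimately show ?thesis unfolding m_def by fastforce
qed

text \<open>Only hyperplanes whose direction contains \<open>v\<close> constrain the real part. Let
  \<open>D\<close> be their cell around \<open>x\<close> and \<open>q\<close> the first index at
  which the flag meets \<open>D\<close>. The lowest vertex of the closed cell in \<open>F q\<close>
  is also the lowest vertex of a chamber of \<open>A\<close> adjoining it inside \<open>D\<close>,
  and this chamber is the one wanted.\<close>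

lemma chamber_exists:
  assumes z: "\<And>H. H \<in> A \<Longrightarrow> dir H v = 0 \<Longrightarrow> val H x \<noteq> 0"
  obtains q C where "q \<le> CARD('n)" "C \<in> chq q" "v \<in> VC q C"
    "\<And>p H. p \<in> C \<Longrightarrow> H \<in> A \<Longrightarrow> dir H v = 0 \<Longrightarrow> val H x * val H p > 0"
proof -
  define B where "B = {H\<in>A. dir H v = 0}"
  define D where "D = cell B x"
  have BA: "B \<subseteq> A" by (auto simp: B_def)
  have xnz: "val H x \<noteq> 0" if "H \<in> B" for H using z that by (auto simp: B_def)
  have "x \<in> D \<inter> F CARD('n)" using xnz by (simp add: D_def cell_def F_iff square_pos)
  then have ex: "D \<inter> F CARD('n) \<noteq> {}" by blast
  define q where "q = (LEAST q. D \<inter> F q \<noteq> {})"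
  have q: "D \<inter> F q \<noteq> {}" "q \<le> CARD('n)" unfolding q_def using LeastI[of "\<lambda>q. D \<inter> F q \<noteq> {}", OF ex] Least_le[of "\<lambda>q. D \<inter> F q \<noteq> {}", OF ex] .
  have qmin: "D \<inter> F r = {}" if "r < q" for r using not_less_Least[of r "\<lambda>q. D \<inter> F q \<noteq> {}"] that unfolding q_def by blast
  have oD: "open D" unfolding D_def by (rule open_cell[OF BA])
  obtain w0 where w0: "w0 \<in> D" "w0 \<in> F q" using q(1) by blast
  have ch: "cell A w \<in> chq q" "cell A w \<subseteq> D" if w: "w \<in> D" "w \<in> F q" "\<And>H. H \<in> A \<Longrightarrow> val H w \<noteq> 0" for w
  proof -
    show sub: "cell A w \<subseteq> D"
    proof
      fix y assume y: "y \<in> cell A w"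
      have "val H y * val H x > 0" if H: "H \<in> B" for H
      proof -
        have "val H y * val H w > 0" "val H w * val H x > 0" using y w(1) H BA by (auto simp: cell_def D_def)
        then show ?thesis by (auto simp: zero_less_mult_iff)
      qed
      then show "y \<in> D" by (simp add: D_def cell_def)
    qed
    show "cell A w \<in> chq q" unfolding flag_chambers_def
    proof (intro CollectI conjI impI)
      show "cell A w \<in> chambers A" by (rule cell_chamber(1)[OF w(3)])
      show "cell A w \<inter> F q \<noteq> {}" using cell_chamber(2)[OF w(3)] w(2) by blast
      show "cell A w \<inter> F (q - 1) = {}" if "q \<noteq> 0" using qmin[of "q - 1"] that sub by auto
    qed
  qed
  have concl: "val H x * val H p > 0" if "p \<in> D" "H \<in> A" "dir H v = 0" for p H
    using that by (simp add: D_def cell_def B_def mult.commute)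
  show thesis
  proof (cases "q = 0")
    case True
    obtain w where w: "w \<in> F q" "w \<in> D" "\<And>H. H \<in> A \<Longrightarrow> val H w \<noteq> 0"
      using dense_in_flag[OF q(2) w0(2,1) oD] by blast
    show thesis
    proof (rule that[OF q(2) ch(1)[OF w(2,1,3)]])
      show "v \<in> VC q (cell A w)" using True VC_0 by simp
      show "val H x * val H p > 0" if "p \<in> cell A w" "H \<in> A" "dir H v = 0" for p H
        using concl ch(2)[OF w(2,1,3)] that by blast
    qed (use w in auto)
  next
    case False
    then have q1: "1 \<le> q" by simp
    have qq: "q \<in> {1..CARD('n)}" using q1 q(2) by simp
    \<comment> \<open>The sign of \<open>h q\<close> is prescribed on chambers of \<open>A\<close>
      only, so a supposed violation is first moved to a nearby point off all hyperplanes.\<close>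
    have pos: "h q u > 0" if u: "u \<in> D" "u \<in> F q" for u
    proof (rule ccontr)
      assume "\<not> h q u > 0"
      moreover have "u \<notin> F (q - 1)" using qmin[of "q - 1"] q1 u by auto
      then have "h q u \<noteq> 0" using F_pred[OF q1 q(2) u(2)] by blast
      ultimately have neg: "h q u < 0" by simp
      have "open {w. h q w < 0}" by (intro open_Collect_less cont_h[OF qq] continuous_on_const)
      then have op: "open (D \<inter> {w. h q w < 0})" using oD by blast
      obtain w where w: "w \<in> F q" "w \<in> D" "h q w < 0" "\<And>H. H \<in> A \<Longrightarrow> val H w \<noteq> 0"
        using dense_in_flag[OF q(2) u(2) _ op] u(1) neg by blast
      have "h q w > 0" by (rule chamber_h_pos[OF ch(1)[OF w(2,1,4)] q1 q(2) cell_chamber(2)[OF w(4)] w(1)]) auto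
      then show False using w(3) by simp
    qed
    have nn: "0 \<le> h q w" if "w \<in> ccell B x q" for w
      by (rule ccell_h_nonneg[OF q1 q(2) w0[unfolded D_def] that pos[unfolded D_def]])
    have w0c: "w0 \<in> ccell B x q" using cell_ccell[of B x q] w0 unfolding D_def by blast
    obtain m where m: "m \<in> ccell B x q" "\<And>w. w \<in> ccell B x q \<Longrightarrow> w \<noteq> m \<Longrightarrow> h q m < h q w"
      "\<Inter>{H\<in>B. m \<in> H} \<inter> F q = {m}"
      by (rule min_vertex_exists[OF BA q1 q(2) xnz nn w0c]) (assumption, assumption, (rule that; assumption))
    let ?K = "{H\<in>B. m \<in> H}"
    have K: "?K \<subseteq> A" and mK: "m \<in> \<Inter>?K" using BA by auto
    have mF: "m \<in> F q" using m(1) by (simp add: ccell_def)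
    have X: "\<Inter>?K \<in> flats A" by (rule flat_through[OF K mK])
    have ad: "aff_dim (\<Inter>?K) = int CARD('n) - int q" by (rule aff_dim_point_flat[OF X q(2) m(3)])
    \<comment> \<open>A hyperplane through \<open>m\<close> not containing the flat would cut out a
      smaller flat that still meets \<open>F q\<close> in \<open>m\<close>, against the dimension
      formula. Containing the flat, it contains \<open>m + v\<close>, so its direction contains
      \<open>v\<close>.\<close>
    have inB: "H \<in> B" if H: "H \<in> A" "m \<in> H" for H
    proof -
      have "\<Inter>?K \<subseteq> H"
      proof (rule ccontr)
        assume nsub: "\<not> \<Inter>?K \<subseteq> H"
        let ?Y = "\<Inter>(insert H ?K)"
        have Y: "?Y \<in> flats A" by (rule flat_through) (use H K mK in auto)
        have "aff_dim (F q \<inter> ?Y) = int q + aff_dim ?Y - int CARD('n)"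
          by (rule aff_dim_flat[OF Y q(2), of m]) (use H mK mF in auto)
        moreover have "F q \<inter> ?Y = {m}" using m(3) H(2) by blast
        ultimately have "aff_dim ?Y = aff_dim (\<Inter>?K)" using ad by (simp add: aff_dim_sing)
        moreover have "aff_dim ?Y < aff_dim (\<Inter>?K)"
        proof (rule aff_dim_psubset)
          have "affine (\<Inter>?K)" "affine ?Y"
          proof -
            have aff: "affine G" if "G \<in> A" for G using Heq[OF that] affine_hyperplane by metis
            show "affine (\<Inter>?K)" "affine ?Y" by (intro affine_Inter; use aff H(1) K in auto)+
          qed
          then show "affine hull ?Y \<subset> affine hull (\<Inter>?K)" using nsub by (auto simp: hull_same)
        qed
        ultimately show False by simp
      qed
      moreover have "m + v \<in> \<Inter>?K"
      proof
        fix G assume G: "G \<in> ?K"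
        then have "G \<in> A" "dir G v = 0" by (auto simp: B_def)
        then show "m + v \<in> G" using G mem_H by (auto simp: val_add)
      qed
      ultimately have "m + v \<in> H" by blast
      then have "dir H v = 0" using H mem_H by (auto simp: val_add)
      then show ?thesis using H(1) by (simp add: B_def)
    qed
    obtain t0 where t0: "t0 > 0" "t0 \<le> 1" "\<And>t H. 0 < t \<Longrightarrow> t < t0 \<Longrightarrow> H \<in> A \<Longrightarrow> val H m \<noteq> 0 \<Longrightarrow> val H (m + t *\<^sub>R (w0 - m)) * val H m > 0"
      by (rule sign_near[OF subset_refl, of m "w0 - m"]) (rule that; assumption)
    \<comment> \<open>Close to \<open>m\<close> the signs at hyperplanes off \<open>m\<close> are
      those of \<open>m\<close>; moving towards \<open>w0\<close> settles the remaining ones, which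
      belong to \<open>B\<close>.\<close>
    define w where "w = m + (t0 / 2) *\<^sub>R (w0 - m)"
    have t: "0 < t0 / 2" "t0 / 2 < t0" "t0 / 2 \<le> 1" using t0(1,2) by auto
    have wD: "w \<in> D" unfolding w_def D_def by (rule cell_segment[OF _ w0(1)[unfolded D_def] t(1,3)]) (use m(1) in \<open>simp add: ccell_def\<close>)
    have wF: "w \<in> F q" unfolding w_def by (rule F_segment[OF q(2) mF w0(2)])
    have wm: "val H w * val H m > 0" if "H \<in> A" "val H m \<noteq> 0" for H
      unfolding w_def by (rule t0(3)[OF t(1,2) that])
    have wnz: "val H w \<noteq> 0" if H: "H \<in> A" for H
    proof (cases "val H m = 0")
      case True
      then have "H \<in> B" using inB H mem_H by blast
      then show ?thesis using wD by (force simp: D_def cell_def)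
    next
      case False
      then show ?thesis using wm[OF H] by force
    qed
    define C where "C = cell A w"
    have C: "C \<in> chq q" "C \<subseteq> D" "w \<in> C"
      using ch[OF wD wF wnz] cell_chamber(2)[OF wnz] unfolding C_def by auto
    note v = vertex[OF C(1) q1 q(2) C(3) wF]
    have "m \<in> ccell A w q"
    proof -
      have "0 \<le> val H m * val H w" if "H \<in> A" for H using wm[OF that] by (cases "val H m = 0") (auto simp: mult.commute)
      then show ?thesis using mF by (simp add: ccell_def)
    qed
    moreover have "ccell A w q \<subseteq> ccell B x q"
    proof
      fix y assume y: "y \<in> ccell A w q"
      have "0 \<le> val H y * val H x" if H: "H \<in> B" for H
      proof -
        have "0 \<le> val H y * val H w" "0 < val H w * val H x" using y wD H BA by (auto simp: ccell_def D_def cell_def)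
        then show ?thesis by (auto simp: zero_less_mult_iff zero_le_mult_iff)
      qed
      then show "y \<in> ccell B x q" using y by (simp add: ccell_def)
    qed
    ultimately have "vx q C = m" using v(1) v(2)[of m] m(2)[of "vx q C"] by force
    have "v \<in> VC q C" unfolding v(4) \<open>vx q C = m\<close> using inB by (auto simp: B_def)
    show thesis by (rule that[OF q(2) C(1) \<open>v \<in> VC q C\<close>]) (use concl C(2) in blast)
  qed
qed

end

section \<open>Orientations\<close>

text \<open>The functionals give an injective linear map from \<open>V\<close> to a coordinate space
  of the same dimension, with coordinates labelled by \<open>\<phi>\<close>. It is therefore onto,
  and the dual vector is the preimage of a basis vector.\<close>

lemma dual_vector_exists:
  fixes g :: "nat \<Rightarrow> 'a::euclidean_space \<Rightarrow> real"
  assumes V: "subspace V" and J: "finite J" "card J = dim V" and g: "\<And>j. j \<in> J \<Longrightarrow> linear (g j)"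
    and inj: "\<And>u. u \<in> V \<Longrightarrow> (\<And>j. j \<in> J \<Longrightarrow> g j u = 0) \<Longrightarrow> u = 0" and i: "i \<in> J"
  shows "\<exists>v\<in>V. \<forall>j\<in>J. g j v = (if j = i then 1 else 0)"
proof -
  have "card J \<le> card (Basis :: 'a set)" using J(2) dim_subset_UNIV[of V] by simp
  then obtain \<phi> where \<phi>: "\<phi> ` J \<subseteq> (Basis :: 'a set)" "inj_on \<phi> J"
    using J(1) card_le_inj[of J "Basis :: 'a set"] by auto
  define T where "T u = (\<Sum>j\<in>J. g j u *\<^sub>R \<phi> j)" for u
  have lT: "linear T" unfolding T_def using g
    by (intro linear_compose_sum ballI linear_compose_scale_right[where f = "\<lambda>x. x", simplified] linear_scaleR_left)
      (auto intro!: linearI simp: linear_add linear_scale scaleR_add_left)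
  have coord: "T u \<bullet> \<phi> j = g j u" if "j \<in> J" for u j
  proof -
    have "T u \<bullet> \<phi> j = (\<Sum>k\<in>J. if k = j then g k u else 0)"
      unfolding T_def inner_sum_left
    proof (rule sum.cong[OF refl])
      fix k assume k: "k \<in> J"
      have "\<phi> k \<bullet> \<phi> j = (if k = j then 1 else 0)"
      proof -
        have "\<phi> k \<in> Basis" "\<phi> j \<in> Basis" using \<phi>(1) k that by blast+
        moreover have "\<phi> k = \<phi> j \<longleftrightarrow> k = j" using \<phi>(2) k that by (rule inj_on_eq_iff)
        ultimately show ?thesis by (simp add: inner_Basis)
      qed
      then show "(g k u *\<^sub>R \<phi> k) \<bullet> \<phi> j = (if k = j then g k u else 0)" by simp
    qed
    also have "\<dots> = g j u" using that J(1) by simp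
    finally show ?thesis .
  qed
  have injT: "inj_on T V"
  proof (rule inj_onI)
    fix u w assume uw: "u \<in> V" "w \<in> V" "T u = T w"
    have "u - w = 0"
    proof (rule inj)
      show "u - w \<in> V" by (rule subspace_diff[OF V uw(1,2)])
      show "g j (u - w) = 0" if "j \<in> J" for j
        using coord[OF that, of u] coord[OF that, of w] uw(3) linear_diff[OF g[OF that]] by simp
    qed
    then show "u = w" by simp
  qed
  have "T ` V = span (\<phi> ` J)"
  proof (rule subspace_dim_equal)
    show "subspace (T ` V)" by (rule linear_subspace_image[OF lT V])
    show "subspace (span (\<phi> ` J))" by simp
    show "T ` V \<subseteq> span (\<phi> ` J)"
    proof (intro image_subsetI)
      show "T u \<in> span (\<phi> ` J)" for u
        unfolding T_def by (intro span_sum span_scale span_base imageI)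
    qed
    have "dim (T ` V) = dim V" by (rule dim_image_eq[OF lT]) (use injT V span_eq_iff in metis)
    moreover have "dim (span (\<phi> ` J)) \<le> card (\<phi> ` J)" using J(1) by (simp add: dim_le_card')
    moreover have "card (\<phi> ` J) = card J" by (rule card_image[OF \<phi>(2)])
    ultimately show "dim (span (\<phi> ` J)) \<le> dim (T ` V)" using J(2) by simp
  qed
  moreover have "\<phi> i \<in> span (\<phi> ` J)" using i by (intro span_base) simp
  ultimately obtain v where v: "v \<in> V" "T v = \<phi> i" by (metis imageE)
  have "g j v = (if j = i then 1 else 0)" if j: "j \<in> J" for j
  proof -
    have "\<phi> i \<in> Basis" "\<phi> j \<in> Basis" using \<phi>(1) i j by blast+
    moreover have "\<phi> i = \<phi> j \<longleftrightarrow> i = j" using \<phi>(2) i j by (rule inj_on_eq_iff)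
    ultimately show ?thesis using coord[OF j, of v] v(2) by (auto simp: inner_Basis)
  qed
  then show ?thesis using v(1) by blast
qed

context arrangement
begin

lemma generic_vector:
  assumes V: "subspace V" obtains v where "v \<in> V" "vgen V v"
proof -
  have 0: "0 \<in> vcone V {} (\<lambda>_. 0)" using subspace_0[OF V] by (simp add: vcone_def)
  show thesis by (rule vgen_exists[OF V empty_subsetI 0]) (rule that; simp add: vcone_def vsub_def)
qed

lemma Sep_iff:
  assumes "H \<in> A" "val H p \<noteq> 0"
  shows "H \<in> Sep A p x \<longleftrightarrow> \<not> val H x * val H p > 0"
proof -
  have line: "val H ((1 - t) *\<^sub>R p + t *\<^sub>R x) = (1 - t) * val H p + t * val H x" for t
    by (simp add: val_def inner_add_right algebra_simps)
  have "closed_segment p x \<inter> H \<noteq> {} \<longleftrightarrow> (\<exists>t. 0 \<le> t \<and> t \<le> 1 \<and> (1 - t) * val H p + t * val H x = 0)"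
    using mem_H[OF assms(1)] line unfolding closed_segment_def by fastforce
  also have "\<dots> \<longleftrightarrow> \<not> val H x * val H p > 0"
  proof
    assume "\<exists>t. 0 \<le> t \<and> t \<le> 1 \<and> (1 - t) * val H p + t * val H x = 0"
    then obtain t where t: "0 \<le> t" "t \<le> 1" "(1 - t) * val H p + t * val H x = 0" by blast
    show "\<not> val H x * val H p > 0"
    proof
      assume pos: "val H x * val H p > 0"
      have "((1 - t) * val H p + t * val H x) * val H p = (1 - t) * (val H p * val H p) + t * (val H x * val H p)"
        by (simp add: algebra_simps)
      moreover have "\<dots> > 0"
      proof (cases "t = 0")
        case True then show ?thesis using assms(2) by (simp add: square_pos)
      next
        case False
        have "0 \<le> (1 - t) * (val H p * val H p)" using t by (intro mult_nonneg_nonneg zero_le_square) simp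
        moreover have "0 < t * (val H x * val H p)" using t pos False by simp
        ultimately show ?thesis by linarith
      qed
      ultimately show False using t(3) by simp
    qed
  next
    assume n: "\<not> val H x * val H p > 0"
    define t where "t = val H p / (val H p - val H x)"
    have sgns: "val H p > 0 \<and> val H x \<le> 0 \<or> val H p < 0 \<and> val H x \<ge> 0"
      using n assms(2) by (auto simp: zero_less_mult_iff)
    then have "0 \<le> t" "t \<le> 1" by (auto simp: t_def divide_simps)
    moreover have "t * (val H p - val H x) = val H p" using sgns by (auto simp: t_def)
    then have "(1 - t) * val H p + t * val H x = 0" by (simp add: algebra_simps)
    ultimately show "\<exists>t. 0 \<le> t \<and> t \<le> 1 \<and> (1 - t) * val H p + t * val H x = 0" by blast
  qed
  finally show ?thesis using assms(1) by (simp add: Sep_def)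
qed

text \<open>\<open>Sep\<close> consists of the hyperplanes that do not have the real part strictly
  on the side of the base point, so excluding their directions turns into the sign condition of
  \<open>wset\<close>. With no hyperplane in the sign conditions, \<open>s\<close> is
  arbitrary.\<close>

lemma S_set_wset:
  assumes "\<And>H. H \<in> A \<Longrightarrow> val H p \<noteq> 0"
  shows "S_set A X p = wset (direction X) {} s p"
proof -
  have "z \<in> S_set A X p \<longleftrightarrow> z \<in> wset (direction X) {} s p" for z
  proof -
    have "z \<in> S_set A X p \<longleftrightarrow> im_vec z \<in> direction X \<and> (\<forall>H\<in>Sep A p (re_vec z). im_vec z \<notin> direction H)"
    proof
      assume "z \<in> S_set A X p"
      then obtain x v where z: "z = cvec x v" "v \<in> direction X" "\<forall>H\<in>Sep A p x. v \<notin> direction H"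
        unfolding S_set_def by blast
      show "im_vec z \<in> direction X \<and> (\<forall>H\<in>Sep A p (re_vec z). im_vec z \<notin> direction H)"
        unfolding z(1) using z(2,3) by simp
    next
      assume z: "im_vec z \<in> direction X \<and> (\<forall>H\<in>Sep A p (re_vec z). im_vec z \<notin> direction H)"
      show "z \<in> S_set A X p" unfolding S_set_def
        by (intro CollectI exI[of _ "re_vec z"] exI[of _ "im_vec z"] conjI) (use z in simp_all)
    qed
    also have "\<dots> \<longleftrightarrow> im_vec z \<in> direction X \<and> (\<forall>H\<in>A. dir H (im_vec z) = 0 \<longrightarrow> val H (re_vec z) * val H p > 0)"
    proof -
      have "Sep A p (re_vec z) \<subseteq> A" by (auto simp: Sep_def)
      then show ?thesis using Sep_iff[OF _ assms] mem_direction_H by blast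
    qed
    finally show ?thesis by (simp add: wset_def vcone_def)
  qed
  then show ?thesis by blast
qed

text \<open>For the direction \<open>V\<close> of the flat of a chamber and \<open>p\<close> in the
  chamber, this is the part in \<open>M\<close> of the product of a chamber of the parallel
  hyperplanes with \<open>V\<close>; it is the closure of \<open>S(C)\<close> in
  \<open>M\<close>.\<close>

definition tube :: "(real ^ 'n) set \<Rightarrow> real ^ 'n \<Rightarrow> (complex ^ 'n) set" where
  "tube V p = {z \<in> M. im_vec z \<in> V \<and> (\<forall>H\<in>A. (\<forall>u\<in>V. dir H u = 0) \<longrightarrow> val H (re_vec z) * val H p > 0)}"

lemma wset_tube: "wset V {} s p \<subseteq> tube V p"
  using wset_M[of V "{}" s p] by (auto simp: tube_def wset_def vcone_def)

text \<open>Weak inequalities survive in the closure, and \<open>M\<close> makes them strict for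
  hyperplanes whose direction contains \<open>V\<close>. Conversely, a point of the tube is a limit
  of points shifted by a generic imaginary vector, for which only those hyperplanes still impose
  real conditions.\<close>

lemma cl_complement_wset:
  assumes V: "subspace V"
  shows "cl_complement A (wset V {} s p) = tube V p"
proof (intro equalityI subsetI)
  fix z assume "z \<in> cl_complement A (wset V {} s p)"
  then have z: "z \<in> closure (wset V {} s p)" "z \<in> M" by (auto simp: cl_complement_def)
  define B where "B = {H\<in>A. \<forall>u\<in>V. dir H u = 0}"
  let ?T = "{z. im_vec z \<in> V} \<inter> (\<Inter>H\<in>B. {z. 0 \<le> val H (re_vec z) * val H p})"
  have "closed ?T"
  proof (intro closed_Int closed_INT ballI)
    have "closed V" by (rule closed_subspace[OF V])
    from closed_vimage[OF this, of im_vec] show "closed {z. im_vec z \<in> V}"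
      using continuous_im_vec[of UNIV] by (simp add: vimage_def)
    show "closed {z. 0 \<le> val H (re_vec z) * val H p}" for H
      by (intro closed_Collect_le continuous_on_mult cont_val continuous_re_vec continuous_on_const continuous_on_id)
  qed
  moreover have "wset V {} s p \<subseteq> ?T" by (auto simp: wset_def vcone_def B_def less_imp_le)
  ultimately have zT: "z \<in> ?T" using z(1) closure_minimal by blast
  have "val H (re_vec z) * val H p > 0" if H: "H \<in> A" "\<forall>u\<in>V. dir H u = 0" for H
  proof -
    have "H \<in> B" using H by (simp add: B_def)
    then have ge: "0 \<le> val H (re_vec z) * val H p" using zT by blast
    have "val H (re_vec z) \<noteq> 0" using z(2) H zT unfolding mem_M by blast
    moreover have "val H p \<noteq> 0"
    proof
      assume p0: "val H p = 0"
      have "wset V {} s p = {}"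
      proof (intro equalityI subsetI)
        fix w assume w: "w \<in> wset V {} s p"
        then have "dir H (im_vec w) = 0" using H by (simp add: wset_def vcone_def)
        then have "val H (re_vec w) * val H p > 0" using w H by (simp add: wset_def)
        then show "w \<in> {}" using p0 by simp
      qed simp
      then show False using z(1) by simp
    qed
    ultimately show ?thesis using ge by (simp add: less_le)
  qed
  then show "z \<in> tube V p" using z(2) zT by (simp add: tube_def)
next
  fix z assume z: "z \<in> tube V p"
  then have zM: "z \<in> M" "im_vec z \<in> V" "\<And>H. H \<in> A \<Longrightarrow> \<forall>u\<in>V. dir H u = 0 \<Longrightarrow> val H (re_vec z) * val H p > 0"
    by (auto simp: tube_def)
  obtain u where u: "u \<in> V" "vgen V u" by (rule generic_vector[OF V])
  obtain t0 where t0: "t0 > 0" "\<And>t H. \<bar>t\<bar> < t0 \<Longrightarrow> H \<in> A \<Longrightarrow> dir H (im_vec z) \<noteq> 0 \<Longrightarrow> sgn (dir H (im_vec z + t *\<^sub>R u)) = sgn (dir H (im_vec z))"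
    by (rule perturb[of "im_vec z" u]) (rule that; assumption)
  have mem: "z + t *\<^sub>R cvec 0 u \<in> wset V {} s p" if t: "0 < t" "t < t0" for t
  proof -
    have im: "im_vec (z + t *\<^sub>R cvec 0 u) = im_vec z + t *\<^sub>R u" "re_vec (z + t *\<^sub>R cvec 0 u) = re_vec z" by simp_all
    have "im_vec z + t *\<^sub>R u \<in> V" using V zM(2) u(1) by (simp add: subspace_add subspace_scale)
    moreover have "val H (re_vec z) * val H p > 0" if H: "H \<in> A" "dir H (im_vec z + t *\<^sub>R u) = 0" for H
    proof -
      have "dir H (im_vec z) = 0"
      proof (rule ccontr)
        assume nz: "dir H (im_vec z) \<noteq> 0"
        have "\<bar>t\<bar> < t0" using t by simp
        from t0(2)[OF this H(1) nz] have "sgn (dir H (im_vec z)) = 0" unfolding H(2) by simp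
        then show False using nz by (simp only: sgn_eq_0_iff)
      qed
      then have "dir H u = 0" using H(2) t(1) by simp
      then show ?thesis using u(2) H(1) zM(3) by (simp add: vgen_def)
    qed
    ultimately show ?thesis by (simp add: wset_def vcone_def im)
  qed
  have lim: "((\<lambda>t. z + t *\<^sub>R cvec 0 u) \<longlongrightarrow> z + 0 *\<^sub>R cvec 0 u) (at_right 0)" by (intro tendsto_intros)
  have ev: "\<forall>\<^sub>F t in at_right 0. z + t *\<^sub>R cvec 0 u \<in> wset V {} s p"
    unfolding eventually_at_right_field using t0(1) mem by blast
  have "z + 0 *\<^sub>R cvec 0 u \<in> closure (wset V {} s p)"
    by (rule Lim_in_closed_set[OF closed_closure _ _ lim]) (use ev closure_subset in \<open>auto elim!: eventually_mono\<close>)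
  then show "z \<in> cl_complement A (wset V {} s p)" using zM(1) by (simp add: cl_complement_def)
qed

lemma closedin_tube:
  assumes "subspace V" shows "closedin (top_of_set M) (tube V p)"
  unfolding cl_complement_wset[OF assms, of "\<lambda>_. 0", symmetric] cl_complement_def
  by (subst Int_commute) (intro closedin_closed_Int closed_closure)

lemma tube_open:
  assumes V: "subspace V"
  obtains U where "open U" "tube V p = imsub V \<inter> U"
proof
  let ?B = "{H\<in>A. \<forall>u\<in>V. dir H u = 0}"
  let ?U = "M \<inter> (\<Inter>H\<in>?B. {z. 0 < val H (re_vec z) * val H p})"
  show "open ?U" using finA by (intro open_Int open_M open_INT ballI)
      (auto intro!: open_Collect_less continuous_on_mult cont_val continuous_re_vec continuous_on_const continuous_on_id)
  show "tube V p = imsub V \<inter> ?U" by (auto simp: tube_def imsub_def)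
qed

end

context flagged_arrangement
begin

lemma lin_injective:
  assumes "\<And>i. i \<in> {1..CARD('n)} \<Longrightarrow> lin i u = 0" shows "u = 0"
proof -
  have "aff_dim (F 0) = 0" using gf by (simp add: generic_flag_def)
  then obtain x where x: "x \<in> F 0" by (auto simp: aff_dim_eq_0)
  have "x + 1 *\<^sub>R u \<in> F 0" by (rule F_line[OF _ x]) (use assms in auto)
  then have "x + u \<in> F 0" by simp
  from F0[OF this x] show ?thesis by simp
qed

lemma dual_vector_props:
  assumes V: "subspace V" and J: "J \<subseteq> {1..CARD('n)}" "card J = dim V"
    and inj: "\<And>u. u \<in> V \<Longrightarrow> (\<And>j. j \<in> J \<Longrightarrow> lin j u = 0) \<Longrightarrow> u = 0" and i: "i \<in> J"
  shows "dual_vector h V J i \<in> V" "j \<in> J \<Longrightarrow> lin j (dual_vector h V J i) = (if j = i then 1 else 0)"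
proof -
  have fin: "finite J" using J(1) finite_subset by blast
  have lJ: "linear (lin j)" if "j \<in> J" for j using that J(1) linear_lin by blast
  obtain v where v: "v \<in> V" "\<forall>j\<in>J. lin j v = (if j = i then 1 else 0)"
    using dual_vector_exists[where g = lin and i = i, OF V fin J(2) lJ inj i] by blast
  have "dual_vector h V J i = v" unfolding dual_vector_def lin_def[symmetric]
  proof (rule the_equality)
    show "v \<in> V \<and> (\<forall>j\<in>J. lin j v = (if j = i then 1 else 0))" using v by blast
    fix w assume w: "w \<in> V \<and> (\<forall>j\<in>J. lin j w = (if j = i then 1 else 0))"
    have "w - v = 0"
    proof (rule inj)
      show "w - v \<in> V" using w v V subspace_diff by blast
      show "lin j (w - v) = 0" if "j \<in> J" for j using w v that linear_diff[OF lJ[OF that]] by simp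
    qed
    then show "w = v" by simp
  qed
  then show "dual_vector h V J i \<in> V" "j \<in> J \<Longrightarrow> lin j (dual_vector h V J i) = (if j = i then 1 else 0)" using v by auto
qed

lemma dual_vector_expand:
  assumes V: "subspace V" and J: "J \<subseteq> {1..CARD('n)}" "card J = dim V"
    and inj: "\<And>u. u \<in> V \<Longrightarrow> (\<And>j. j \<in> J \<Longrightarrow> lin j u = 0) \<Longrightarrow> u = 0" and v: "v \<in> V"
  shows "v = (\<Sum>i\<in>J. lin i v *\<^sub>R dual_vector h V J i)"
proof -
  note d = dual_vector_props[OF V J inj]
  have fin: "finite J" using J(1) finite_subset by blast
  let ?s = "\<Sum>i\<in>J. lin i v *\<^sub>R dual_vector h V J i"
  have "v - ?s = 0"
  proof (rule inj)
    show "v - ?s \<in> V" by (intro subspace_diff[OF V v] subspace_sum[OF V] subspace_scale[OF V] d(1))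
    fix j assume j: "j \<in> J"
    then have l: "linear (lin j)" using J(1) linear_lin by blast
    have "lin j ?s = (\<Sum>i\<in>J. lin i v * lin j (dual_vector h V J i))"
      by (simp add: linear_sum[OF l] linear_scale[OF l])
    also have "\<dots> = (\<Sum>i\<in>J. if i = j then lin i v else 0)"
      by (rule sum.cong) (use d(2) j in auto)
    also have "\<dots> = lin j v" using fin j by simp
    finally show "lin j (v - ?s) = 0" using linear_diff[OF l] by simp
  qed
  then show ?thesis by simp
qed

text \<open>The vectors span a space whose dimension is the length of the list, so they are distinct
  and independent.\<close>

theorem orientation_basis:
  assumes C: "C \<in> chq q" and q: "q \<le> CARD('n)"
  defines "bs \<equiv> orientation_basis h q (chamber_flat A F h q C)"
  shows "length bs = 2 * CARD('n) - q" "distinct bs" "independent (set bs)" "span (set bs) = imsub (VC q C)"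
proof -
  let ?V = "VC q C" and ?J = "{q+1..CARD('n)}" and ?I = "{1..CARD('n)}"
  let ?e = "\<lambda>i. cvec (dual_vector h UNIV ?I i) 0" and ?f = "\<lambda>i. cvec 0 (dual_vector h ?V ?J i)"
  note VF = VC_facts[OF C q]
  have J: "?J \<subseteq> ?I" "card ?J = dim ?V" using VF(2) by auto
  have I: "?I \<subseteq> ?I" "card ?I = dim (UNIV :: (real ^ 'n) set)" by simp_all
  have set_bs: "set bs = ?e ` ?I \<union> ?f ` ?J"
  proof -
    have "set [1..<CARD('n) + 1] = ?I" "set [q+1..<CARD('n) + 1] = ?J" by auto
    then show ?thesis
      unfolding bs_def orientation_basis_def VC_def[symmetric] set_append set_map by (simp only:)
  qed
  show len: "length bs = 2 * CARD('n) - q"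
    unfolding bs_def orientation_basis_def length_append length_map length_upt using q by linarith
  have sub: "subspace (imsub ?V)" by (rule subspace_imsub[OF VF(1)])
  have inV: "set bs \<subseteq> imsub ?V"
    unfolding set_bs imsub_def using dual_vector_props(1)[OF VF(1) J VF(3)] subspace_0[OF VF(1)] by auto
  have span: "imsub ?V \<subseteq> span (set bs)"
  proof
    fix z assume z: "z \<in> imsub ?V"
    have 1: "re_vec z = (\<Sum>i\<in>?I. lin i (re_vec z) *\<^sub>R dual_vector h UNIV ?I i)"
      by (rule dual_vector_expand[OF subspace_UNIV I lin_injective]) auto
    have 2: "im_vec z = (\<Sum>i\<in>?J. lin i (im_vec z) *\<^sub>R dual_vector h ?V ?J i)"
      by (rule dual_vector_expand[OF VF(1) J VF(3)]) (use z in \<open>auto simp: imsub_def\<close>)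
    have l1: "linear (\<lambda>x. cvec x 0 :: complex ^ 'n)" "linear (\<lambda>x. cvec 0 x :: complex ^ 'n)"
      by (intro linearI complex_vec_eqI; simp)+
    have "z = cvec (re_vec z) 0 + cvec 0 (im_vec z)" by (rule complex_vec_eqI) simp_all
    also have "cvec (re_vec z) 0 = (\<Sum>i\<in>?I. lin i (re_vec z) *\<^sub>R ?e i)"
      by (subst 1) (simp add: linear_sum[OF l1(1)] linear_scale[OF l1(1)])
    also have "cvec 0 (im_vec z) = (\<Sum>i\<in>?J. lin i (im_vec z) *\<^sub>R ?f i)"
      by (subst 2) (simp add: linear_sum[OF l1(2)] linear_scale[OF l1(2)])
    finally have eq: "z = (\<Sum>i\<in>?I. lin i (re_vec z) *\<^sub>R ?e i) + (\<Sum>i\<in>?J. lin i (im_vec z) *\<^sub>R ?f i)" .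
    show "z \<in> span (set bs)"
      unfolding set_bs by (subst eq) (intro span_add span_sum span_scale span_base UnI1 UnI2 imageI; assumption)
  qed
  show sp: "span (set bs) = imsub ?V" by (rule span_subspace[OF inV span sub])
  have d: "dim (imsub ?V) = length bs" unfolding len dim_imsub[OF VF(1)] VF(2) using q by simp
  have "card (set bs) \<le> length bs" by (rule card_length)
  then show "independent (set bs)" by (intro card_le_dim_spanning[OF inV span]) (simp_all add: d)
  have "length bs \<le> card (set bs)" using dim_le_card[OF span] d by simp
  then show "distinct bs" using card_length[of bs] by (intro card_distinct) simp
qed

end

section \<open>The filtration by chambers\<close>

text \<open>A compact set of \<open>M\<close> meets the closed set \<open>Y\<close> in a compact
  set, so extension by zero preserves local finiteness. This makes cycles on the closures of the
  \<open>S(C)\<close> cycles of \<open>M\<close>.\<close>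

lemma lfs_closedin:
  assumes w: "lfs Y k Y w" and Y: "closedin (top_of_set M) Y"
  shows "lfs M k Y w"
proof -
  have YM: "Y \<subseteq> M" using Y closedin_imp_subset by blast
  have "singular_simplex k (top_of_set M) f" if "w f \<noteq> 0" for f
    using lfs_singular[OF w that] YM by (auto simp: singular_simplex_subtopology)
  moreover have "finite {f. w f \<noteq> 0 \<and> f ` standard_simplex k \<inter> K \<noteq> {}}" if K: "compact K" "K \<subseteq> M" for K
  proof -
    have "compact (Y \<inter> K)" by (rule closedin_compact_Int[OF Y K])
    from lfs_finite[OF w this] have "finite {f. w f \<noteq> 0 \<and> f ` standard_simplex k \<inter> (Y \<inter> K) \<noteq> {}}" by simp
    moreover have "{f. w f \<noteq> 0 \<and> f ` standard_simplex k \<inter> K \<noteq> {}} \<subseteq> {f. w f \<noteq> 0 \<and> f ` standard_simplex k \<inter> (Y \<inter> K) \<noteq> {}}"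
      using lfs_subset[OF w] by blast
    ultimately show ?thesis by (rule rev_finite_subset)
  qed
  ultimately show ?thesis
    using lfs_subset[OF w] by (simp add: lfs_def lf_singular_chain_def compactin_subtopology)
qed

lemma (in flagged_arrangement) flag_rank:
  assumes "C \<in> chq r" "r \<le> CARD('n)" shows "(LEAST r. C \<inter> F r \<noteq> {}) = r"
proof (rule Least_equality)
  show "C \<inter> F r \<noteq> {}" using assms(1) by (simp add: flag_chambers_def)
  show "r \<le> s" if "C \<inter> F s \<noteq> {}" for s
  proof (rule ccontr)
    assume "\<not> r \<le> s"
    then have "F s \<subseteq> F (r - 1)" "r \<noteq> 0" using F_mono[of s "r - 1"] assms(2) by auto
    then show False using assms(1) that by (auto simp: flag_chambers_def)
  qed
qed

text \<open>Base points are fixed for chambers of every rank, since the filtration involves all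
  degrees at once.\<close>

locale pointed_arrangement = flagged_arrangement A a b F h
  for A :: "(real ^ 'n) set set" and a b F h +
  fixes p :: "(real ^ 'n) set \<Rightarrow> real ^ 'n"
  assumes p: "r \<le> CARD('n) \<Longrightarrow> C \<in> chq r \<Longrightarrow> p C \<in> C \<inter> F r"
begin

definition all_chambers :: "(real ^ 'n) set set" where "all_chambers = (\<Union>r\<in>{..CARD('n)}. chq r)"

definition rk :: "(real ^ 'n) set \<Rightarrow> nat" where "rk C = (LEAST r. C \<inter> F r \<noteq> {})"

text \<open>The direction of the flat of \<open>C\<close>. With it, \<open>S C\<close> is the set
  \<open>S(C)\<close> and \<open>Y C\<close> its closure in \<open>M\<close>.\<close>

definition W :: "(real ^ 'n) set \<Rightarrow> (real ^ 'n) set" where "W C = VC (rk C) C"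

definition frame :: "(real ^ 'n) set \<Rightarrow> (complex ^ 'n) list" where
  "frame C = orientation_basis h (rk C) (chamber_flat A F h (rk C) C)"

abbreviation S :: "(real ^ 'n) set \<Rightarrow> (complex ^ 'n) set" where "S C \<equiv> wset (W C) {} (\<lambda>_. 0) (p C)"

abbreviation Y :: "(real ^ 'n) set \<Rightarrow> (complex ^ 'n) set" where "Y C \<equiv> tube (W C) (p C)"

text \<open>A single real number that orders the chambers lexicographically by \<open>q\<close> and the height
  of the lowest vertex.\<close>

definition key :: "(real ^ 'n) set \<Rightarrow> real" where
  "key C = real (rk C) + arctan (h (rk C) (vx (rk C) C)) / pi"

lemma rk_eq: "C \<in> chq r \<Longrightarrow> r \<le> CARD('n) \<Longrightarrow> rk C = r"
  unfolding rk_def by (rule flag_rank)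

lemma all_chambers_chq: "C \<in> all_chambers \<longleftrightarrow> rk C \<le> CARD('n) \<and> C \<in> chq (rk C)"
  unfolding all_chambers_def using rk_eq by blast

lemma p_facts:
  assumes "C \<in> all_chambers"
  shows "p C \<in> C" "p C \<in> F (rk C)" "H \<in> A \<Longrightarrow> val H (p C) \<noteq> 0"
proof -
  have C: "rk C \<le> CARD('n)" "C \<in> chq (rk C)" using assms all_chambers_chq by blast+
  show pC: "p C \<in> C" "p C \<in> F (rk C)" using p[OF C] by auto
  show "H \<in> A \<Longrightarrow> val H (p C) \<noteq> 0"
    using C(2) chamber_cell(2)[OF _ pC(1)] by (simp add: flag_chambers_def)
qed

lemma W_facts:
  assumes "C \<in> all_chambers"
  shows "subspace (W C)" "dim (W C) = CARD('n) - rk C"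
  using VC_facts[of C "rk C"] assms all_chambers_chq unfolding W_def by blast+

text \<open>Values of \<open>arctan\<close> divided by \<open>pi\<close> lie strictly between -1/2
  and 1/2, so they never outweigh a difference of ranks.\<close>

lemma key_less: "r < s \<Longrightarrow> real r + arctan u / pi < real s + arctan v / pi"
proof -
  assume "r < s"
  then have "real r + 1 \<le> real s" by simp
  moreover have "arctan u / pi < 1 / 2" "- (1 / 2) < arctan v / pi"
    using arctan_ubound[of u] arctan_lbound[of v] pi_gt_zero by (simp_all add: field_simps)
  ultimately show ?thesis by linarith
qed

lemma key_rk: "key C < key C' \<Longrightarrow> rk C \<le> rk C'"
  using key_less[of "rk C'" "rk C"] unfolding key_def by (meson not_le order_less_asym)

lemma order:
  assumes C: "C \<in> all_chambers" and C': "C' \<in> all_chambers"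
    and s: "\<And>H. H \<in> A \<Longrightarrow> (\<forall>u\<in>W C. dir H u = 0) \<Longrightarrow> val H (p C') * val H (p C) > 0"
  shows "C' = C \<or> key C < key C'"
proof -
  have c: "rk C \<le> CARD('n)" "C \<in> chq (rk C)" "rk C' \<le> CARD('n)" "C' \<in> chq (rk C')"
    using C C' all_chambers_chq by blast+
  have "C' = C \<and> rk C' = rk C \<or> rk C < rk C' \<or> rk C = rk C' \<and> h (rk C) (vx (rk C) C) < h (rk C') (vx (rk C') C')"
    using chamber_order[OF c(2,1) p_facts(1,2)[OF C] c(4,3) p_facts(1,2)[OF C'] s[unfolded W_def]] by force
  then show ?thesis using key_less by (auto simp: key_def arctan_less_iff divide_strict_right_mono)
qed

lemma Y_S:
  assumes "z \<in> Y C" "z \<in> S C'" "H \<in> A" "\<forall>u\<in>W C. dir H u = 0"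
  shows "val H (p C') * val H (p C) > 0"
proof -
  have "im_vec z \<in> W C" using assms(1) by (simp add: tube_def)
  then have "dir H (im_vec z) = 0" using assms(4) by blast
  then have "val H (re_vec z) * val H (p C') > 0" using assms(2,3) by (simp add: wset_def)
  moreover have "val H (re_vec z) * val H (p C) > 0" using assms(1,3,4) by (simp add: tube_def)
  ultimately show ?thesis by (auto simp: zero_less_mult_iff)
qed

lemma Y_S_order: "C \<in> all_chambers \<Longrightarrow> C' \<in> all_chambers \<Longrightarrow> z \<in> Y C \<Longrightarrow> z \<in> S C' \<Longrightarrow> C' = C \<or> key C < key C'"
  by (rule order) (auto intro: Y_S)

lemma S_disjoint:
  assumes "C \<in> all_chambers" "C' \<in> all_chambers" "z \<in> S C" "z \<in> S C'" shows "C = C'"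
proof -
  have "z \<in> Y C" "z \<in> Y C'" using assms(3,4) wset_tube by blast+
  then show ?thesis using Y_S_order[OF assms(1,2) _ assms(4)] Y_S_order[OF assms(2,1) _ assms(3)] by fastforce
qed

lemma S_cover:
  assumes "z \<in> M" shows "\<exists>C\<in>all_chambers. z \<in> S C"
proof -
  have "val H (re_vec z) \<noteq> 0" if "H \<in> A" "dir H (im_vec z) = 0" for H using assms that mem_M by blast
  then obtain q C where C: "q \<le> CARD('n)" "C \<in> chq q" "im_vec z \<in> VC q C"
    "\<And>p H. p \<in> C \<Longrightarrow> H \<in> A \<Longrightarrow> dir H (im_vec z) = 0 \<Longrightarrow> val H (re_vec z) * val H p > 0"
    by (rule chamber_exists) (assumption, assumption, (rule that; assumption))
  have rk: "rk C = q" by (rule rk_eq[OF C(2,1)])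
  have CI: "C \<in> all_chambers" using C(1,2) by (simp add: all_chambers_chq rk)
  have "z \<in> S C" using C(3) C(4)[OF p_facts(1)[OF CI]] by (simp add: wset_def vcone_def W_def rk)
  then show ?thesis using CI by blast
qed

text \<open>Where the two sets meet, the real conditions of \<open>C'\<close> imply those of
  \<open>C\<close>, so the intersection is again a \<open>wset\<close>, for the intersected
  direction space. Equal dimension would give \<open>W C \<subseteq> W C'\<close>, and then equality
  because a later chamber has a direction space of at most the same dimension; a generic imaginary
  vector would then produce a common point of \<open>S C\<close> and \<open>S C'\<close>.\<close>

lemma Y_Int_S:
  assumes C: "C \<in> all_chambers" and C': "C' \<in> all_chambers" and ne: "C' \<noteq> C"
  shows "Y C \<inter> S C' = {} \<or> Y C \<inter> S C' = wset (W C \<inter> W C') {} (\<lambda>_. 0) (p C') \<and> dim (W C \<inter> W C') \<noteq> dim (W C)"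
proof (cases "\<forall>H\<in>A. (\<forall>u\<in>W C. dir H u = 0) \<longrightarrow> val H (p C') * val H (p C) > 0")
  case False
  then show ?thesis using Y_S by blast
next
  case True
  have s: "val H (p C') * val H (p C) > 0" if "H \<in> A" "\<forall>u\<in>W C. dir H u = 0" for H using True that by blast
  have "z \<in> Y C \<inter> S C' \<longleftrightarrow> z \<in> wset (W C \<inter> W C') {} (\<lambda>_. 0) (p C')" for z
  proof
    show "z \<in> Y C \<inter> S C' \<Longrightarrow> z \<in> wset (W C \<inter> W C') {} (\<lambda>_. 0) (p C')"
      by (auto simp: tube_def wset_def vcone_def)
    assume z: "z \<in> wset (W C \<inter> W C') {} (\<lambda>_. 0) (p C')"
    then have zW: "im_vec z \<in> W C" "im_vec z \<in> W C'"
      and zp: "\<And>H. H \<in> A \<Longrightarrow> dir H (im_vec z) = 0 \<Longrightarrow> val H (re_vec z) * val H (p C') > 0"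
      by (auto simp: wset_def vcone_def)
    have "val H (re_vec z) * val H (p C) > 0" if H: "H \<in> A" "\<forall>u\<in>W C. dir H u = 0" for H
    proof -
      have "dir H (im_vec z) = 0" using H zW by blast
      from zp[OF H(1) this] s[OF H] show ?thesis by (auto simp: zero_less_mult_iff)
    qed
    then show "z \<in> Y C \<inter> S C'"
      using zW zp z wset_M[of "W C \<inter> W C'" "{}" "\<lambda>_. 0" "p C'"] by (auto simp: tube_def wset_def vcone_def)
  qed
  then have eq: "Y C \<inter> S C' = wset (W C \<inter> W C') {} (\<lambda>_. 0) (p C')" by blast
  moreover have "dim (W C \<inter> W C') \<noteq> dim (W C)"
  proof
    assume d: "dim (W C \<inter> W C') = dim (W C)"
    note V = W_facts[OF C] and V' = W_facts[OF C']
    have "W C \<inter> W C' = W C"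
      by (rule subspace_dim_equal) (use V(1) V'(1) d in \<open>auto intro: subspace_inter\<close>)
    then have sub: "W C \<subseteq> W C'" by blast
    have "C' = C \<or> key C < key C'" by (rule order[OF C C' s])
    then have "rk C \<le> rk C'" using ne key_rk by blast
    then have "dim (W C') \<le> dim (W C)" unfolding V(2) V'(2) by simp
    then have WW: "W C = W C'" using subspace_dim_equal[OF V(1) V'(1) sub] by blast
    obtain v where v: "v \<in> W C" "vgen (W C) v" by (rule generic_vector[OF V(1)])
    have "cvec (p C') v \<in> S C'"
      using v(1) WW p_facts(3)[OF C'] by (simp add: wset_def vcone_def square_pos)
    moreover have "cvec (p C') v \<in> S C" using v s by (simp add: wset_def vcone_def vgen_def)
    ultimately show False using S_disjoint[OF C C'] ne by blast
  qed
  ultimately show ?thesis by blast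
qed

lemma finite_all_chambers: "finite all_chambers"
  by (rule finite_subset[OF _ finite_chambers]) (auto simp: all_chambers_def flag_chambers_def)

lemma frame_facts:
  assumes "C \<in> all_chambers"
  shows "length (frame C) = 2 * CARD('n) - rk C" "distinct (frame C)" "independent (set (frame C))"
    "span (set (frame C)) = imsub (W C)" "CARD('n) + dim (W C) = length (frame C)"
proof -
  have C: "rk C \<le> CARD('n)" "C \<in> chq (rk C)" using assms all_chambers_chq by blast+
  note o = orientation_basis[OF C(2,1), folded frame_def W_def]
  show "length (frame C) = 2 * CARD('n) - rk C" "distinct (frame C)" "independent (set (frame C))"
    "span (set (frame C)) = imsub (W C)" by (rule o)+
  show "CARD('n) + dim (W C) = length (frame C)" unfolding o(1) W_facts(2)[OF assms] using C(1) by simp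
qed

lemma oriented_cycle_exists:
  assumes C: "C \<in> all_chambers" shows "\<exists>z. oriented_cycle (Y C) (frame C) z"
proof -
  note f = frame_facts[OF C]
  obtain U where U: "open U" "Y C = imsub (W C) \<inter> U" by (rule tube_open[OF W_facts(1)[OF C]])
  have "length (frame C) > 0" using f(5) zero_less_card_finite[where 'a = 'n] by linarith
  then obtain m where m: "length (frame C) = Suc m" using gr0_conv_Suc by blast
  have E: "imsub (W C) = {z. z - 0 \<in> span (set (frame C))}" using f(4) by simp
  show ?thesis using fundamental_cycle_exists[OF f(3,2) m E U(1)] unfolding U(2) .
qed

definition zc :: "(real ^ 'n) set \<Rightarrow> (complex ^ 'n) lf_chain" where
  "zc C = (SOME z. oriented_cycle (Y C) (frame C) z)"

lemma zc:
  assumes "C \<in> all_chambers"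
  shows "oriented_cycle (Y C) (frame C) (zc C)" "lfs (Y C) (length (frame C)) (Y C) (zc C)"
    "lf_boundary (length (frame C)) (zc C) = 0"
proof -
  show z: "oriented_cycle (Y C) (frame C) (zc C)"
    unfolding zc_def by (rule someI_ex[OF oriented_cycle_exists[OF assms]])
  then show "lfs (Y C) (length (frame C)) (Y C) (zc C)" "lf_boundary (length (frame C)) (zc C) = 0"
    unfolding oriented_cycle_def by blast+
qed

definition gen :: "(real ^ 'n) set \<Rightarrow> real ^ 'n" where "gen C = (SOME v. v \<in> W C \<and> vgen (W C) v)"

lemma gen:
  assumes "C \<in> all_chambers" shows "gen C \<in> W C" "vgen (W C) (gen C)"
proof -
  obtain v where "v \<in> W C \<and> vgen (W C) v" using generic_vector[OF W_facts(1)[OF assms]] by blast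
  from someI[where P = "\<lambda>v. v \<in> W C \<and> vgen (W C) v", OF this, folded gen_def]
  show "gen C \<in> W C" "vgen (W C) (gen C)" by blast+
qed

lemma ncell_wset:
  assumes V: "subspace V" and p: "\<And>H. H \<in> A \<Longrightarrow> val H x \<noteq> 0" and v: "v \<in> V" "vgen V v"
    and Q: "closedin (top_of_set M) Q" "Q \<inter> wset V {} (\<lambda>_. 0) x = {}" "closedin (top_of_set M) (Q \<union> wset V {} (\<lambda>_. 0) x)"
  shows "ncell M (Q \<union> wset V {} (\<lambda>_. 0) x) Q (CARD('n) + dim V) (cvec x v)"
proof -
  have e: "vsub V {} (\<lambda>_. 0) = V" "vcone V {} (\<lambda>_. 0) = V" by (auto simp: vsub_def vcone_def)
  show ?thesis using wset_ncell[OF V _ p, of "{}" v "\<lambda>_. 0" Q] v Q by (simp add: e)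
qed

end

lemma subspace_shift:
  assumes "subspace V" "y \<in> V" shows "{z. z - y \<in> V} = V"
proof (intro equalityI subsetI)
  show "z \<in> V" if "z \<in> {z. z - y \<in> V}" for z
    using subspace_add[OF assms(1) _ assms(2), of "z - y"] that by simp
  show "z \<in> {z. z - y \<in> V}" if "z \<in> V" for z
    using subspace_diff[OF assms(1) that assms(2)] by simp
qed

locale sorted_chambers = pointed_arrangement A a b F h p
  for A :: "(real ^ 'n) set set" and a b F h p +
  fixes cs :: "(real ^ 'n) set list"
  assumes cs: "set cs = all_chambers" "distinct cs" "sorted (map key cs)"
begin

abbreviation N :: nat where "N \<equiv> length cs"

definition P :: "nat \<Rightarrow> (complex ^ 'n) set" where "P i = (\<Union>j\<in>{i..<N}. S (cs ! j))"

lemma cs_mem: "i < N \<Longrightarrow> cs ! i \<in> all_chambers"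
  using cs(1) nth_mem by blast

lemma key_mono: "i \<le> j \<Longrightarrow> j < N \<Longrightarrow> key (cs ! i) \<le> key (cs ! j)"
  using sorted_nth_mono[OF cs(3), of i j] by simp

text \<open>A point of the closure lies in some \<open>S C'\<close>, and the order of the chambers
  allows only the given chamber or a later one.\<close>

lemma Y_subset_P: assumes "i < N" shows "Y (cs ! i) \<subseteq> P i"
proof
  fix z assume z: "z \<in> Y (cs ! i)"
  then have "z \<in> M" by (simp add: tube_def)
  then obtain C where C: "C \<in> all_chambers" "z \<in> S C" using S_cover by blast
  then obtain k where k: "k < N" "C = cs ! k" using cs(1) by (metis in_set_conv_nth)
  have "C = cs ! i \<or> key (cs ! i) < key C" by (rule Y_S_order[OF cs_mem[OF assms] C(1) z C(2)])
  then have "i \<le> k"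
  proof
    assume "C = cs ! i"
    then show ?thesis using k assms cs(2) by (simp add: nth_eq_iff_index_eq)
  next
    assume less: "key (cs ! i) < key C"
    show ?thesis
    proof (rule ccontr)
      assume "\<not> i \<le> k"
      then have "key (cs ! k) \<le> key (cs ! i)" by (intro key_mono assms) simp
      then show False using less k(2) by simp
    qed
  qed
  then show "z \<in> P i" using C(2) k by (auto simp: P_def)
qed

lemma P_anti: "i \<le> j \<Longrightarrow> P j \<subseteq> P i"
  unfolding P_def by (intro UN_mono) auto

text \<open>Passing to closures adds nothing to a final segment, so \<open>P i\<close> is a finite
  union of closed sets.\<close>

lemma P_Y: "P i = (\<Union>j\<in>{i..<N}. Y (cs ! j))"
proof
  show "P i \<subseteq> (\<Union>j\<in>{i..<N}. Y (cs ! j))" unfolding P_def by (intro UN_mono wset_tube subset_refl)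
  show "(\<Union>j\<in>{i..<N}. Y (cs ! j)) \<subseteq> P i"
  proof (rule UN_least)
    fix j assume "j \<in> {i..<N}"
    then have j: "i \<le> j" "j < N" by simp_all
    show "Y (cs ! j) \<subseteq> P i" by (rule subset_trans[OF Y_subset_P[OF j(2)] P_anti[OF j(1)]])
  qed
qed

lemma closedin_P: "closedin (top_of_set M) (P i)"
  unfolding P_Y by (intro closedin_Union) (auto intro!: closedin_tube W_facts(1) cs_mem)

lemma P_sub_M: "P i \<subseteq> M"
  using closedin_P closedin_imp_subset by blast

lemma P_split:
  assumes "i < N" shows "P i = P (Suc i) \<union> S (cs ! i)" "P (Suc i) \<inter> S (cs ! i) = {}"
proof -
  have "{i..<N} = insert i {Suc i..<N}" using assms by auto
  then show "P i = P (Suc i) \<union> S (cs ! i)" by (auto simp: P_def)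
  show "P (Suc i) \<inter> S (cs ! i) = {}"
  proof (rule ccontr)
    assume "P (Suc i) \<inter> S (cs ! i) \<noteq> {}"
    then obtain j z where j: "Suc i \<le> j" "j < N" "z \<in> S (cs ! j)" "z \<in> S (cs ! i)" by (auto simp: P_def)
    have "cs ! j = cs ! i" by (rule S_disjoint[OF cs_mem[OF j(2)] cs_mem[OF assms] j(3,4)])
    then show False using j(1,2) assms cs(2) by (simp add: nth_eq_iff_index_eq)
  qed
qed

lemma P_0: "P 0 = M"
proof
  show "M \<subseteq> P 0"
  proof
    fix z assume "z \<in> M"
    then obtain C where C: "C \<in> all_chambers" "z \<in> S C" using S_cover by blast
    then obtain k where "k < N" "C = cs ! k" using cs(1) by (metis in_set_conv_nth)
    then show "z \<in> P 0" using C(2) by (auto simp: P_def)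
  qed
qed (rule P_sub_M)

lemma P_N: "P N = {}" by (simp add: P_def)

definition yc :: "nat \<Rightarrow> complex ^ 'n" where "yc i = cvec (p (cs ! i)) (gen (cs ! i))"

lemma cell_i:
  assumes "i < N" shows "ncell M (P i) (P (Suc i)) (length (frame (cs ! i))) (yc i)"
proof -
  let ?C = "cs ! i"
  note C = cs_mem[OF assms]
  show ?thesis
    using ncell_wset[OF W_facts(1)[OF C] p_facts(3)[OF C] gen[OF C] closedin_P P_split(2)[OF assms]]
      P_split(1)[OF assms] closedin_P[of i] frame_facts(5)[OF C] by (simp add: yc_def)
qed

lemma yc_S: assumes "i < N" shows "yc i \<in> S (cs ! i)"
  using gen[OF cs_mem[OF assms]] p_facts(3)[OF cs_mem[OF assms]]
  by (simp add: yc_def wset_def vcone_def square_pos)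

lemma zc_lfs: "C \<in> all_chambers \<Longrightarrow> lfs M (length (frame C)) (Y C) (zc C)"
  by (rule lfs_closedin[OF zc(2) closedin_tube[OF W_facts(1)]])

lemma zc_lgen:
  assumes "i < N" shows "lgen M (length (frame (cs ! i))) (P i) (yc i) (zc (cs ! i))"
proof -
  let ?C = "cs ! i"
  note C = cs_mem[OF assms]
  note f = frame_facts[OF C]
  obtain U where U: "open U" "Y ?C = imsub (W ?C) \<inter> U" by (rule tube_open[OF W_facts(1)[OF C]])
  \<comment> \<open>Removing the closed set \<open>P (Suc i)\<close> isolates the cell: within
    \<open>U'\<close> the set \<open>P i\<close>, the closure \<open>Y ?C\<close> and the affine
    space agree.\<close>
  define U' where "U' = U \<inter> (M - P (Suc i))"
  have yS: "yc i \<in> S ?C" by (rule yc_S[OF assms])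
  have yY: "yc i \<in> Y ?C" using yS wset_tube by blast
  have yP: "yc i \<notin> P (Suc i)" using P_split(2)[OF assms] yS by blast
  have "openin (top_of_set M) (M - P (Suc i))" 
    by (rule openin_diff[OF _ closedin_P]) (simp add: openin_subtopology_self)
  then have "open (M - P (Suc i))" using open_M openin_open_eq by blast
  then have oU': "open U'" unfolding U'_def using U(1) by blast
  have "yc i \<in> M" using yS wset_M by blast
  then have yU': "yc i \<in> U'" using yY U(2) yP by (auto simp: U'_def)
  have yW: "yc i \<in> imsub (W ?C)" using yY U(2) by blast
  have E: "{z. z - yc i \<in> span (set (frame ?C))} = imsub (W ?C)"
    unfolding f(4) by (rule subspace_shift[OF subspace_imsub[OF W_facts(1)[OF C]] yW])
  have PU: "P i \<inter> U' \<subseteq> Y ?C"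
  proof -
    have "P i \<inter> U' \<subseteq> S ?C" unfolding P_split(1)[OF assms] U'_def by blast
    then show ?thesis using wset_tube by (rule subset_trans)
  qed
  show ?thesis
  proof (rule oriented_cycle_lgen[OF f(3,2) oU' yU' _ PU Y_subset_P[OF assms] P_sub_M _ zc(1)[OF C]])
    show "P i \<inter> U' = {z. z - yc i \<in> span (set (frame ?C))} \<inter> U'"
      unfolding E using PU Y_subset_P[OF assms] U(2) by (auto simp: U'_def)
    show "lfs M (length (frame ?C)) (P i) (zc ?C)"
      by (rule lfs_mono[OF zc_lfs[OF C] Y_subset_P[OF assms]])
  qed
qed

sublocale filt: cell_filtration M N P "\<lambda>i. length (frame (cs ! i))" yc "\<lambda>i. zc (cs ! i)"
proof
  fix i assume i: "i < N"
  show "lfs M (length (frame (cs ! i))) (P i) (zc (cs ! i))"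
    by (rule lfs_mono[OF zc_lfs[OF cs_mem[OF i]] Y_subset_P[OF i]])
  show "lf_boundary (length (frame (cs ! i))) (zc (cs ! i)) = 0" by (rule zc(3)[OF cs_mem[OF i]])
qed (use P_0 P_N cell_i zc_lgen in auto)

text \<open>The closure of \<open>S(C)\<close> is filtered by its intersections with the later
  pieces. The top cell is controlled by the local class at \<open>yc i\<close>; every other nonempty
  piece has a dimension different from the degree of the cycle and does not obstruct a bounding
  chain.\<close>

lemma cycle_in_Y_bounds:
  assumes i: "i < N" and w: "lfs M (length (frame (cs ! i))) (Y (cs ! i)) w" "lf_boundary (length (frame (cs ! i))) w = 0"
    and l: "loc (length (frame (cs ! i))) (Y (cs ! i)) (yc i) w"
  shows "\<exists>u. lfs M (Suc (length (frame (cs ! i)))) (Y (cs ! i)) u \<and> w = lf_boundary (Suc (length (frame (cs ! i)))) u"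
proof -
  let ?C = "cs ! i" and ?k = "length (frame (cs ! i))"
  note C = cs_mem[OF i]
  have clY: "closedin (top_of_set M) (Y ?C)" by (rule closedin_tube[OF W_facts(1)[OF C]])
  define Q where "Q j = Y ?C \<inter> P (Suc i + j)" for j
  have clQ: "closedin (top_of_set M) (Q j)" for j unfolding Q_def by (rule closedin_Int[OF clY closedin_P])
  have SY: "S ?C \<subseteq> Y ?C" by (rule wset_tube)
  have Y_eq: "Y ?C = Q 0 \<union> S ?C" using Y_subset_P[OF i] P_split(1)[OF i] SY by (auto simp: Q_def)
  have disj: "Q 0 \<inter> S ?C = {}" using P_split(2)[OF i] by (auto simp: Q_def)
  have "ncell M (Q 0 \<union> S ?C) (Q 0) (CARD('n) + dim (W ?C)) (yc i)" unfolding yc_def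
    by (rule ncell_wset[OF W_facts(1)[OF C] p_facts(3)[OF C] gen[OF C] clQ disj]) (use clY Y_eq in simp_all)
  then have c: "ncell M (Y ?C) (Q 0) ?k (yc i)" unfolding Y_eq[symmetric] frame_facts(5)[OF C] .
  obtain u w' where u: "lfs M (Suc ?k) (Y ?C) u" "lfs M ?k (Q 0) w'" "w = lf_boundary (Suc ?k) u + w'"
      "lf_boundary ?k w' = lf_boundary ?k w"
    by (rule ncell_push[OF c relc_cycle[OF w] disjI2[OF l]]) (rule that; assumption)
  have "\<exists>u. lfs M (Suc ?k) (Q 0) u \<and> w' = lf_boundary (Suc ?k) u"
  proof (rule filtration_bounds[where N = "N - Suc i" and P = Q
        and d = "\<lambda>j. CARD('n) + dim (W ?C \<inter> W (cs ! (Suc i + j)))"])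
    show "lfs M ?k (Q 0) w'" "lf_boundary ?k w' = 0" using u(2,4) w(2) by simp_all
    have eN: "Suc i + (N - Suc i) = N" using i by simp
    show "Q (N - Suc i) = {}" unfolding Q_def eN P_N by simp
    fix j assume "j < N - Suc i"
    then have j: "Suc i + j < N" by simp
    let ?D = "cs ! (Suc i + j)"
    note D = cs_mem[OF j]
    have ne: "?D \<noteq> ?C" using j i cs(2) by (simp add: nth_eq_iff_index_eq)
    have split: "Q j = Q (Suc j) \<union> (Y ?C \<inter> S ?D)" "Q (Suc j) \<inter> (Y ?C \<inter> S ?D) = {}"
      using P_split[OF j] unfolding Q_def add_Suc_right by blast+
    from Y_Int_S[OF C D ne] show "Q (Suc j) = Q j \<or>
        (\<exists>y. ncell M (Q j) (Q (Suc j)) (CARD('n) + dim (W ?C \<inter> W ?D)) y) \<and> CARD('n) + dim (W ?C \<inter> W ?D) \<noteq> ?k"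
    proof
      assume "Y ?C \<inter> S ?D = {}"
      then show ?thesis using split(1) by simp
    next
      assume eq: "Y ?C \<inter> S ?D = wset (W ?C \<inter> W ?D) {} (\<lambda>_. 0) (p ?D) \<and> dim (W ?C \<inter> W ?D) \<noteq> dim (W ?C)"
      have V: "subspace (W ?C \<inter> W ?D)" by (rule subspace_inter[OF W_facts(1)[OF C] W_facts(1)[OF D]])
      obtain v where v: "v \<in> W ?C \<inter> W ?D" "vgen (W ?C \<inter> W ?D) v" by (rule generic_vector[OF V])
      have "ncell M (Q (Suc j) \<union> wset (W ?C \<inter> W ?D) {} (\<lambda>_. 0) (p ?D)) (Q (Suc j))
          (CARD('n) + dim (W ?C \<inter> W ?D)) (cvec (p ?D) v)"
        by (rule ncell_wset[OF V p_facts(3)[OF D] v clQ])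
          (use split clQ[of j] eq in simp_all)
      then have "ncell M (Q j) (Q (Suc j)) (CARD('n) + dim (W ?C \<inter> W ?D)) (cvec (p ?D) v)"
        using split(1) eq by simp
      then show ?thesis using eq frame_facts(5)[OF C] by auto
    qed
  qed simp
  then obtain u' where u': "lfs M (Suc ?k) (Q 0) u'" "w' = lf_boundary (Suc ?k) u'" by blast
  have "w = lf_boundary (Suc ?k) (u + u')" unfolding u(3) u'(2) bd_add[OF u(1) u'(1)] ..
  moreover have "lfs M (Suc ?k) (Y ?C) u'" by (rule lfs_mono[OF u'(1)]) (simp add: Q_def)
  ultimately show ?thesis using lfs_add[OF u(1)] by blast
qed

lemma fundamental_cycle_zc:
  assumes C: "C \<in> all_chambers" shows "fundamental_cycle (Y C) (frame C) (zc C)"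
proof -
  obtain U where U: "open U" "Y C = imsub (W C) \<inter> U" by (rule tube_open[OF W_facts(1)[OF C]])
  show ?thesis
  proof (rule oriented_cycle_fundamental[OF frame_facts(3,2)[OF C] zc(1)[OF C] U(1)])
    show "Y C \<subseteq> U" using U(2) by blast
    show "Y C \<inter> U = {z. z - y \<in> span (set (frame C))} \<inter> U" if "y \<in> Y C" for y
    proof -
      have "y \<in> imsub (W C)" using that U(2) by blast
      from subspace_shift[OF subspace_imsub[OF W_facts(1)[OF C]] this]
      show ?thesis unfolding frame_facts(4)[OF C] U(2) by blast
    qed
  qed
qed

text \<open>Two fundamental cycles have the same local class at the point \<open>yc i\<close> of
  \<open>S(C)\<close>, so their difference bounds already inside \<open>Y C\<close>.\<close>

lemma fundamental_class:
  assumes C: "C \<in> all_chambers"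
  shows "BM_fundamental_class M (Y C) (frame C) = BM_class (length (frame C)) (top_of_set M) (zc C)"
proof (rule BM_fundamental_class_eq[OF fundamental_cycle_zc[OF C] _ zc(3)[OF C]])
  let ?k = "length (frame C)"
  obtain i where i: "i < N" "C = cs ! i" using C cs(1) by (metis in_set_conv_nth)
  have YM: "Y C \<subseteq> M" by (auto simp: tube_def)
  show "lfs M ?k M (zc C)" by (rule lfs_mono[OF zc_lfs[OF C] YM])
  fix c assume "fundamental_cycle (Y C) (frame C) c"
  then have c: "lfs (Y C) ?k (Y C) c" "lf_boundary ?k c = 0"
    "\<And>y. y \<in> Y C \<Longrightarrow> \<exists>eps>0. local_orientation_simplex (frame C) y eps ` standard_simplex ?k \<subseteq> Y C \<and>
       loc ?k (Y C) y (c - lk (frag_of (local_orientation_simplex (frame C) y eps)))"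
    unfolding fundamental_cycle_iff by blast+
  have cM: "lfs M ?k (Y C) c" by (rule lfs_closedin[OF c(1) closedin_tube[OF W_facts(1)[OF C]]])
  have yY: "yc i \<in> Y C" using yc_S[OF i(1)] wset_tube i(2) by blast
  obtain eps where eps: "eps > 0" "local_orientation_simplex (frame C) (yc i) eps ` standard_simplex ?k \<subseteq> Y C"
      "loc ?k (Y C) (yc i) (c - lk (frag_of (local_orientation_simplex (frame C) (yc i) eps)))"
    using c(3)[OF yY] by blast
  have eq: "c - zc C = (c - lk (frag_of (local_orientation_simplex (frame C) (yc i) eps)))
      - (zc C - lk (frag_of (local_orientation_simplex (frame C) (yc i) eps)))" by (simp only: diff_diff_eq2 diff_add_cancel)
  have l: "loc ?k (Y C) (yc i) (c - zc C)"
    unfolding eq by (rule loc_diff[OF eps(3) oriented_cycle_loc[OF zc(1)[OF C] yY eps(1,2)]])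
  have b: "lf_boundary ?k (c - zc C) = 0"
    unfolding bd_diff[OF cM zc_lfs[OF C]] c(2) zc(3)[OF C] by (rule diff_self)
  obtain u where "lfs M (Suc ?k) (Y C) u" "c - zc C = lf_boundary (Suc ?k) u"
    using cycle_in_Y_bounds[OF i(1), folded i(2), OF lfs_diff[OF cM zc_lfs[OF C]] b l] by blast
  then show "\<exists>u. lfs M (Suc ?k) M u \<and> c - zc C = lf_boundary (Suc ?k) u"
    using lfs_mono[OF _ YM] by blast
qed

lemma S_class_eq:
  assumes q: "q \<le> CARD('n)" and C: "C \<in> chq q"
  shows "S_class A F h q p C = BM_class (2 * CARD('n) - q) (top_of_set M) (zc C)"
proof -
  have rk: "rk C = q" by (rule rk_eq[OF C q])
  have CI: "C \<in> all_chambers" using C q by (simp add: all_chambers_chq rk)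
  have W: "direction (chamber_flat A F h q C) = W C" by (simp add: W_def VC_def rk)
  have "cl_complement A (S_set A (chamber_flat A F h q C) (p C)) = Y C"
  proof -
    have "S_set A (chamber_flat A F h q C) (p C) = wset (direction (chamber_flat A F h q C)) {} (\<lambda>_. 0) (p C)"
      by (rule S_set_wset) (rule p_facts(3)[OF CI])
    then show ?thesis unfolding W by (simp only: cl_complement_wset[OF W_facts(1)[OF CI]])
  qed
  then show ?thesis
    using fundamental_class[OF CI] frame_facts(1)[OF CI] by (simp add: S_class_def frame_def rk)
qed

theorem basis:
  assumes q: "q \<le> CARD('n)" and g: "\<And>C. C \<in> chq q \<Longrightarrow> g C = S_class A F h q p C"
  shows "abelian_group_basis (BM_homology_group (2 * CARD('n) - q) (top_of_set M)) (chq q) g"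
proof -
  let ?k = "2 * CARD('n) - q"
  have mem: "C \<in> all_chambers" "length (frame C) = ?k" if "C \<in> chq q" for C
  proof -
    have rk: "rk C = q" by (rule rk_eq[OF that q])
    show CI: "C \<in> all_chambers" using that q by (simp add: all_chambers_chq rk)
    show "length (frame C) = ?k" using frame_facts(1)[OF CI] rk by simp
  qed
  \<comment> \<open>The positions of the chambers in \<open>chq q\<close>: the length of the frame
    determines the rank, since ranks are at most \<open>CARD('n)\<close>.\<close>
  let ?J = "{j\<in>{0..<N}. length (frame (cs ! j)) = ?k}"
  have bij: "bij_betw (\<lambda>j. cs ! j) ?J (chq q)" unfolding bij_betw_def
  proof
    show "inj_on (\<lambda>j. cs ! j) ?J" using cs(2) by (auto intro!: inj_onI simp: nth_eq_iff_index_eq)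
    show "(\<lambda>j. cs ! j) ` ?J = chq q"
    proof (intro equalityI subsetI)
      fix C assume "C \<in> (\<lambda>j. cs ! j) ` ?J"
      then obtain j where j: "j < N" "C = cs ! j" "length (frame C) = ?k" by auto
      have CI: "C \<in> all_chambers" using cs_mem j by simp
      then have "rk C \<le> CARD('n)" "C \<in> chq (rk C)" using all_chambers_chq by blast+
      then show "C \<in> chq q" using frame_facts(1)[OF CI] j(3) q by (metis diff_diff_cancel le_add1 le_trans mult_2)
    next
      fix C assume C: "C \<in> chq q"
      then obtain j where "j < N" "C = cs ! j" using mem(1) cs(1) by (metis in_set_conv_nth)
      then show "C \<in> (\<lambda>j. cs ! j) ` ?J" using mem(2)[OF C] by auto
    qed
  qed
  have reindex: "filt.comb ?k (\<lambda>j. n (cs ! j)) 0 = (\<Sum>C\<in>chq q. lf_scale (n C) (zc C))" for n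
    unfolding filt.comb_def by (rule sum.reindex_bij_betw[OF bij, of "\<lambda>C. lf_scale (n C) (zc C)"])
  \<comment> \<open>Turns coefficients found for positions in \<open>cs\<close> into coefficients
    indexed by chambers.\<close>
  define idx where "idx = the_inv_into ?J (\<lambda>j. cs ! j)"
  have idx: "idx (cs ! j) = j" if "j \<in> ?J" for j
    unfolding idx_def by (rule the_inv_into_f_f[OF bij_betw_imp_inj_on[OF bij] that])
  show ?thesis
  proof (rule abelian_group_basis_BM)
    show "finite (chq q)" by (rule finite_subset[OF _ finite_chambers]) (auto simp: flag_chambers_def)
    show "lfs M ?k M (zc C) \<and> lf_boundary ?k (zc C) = 0" if "C \<in> chq q" for C
    proof -
      have YM: "Y C \<subseteq> M" by (auto simp: tube_def)
      show ?thesis using lfs_mono[OF zc_lfs[OF mem(1)[OF that]] YM] zc(3)[OF mem(1)[OF that]] mem(2)[OF that] by simp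
    qed
    show "g C = BM_class ?k (top_of_set M) (zc C)" if "C \<in> chq q" for C
      unfolding g[OF that] by (rule S_class_eq[OF q that])
  next
    fix w assume w: "lfs M ?k M w" "lf_boundary ?k w = 0"
    have "\<exists>n u. lfs M (Suc ?k) (P 0) u \<and> w = lf_boundary (Suc ?k) u + filt.comb ?k n 0"
      by (rule filt.spanning) (use w in \<open>simp_all add: P_0\<close>)
    then obtain n u where nu: "lfs M (Suc ?k) M u" "w = lf_boundary (Suc ?k) u + filt.comb ?k n 0"
      unfolding P_0 by blast
    have "filt.comb ?k n 0 = filt.comb ?k (\<lambda>j. n (idx (cs ! j))) 0"
      unfolding filt.comb_def by (rule sum.cong[OF refl]) (simp only: idx)
    then have "w = lf_boundary (Suc ?k) u + (\<Sum>C\<in>chq q. lf_scale (n (idx C)) (zc C))"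
      using nu(2) reindex[of "\<lambda>C. n (idx C)"] by simp
    then show "\<exists>n u. lfs M (Suc ?k) M u \<and> w = lf_boundary (Suc ?k) u + (\<Sum>C\<in>chq q. lf_scale (n C) (zc C))"
      using nu(1) by (intro exI[of _ "\<lambda>C. n (idx C)"] exI[of _ u] conjI)
  next
    fix n :: "(real ^ 'n) set \<Rightarrow> int" and u C
    assume u: "lfs M (Suc ?k) M u" "(\<Sum>C\<in>chq q. lf_scale (n C) (zc C)) = lf_boundary (Suc ?k) u" and C: "C \<in> chq q"
    have "C \<in> (\<lambda>j. cs ! j) ` ?J" using bij_betw_imp_surj_on[OF bij] C by simp
    then obtain j where j: "j \<in> ?J" "C = cs ! j" by (rule imageE)
    have "(\<lambda>j. n (cs ! j)) j = 0"
    proof (rule filt.independence[where i = 0 and u = u and k = ?k])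
      show "lfs M (Suc ?k) (P 0) u" unfolding P_0 by (rule u(1))
      show "filt.comb ?k (\<lambda>j. n (cs ! j)) 0 = lf_boundary (Suc ?k) u" unfolding reindex by (rule u(2))
    qed (use j in simp_all)
    then show "n C = 0" unfolding j(2) .
  qed
qed

end

theorem theorem4p4:
  fixes A :: "(real ^ 'n) set set"
    and F :: "nat \<Rightarrow> (real ^ 'n) set"
    and h :: "nat \<Rightarrow> real ^ 'n \<Rightarrow> real"
    and p :: "(real ^ 'n) set \<Rightarrow> real ^ 'n"
    and q :: nat
  assumes "hyperplane_arrangement A"
    and "generic_flag A F"
    and "flag_forms F h"
    and "flag_position A F h"
    and "q \<le> CARD('n)"
    and "\<And>C. C \<in> flag_chambers A F q \<Longrightarrow> p C \<in> C \<inter> F q"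
  shows "abelian_group_basis
           (BM_homology_group (2 * CARD('n) - q) (top_of_set (arr_complement A)))
           (flag_chambers A F q)
           (S_class A F h q p)"
proof -
  have "\<forall>H\<in>A. \<exists>ab. fst ab \<noteq> 0 \<and> H = {x. fst ab \<bullet> x = snd ab}"
    using assms(1) by (auto simp: hyperplane_arrangement_def)
  then obtain ab where ab: "\<And>H. H \<in> A \<Longrightarrow> fst (ab H) \<noteq> 0 \<and> H = {x. fst (ab H) \<bullet> x = snd (ab H)}" by metis
  have finA: "finite A" using assms(1) by (simp add: hyperplane_arrangement_def)
  interpret flagged_arrangement A "\<lambda>H. fst (ab H)" "\<lambda>H. snd (ab H)" F h
  proof unfold_locales
    show "fst (ab H) \<noteq> 0" if "H \<in> A" for H using ab[OF that] by (rule conjunct1)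
    show "H = {x. fst (ab H) \<bullet> x = snd (ab H)}" if "H \<in> A" for H using ab[OF that] by (rule conjunct2)
  qed (rule finA assms(2-4))+
  \<comment> \<open>Base points are given for \<open>q\<close> only. For chambers of other ranks any
    point in the right member of the flag is chosen; on \<open>flag_chambers A F q\<close> the given
    \<open>p\<close> is kept, so the classes do not change.\<close>
  define p' where "p' C = (if C \<in> flag_chambers A F q then p C else SOME x. x \<in> C \<inter> F (LEAST r. C \<inter> F r \<noteq> {}))" for C
  interpret pa: pointed_arrangement A "\<lambda>H. fst (ab H)" "\<lambda>H. snd (ab H)" F h p'
  proof unfold_locales
    fix r C assume r: "r \<le> CARD('n)" and C: "C \<in> chq r"
    have least: "(LEAST r. C \<inter> F r \<noteq> {}) = s" if "C \<in> chq s" "s \<le> CARD('n)" for s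
      by (rule flag_rank[OF that])
    show "p' C \<in> C \<inter> F r"
    proof (cases "C \<in> flag_chambers A F q")
      case True
      then have "r = q" using least[OF C r] least[OF True assms(5)] by simp
      then show ?thesis using True assms(6) by (simp add: p'_def)
    next
      case False
      have "\<exists>x. x \<in> C \<inter> F r" using C by (auto simp: flag_chambers_def)
      then have "(SOME x. x \<in> C \<inter> F r) \<in> C \<inter> F r" by (rule someI_ex)
      then show ?thesis unfolding p'_def least[OF C r] using False by (simp only: if_False)
    qed
  qed
  obtain cs where cs: "set cs = pa.all_chambers" "distinct cs" "sorted (map pa.key cs)"
  proof -
    obtain xs where xs: "set xs = pa.all_chambers" "distinct xs"
      using finite_distinct_list[OF pa.finite_all_chambers] by blast
    show thesis by (rule that[of "sort_key pa.key xs"]) (use xs in simp_all)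
  qed
  interpret sc: sorted_chambers A "\<lambda>H. fst (ab H)" "\<lambda>H. snd (ab H)" F h p' cs
    by unfold_locales (rule cs)+
  show ?thesis by (rule sc.basis[OF assms(5)]) (simp add: S_class_def p'_def)
qed

end
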